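(* Let $k$ be an algebraically closed field of characteristic zero, $G$ a finite group, $a\in Z(G)$, $\chi:G\to k^{\times}$ a linear character with $q:=\chi(a)\neq1$ and $|q|=|\chi|=s$, and let $H=kG(\chi^{-1},a,0)$. Let $p,t\in\mathbb N^+$, $i,j\in I$ and $\beta\in k^{\times}$. Write $p=us+r$ with $u\ge0$ and $0\le r<s$. Then, as $H$-modules, $$V_p(i)\otimes V_t(j,\beta)\cong\Big(\bigoplus_{l\in I}\bigoplus_{1\le m\le \min(t,u)}N_{i,j}^l(s-r)V_{2m-1+|t-u|}(l,\beta)\Big)\oplus\Big(\bigoplus_{l\in I}\bigoplus_{m=1}^{\min(t,u+1)}N_{i,j}^l\,r\,V_{2m-1+|t-u-1|}(l,\beta)\Big),$$ $$V_t(j,\beta)\otimes V_p(i)\cong\Big(\bigoplus_{l\in I}\bigoplus_{1\le m\le \min(u,t)}N_{j,i}^l(s-r)V_{2m-1+|t-u|}(l,\omega_i^s\beta)\Big)\oplus\Big(\bigoplus_{l\in I}\bigoplus_{m=1}^{\min(u+1,t)}N_{j,i}^l\,r\,V_{2m-1+|t-u-1|}(l,\omega_i^s\beta)\Big).$$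
   Context: $k^{\times}=k\setminus\{0\}$; $\mathbb N^+$ is the set of positive integers; $\hat G$ is the group of linear characters $G\to k^{\times}$; $|\chi|$ is the order of $\chi$ in $\hat G$ and $|q|$ the order of $q$ in $k^{\times}$. For $n\in\mathbb N$ and a module $M$, $nM$ is the direct sum of $n$ copies of $M$ ($0M=0$); empty direct sums are $0$. $H=kG(\chi^{-1},a,0)$ is the Hopf algebra generated as an algebra by $G$ and $x$ with relations $xg=\chi^{-1}(g)gx$ ($g\in G$) in addition to those of $kG$; it has $k$-basis $\{gx^i\mid g\in G, i\ge 0\}$, and $\Delta(x)=x\otimes a+1\otimes x$, $\varepsilon(x)=0$, $S(x)=-xa^{-1}$, $\Delta(g)=g\otimes g$, $\varepsilon(g)=1$, $S(g)=g^{-1}$. Tensor products of $H$-modules are over $k$, with action through $\Delta$. $\{V_i\mid i\in I\}$ is a complete set of representatives of isomorphism classes of simple $kG$-modules. $N_{i,j}^l$ is the multiplicity of $V_l$ in $V_i\otimes V_j$. For $i\in I$, $\omega_i\in k^{\times}$ is the scalar by which the central element $a$ acts on $V_i$. For $i\in I$ put $M(V_i)=H\otimes_{kG}V_i$. For $t\in\mathbb N^+$ put $V_t(i)=M(V_i)/x^tM(V_i)$ (where $x^tM(V_i)$ is the submodule generated by $x^t\otimes V_i$), and for $\beta\in k$ put $V_t(i,\beta)=M(V_i)/(x^s-\beta)^tM(V_i)$ (here $x^s$ is central in $H$). *)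

theory Defs
  imports
    "HOL-Algebra.Algebra"
    "HOL-Algebra.Free_Abelian_Groups"
    "HOL-Computational_Algebra.Polynomial"
begin

section \<open>Left modules over a not necessarily commutative ring\<close>

text \<open>
  The library locale \<open>module\<close> asks for a commutative ring; this is the same list of axioms over an
  arbitrary ring. The fields \<open>mult\<close> and \<open>one\<close> of the library's module records are meaningless
  for modules and are left \<open>undefined\<close> below.
\<close>

locale left_module = R?: ring R + M?: abelian_group M
  for R :: "('r, 'x) ring_scheme" (structure) and M :: "('r, 'm, 'y) module_scheme" (structure) +
  assumes smult_closed: "\<lbrakk>h \<in> carrier R; m \<in> carrier M\<rbrakk> \<Longrightarrow> h \<odot>\<^bsub>M\<^esub> m \<in> carrier M"
    and smult_l_distr: "\<lbrakk>h \<in> carrier R; h' \<in> carrier R; m \<in> carrier M\<rbrakk> \<Longrightarrow>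
      (h \<oplus>\<^bsub>R\<^esub> h') \<odot>\<^bsub>M\<^esub> m = (h \<odot>\<^bsub>M\<^esub> m) \<oplus>\<^bsub>M\<^esub> (h' \<odot>\<^bsub>M\<^esub> m)"
    and smult_r_distr: "\<lbrakk>h \<in> carrier R; m \<in> carrier M; m' \<in> carrier M\<rbrakk> \<Longrightarrow>
      h \<odot>\<^bsub>M\<^esub> (m \<oplus>\<^bsub>M\<^esub> m') = (h \<odot>\<^bsub>M\<^esub> m) \<oplus>\<^bsub>M\<^esub> (h \<odot>\<^bsub>M\<^esub> m')"
    and smult_assoc: "\<lbrakk>h \<in> carrier R; h' \<in> carrier R; m \<in> carrier M\<rbrakk> \<Longrightarrow>
      (h \<otimes>\<^bsub>R\<^esub> h') \<odot>\<^bsub>M\<^esub> m = h \<odot>\<^bsub>M\<^esub> (h' \<odot>\<^bsub>M\<^esub> m)"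
    and smult_one: "m \<in> carrier M \<Longrightarrow> \<one>\<^bsub>R\<^esub> \<odot>\<^bsub>M\<^esub> m = m"

definition module_iso ::
  "('r, 'x) ring_scheme \<Rightarrow> ('r, 'm, 'y) module_scheme \<Rightarrow> ('r, 'n, 'z) module_scheme \<Rightarrow> bool" where
  "module_iso R M N \<longleftrightarrow> (\<exists>f. bij_betw f (carrier M) (carrier N) \<and>
     (\<forall>m\<in>carrier M. \<forall>m'\<in>carrier M. f (m \<oplus>\<^bsub>M\<^esub> m') = f m \<oplus>\<^bsub>N\<^esub> f m') \<and>
     (\<forall>h\<in>carrier R. \<forall>m\<in>carrier M. f (h \<odot>\<^bsub>M\<^esub> m) = h \<odot>\<^bsub>N\<^esub> f m))"

definition simple_module :: "('r, 'x) ring_scheme \<Rightarrow> ('r, 'm, 'y) module_scheme \<Rightarrow> bool" where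
  "simple_module R M \<longleftrightarrow> left_module R M \<and> carrier M \<noteq> {\<zero>\<^bsub>M\<^esub>} \<and>
     (\<forall>N. submodule N R M \<longrightarrow> N = {\<zero>\<^bsub>M\<^esub>} \<or> N = carrier M)"

text \<open>
  \<open>V\<close> is a complete set of representatives, without repetition, of the isomorphism classes of
  simple modules. Completeness can only mention modules whose elements have one fixed type; subsets
  of \<open>R\<close> are enough, because every simple \<open>R\<close>-module is isomorphic to a quotient of the
  regular module by a maximal left ideal, whose elements are cosets.
\<close>

definition simple_representatives ::
  "('r, 'x) ring_scheme \<Rightarrow> 'i set \<Rightarrow> ('i \<Rightarrow> ('r, 'v) module) \<Rightarrow> bool" where
  "simple_representatives R I V \<longleftrightarrow>
     (\<forall>i\<in>I. simple_module R (V i)) \<and>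
     (\<forall>i\<in>I. \<forall>j\<in>I. module_iso R (V i) (V j) \<longrightarrow> i = j) \<and>
     (\<forall>W :: ('r, 'r set) module. simple_module R W \<longrightarrow> (\<exists>i\<in>I. module_iso R W (V i)))"

definition generated_submodule ::
  "('r, 'x) ring_scheme \<Rightarrow> ('r, 'm, 'y) module_scheme \<Rightarrow> 'm set \<Rightarrow> 'm set" where
  "generated_submodule R M S = \<Inter>{N. submodule N R M \<and> S \<subseteq> N}"

definition quotient_module :: "('r, 'm, 'y) module_scheme \<Rightarrow> 'm set \<Rightarrow> ('r, 'm set) module" where
  "quotient_module M N =
     \<lparr>carrier = a_rcosets\<^bsub>M\<^esub> N, monoid.mult = undefined, monoid.one = undefined,
      ring.zero = N, ring.add = set_add M,
      module.smult = (\<lambda>h C. \<Union>c\<in>C. N +>\<^bsub>M\<^esub> (h \<odot>\<^bsub>M\<^esub> c))\<rparr>"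

definition direct_sum :: "'j set \<Rightarrow> ('j \<Rightarrow> ('r, 'm) module) \<Rightarrow> ('r, 'j \<Rightarrow> 'm) module" where
  "direct_sum J M =
     \<lparr>carrier = {f \<in> (\<Pi>\<^sub>E j\<in>J. carrier (M j)). finite {j \<in> J. f j \<noteq> \<zero>\<^bsub>M j\<^esub>}},
      monoid.mult = undefined, monoid.one = undefined, ring.zero = (\<lambda>j\<in>J. \<zero>\<^bsub>M j\<^esub>),
      ring.add = (\<lambda>f f'. \<lambda>j\<in>J. f j \<oplus>\<^bsub>M j\<^esub> f' j),
      module.smult = (\<lambda>h f. \<lambda>j\<in>J. h \<odot>\<^bsub>M j\<^esub> f j)\<rparr>"

definition copies :: "nat \<Rightarrow> ('r, 'm) module \<Rightarrow> ('r, nat \<Rightarrow> 'm) module" where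
  "copies n M = direct_sum {..<n} (\<lambda>_. M)"

definition binary_sum :: "('r, 'm) module \<Rightarrow> ('r, 'n) module \<Rightarrow> ('r, 'm \<times> 'n) module" where
  "binary_sum M N =
     \<lparr>carrier = carrier M \<times> carrier N, monoid.mult = undefined, monoid.one = undefined,
      ring.zero = (\<zero>\<^bsub>M\<^esub>, \<zero>\<^bsub>N\<^esub>),
      ring.add = (\<lambda>(m, n) (m', n'). (m \<oplus>\<^bsub>M\<^esub> m', n \<oplus>\<^bsub>N\<^esub> n')),
      module.smult = (\<lambda>h (m, n). (h \<odot>\<^bsub>M\<^esub> m, h \<odot>\<^bsub>N\<^esub> n))\<rparr>"


section \<open>Balanced tensor products\<close>

text \<open>
  For an abelian group \<open>M\<close> with a right action \<open>ra\<close> and an abelian group \<open>N\<close> with a left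
  action \<open>la\<close> of the same set \<open>S\<close> of scalars, the tensor product is the free abelian group on
  the pairs \<open>(m, n)\<close> modulo biadditivity and \<open>ms \<otimes> n = m \<otimes> sn\<close>. Both tensor products over
  \<open>k\<close> and tensor products over \<open>kG\<close> are instances.
\<close>

definition tensor_kernel :: "'s set \<Rightarrow> ('m, 'x) ring_scheme \<Rightarrow> ('m \<Rightarrow> 's \<Rightarrow> 'm) \<Rightarrow>
    ('n, 'y) ring_scheme \<Rightarrow> ('s \<Rightarrow> 'n \<Rightarrow> 'n) \<Rightarrow> ('m \<times> 'n \<Rightarrow>\<^sub>0 int) set" where
  "tensor_kernel S M ra N la = generate (free_Abelian_group (carrier M \<times> carrier N))
     ({frag_of (m \<oplus>\<^bsub>M\<^esub> m', n) - frag_of (m, n) - frag_of (m', n) | m m' n.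
         m \<in> carrier M \<and> m' \<in> carrier M \<and> n \<in> carrier N} \<union>
      {frag_of (m, n \<oplus>\<^bsub>N\<^esub> n') - frag_of (m, n) - frag_of (m, n') | m n n'.
         m \<in> carrier M \<and> n \<in> carrier N \<and> n' \<in> carrier N} \<union>
      {frag_of (ra m s, n) - frag_of (m, la s n) | m s n.
         m \<in> carrier M \<and> s \<in> S \<and> n \<in> carrier N})"

definition tensor_group :: "'s set \<Rightarrow> ('m, 'x) ring_scheme \<Rightarrow> ('m \<Rightarrow> 's \<Rightarrow> 'm) \<Rightarrow>
    ('n, 'y) ring_scheme \<Rightarrow> ('s \<Rightarrow> 'n \<Rightarrow> 'n) \<Rightarrow> ('m \<times> 'n \<Rightarrow>\<^sub>0 int) set monoid" where
  "tensor_group S M ra N la =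
     free_Abelian_group (carrier M \<times> carrier N) Mod tensor_kernel S M ra N la"

text \<open>
  The class of \<open>z\<close> in \<open>M \<otimes> N\<close>, the pure tensors, and the map \<open>f \<otimes> g\<close> induced by
  endomorphisms \<open>f\<close> of \<open>M\<close> and \<open>g\<close> of \<open>N\<close> compatible with the scalars (for which all
  members of the union are the same coset).
\<close>

definition tensor_class :: "'s set \<Rightarrow> ('m, 'x) ring_scheme \<Rightarrow> ('m \<Rightarrow> 's \<Rightarrow> 'm) \<Rightarrow>
    ('n, 'y) ring_scheme \<Rightarrow> ('s \<Rightarrow> 'n \<Rightarrow> 'n) \<Rightarrow> ('m \<times> 'n \<Rightarrow>\<^sub>0 int) \<Rightarrow> ('m \<times> 'n \<Rightarrow>\<^sub>0 int) set" where
  "tensor_class S M ra N la z =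
     tensor_kernel S M ra N la #>\<^bsub>free_Abelian_group (carrier M \<times> carrier N)\<^esub> z"

definition pure_tensor :: "'s set \<Rightarrow> ('m, 'x) ring_scheme \<Rightarrow> ('m \<Rightarrow> 's \<Rightarrow> 'm) \<Rightarrow>
    ('n, 'y) ring_scheme \<Rightarrow> ('s \<Rightarrow> 'n \<Rightarrow> 'n) \<Rightarrow> 'm \<Rightarrow> 'n \<Rightarrow> ('m \<times> 'n \<Rightarrow>\<^sub>0 int) set" where
  "pure_tensor S M ra N la m n = tensor_class S M ra N la (frag_of (m, n))"

definition tensor_map :: "'s set \<Rightarrow> ('m, 'x) ring_scheme \<Rightarrow> ('m \<Rightarrow> 's \<Rightarrow> 'm) \<Rightarrow>
    ('n, 'y) ring_scheme \<Rightarrow> ('s \<Rightarrow> 'n \<Rightarrow> 'n) \<Rightarrow> ('m \<Rightarrow> 'm) \<Rightarrow> ('n \<Rightarrow> 'n) \<Rightarrow>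
    ('m \<times> 'n \<Rightarrow>\<^sub>0 int) set \<Rightarrow> ('m \<times> 'n \<Rightarrow>\<^sub>0 int) set" where
  "tensor_map S M ra N la f g C =
     (\<Union>z\<in>C. tensor_class S M ra N la (frag_extend (\<lambda>(m, n). frag_of (f m, g n)) z))"


section \<open>Twisted monoid algebras\<close>

text \<open>
  The \<open>k\<close>-algebra with basis (the carrier of) a monoid \<open>P\<close> and product
  \<open>b \<cdot> b' = c b b' (b b')\<close> on basis elements.
\<close>

definition twisted_algebra ::
  "('b, 'x) monoid_scheme \<Rightarrow> ('b \<Rightarrow> 'b \<Rightarrow> 'k::field) \<Rightarrow> ('b \<Rightarrow>\<^sub>0 'k) ring" where
  "twisted_algebra P c =
     \<lparr>carrier = {f. Poly_Mapping.keys f \<subseteq> carrier P},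
      monoid.mult = (\<lambda>f f'. \<Sum>b\<in>Poly_Mapping.keys f. \<Sum>b'\<in>Poly_Mapping.keys f'.
        Poly_Mapping.single (b \<otimes>\<^bsub>P\<^esub> b')
          (Poly_Mapping.lookup f b * Poly_Mapping.lookup f' b' * c b b')),
      monoid.one = Poly_Mapping.single \<one>\<^bsub>P\<^esub> 1, ring.zero = 0, ring.add = (+)\<rparr>"

definition scalar :: "('b, 'x) monoid_scheme \<Rightarrow> 'k::field \<Rightarrow> ('b \<Rightarrow>\<^sub>0 'k)" where
  "scalar P \<alpha> = Poly_Mapping.single \<one>\<^bsub>P\<^esub> \<alpha>"

lemma twisted_mult_superset:
  fixes c :: "'b \<Rightarrow> 'b \<Rightarrow> 'k::field"
  assumes "finite A" "finite B" "Poly_Mapping.keys f \<subseteq> A" "Poly_Mapping.keys f' \<subseteq> B"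
  shows "f \<otimes>\<^bsub>twisted_algebra P c\<^esub> f' = (\<Sum>b\<in>A. \<Sum>b'\<in>B.
        Poly_Mapping.single (b \<otimes>\<^bsub>P\<^esub> b')
          (Poly_Mapping.lookup f b * Poly_Mapping.lookup f' b' * c b b'))"
proof -
  have inner: "(\<Sum>b'\<in>Poly_Mapping.keys f'. Poly_Mapping.single (b \<otimes>\<^bsub>P\<^esub> b')
          (Poly_Mapping.lookup f b * Poly_Mapping.lookup f' b' * c b b')) =
      (\<Sum>b'\<in>B. Poly_Mapping.single (b \<otimes>\<^bsub>P\<^esub> b')
          (Poly_Mapping.lookup f b * Poly_Mapping.lookup f' b' * c b b'))" for b
    by (rule sum.mono_neutral_left) (use assms in \<open>auto simp: in_keys_iff\<close>)
  have "f \<otimes>\<^bsub>twisted_algebra P c\<^esub> f' = (\<Sum>b\<in>Poly_Mapping.keys f. \<Sum>b'\<in>B.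
        Poly_Mapping.single (b \<otimes>\<^bsub>P\<^esub> b')
          (Poly_Mapping.lookup f b * Poly_Mapping.lookup f' b' * c b b'))"
    by (simp add: twisted_algebra_def inner)
  also have "\<dots> = (\<Sum>b\<in>A. \<Sum>b'\<in>B. Poly_Mapping.single (b \<otimes>\<^bsub>P\<^esub> b')
          (Poly_Mapping.lookup f b * Poly_Mapping.lookup f' b' * c b b'))"
    by (rule sum.mono_neutral_left) (use assms in \<open>auto simp: in_keys_iff\<close>)
  finally show ?thesis .
qed

lemma twisted_mult_add_left:
  "(f + f') \<otimes>\<^bsub>twisted_algebra P c\<^esub> h =
   f \<otimes>\<^bsub>twisted_algebra P c\<^esub> h + f' \<otimes>\<^bsub>twisted_algebra P c\<^esub> h"
proof -
  let ?A = "Poly_Mapping.keys f \<union> Poly_Mapping.keys f'"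
  have "Poly_Mapping.keys (f + f') \<subseteq> ?A" by (rule keys_add)
  then show ?thesis
    by (simp add: twisted_mult_superset[of ?A "Poly_Mapping.keys h"] lookup_add algebra_simps
        single_add sum.distrib)
qed

lemma twisted_mult_add_right:
  "h \<otimes>\<^bsub>twisted_algebra P c\<^esub> (f + f') =
   h \<otimes>\<^bsub>twisted_algebra P c\<^esub> f + h \<otimes>\<^bsub>twisted_algebra P c\<^esub> f'"
proof -
  let ?A = "Poly_Mapping.keys f \<union> Poly_Mapping.keys f'"
  have "Poly_Mapping.keys (f + f') \<subseteq> ?A" by (rule keys_add)
  then show ?thesis
    by (simp add: twisted_mult_superset[of "Poly_Mapping.keys h" ?A] lookup_add algebra_simps
        single_add sum.distrib)
qed

lemma twisted_mult_zero [simp]: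
  "0 \<otimes>\<^bsub>twisted_algebra P c\<^esub> f = 0" "f \<otimes>\<^bsub>twisted_algebra P c\<^esub> 0 = 0"
  by (simp_all add: twisted_algebra_def)

lemma twisted_mult_sum_left:
  "(\<Sum>i\<in>A. f i) \<otimes>\<^bsub>twisted_algebra P c\<^esub> h = (\<Sum>i\<in>A. f i \<otimes>\<^bsub>twisted_algebra P c\<^esub> h)"
  by (induction A rule: infinite_finite_induct) (simp_all add: twisted_mult_add_left)

lemma twisted_mult_sum_right:
  "h \<otimes>\<^bsub>twisted_algebra P c\<^esub> (\<Sum>i\<in>A. f i) = (\<Sum>i\<in>A. h \<otimes>\<^bsub>twisted_algebra P c\<^esub> f i)"
  by (induction A rule: infinite_finite_induct) (simp_all add: twisted_mult_add_right)

lemma twisted_mult_single: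
  "Poly_Mapping.single b \<alpha> \<otimes>\<^bsub>twisted_algebra P c\<^esub> Poly_Mapping.single b' \<alpha>' =
   Poly_Mapping.single (b \<otimes>\<^bsub>P\<^esub> b') (\<alpha> * \<alpha>' * c b b')"
  by (subst twisted_mult_superset[of "{b}" "{b'}"]) auto

lemma poly_mapping_sum_single:
  "f = (\<Sum>b\<in>Poly_Mapping.keys f. Poly_Mapping.single b (Poly_Mapping.lookup f b))"
  by (rule poly_mapping_eqI) (auto simp: lookup_sum lookup_single when_def in_keys_iff)

lemma ring_twisted_algebra:
  fixes c :: "'b \<Rightarrow> 'b \<Rightarrow> 'k::field"
  assumes P: "monoid P"
    and unit: "\<And>b. b \<in> carrier P \<Longrightarrow> c \<one>\<^bsub>P\<^esub> b = 1 \<and> c b \<one>\<^bsub>P\<^esub> = 1"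
    and cocycle: "\<And>b b' b''. \<lbrakk>b \<in> carrier P; b' \<in> carrier P; b'' \<in> carrier P\<rbrakk> \<Longrightarrow>
      c b b' * c (b \<otimes>\<^bsub>P\<^esub> b') b'' = c b' b'' * c b (b' \<otimes>\<^bsub>P\<^esub> b'')"
  shows "ring (twisted_algebra P c)"
proof -
  interpret P: monoid P by fact
  let ?A = "twisted_algebra P c"
  have carr: "f \<in> carrier ?A \<longleftrightarrow> Poly_Mapping.keys f \<subseteq> carrier P" for f
    by (simp add: twisted_algebra_def)
  have add: "f \<oplus>\<^bsub>?A\<^esub> f' = f + f'" and zero: "\<zero>\<^bsub>?A\<^esub> = 0"
    and one: "\<one>\<^bsub>?A\<^esub> = Poly_Mapping.single \<one>\<^bsub>P\<^esub> 1" for f f'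
    by (simp_all add: twisted_algebra_def)
  have single_ext: "F f" if f: "f \<in> carrier ?A"
    and F0: "F 0" and Fs: "\<And>b \<alpha>. b \<in> carrier P \<Longrightarrow> F (Poly_Mapping.single b \<alpha>)"
    and Fadd: "\<And>f f'. F f \<Longrightarrow> F f' \<Longrightarrow> F (f + f')" for F f
  proof -
    have "F (\<Sum>b\<in>B. Poly_Mapping.single b (Poly_Mapping.lookup f b))" if "B \<subseteq> carrier P" for B
      using that by (induction B rule: infinite_finite_induct) (auto intro: F0 Fs Fadd)
    then show ?thesis using f poly_mapping_sum_single[of f] carr by metis
  qed
  have ab: "abelian_group ?A"
  proof (rule abelian_groupI, unfold add zero)
    fix x y z
    assume "x \<in> carrier ?A"
    then have "- x \<in> carrier ?A" by (simp add: carr)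
    then show "\<exists>y\<in>carrier ?A. y + x = 0" by force
    assume "y \<in> carrier ?A"
    then show "x + y \<in> carrier ?A"
      using \<open>x \<in> carrier ?A\<close> keys_add[of x y] by (auto simp: carr)
  qed (auto simp: carr add.assoc add.commute)
  have mon: "Group.monoid ?A"
  proof (rule monoidI, unfold one)
    show "Poly_Mapping.single \<one>\<^bsub>P\<^esub> 1 \<in> carrier ?A" by (simp add: carr)
  next
    fix x y z assume x: "x \<in> carrier ?A"
    show "Poly_Mapping.single \<one>\<^bsub>P\<^esub> 1 \<otimes>\<^bsub>?A\<^esub> x = x"
      by (rule single_ext[OF x, where F = "\<lambda>x. Poly_Mapping.single \<one>\<^bsub>P\<^esub> 1 \<otimes>\<^bsub>?A\<^esub> x = x"])
        (auto simp: twisted_mult_single unit twisted_mult_add_right)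
    show "x \<otimes>\<^bsub>?A\<^esub> Poly_Mapping.single \<one>\<^bsub>P\<^esub> 1 = x"
      by (rule single_ext[OF x, where F = "\<lambda>x. x \<otimes>\<^bsub>?A\<^esub> Poly_Mapping.single \<one>\<^bsub>P\<^esub> 1 = x"])
        (auto simp: twisted_mult_single unit twisted_mult_add_left)
    assume y: "y \<in> carrier ?A"
    show "x \<otimes>\<^bsub>?A\<^esub> y \<in> carrier ?A"
    proof -
      have "Poly_Mapping.keys (x \<otimes>\<^bsub>?A\<^esub> y) \<subseteq>
          (\<Union>b\<in>Poly_Mapping.keys x. \<Union>b'\<in>Poly_Mapping.keys y. {b \<otimes>\<^bsub>P\<^esub> b'})"
        unfolding twisted_algebra_def
        by (simp, rule order_trans[OF keys_sum], rule UN_mono[OF order_refl],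
            rule order_trans[OF keys_sum], rule UN_mono[OF order_refl]) (simp add: keys_single)
      then show ?thesis using x y unfolding carr by fastforce
    qed
    assume z: "z \<in> carrier ?A"
    show "x \<otimes>\<^bsub>?A\<^esub> y \<otimes>\<^bsub>?A\<^esub> z = x \<otimes>\<^bsub>?A\<^esub> (y \<otimes>\<^bsub>?A\<^esub> z)" using x
    proof (rule single_ext)
      fix b \<alpha> assume b: "b \<in> carrier P"
      show "Poly_Mapping.single b \<alpha> \<otimes>\<^bsub>?A\<^esub> y \<otimes>\<^bsub>?A\<^esub> z = Poly_Mapping.single b \<alpha> \<otimes>\<^bsub>?A\<^esub> (y \<otimes>\<^bsub>?A\<^esub> z)"
        using y
      proof (rule single_ext)
        fix b' \<alpha>' assume b': "b' \<in> carrier P"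
        show "Poly_Mapping.single b \<alpha> \<otimes>\<^bsub>?A\<^esub> Poly_Mapping.single b' \<alpha>' \<otimes>\<^bsub>?A\<^esub> z =
          Poly_Mapping.single b \<alpha> \<otimes>\<^bsub>?A\<^esub> (Poly_Mapping.single b' \<alpha>' \<otimes>\<^bsub>?A\<^esub> z)"
          using z
        proof (rule single_ext)
          fix b'' \<alpha>'' assume b'': "b'' \<in> carrier P"
          show "Poly_Mapping.single b \<alpha> \<otimes>\<^bsub>?A\<^esub> Poly_Mapping.single b' \<alpha>' \<otimes>\<^bsub>?A\<^esub>
              Poly_Mapping.single b'' \<alpha>'' = Poly_Mapping.single b \<alpha> \<otimes>\<^bsub>?A\<^esub>
              (Poly_Mapping.single b' \<alpha>' \<otimes>\<^bsub>?A\<^esub> Poly_Mapping.single b'' \<alpha>'')"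
            using cocycle[OF b b' b''] P.m_assoc[OF b b' b'']
            by (simp add: twisted_mult_single mult.assoc mult.left_commute)
        qed (auto simp: twisted_mult_add_right)
      qed (auto simp: twisted_mult_add_left twisted_mult_add_right)
    qed (auto simp: twisted_mult_add_left)
  qed
  show ?thesis
    by (rule ringI[OF ab mon]) (simp_all add: add twisted_mult_add_left twisted_mult_add_right)
qed


section \<open>Linear characters\<close>

definition unit_group :: "'k::field monoid" where
  "unit_group = \<lparr>carrier = - {0}, monoid.mult = (*), monoid.one = 1\<rparr>"

definition character_group :: "('g, 'x) monoid_scheme \<Rightarrow> ('g \<Rightarrow> 'k::field) monoid" where
  "character_group G =
     \<lparr>carrier = hom G unit_group \<inter> extensional (carrier G),
      monoid.mult = (\<lambda>\<phi> \<psi>. \<lambda>g\<in>carrier G. \<phi> g * \<psi> g), monoid.one = (\<lambda>g\<in>carrier G. 1)\<rparr>"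


lemma character_mult:
  "\<lbrakk>\<chi> \<in> carrier (character_group G); g \<in> carrier G; h \<in> carrier G\<rbrakk> \<Longrightarrow> \<chi> (g \<otimes>\<^bsub>G\<^esub> h) = \<chi> g * \<chi> h"
  by (auto simp: character_group_def hom_def unit_group_def)

lemma character_nonzero:
  "\<lbrakk>\<chi> \<in> carrier (character_group G); g \<in> carrier G\<rbrakk> \<Longrightarrow> \<chi> g \<noteq> 0"
  by (auto simp: character_group_def hom_def unit_group_def)

lemma character_one:
  assumes "group G" and "\<chi> \<in> carrier (character_group G)"
  shows "\<chi> \<one>\<^bsub>G\<^esub> = 1"
proof -
  interpret group G by fact
  have "\<chi> \<one>\<^bsub>G\<^esub> * \<chi> \<one>\<^bsub>G\<^esub> = \<chi> \<one>\<^bsub>G\<^esub>"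
    using character_mult[OF assms(2) one_closed one_closed] by simp
  then show ?thesis using character_nonzero[OF assms(2) one_closed] by simp
qed


section \<open>The Hopf algebras \<open>kG\<close> and \<open>H = kG(\<chi>\<^sup>-\<^sup>1, a, 0)\<close>\<close>

abbreviation group_algebra :: "('g, 'x) monoid_scheme \<Rightarrow> ('g \<Rightarrow>\<^sub>0 'k::field) ring" where
  "group_algebra G \<equiv> twisted_algebra G (\<lambda>_ _. 1)"

text \<open>
  The pair \<open>(g, i)\<close> stands for the basis element \<open>g x\<^sup>i\<close> of \<open>H\<close>. Since
  \<open>x g = \<chi>\<^sup>-\<^sup>1(g) g x\<close>, one has \<open>(g x\<^sup>i)(h x\<^sup>j) = \<chi>\<^sup>-\<^sup>1(h)\<^sup>i gh x\<^sup>i\<^sup>+\<^sup>j\<close>.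
\<close>

definition ore_basis :: "('g, 'x) monoid_scheme \<Rightarrow> ('g \<times> nat) monoid" where
  "ore_basis G = G \<times>\<times> \<lparr>carrier = UNIV, monoid.mult = (+), monoid.one = 0\<rparr>"

definition ore_twist :: "('g \<Rightarrow> 'k::field) \<Rightarrow> 'g \<times> nat \<Rightarrow> 'g \<times> nat \<Rightarrow> 'k" where
  "ore_twist \<chi> = (\<lambda>(g, i) (h, j). inverse (\<chi> h) ^ i)"

definition ore_algebra ::
  "('g, 'x) monoid_scheme \<Rightarrow> ('g \<Rightarrow> 'k::field) \<Rightarrow> ('g \<times> nat \<Rightarrow>\<^sub>0 'k) ring" where
  "ore_algebra G \<chi> = twisted_algebra (ore_basis G) (ore_twist \<chi>)"

definition ore_g :: "'g \<Rightarrow> ('g \<times> nat \<Rightarrow>\<^sub>0 'k::field)" where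
  "ore_g g = Poly_Mapping.single (g, 0) 1"

definition ore_x :: "('g, 'x) monoid_scheme \<Rightarrow> ('g \<times> nat \<Rightarrow>\<^sub>0 'k::field)" where
  "ore_x G = Poly_Mapping.single (\<one>\<^bsub>G\<^esub>, 1) 1"

definition ore_embed :: "('g \<Rightarrow>\<^sub>0 'k::field) \<Rightarrow> ('g \<times> nat \<Rightarrow>\<^sub>0 'k)" where
  "ore_embed f = (\<Sum>g\<in>Poly_Mapping.keys f. Poly_Mapping.single (g, 0) (Poly_Mapping.lookup f g))"

lemma ring_group_algebra: "group G \<Longrightarrow> ring (group_algebra G)"
  by (rule ring_twisted_algebra) (auto intro: group.is_monoid)

lemma ring_ore_algebra:
  assumes "group G" and "\<chi> \<in> carrier (character_group G)"
  shows "ring (ore_algebra G \<chi>)"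
proof -
  interpret group G by fact
  note hom = character_mult[OF assms(2)] character_nonzero[OF assms(2)]
    and one = character_one[OF assms(1,2)]
  have "monoid \<lparr>carrier = UNIV, monoid.mult = (+), monoid.one = 0::nat\<rparr>"
    by (rule monoidI) auto
  then show ?thesis unfolding ore_algebra_def ore_basis_def
    by (intro ring_twisted_algebra DirProd_monoid monoid_axioms)
      (auto simp: ore_twist_def hom one power_add power_mult_distrib algebra_simps DirProd_def)
qed

lemma ore_g_mult: "ore_g g \<otimes>\<^bsub>ore_algebra G \<chi>\<^esub> ore_g h = ore_g (g \<otimes>\<^bsub>G\<^esub> h)"
  by (simp add: ore_g_def ore_algebra_def twisted_mult_single ore_basis_def DirProd_def
      ore_twist_def)

lemma ore_relation:
  assumes "group G" and "g \<in> carrier G"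
  shows "ore_x G \<otimes>\<^bsub>ore_algebra G \<chi>\<^esub> ore_g g =
    scalar (ore_basis G) (inverse (\<chi> g)) \<otimes>\<^bsub>ore_algebra G \<chi>\<^esub> (ore_g g \<otimes>\<^bsub>ore_algebra G \<chi>\<^esub> ore_x G)"
proof -
  interpret group G by fact
  show ?thesis using assms(2)
    by (simp add: ore_x_def ore_g_def scalar_def ore_algebra_def twisted_mult_single ore_basis_def
        DirProd_def ore_twist_def)
qed

lemma ore_normal_form:
  assumes "group G" and "\<chi> \<in> carrier (character_group G)" and "g \<in> carrier G"
  shows "ore_g g \<otimes>\<^bsub>ore_algebra G \<chi>\<^esub> (ore_x G [^]\<^bsub>ore_algebra G \<chi>\<^esub> i) = Poly_Mapping.single (g, i) 1"
proof -
  interpret group G by fact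
  note hom = character_mult[OF assms(2)] character_nonzero[OF assms(2)]
    and one = character_one[OF assms(1,2)]
  have "ore_x G [^]\<^bsub>ore_algebra G \<chi>\<^esub> i = Poly_Mapping.single (\<one>\<^bsub>G\<^esub>, i) 1"
  proof (induction i)
    case 0
    show ?case by (simp add: nat_pow_def ore_algebra_def twisted_algebra_def ore_basis_def DirProd_def)
  next
    case (Suc i)
    then show ?case
      by (simp add: nat_pow_def ore_algebra_def twisted_mult_single ore_x_def ore_basis_def
          DirProd_def ore_twist_def one)
  qed
  then show ?thesis using assms(3) one
    by (simp add: ore_g_def ore_algebra_def twisted_mult_single ore_basis_def DirProd_def
        ore_twist_def)
qed

text \<open>
  \<open>A \<otimes> A\<close> for a twisted monoid algebra \<open>A\<close>: the pair \<open>(b, b')\<close> stands for the basis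
  element \<open>b \<otimes> b'\<close>.
\<close>

definition twisted_square ::
  "('b, 'x) monoid_scheme \<Rightarrow> ('b \<Rightarrow> 'b \<Rightarrow> 'k::field) \<Rightarrow> ('b \<times> 'b \<Rightarrow>\<^sub>0 'k) ring" where
  "twisted_square P c = twisted_algebra (P \<times>\<times> P) (\<lambda>(b, b') (d, d'). c b d * c b' d')"

definition group_comult :: "('g \<Rightarrow>\<^sub>0 'k::field) \<Rightarrow> ('g \<times> 'g \<Rightarrow>\<^sub>0 'k)" where
  "group_comult f =
     (\<Sum>g\<in>Poly_Mapping.keys f. Poly_Mapping.single (g, g) (Poly_Mapping.lookup f g))"

definition ore_comult_x ::
  "('g, 'x) monoid_scheme \<Rightarrow> 'g \<Rightarrow> (('g \<times> nat) \<times> ('g \<times> nat) \<Rightarrow>\<^sub>0 'k::field)" where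
  "ore_comult_x G a = Poly_Mapping.single ((\<one>\<^bsub>G\<^esub>, 1), (a, 0)) 1 +
     Poly_Mapping.single ((\<one>\<^bsub>G\<^esub>, 0), (\<one>\<^bsub>G\<^esub>, 1)) 1"

text \<open>The linear map with \<open>\<Delta>(g x\<^sup>i) = (g \<otimes> g)(x \<otimes> a + 1 \<otimes> x)\<^sup>i\<close>.\<close>

definition ore_comult :: "('g, 'x) monoid_scheme \<Rightarrow> ('g \<Rightarrow> 'k::field) \<Rightarrow> 'g \<Rightarrow>
    ('g \<times> nat \<Rightarrow>\<^sub>0 'k) \<Rightarrow> (('g \<times> nat) \<times> ('g \<times> nat) \<Rightarrow>\<^sub>0 'k)" where
  "ore_comult G \<chi> a f = (let HH = twisted_square (ore_basis G) (ore_twist \<chi>) in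
     \<Sum>(g, i)\<in>Poly_Mapping.keys f.
       Poly_Mapping.single ((g, 0), (g, 0)) (Poly_Mapping.lookup f (g, i))
         \<otimes>\<^bsub>HH\<^esub> (ore_comult_x G a [^]\<^bsub>HH\<^esub> i))"


lemma ore_comult_g:
  assumes "group G" and "\<chi> \<in> carrier (character_group G)" and "g \<in> carrier G"
  shows "ore_comult G \<chi> a (ore_g g) = Poly_Mapping.single ((g, 0), (g, 0)) 1"
proof -
  interpret group G by fact
  show ?thesis using assms(3) character_one[OF assms(1,2)]
    by (simp add: ore_comult_def ore_g_def Let_def nat_pow_def twisted_square_def
        twisted_algebra_def ore_basis_def DirProd_def ore_twist_def)
qed

lemma ore_comult_x:
  assumes "group G" and "\<chi> \<in> carrier (character_group G)" and "a \<in> carrier G"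
  shows "ore_comult G \<chi> a (ore_x G) = ore_comult_x G a"
proof -
  interpret group G by fact
  show ?thesis using assms(3) character_one[OF assms(1,2)]
    by (simp add: ore_comult_def ore_x_def ore_comult_x_def Let_def nat_pow_def twisted_square_def
        twisted_mult_add_right twisted_mult_single)
      (simp add: twisted_algebra_def twisted_mult_single ore_basis_def DirProd_def ore_twist_def)
qed


section \<open>Tensor products of modules\<close>

text \<open>
  For modules \<open>M\<close> and \<open>N\<close> over a twisted monoid algebra on \<open>P\<close> with comultiplication
  \<open>\<Delta>\<close>, the tensor product \<open>M \<otimes>\<^sub>k N\<close> with \<open>h\<close> acting as
  \<open>\<Delta>(h) = \<Sum> \<alpha>\<^sub>b\<^sub>,\<^sub>b\<^sub>' b \<otimes> b'\<close>, that is, by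
  \<open>h (m \<otimes> n) = \<Sum> (\<alpha>\<^sub>b\<^sub>,\<^sub>b\<^sub>' b) m \<otimes> b' n\<close>. The finite sum in \<open>M \<otimes> N\<close> is
  the library's \<open>finprod\<close>, as the group \<open>M \<otimes> N\<close> is a \<open>monoid\<close> record.
\<close>

definition tensor_module ::
  "('b, 'x) monoid_scheme \<Rightarrow> (('b \<Rightarrow>\<^sub>0 'k) \<Rightarrow> ('b \<times> 'b \<Rightarrow>\<^sub>0 'k)) \<Rightarrow>
   ('b \<Rightarrow>\<^sub>0 'k::field, 'm) module \<Rightarrow> ('b \<Rightarrow>\<^sub>0 'k, 'n) module \<Rightarrow>
   ('b \<Rightarrow>\<^sub>0 'k, ('m \<times> 'n \<Rightarrow>\<^sub>0 int) set) module" where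
  "tensor_module P \<Delta> M N =
    (let ra = (\<lambda>m \<alpha>. scalar P \<alpha> \<odot>\<^bsub>M\<^esub> m); la = (\<lambda>\<alpha> n. scalar P \<alpha> \<odot>\<^bsub>N\<^esub> n);
         T = tensor_group (UNIV :: 'k set) M ra N la in
     \<lparr>carrier = carrier T, monoid.mult = undefined, monoid.one = undefined,
      ring.zero = \<one>\<^bsub>T\<^esub>, ring.add = monoid.mult T,
      module.smult = (\<lambda>h C. finprod T (\<lambda>(b, b'). tensor_map (UNIV :: 'k set) M ra N la
          (\<lambda>m. Poly_Mapping.single b (Poly_Mapping.lookup (\<Delta> h) (b, b')) \<odot>\<^bsub>M\<^esub> m)
          (\<lambda>n. Poly_Mapping.single b' 1 \<odot>\<^bsub>N\<^esub> n) C)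
        (Poly_Mapping.keys (\<Delta> h)))\<rparr>)"

definition group_tensor ::
  "('g, 'x) monoid_scheme \<Rightarrow> ('g \<Rightarrow>\<^sub>0 'k::field, 'm) module \<Rightarrow> ('g \<Rightarrow>\<^sub>0 'k, 'n) module \<Rightarrow>
   ('g \<Rightarrow>\<^sub>0 'k, ('m \<times> 'n \<Rightarrow>\<^sub>0 int) set) module" where
  "group_tensor G = tensor_module G group_comult"

definition ore_tensor ::
  "('g, 'x) monoid_scheme \<Rightarrow> ('g \<Rightarrow> 'k::field) \<Rightarrow> 'g \<Rightarrow>
   ('g \<times> nat \<Rightarrow>\<^sub>0 'k, 'm) module \<Rightarrow> ('g \<times> nat \<Rightarrow>\<^sub>0 'k, 'n) module \<Rightarrow>
   ('g \<times> nat \<Rightarrow>\<^sub>0 'k, ('m \<times> 'n \<Rightarrow>\<^sub>0 int) set) module" where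
  "ore_tensor G \<chi> a = tensor_module (ore_basis G) (ore_comult G \<chi> a)"


section \<open>The data attached to the simple \<open>kG\<close>-modules\<close>

text \<open>
  The multiplicities of the simple modules in \<open>V i \<otimes> V j\<close>: the numbers \<open>N l\<close> with
  \<open>V i \<otimes> V j \<cong> \<Oplus>\<^sub>l N l \<cdot> V l\<close>. For a finite group and a field of characteristic zero
  such numbers exist (Maschke) and are unique on \<open>I\<close> (Krull-Schmidt).
\<close>

definition fusion_mult :: "('g, 'x) monoid_scheme \<Rightarrow> 'i set \<Rightarrow>
    ('i \<Rightarrow> ('g \<Rightarrow>\<^sub>0 'k::field, 'v) module) \<Rightarrow> 'i \<Rightarrow> 'i \<Rightarrow> 'i \<Rightarrow> nat" where
  "fusion_mult G I V i j = (SOME N. module_iso (group_algebra G)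
     (group_tensor G (V i) (V j)) (direct_sum I (\<lambda>l. copies (N l) (V l))))"

text \<open>The scalar by which the central group element \<open>a\<close> acts on a simple module.\<close>

definition central_scalar ::
  "('g, 'x) monoid_scheme \<Rightarrow> 'g \<Rightarrow> ('g \<Rightarrow>\<^sub>0 'k::field, 'v) module \<Rightarrow> 'k" where
  "central_scalar G a W =
     (THE \<omega>. \<forall>w\<in>carrier W. Poly_Mapping.single a 1 \<odot>\<^bsub>W\<^esub> w = scalar G \<omega> \<odot>\<^bsub>W\<^esub> w)"


section \<open>The modules \<open>M(W)\<close>, \<open>V\<^sub>t(i)\<close> and \<open>V\<^sub>t(i, \<beta>)\<close>\<close>

text \<open>\<open>M(W) = H \<otimes> W\<close> over \<open>kG\<close>.\<close>

definition induced_module :: "('g, 'x) monoid_scheme \<Rightarrow> ('g \<Rightarrow> 'k::field) \<Rightarrow>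
    ('g \<Rightarrow>\<^sub>0 'k, 'v) module \<Rightarrow>
    ('g \<times> nat \<Rightarrow>\<^sub>0 'k, (('g \<times> nat \<Rightarrow>\<^sub>0 'k) \<times> 'v \<Rightarrow>\<^sub>0 int) set) module" where
  "induced_module G \<chi> W =
    (let H = ore_algebra G \<chi>; S = carrier (group_algebra G);
         ra = (\<lambda>h y. h \<otimes>\<^bsub>H\<^esub> ore_embed y); la = module.smult W; T = tensor_group S H ra W la in
     \<lparr>carrier = carrier T, monoid.mult = undefined, monoid.one = undefined,
      ring.zero = \<one>\<^bsub>T\<^esub>, ring.add = monoid.mult T,
      module.smult = (\<lambda>h. tensor_map S H ra W la (\<lambda>h'. h \<otimes>\<^bsub>H\<^esub> h') (\<lambda>w. w))\<rparr>)"

definition induced_tensor :: "('g, 'x) monoid_scheme \<Rightarrow> ('g \<Rightarrow> 'k::field) \<Rightarrow>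
    ('g \<Rightarrow>\<^sub>0 'k, 'v) module \<Rightarrow> ('g \<times> nat \<Rightarrow>\<^sub>0 'k) \<Rightarrow> 'v \<Rightarrow>
    (('g \<times> nat \<Rightarrow>\<^sub>0 'k) \<times> 'v \<Rightarrow>\<^sub>0 int) set" where
  "induced_tensor G \<chi> W = pure_tensor (carrier (group_algebra G)) (ore_algebra G \<chi>)
     (\<lambda>h y. h \<otimes>\<^bsub>ore_algebra G \<chi>\<^esub> ore_embed y) W (module.smult W)"

text \<open>For \<open>W = V i\<close> these are \<open>V\<^sub>t(i)\<close> and \<open>V\<^sub>t(i, \<beta>)\<close>.\<close>

definition nilpotent_module :: "('g, 'x) monoid_scheme \<Rightarrow> ('g \<Rightarrow> 'k::field) \<Rightarrow>
    nat \<Rightarrow> ('g \<Rightarrow>\<^sub>0 'k, 'v) module \<Rightarrow>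
    ('g \<times> nat \<Rightarrow>\<^sub>0 'k, (('g \<times> nat \<Rightarrow>\<^sub>0 'k) \<times> 'v \<Rightarrow>\<^sub>0 int) set set) module" where
  "nilpotent_module G \<chi> t W =
    (let H = ore_algebra G \<chi>; M = induced_module G \<chi> W in
     quotient_module M (generated_submodule H M
       {induced_tensor G \<chi> W (ore_x G [^]\<^bsub>H\<^esub> t) w | w. w \<in> carrier W}))"

definition eigen_module :: "('g, 'x) monoid_scheme \<Rightarrow> ('g \<Rightarrow> 'k::field) \<Rightarrow> nat \<Rightarrow>
    nat \<Rightarrow> ('g \<Rightarrow>\<^sub>0 'k, 'v) module \<Rightarrow> 'k \<Rightarrow>
    ('g \<times> nat \<Rightarrow>\<^sub>0 'k, (('g \<times> nat \<Rightarrow>\<^sub>0 'k) \<times> 'v \<Rightarrow>\<^sub>0 int) set set) module" where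
  "eigen_module G \<chi> s t W \<beta> =
    (let H = ore_algebra G \<chi>; M = induced_module G \<chi> W;
         z = ((ore_x G [^]\<^bsub>H\<^esub> s) \<ominus>\<^bsub>H\<^esub> scalar (ore_basis G) \<beta>) [^]\<^bsub>H\<^esub> t in
     quotient_module M ((\<lambda>m. z \<odot>\<^bsub>M\<^esub> m) ` carrier M))"

end

theory Submission
  imports Defs "HOL-Library.Function_Algebras"
begin

text \<open>
  Put \<open>n c = u + 1\<close> for \<open>c < r\<close> and \<open>n c = u\<close> for \<open>r \<le> c < s\<close> in the nilpotent case, and \<open>n c = t\<close> in the
  other one. Both \<open>V\<^sub>p(i)\<close> and \<open>V\<^sub>t(j, \<beta>)\<close> have the form \<open>U \<otimes> W\<close>, where \<open>W\<close> is the simple \<open>kG\<close>-module and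
  \<open>U\<close> has the basis \<open>x\<^sup>c (x\<^sup>s - \<beta>)\<^sup>m\<close> with \<open>c < s\<close>, \<open>m < n c\<close>, an element \<open>g\<close> acting on degree \<open>c\<close> of \<open>U\<close> by
  \<open>\<chi>(g)\<^sup>c\<close>. On the tensor product of two such modules \<open>x\<close> acts as the sum of
  \<open>x \<otimes> a\<close> and \<open>1 \<otimes> x\<close>, which commute up to the primitive \<open>s\<close>-th root of unity \<open>q = \<chi>(a)\<close>; hence
  \<open>x\<^sup>s\<close> acts as \<open>x\<^sup>s \<otimes> a\<^sup>s + 1 \<otimes> x\<^sup>s\<close>. If one \<open>\<beta>\<close> is nonzero and the other is zero, this is a nonzero scalar
  \<open>\<gamma>\<close> plus a nilpotent operator \<open>\<kappa> y \<otimes> 1 + 1 \<otimes> y'\<close> in the shifts \<open>y\<close>, \<open>y'\<close>. The nilpotent operator preserves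
  the degrees of both factors, so on the part of bidegree \<open>(c, -c)\<close>, which has the basis of
  \<open>k[y, y']/(y\<^sup>u, y'\<^sup>t)\<close> with \<open>u = n\<^sub>1 c\<close>, \<open>t = n\<^sub>2 (-c)\<close>, the theory of \<open>sl\<^sub>2\<close> gives a decomposition into strings of length
  \<open>u + t - 1 - 2j\<close> for \<open>j < min u t\<close>. Since \<open>x\<close> is invertible, its powers carry these strings to the other degrees
  modulo \<open>s\<close>, and each string yields one \<open>V\<^sub>u\<^sub>+\<^sub>t\<^sub>-\<^sub>1\<^sub>-\<^sub>2\<^sub>j(l, \<gamma>)\<close> for every copy of \<open>V l\<close> in the tensor product of the
  simple \<open>kG\<close>-modules.
\<close>

section \<open>Isomorphisms, direct sums and quotients of modules\<close>

text \<open>The factors \<open>r\<close> and \<open>s - r\<close> of the theorem count the degrees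
  \<open>c < s\<close> with \<open>n c = u + 1\<close> and with \<open>n c = u\<close>. The
  comparison map is built from a direct sum of cyclic pieces, one per string, to the tensor product.
  Its injectivity is proved directly: the summands for different powers of \<open>x\<close> are
  separated by the eigenvalues \<open>q ^ c\<close> of the grading, and the vectors of the strings
  in one bidegree by the lowering operator. Surjectivity is a count of dimensions. The abstract
  modules have unrelated element types and are built from cosets, so each is replaced once by a
  space of functions on a finite set, and the rest is a computation with operators. These operators
  are linear on all functions, not only on those with the right support; a Kronecker product can
  then be defined slice by slice, and an identity between operators is tested on pure tensors. A
  simple \<open>kG\<close>-module comes without a basis; one is found by realizing the module as a
  Maschke complement inside the regular representation.\<close>

lemma module_isoI:
  assumes "bij_betw f (carrier M) (carrier N)"
    and "\<And>m m'. \<lbrakk>m \<in> carrier M; m' \<in> carrier M\<rbrakk> \<Longrightarrow> f (m \<oplus>\<^bsub>M\<^esub> m') = f m \<oplus>\<^bsub>N\<^esub> f m'"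
    and "\<And>h m. \<lbrakk>h \<in> carrier R; m \<in> carrier M\<rbrakk> \<Longrightarrow> f (h \<odot>\<^bsub>M\<^esub> m) = h \<odot>\<^bsub>N\<^esub> f m"
  shows "module_iso R M N"
  using assms unfolding module_iso_def by blast

lemma module_iso_refl: "module_iso R M M"
  by (rule module_isoI[where f = id]) auto

lemma module_iso_trans [trans]:
  assumes "module_iso R M N" and "module_iso R N P"
  shows "module_iso R M P"
proof -
  obtain f where f: "bij_betw f (carrier M) (carrier N)"
    "\<forall>m\<in>carrier M. \<forall>m'\<in>carrier M. f (m \<oplus>\<^bsub>M\<^esub> m') = f m \<oplus>\<^bsub>N\<^esub> f m'"
    "\<forall>h\<in>carrier R. \<forall>m\<in>carrier M. f (h \<odot>\<^bsub>M\<^esub> m) = h \<odot>\<^bsub>N\<^esub> f m"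
    using assms(1) unfolding module_iso_def by blast
  obtain g where g: "bij_betw g (carrier N) (carrier P)"
    "\<forall>m\<in>carrier N. \<forall>m'\<in>carrier N. g (m \<oplus>\<^bsub>N\<^esub> m') = g m \<oplus>\<^bsub>P\<^esub> g m'"
    "\<forall>h\<in>carrier R. \<forall>m\<in>carrier N. g (h \<odot>\<^bsub>N\<^esub> m) = h \<odot>\<^bsub>P\<^esub> g m"
    using assms(2) unfolding module_iso_def by blast
  have fc: "f m \<in> carrier N" if "m \<in> carrier M" for m
    using f(1) that by (auto simp: bij_betw_def)
  show ?thesis
    by (rule module_isoI[where f = "g \<circ> f"]) (auto intro: bij_betw_trans f(1) g(1) simp: f g fc)
qed

text \<open>Closure is what inverting an isomorphism requires of its source. For a tensor product of
  \<open>kG\<close>-modules it is immediate, and it allows the isomorphism with a coordinate module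
  to be read backwards without first checking the module axioms.\<close>

definition closed_module :: "('r, 'x) ring_scheme \<Rightarrow> ('r, 'm, 'y) module_scheme \<Rightarrow> bool" where
  "closed_module R M \<longleftrightarrow> (\<forall>m\<in>carrier M. \<forall>m'\<in>carrier M. m \<oplus>\<^bsub>M\<^esub> m' \<in> carrier M) \<and>
     (\<forall>h\<in>carrier R. \<forall>m\<in>carrier M. h \<odot>\<^bsub>M\<^esub> m \<in> carrier M)"

lemma module_iso_sym:
  assumes "module_iso R M N" and "closed_module R M"
  shows "module_iso R N M"
proof -
  obtain f where f: "bij_betw f (carrier M) (carrier N)"
    and fa: "\<forall>m\<in>carrier M. \<forall>m'\<in>carrier M. f (m \<oplus>\<^bsub>M\<^esub> m') = f m \<oplus>\<^bsub>N\<^esub> f m'"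
    and fs: "\<forall>h\<in>carrier R. \<forall>m\<in>carrier M. f (h \<odot>\<^bsub>M\<^esub> m) = h \<odot>\<^bsub>N\<^esub> f m"
    using assms(1) unfolding module_iso_def by blast
  let ?g = "the_inv_into (carrier M) f"
  have inj: "inj_on f (carrier M)" using f by (simp add: bij_betw_def)
  have gf: "?g (f m) = m" if "m \<in> carrier M" for m using inj that by (simp add: the_inv_into_f_f)
  have ex: "\<exists>m\<in>carrier M. f m = n" if "n \<in> carrier N" for n
    using bij_betw_imp_surj_on[OF f] that by (metis imageE)
  show ?thesis
  proof (rule module_isoI[where f = ?g])
    show "bij_betw ?g (carrier N) (carrier M)" using f by (rule bij_betw_the_inv_into)
  next
    fix n n' assume "n \<in> carrier N" "n' \<in> carrier N"
    then obtain m m' where "m \<in> carrier M" "f m = n" "m' \<in> carrier M" "f m' = n'" using ex by metis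
    then show "?g (n \<oplus>\<^bsub>N\<^esub> n') = ?g n \<oplus>\<^bsub>M\<^esub> ?g n'"
      using fa assms(2) gf unfolding closed_module_def by metis
  next
    fix h n assume h: "h \<in> carrier R" and "n \<in> carrier N"
    then obtain m where "m \<in> carrier M" "f m = n" using ex by metis
    then show "?g (h \<odot>\<^bsub>N\<^esub> n) = h \<odot>\<^bsub>M\<^esub> ?g n"
      using h fs assms(2) gf unfolding closed_module_def by metis
  qed
qed

lemma left_module_closed: "left_module R M \<Longrightarrow> closed_module R M"
  unfolding closed_module_def left_module_def left_module_axioms_def
  by (auto intro: abelian_monoid.a_closed abelian_group.axioms)

lemma left_moduleI:
  assumes "ring R" "abelian_group M"
    and "\<And>h m. \<lbrakk>h \<in> carrier R; m \<in> carrier M\<rbrakk> \<Longrightarrow> h \<odot>\<^bsub>M\<^esub> m \<in> carrier M"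
    and "\<And>h h' m. \<lbrakk>h \<in> carrier R; h' \<in> carrier R; m \<in> carrier M\<rbrakk> \<Longrightarrow>
      (h \<oplus>\<^bsub>R\<^esub> h') \<odot>\<^bsub>M\<^esub> m = (h \<odot>\<^bsub>M\<^esub> m) \<oplus>\<^bsub>M\<^esub> (h' \<odot>\<^bsub>M\<^esub> m)"
    and "\<And>h m m'. \<lbrakk>h \<in> carrier R; m \<in> carrier M; m' \<in> carrier M\<rbrakk> \<Longrightarrow>
      h \<odot>\<^bsub>M\<^esub> (m \<oplus>\<^bsub>M\<^esub> m') = (h \<odot>\<^bsub>M\<^esub> m) \<oplus>\<^bsub>M\<^esub> (h \<odot>\<^bsub>M\<^esub> m')"
    and "\<And>h h' m. \<lbrakk>h \<in> carrier R; h' \<in> carrier R; m \<in> carrier M\<rbrakk> \<Longrightarrow>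
      (h \<otimes>\<^bsub>R\<^esub> h') \<odot>\<^bsub>M\<^esub> m = h \<odot>\<^bsub>M\<^esub> (h' \<odot>\<^bsub>M\<^esub> m)"
    and "\<And>m. m \<in> carrier M \<Longrightarrow> \<one>\<^bsub>R\<^esub> \<odot>\<^bsub>M\<^esub> m = m"
  shows "left_module R M"
  using assms unfolding left_module_def left_module_axioms_def by blast

context left_module
begin

lemma module_ring: "ring R" and module_group: "abelian_group M"
  by (rule R.ring_axioms, rule M.abelian_group_axioms)

lemma idem_zero: "\<lbrakk>m \<in> carrier M; m \<oplus>\<^bsub>M\<^esub> m = m\<rbrakk> \<Longrightarrow> m = \<zero>\<^bsub>M\<^esub>"
  using M.add.l_cancel_one by blast

lemma smult_zero_right: "h \<in> carrier R \<Longrightarrow> h \<odot>\<^bsub>M\<^esub> \<zero>\<^bsub>M\<^esub> = \<zero>\<^bsub>M\<^esub>"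
  by (rule idem_zero) (simp_all add: smult_closed smult_r_distr[symmetric])

end

lemma additive_zero:
  assumes "abelian_group M" "abelian_group N" "f \<in> carrier M \<rightarrow> carrier N"
    "\<And>m m'. \<lbrakk>m \<in> carrier M; m' \<in> carrier M\<rbrakk> \<Longrightarrow> f (m \<oplus>\<^bsub>M\<^esub> m') = f m \<oplus>\<^bsub>N\<^esub> f m'"
  shows "f \<zero>\<^bsub>M\<^esub> = \<zero>\<^bsub>N\<^esub>"
proof -
  interpret M: abelian_group M by fact
  interpret N: abelian_group N by fact
  have "f \<zero>\<^bsub>M\<^esub> \<in> carrier N" "f \<zero>\<^bsub>M\<^esub> \<oplus>\<^bsub>N\<^esub> f \<zero>\<^bsub>M\<^esub> = f \<zero>\<^bsub>M\<^esub>"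
    using assms(3) assms(4)[of "\<zero>\<^bsub>M\<^esub>" "\<zero>\<^bsub>M\<^esub>"] by auto
  then show ?thesis using N.add.l_cancel_one by blast
qed

lemma module_isoE:
  assumes "module_iso R M N" and M: "left_module R M" and N: "left_module R N"
  obtains f g where "f \<in> carrier M \<rightarrow> carrier N" "g \<in> carrier N \<rightarrow> carrier M"
    "\<And>m. m \<in> carrier M \<Longrightarrow> g (f m) = m" "\<And>n. n \<in> carrier N \<Longrightarrow> f (g n) = n"
    "\<And>m m'. \<lbrakk>m \<in> carrier M; m' \<in> carrier M\<rbrakk> \<Longrightarrow> f (m \<oplus>\<^bsub>M\<^esub> m') = f m \<oplus>\<^bsub>N\<^esub> f m'"
    "\<And>h m. \<lbrakk>h \<in> carrier R; m \<in> carrier M\<rbrakk> \<Longrightarrow> f (h \<odot>\<^bsub>M\<^esub> m) = h \<odot>\<^bsub>N\<^esub> f m"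
    "f \<zero>\<^bsub>M\<^esub> = \<zero>\<^bsub>N\<^esub>" "g \<zero>\<^bsub>N\<^esub> = \<zero>\<^bsub>M\<^esub>"
proof -
  obtain f where f: "bij_betw f (carrier M) (carrier N)"
    and fa: "\<forall>m\<in>carrier M. \<forall>m'\<in>carrier M. f (m \<oplus>\<^bsub>M\<^esub> m') = f m \<oplus>\<^bsub>N\<^esub> f m'"
    and fs: "\<forall>h\<in>carrier R. \<forall>m\<in>carrier M. f (h \<odot>\<^bsub>M\<^esub> m) = h \<odot>\<^bsub>N\<^esub> f m"
    using assms(1) unfolding module_iso_def by blast
  let ?g = "the_inv_into (carrier M) f"
  have inj: "inj_on f (carrier M)" and im: "f ` carrier M = carrier N"
    using f by (simp_all add: bij_betw_def)
  have fc: "f \<in> carrier M \<rightarrow> carrier N" using im by auto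
  have fz: "f \<zero>\<^bsub>M\<^esub> = \<zero>\<^bsub>N\<^esub>"
    by (rule additive_zero)
      (use fc fa left_module.module_group[OF M] left_module.module_group[OF N] in auto)
  have gf: "?g (f m) = m" if "m \<in> carrier M" for m using inj that by (simp add: the_inv_into_f_f)
  have gz: "?g \<zero>\<^bsub>N\<^esub> = \<zero>\<^bsub>M\<^esub>"
    using gf[of "\<zero>\<^bsub>M\<^esub>"] fz left_module.module_group[OF M] by (simp add: abelian_group_def abelian_monoid.zero_closed)
  have gc: "?g \<in> carrier N \<rightarrow> carrier M"
    using bij_betw_the_inv_into[OF f] by (auto simp: bij_betw_def)
  have fg: "f (?g n) = n" if "n \<in> carrier N" for n
    using that inj im by (auto intro: f_the_inv_into_f)
  show thesis
    by (rule that[OF fc gc gf fg]) (use fa fs fz gz in auto)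
qed

lemma left_module_transfer:
  assumes M: "left_module R M" and f: "bij_betw f (carrier M) (carrier N)"
    and fa: "\<And>m m'. \<lbrakk>m \<in> carrier M; m' \<in> carrier M\<rbrakk> \<Longrightarrow> f (m \<oplus>\<^bsub>M\<^esub> m') = f m \<oplus>\<^bsub>N\<^esub> f m'"
    and fs: "\<And>h m. \<lbrakk>h \<in> carrier R; m \<in> carrier M\<rbrakk> \<Longrightarrow> f (h \<odot>\<^bsub>M\<^esub> m) = h \<odot>\<^bsub>N\<^esub> f m"
    and fz: "f \<zero>\<^bsub>M\<^esub> = \<zero>\<^bsub>N\<^esub>"
  shows "left_module R N"
proof -
  interpret M: left_module R M by fact
  have fc: "f m \<in> carrier N" if "m \<in> carrier M" for m using f that by (auto simp: bij_betw_def)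
  \<comment> \<open>Surjectivity of \<open>f\<close> as an elimination rule: each axiom for
    \<open>N\<close> only has to be checked at elements \<open>f m\<close>, where it is the image of
    the same axiom for \<open>M\<close>.\<close>
  have ex: "\<And>P. (\<And>m. m \<in> carrier M \<Longrightarrow> P (f m)) \<Longrightarrow> n \<in> carrier N \<Longrightarrow> P n" for n
    using bij_betw_imp_surj_on[OF f] by (metis imageE)
  have ag: "abelian_group N"
  proof (rule abelian_groupI)
    show "\<zero>\<^bsub>N\<^esub> \<in> carrier N" using fc[of "\<zero>\<^bsub>M\<^esub>"] fz by simp
  next
    fix x y assume "x \<in> carrier N" "y \<in> carrier N"
    then show "x \<oplus>\<^bsub>N\<^esub> y \<in> carrier N"
      by (elim ex[rotated]) (simp add: fa[symmetric] fc)
  next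
    fix x y z assume "x \<in> carrier N" "y \<in> carrier N" "z \<in> carrier N"
    then show "x \<oplus>\<^bsub>N\<^esub> y \<oplus>\<^bsub>N\<^esub> z = x \<oplus>\<^bsub>N\<^esub> (y \<oplus>\<^bsub>N\<^esub> z)"
      by (elim ex[rotated]) (simp add: fa[symmetric] M.M.add.m_assoc)
  next
    fix x y assume "x \<in> carrier N" "y \<in> carrier N"
    then show "x \<oplus>\<^bsub>N\<^esub> y = y \<oplus>\<^bsub>N\<^esub> x"
      by (elim ex[rotated]) (simp add: fa[symmetric] M.M.add.m_comm)
  next
    fix x assume "x \<in> carrier N"
    then show "\<zero>\<^bsub>N\<^esub> \<oplus>\<^bsub>N\<^esub> x = x"
      by (elim ex[rotated]) (simp add: fa[symmetric] fz[symmetric])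
  next
    fix x assume "x \<in> carrier N"
    then obtain m where m: "m \<in> carrier M" "x = f m" using f by (auto simp: bij_betw_def)
    have "f (\<ominus>\<^bsub>M\<^esub> m) \<oplus>\<^bsub>N\<^esub> x = \<zero>\<^bsub>N\<^esub>" using m by (simp add: fa[symmetric] fz[symmetric] M.M.l_neg)
    then show "\<exists>y\<in>carrier N. y \<oplus>\<^bsub>N\<^esub> x = \<zero>\<^bsub>N\<^esub>" using m fc[of "\<ominus>\<^bsub>M\<^esub> m"] by auto
  qed
  show ?thesis
  proof (rule left_moduleI[OF M.module_ring ag])
    fix h m assume h: "h \<in> carrier R" and "m \<in> carrier N"
    from this(2) show "h \<odot>\<^bsub>N\<^esub> m \<in> carrier N"
      by (elim ex[rotated]) (simp add: h fs[symmetric] fc M.smult_closed)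
  next
    fix h h' m assume h: "h \<in> carrier R" "h' \<in> carrier R" and "m \<in> carrier N"
    from this(3) show "(h \<oplus>\<^bsub>R\<^esub> h') \<odot>\<^bsub>N\<^esub> m = (h \<odot>\<^bsub>N\<^esub> m) \<oplus>\<^bsub>N\<^esub> (h' \<odot>\<^bsub>N\<^esub> m)"
      by (elim ex[rotated]) (simp add: h fs[symmetric] fa[symmetric] M.smult_closed M.smult_l_distr)
  next
    fix h m m' assume h: "h \<in> carrier R" and "m \<in> carrier N" "m' \<in> carrier N"
    from this(2,3) show "h \<odot>\<^bsub>N\<^esub> (m \<oplus>\<^bsub>N\<^esub> m') = (h \<odot>\<^bsub>N\<^esub> m) \<oplus>\<^bsub>N\<^esub> (h \<odot>\<^bsub>N\<^esub> m')"
      by (elim ex[rotated]) (simp add: h fs[symmetric] fa[symmetric] M.smult_closed M.smult_r_distr)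
  next
    fix h h' m assume h: "h \<in> carrier R" "h' \<in> carrier R" and "m \<in> carrier N"
    from this(3) show "(h \<otimes>\<^bsub>R\<^esub> h') \<odot>\<^bsub>N\<^esub> m = h \<odot>\<^bsub>N\<^esub> (h' \<odot>\<^bsub>N\<^esub> m)"
      by (elim ex[rotated]) (simp add: h fs[symmetric] M.smult_closed M.smult_assoc)
  next
    fix m assume "m \<in> carrier N"
    then show "\<one>\<^bsub>R\<^esub> \<odot>\<^bsub>N\<^esub> m = m"
      by (elim ex[rotated]) (simp add: fs[symmetric] M.smult_one)
  qed
qed

section \<open>Direct sums: reindexing, nesting and splitting\<close>

lemma left_module_direct_sum:
  assumes R: "ring R" and M: "\<And>j. j \<in> J \<Longrightarrow> left_module R (M j)"
  shows "left_module R (direct_sum J M)"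
proof -
  have ag: "abelian_group (M j)" if "j \<in> J" for j using left_module.module_group[OF M[OF that]] .
  note am = ag[THEN abelian_group.axioms(1)]
  have minus0: "\<ominus>\<^bsub>M j\<^esub> \<zero>\<^bsub>M j\<^esub> = \<zero>\<^bsub>M j\<^esub>" if "j \<in> J" for j
    using abelian_group.minus_equality[OF ag[OF that], of "\<zero>\<^bsub>M j\<^esub>" "\<zero>\<^bsub>M j\<^esub>"] am[OF that]
    by (simp add: abelian_monoid.l_zero abelian_monoid.zero_closed)
  have fin2: "finite {j \<in> J. f j \<oplus>\<^bsub>M j\<^esub> f' j \<noteq> \<zero>\<^bsub>M j\<^esub>}"
    if "finite {j \<in> J. f j \<noteq> \<zero>\<^bsub>M j\<^esub>}" "finite {j \<in> J. f' j \<noteq> \<zero>\<^bsub>M j\<^esub>}" for f f'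
    by (rule finite_subset[OF _ finite_UnI[OF that]])
      (auto simp: am abelian_monoid.l_zero abelian_monoid.zero_closed)
  have fin1: "finite {j \<in> J. h \<odot>\<^bsub>M j\<^esub> f j \<noteq> \<zero>\<^bsub>M j\<^esub>}"
    if "finite {j \<in> J. f j \<noteq> \<zero>\<^bsub>M j\<^esub>}" "h \<in> carrier R" for f h
    by (rule finite_subset[OF _ that(1)]) (use that(2) in \<open>auto simp: left_module.smult_zero_right[OF M]\<close>)
  have abg: "abelian_group (direct_sum J M)"
  proof (rule abelian_groupI)
    fix f assume "f \<in> carrier (direct_sum J M)"
    then have f: "f \<in> (\<Pi>\<^sub>E j\<in>J. carrier (M j))" "finite {j \<in> J. f j \<noteq> \<zero>\<^bsub>M j\<^esub>}"
      by (auto simp: direct_sum_def)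
    let ?g = "\<lambda>j\<in>J. \<ominus>\<^bsub>M j\<^esub> f j"
    have "?g \<in> (\<Pi>\<^sub>E j\<in>J. carrier (M j))"
      using f(1) by (auto intro!: abelian_group.a_inv_closed[OF ag])
    moreover have "finite {j \<in> J. ?g j \<noteq> \<zero>\<^bsub>M j\<^esub>}"
      by (rule finite_subset[OF _ f(2)]) (auto simp: minus0)
    moreover have "?g \<oplus>\<^bsub>direct_sum J M\<^esub> f = \<zero>\<^bsub>direct_sum J M\<^esub>"
      using f(1) by (auto simp: direct_sum_def PiE_mem intro!: restrict_ext abelian_group.l_neg[OF ag])
    ultimately show "\<exists>y\<in>carrier (direct_sum J M). y \<oplus>\<^bsub>direct_sum J M\<^esub> f = \<zero>\<^bsub>direct_sum J M\<^esub>"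
      by (intro bexI[of _ ?g]) (auto simp: direct_sum_def)
  next
    fix f f' assume "f \<in> carrier (direct_sum J M)" "f' \<in> carrier (direct_sum J M)"
    then show "f \<oplus>\<^bsub>direct_sum J M\<^esub> f' \<in> carrier (direct_sum J M)"
      using fin2[of f f'] by (auto simp: direct_sum_def PiE_mem cong: conj_cong intro!: abelian_monoid.a_closed[OF am])
  next
    fix f assume "f \<in> carrier (direct_sum J M)"
    then have "f \<in> (\<Pi>\<^sub>E j\<in>J. carrier (M j))" by (simp add: direct_sum_def)
    then show "\<zero>\<^bsub>direct_sum J M\<^esub> \<oplus>\<^bsub>direct_sum J M\<^esub> f = f"
      by (intro extensionalityI[of _ J])
        (auto simp: direct_sum_def PiE_def intro!: abelian_monoid.l_zero[OF am])
  qed (auto simp: direct_sum_def abelian_monoid.zero_closed[OF am]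
        intro!: restrict_ext abelian_monoid.a_assoc[OF am] abelian_monoid.a_comm[OF am])
  note S = left_module.smult_closed[OF M] left_module.smult_assoc[OF M] left_module.smult_one[OF M]
    left_module.smult_l_distr[OF M] left_module.smult_r_distr[OF M]
  show ?thesis
  proof (rule left_moduleI[OF R abg])
    fix f assume "f \<in> carrier (direct_sum J M)"
    then have "f \<in> (\<Pi>\<^sub>E j\<in>J. carrier (M j))" by (simp add: direct_sum_def)
    then show "\<one>\<^bsub>R\<^esub> \<odot>\<^bsub>direct_sum J M\<^esub> f = f"
      by (intro extensionalityI[of _ J]) (auto simp: direct_sum_def S PiE_mem PiE_iff)
  next
    fix h f assume "h \<in> carrier R" "f \<in> carrier (direct_sum J M)"
    then show "h \<odot>\<^bsub>direct_sum J M\<^esub> f \<in> carrier (direct_sum J M)"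
      using fin1[of f h] by (auto simp: direct_sum_def cong: conj_cong intro!: S)
  qed (auto simp: direct_sum_def intro!: restrict_ext S)
qed

text \<open>An isomorphism in the sense of \<open>module_iso\<close> says nothing about zero. The
  module hypotheses on both families make the component maps and their inverses preserve zero, and
  this keeps supports finite in both directions.\<close>

lemma direct_sum_iso:
  assumes h: "bij_betw h J J'" and M: "\<And>j. j \<in> J \<Longrightarrow> left_module R (M j)"
    and N: "\<And>j. j \<in> J' \<Longrightarrow> left_module R (N j)"
    and iso: "\<And>j. j \<in> J \<Longrightarrow> module_iso R (M j) (N (h j))"
  shows "module_iso R (direct_sum J M) (direct_sum J' N)"
proof -
  let ?i = "the_inv_into J h"
  have h1: "?i j' \<in> J" "h (?i j') = j'" if "j' \<in> J'" for j'
    using h that bij_betw_the_inv_into[OF h]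
    by (auto simp: bij_betw_def f_the_inv_into_f)
  have h2: "?i (h j) = j" "h j \<in> J'" if "j \<in> J" for j
    using h that by (auto simp: bij_betw_def the_inv_into_f_f)
  define P where "P = (\<lambda>j f g. f \<in> carrier (M j) \<rightarrow> carrier (N (h j)) \<and> g \<in> carrier (N (h j)) \<rightarrow> carrier (M j) \<and>
    (\<forall>m\<in>carrier (M j). g (f m) = m) \<and> (\<forall>n\<in>carrier (N (h j)). f (g n) = n) \<and>
    (\<forall>m\<in>carrier (M j). \<forall>m'\<in>carrier (M j). f (m \<oplus>\<^bsub>M j\<^esub> m') = f m \<oplus>\<^bsub>N (h j)\<^esub> f m') \<and>
    (\<forall>r\<in>carrier R. \<forall>m\<in>carrier (M j). f (r \<odot>\<^bsub>M j\<^esub> m) = r \<odot>\<^bsub>N (h j)\<^esub> f m) \<and>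
    f \<zero>\<^bsub>M j\<^esub> = \<zero>\<^bsub>N (h j)\<^esub> \<and> g \<zero>\<^bsub>N (h j)\<^esub> = \<zero>\<^bsub>M j\<^esub>)"
  have "\<exists>p. P j (fst p) (snd p)" if "j \<in> J" for j
    by (rule module_isoE[OF iso[OF that] M[OF that] N[OF h2(2)[OF that]]])
      (unfold P_def, metis fst_conv snd_conv)
  then obtain FH where "\<And>j. j \<in> J \<Longrightarrow> P j (fst (FH j)) (snd (FH j))"
    using bchoice[of J "\<lambda>j p. P j (fst p) (snd p)"] by blast
  then have "P j (fst (FH j)) (snd (FH j))" if "j \<in> J" for j using that .
  moreover define F H where "F j = fst (FH j)" and "H j = snd (FH j)" for j
  ultimately have "P j (F j) (H j)" if "j \<in> J" for j using that by simp
  note F = this[unfolded P_def]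
  have F': "F (?i j) \<in> carrier (M (?i j)) \<rightarrow> carrier (N j)"
    "\<And>m m'. \<lbrakk>m \<in> carrier (M (?i j)); m' \<in> carrier (M (?i j))\<rbrakk> \<Longrightarrow>
      F (?i j) (m \<oplus>\<^bsub>M (?i j)\<^esub> m') = F (?i j) m \<oplus>\<^bsub>N j\<^esub> F (?i j) m'"
    "\<And>r m. \<lbrakk>r \<in> carrier R; m \<in> carrier (M (?i j))\<rbrakk> \<Longrightarrow> F (?i j) (r \<odot>\<^bsub>M (?i j)\<^esub> m) = r \<odot>\<^bsub>N j\<^esub> F (?i j) m"
    "F (?i j) \<zero>\<^bsub>M (?i j)\<^esub> = \<zero>\<^bsub>N j\<^esub>" "\<And>n. n \<in> carrier (N j) \<Longrightarrow> F (?i j) (H (?i j) n) = n"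
    if "j \<in> J'" for j
    using F[OF h1(1)[OF that]] h1(2)[OF that] by auto
  have mem: "f (?i j) \<in> carrier (M (?i j))" if "f \<in> carrier (direct_sum J M)" "j \<in> J'" for f j
    using that h1 by (auto simp: direct_sum_def)
  let ?\<Phi> = "\<lambda>f. \<lambda>j\<in>J'. F (?i j) (f (?i j))"
  let ?\<Psi> = "\<lambda>f. \<lambda>j\<in>J. H j (f (h j))"
  show ?thesis
  proof (rule module_isoI[where f = ?\<Phi>])
    show "bij_betw ?\<Phi> (carrier (direct_sum J M)) (carrier (direct_sum J' N))"
    proof (rule bij_betw_byWitness[where f' = ?\<Psi>])
      show "\<forall>f\<in>carrier (direct_sum J M). ?\<Psi> (?\<Phi> f) = f"
      proof
        fix f assume "f \<in> carrier (direct_sum J M)"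
        then have "f \<in> (\<Pi>\<^sub>E j\<in>J. carrier (M j))" by (simp add: direct_sum_def)
        then show "?\<Psi> (?\<Phi> f) = f"
          by (intro extensionalityI[of _ J]) (auto simp: h2 F PiE_mem PiE_iff)
      qed
      show "\<forall>f\<in>carrier (direct_sum J' N). ?\<Phi> (?\<Psi> f) = f"
      proof
        fix f assume "f \<in> carrier (direct_sum J' N)"
        then have "f \<in> (\<Pi>\<^sub>E j\<in>J'. carrier (N j))" by (simp add: direct_sum_def)
        then show "?\<Phi> (?\<Psi> f) = f"
          by (intro extensionalityI[of _ J']) (auto simp: h1 F' PiE_mem PiE_iff)
      qed
      show "?\<Phi> ` carrier (direct_sum J M) \<subseteq> carrier (direct_sum J' N)"
      proof (rule image_subsetI)
        fix f assume "f \<in> carrier (direct_sum J M)"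
        then have f: "f \<in> (\<Pi>\<^sub>E j\<in>J. carrier (M j))" "finite {j \<in> J. f j \<noteq> \<zero>\<^bsub>M j\<^esub>}"
          by (auto simp: direct_sum_def)
        have "?\<Phi> f \<in> (\<Pi>\<^sub>E j\<in>J'. carrier (N j))"
          using f(1) h1 F' by (auto intro!: funcset_mem[OF F'(1)])
        moreover have "finite {j \<in> J'. ?\<Phi> f j \<noteq> \<zero>\<^bsub>N j\<^esub>}"
        proof (rule finite_subset[OF _ finite_imageI[OF f(2)]])
          show "{j \<in> J'. ?\<Phi> f j \<noteq> \<zero>\<^bsub>N j\<^esub>} \<subseteq> h ` {j \<in> J. f j \<noteq> \<zero>\<^bsub>M j\<^esub>}"
          proof
            fix j assume j: "j \<in> {j \<in> J'. ?\<Phi> f j \<noteq> \<zero>\<^bsub>N j\<^esub>}"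
            then have "f (?i j) \<noteq> \<zero>\<^bsub>M (?i j)\<^esub>" using F'(4) by auto
            then show "j \<in> h ` {j \<in> J. f j \<noteq> \<zero>\<^bsub>M j\<^esub>}" using h1 j by (intro image_eqI[of _ _ "?i j"]) auto
          qed
        qed
        ultimately show "?\<Phi> f \<in> carrier (direct_sum J' N)" by (simp add: direct_sum_def)
      qed
      show "?\<Psi> ` carrier (direct_sum J' N) \<subseteq> carrier (direct_sum J M)"
      proof (rule image_subsetI)
        fix f assume "f \<in> carrier (direct_sum J' N)"
        then have f: "f \<in> (\<Pi>\<^sub>E j\<in>J'. carrier (N j))" "finite {j \<in> J'. f j \<noteq> \<zero>\<^bsub>N j\<^esub>}"
          by (auto simp: direct_sum_def)
        have "?\<Psi> f \<in> (\<Pi>\<^sub>E j\<in>J. carrier (M j))"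
        proof (rule PiE_I)
          fix j assume j: "j \<in> J"
          then have "f (h j) \<in> carrier (N (h j))" using h2 PiE_mem[OF f(1)] by blast
          then show "?\<Psi> f j \<in> carrier (M j)" using F[OF j] j by (simp add: Pi_iff)
        qed simp
        moreover have "finite {j \<in> J. ?\<Psi> f j \<noteq> \<zero>\<^bsub>M j\<^esub>}"
        proof (rule finite_subset[OF _ finite_imageI[OF f(2)]])
          show "{j \<in> J. ?\<Psi> f j \<noteq> \<zero>\<^bsub>M j\<^esub>} \<subseteq> ?i ` {j \<in> J'. f j \<noteq> \<zero>\<^bsub>N j\<^esub>}"
          proof
            fix j assume j: "j \<in> {j \<in> J. ?\<Psi> f j \<noteq> \<zero>\<^bsub>M j\<^esub>}"
            then have "f (h j) \<noteq> \<zero>\<^bsub>N (h j)\<^esub>" using F by auto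
            then show "j \<in> ?i ` {j \<in> J'. f j \<noteq> \<zero>\<^bsub>N j\<^esub>}" using h2 j by (intro image_eqI[of _ _ "h j"]) auto
          qed
        qed
        ultimately show "?\<Psi> f \<in> carrier (direct_sum J M)" by (simp add: direct_sum_def)
      qed
    qed
  next
    fix m m' assume m: "m \<in> carrier (direct_sum J M)" "m' \<in> carrier (direct_sum J M)"
    show "?\<Phi> (m \<oplus>\<^bsub>direct_sum J M\<^esub> m') = ?\<Phi> m \<oplus>\<^bsub>direct_sum J' N\<^esub> ?\<Phi> m'"
      using F'(2)[OF _ mem[OF m(1)] mem[OF m(2)]] h1 by (auto simp: direct_sum_def intro!: restrict_ext)
  next
    fix r m assume m: "r \<in> carrier R" "m \<in> carrier (direct_sum J M)"
    show "?\<Phi> (r \<odot>\<^bsub>direct_sum J M\<^esub> m) = r \<odot>\<^bsub>direct_sum J' N\<^esub> ?\<Phi> m"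
      using F'(3)[OF _ m(1) mem[OF m(2)]] h1 by (auto simp: direct_sum_def intro!: restrict_ext)
  qed
qed

text \<open>Currying: a family indexed by pairs has finite support exactly if finitely many of its
  rows are nonzero and each row has finite support.\<close>

lemma direct_sum_nest:
  "module_iso R (direct_sum (Sigma J K) (\<lambda>(j, k). M j k)) (direct_sum J (\<lambda>j. direct_sum (K j) (M j)))"
proof -
  let ?\<Phi> = "\<lambda>f. \<lambda>j\<in>J. \<lambda>k\<in>K j. f (j, k)"
  let ?\<Psi> = "\<lambda>g. \<lambda>(j, k)\<in>Sigma J K. g j k"
  show ?thesis
  proof (rule module_isoI[where f = ?\<Phi>])
    show "bij_betw ?\<Phi> (carrier (direct_sum (Sigma J K) (\<lambda>(j, k). M j k)))
      (carrier (direct_sum J (\<lambda>j. direct_sum (K j) (M j))))"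
    proof (rule bij_betw_byWitness[where f' = ?\<Psi>])
      show "\<forall>f\<in>carrier (direct_sum (Sigma J K) (\<lambda>(j, k). M j k)). ?\<Psi> (?\<Phi> f) = f"
      proof
        fix f assume "f \<in> carrier (direct_sum (Sigma J K) (\<lambda>(j, k). M j k))"
        then have "f \<in> extensional (Sigma J K)" by (simp add: direct_sum_def PiE_def)
        then show "?\<Psi> (?\<Phi> f) = f" by (rule extensionalityI[rotated]) auto
      qed
      show "\<forall>f\<in>carrier (direct_sum J (\<lambda>j. direct_sum (K j) (M j))). ?\<Phi> (?\<Psi> f) = f"
        by (fastforce simp: direct_sum_def fun_eq_iff PiE_iff extensional_def)
      show "?\<Phi> ` carrier (direct_sum (Sigma J K) (\<lambda>(j, k). M j k)) \<subseteq>
        carrier (direct_sum J (\<lambda>j. direct_sum (K j) (M j)))"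
      proof (rule image_subsetI)
        fix f assume "f \<in> carrier (direct_sum (Sigma J K) (\<lambda>(j, k). M j k))"
        then have f: "f \<in> (\<Pi>\<^sub>E p\<in>Sigma J K. carrier (case p of (j, k) \<Rightarrow> M j k))"
          and fin: "finite {p \<in> Sigma J K. f p \<noteq> \<zero>\<^bsub>(case p of (j, k) \<Rightarrow> M j k)\<^esub>}" (is "finite ?S")
          by (auto simp: direct_sum_def)
        have 1: "finite {k \<in> K j. f (j, k) \<noteq> \<zero>\<^bsub>M j k\<^esub>}" if "j \<in> J" for j
          by (rule finite_subset[OF _ finite_imageI[OF fin, of snd]]) (use that in force)
        have 2: "finite {j \<in> J. (\<lambda>k\<in>K j. f (j, k)) \<noteq> (\<lambda>k\<in>K j. \<zero>\<^bsub>M j k\<^esub>)}"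
        proof (rule finite_subset[OF _ finite_imageI[OF fin, of fst]], rule subsetI)
          fix j assume "j \<in> {j \<in> J. (\<lambda>k\<in>K j. f (j, k)) \<noteq> (\<lambda>k\<in>K j. \<zero>\<^bsub>M j k\<^esub>)}"
          then obtain k where "j \<in> J" "k \<in> K j" "f (j, k) \<noteq> \<zero>\<^bsub>M j k\<^esub>"
            by (auto simp: fun_eq_iff restrict_def split: if_splits)
          then show "j \<in> fst ` ?S" by force
        qed
        have "(\<lambda>k\<in>K j. f (j, k)) \<in> (\<Pi>\<^sub>E k\<in>K j. carrier (M j k))" if "j \<in> J" for j
          using f that by (auto dest!: PiE_mem)
        moreover have "{k \<in> K j. (\<lambda>k\<in>K j. f (j, k)) k \<noteq> \<zero>\<^bsub>M j k\<^esub>} = {k \<in> K j. f (j, k) \<noteq> \<zero>\<^bsub>M j k\<^esub>}" for j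
          by auto
        moreover have "{j \<in> J. ?\<Phi> f j \<noteq> (\<lambda>k\<in>K j. \<zero>\<^bsub>M j k\<^esub>)} =
          {j \<in> J. (\<lambda>k\<in>K j. f (j, k)) \<noteq> (\<lambda>k\<in>K j. \<zero>\<^bsub>M j k\<^esub>)}" by auto
        ultimately show "?\<Phi> f \<in> carrier (direct_sum J (\<lambda>j. direct_sum (K j) (M j)))"
          using 1 2 by (auto simp: direct_sum_def)
      qed
      show "?\<Psi> ` carrier (direct_sum J (\<lambda>j. direct_sum (K j) (M j))) \<subseteq>
        carrier (direct_sum (Sigma J K) (\<lambda>(j, k). M j k))"
      proof (rule image_subsetI)
        fix g assume "g \<in> carrier (direct_sum J (\<lambda>j. direct_sum (K j) (M j)))"
        then have g: "\<And>j. j \<in> J \<Longrightarrow> g j \<in> (\<Pi>\<^sub>E k\<in>K j. carrier (M j k))"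
          and fin1: "\<And>j. j \<in> J \<Longrightarrow> finite {k \<in> K j. g j k \<noteq> \<zero>\<^bsub>M j k\<^esub>}"
          and fin2: "finite {j \<in> J. g j \<noteq> (\<lambda>k\<in>K j. \<zero>\<^bsub>M j k\<^esub>)}"
          by (auto simp: direct_sum_def)
        have "finite (Sigma {j \<in> J. g j \<noteq> (\<lambda>k\<in>K j. \<zero>\<^bsub>M j k\<^esub>)} (\<lambda>j. {k \<in> K j. g j k \<noteq> \<zero>\<^bsub>M j k\<^esub>}))"
          using fin1 fin2 by auto
        then have "finite {p \<in> Sigma J K. ?\<Psi> g p \<noteq> \<zero>\<^bsub>(case p of (j, k) \<Rightarrow> M j k)\<^esub>}"
          by (rule finite_subset[rotated]) (auto dest: fun_cong simp: restrict_apply)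
        moreover have "?\<Psi> g \<in> (\<Pi>\<^sub>E p\<in>Sigma J K. carrier (case p of (j, k) \<Rightarrow> M j k))"
          by (rule PiE_I) (auto intro!: PiE_mem[OF g])
        ultimately show "?\<Psi> g \<in> carrier (direct_sum (Sigma J K) (\<lambda>(j, k). M j k))"
          by (simp add: direct_sum_def)
      qed
    qed
  qed (auto simp: direct_sum_def fun_eq_iff)
qed

lemma binary_sum_iso:
  assumes "module_iso R M M'" and "module_iso R N N'"
  shows "module_iso R (binary_sum M N) (binary_sum M' N')"
proof -
  obtain f where f: "bij_betw f (carrier M) (carrier M')"
    "\<forall>m\<in>carrier M. \<forall>m'\<in>carrier M. f (m \<oplus>\<^bsub>M\<^esub> m') = f m \<oplus>\<^bsub>M'\<^esub> f m'"
    "\<forall>h\<in>carrier R. \<forall>m\<in>carrier M. f (h \<odot>\<^bsub>M\<^esub> m) = h \<odot>\<^bsub>M'\<^esub> f m"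
    using assms(1) unfolding module_iso_def by blast
  obtain g where g: "bij_betw g (carrier N) (carrier N')"
    "\<forall>m\<in>carrier N. \<forall>m'\<in>carrier N. g (m \<oplus>\<^bsub>N\<^esub> m') = g m \<oplus>\<^bsub>N'\<^esub> g m'"
    "\<forall>h\<in>carrier R. \<forall>m\<in>carrier N. g (h \<odot>\<^bsub>N\<^esub> m) = h \<odot>\<^bsub>N'\<^esub> g m"
    using assms(2) unfolding module_iso_def by blast
  show ?thesis
    by (rule module_isoI[where f = "map_prod f g"])
      (use f g in \<open>auto simp: binary_sum_def intro: bij_betw_map_prod\<close>)
qed

lemma direct_sum_Plus:
  "module_iso R (direct_sum (J <+> K) (case_sum M N)) (binary_sum (direct_sum J M) (direct_sum K N))"
proof -
  let ?\<Phi> = "\<lambda>f. (\<lambda>j\<in>J. f (Inl j), \<lambda>k\<in>K. f (Inr k))"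
  let ?\<Psi> = "\<lambda>(g, g'). \<lambda>x\<in>J <+> K. case_sum g g' x"
  show ?thesis
  proof (rule module_isoI[where f = ?\<Phi>])
    show "bij_betw ?\<Phi> (carrier (direct_sum (J <+> K) (case_sum M N)))
      (carrier (binary_sum (direct_sum J M) (direct_sum K N)))"
    proof (rule bij_betw_byWitness[where f' = ?\<Psi>])
      show "\<forall>f\<in>carrier (direct_sum (J <+> K) (case_sum M N)). ?\<Psi> (?\<Phi> f) = f"
      proof
        fix f assume "f \<in> carrier (direct_sum (J <+> K) (case_sum M N))"
        then have "f \<in> extensional (J <+> K)" by (simp add: direct_sum_def PiE_def)
        then show "?\<Psi> (?\<Phi> f) = f" by (rule extensionalityI[rotated]) auto
      qed
      show "\<forall>f\<in>carrier (binary_sum (direct_sum J M) (direct_sum K N)). ?\<Phi> (?\<Psi> f) = f"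
      proof
        fix f assume "f \<in> carrier (binary_sum (direct_sum J M) (direct_sum K N))"
        then obtain g g' where f: "f = (g, g')" "restrict g J = g" "restrict g' K = g'"
          by (cases f) (auto simp: direct_sum_def binary_sum_def PiE_def extensional_restrict)
        have "(\<lambda>j\<in>J. (\<lambda>x\<in>J <+> K. case_sum g g' x) (Inl j)) = restrict g J"
          "(\<lambda>k\<in>K. (\<lambda>x\<in>J <+> K. case_sum g g' x) (Inr k)) = restrict g' K"
          by (auto intro!: restrict_ext)
        then show "?\<Phi> (?\<Psi> f) = f" using f by simp
      qed
      show "?\<Phi> ` carrier (direct_sum (J <+> K) (case_sum M N)) \<subseteq>
        carrier (binary_sum (direct_sum J M) (direct_sum K N))"
      proof (rule image_subsetI)
        fix f assume "f \<in> carrier (direct_sum (J <+> K) (case_sum M N))"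
        then have f: "f \<in> (\<Pi>\<^sub>E x\<in>J <+> K. carrier (case_sum M N x))"
          and fin: "finite {x \<in> J <+> K. f x \<noteq> \<zero>\<^bsub>case_sum M N x\<^esub>}" (is "finite ?S")
          by (auto simp: direct_sum_def)
        have "finite (Inl -` ?S)" "finite (Inr -` ?S)" using fin by (simp_all only: finite_vimageI inj_Inl inj_Inr)
        moreover have "{j \<in> J. (\<lambda>j\<in>J. f (Inl j)) j \<noteq> \<zero>\<^bsub>M j\<^esub>} = Inl -` ?S"
          "{k \<in> K. (\<lambda>k\<in>K. f (Inr k)) k \<noteq> \<zero>\<^bsub>N k\<^esub>} = Inr -` ?S" by auto
        moreover have "(\<lambda>j\<in>J. f (Inl j)) \<in> (\<Pi>\<^sub>E j\<in>J. carrier (M j))"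
          "(\<lambda>k\<in>K. f (Inr k)) \<in> (\<Pi>\<^sub>E k\<in>K. carrier (N k))"
          using PiE_mem[OF f, of "Inl _"] PiE_mem[OF f, of "Inr _"] by auto
        ultimately show "?\<Phi> f \<in> carrier (binary_sum (direct_sum J M) (direct_sum K N))"
          by (simp add: direct_sum_def binary_sum_def)
      qed
      show "?\<Psi> ` carrier (binary_sum (direct_sum J M) (direct_sum K N)) \<subseteq>
        carrier (direct_sum (J <+> K) (case_sum M N))"
      proof (rule image_subsetI, clarify)
        fix g g' assume "(g, g') \<in> carrier (binary_sum (direct_sum J M) (direct_sum K N))"
        then have g: "g \<in> (\<Pi>\<^sub>E j\<in>J. carrier (M j))" "g' \<in> (\<Pi>\<^sub>E j\<in>K. carrier (N j))"
          and fin: "finite {j \<in> J. g j \<noteq> \<zero>\<^bsub>M j\<^esub>}" "finite {j \<in> K. g' j \<noteq> \<zero>\<^bsub>N j\<^esub>}"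
          by (auto simp: direct_sum_def binary_sum_def)
        have "finite {x \<in> J <+> K. (\<lambda>x\<in>J <+> K. case_sum g g' x) x \<noteq> \<zero>\<^bsub>case_sum M N x\<^esub>}"
          by (rule finite_subset[OF _ finite_Plus[OF fin]]) auto
        moreover have "(\<lambda>x\<in>J <+> K. case_sum g g' x) \<in> (\<Pi>\<^sub>E x\<in>J <+> K. carrier (case_sum M N x))"
          using g by auto
        ultimately show "(\<lambda>x\<in>J <+> K. case_sum g g' x) \<in> carrier (direct_sum (J <+> K) (case_sum M N))"
          by (simp add: direct_sum_def)
      qed
    qed
  qed (auto simp: direct_sum_def binary_sum_def fun_eq_iff)
qed

text \<open>First isomorphism theorem, read from the target: the coset that belongs to
  \<open>n\<close> is the fibre of \<open>F\<close> over \<open>n\<close>. Sending \<open>n\<close>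
  to its fibre needs no choice of preimages, and it carries the module axioms of \<open>N\<close>
  over to the quotient.\<close>

lemma quotient_module_kernel:
  assumes M: "left_module R M" and N: "left_module R N"
    and F: "F ` carrier M = carrier N"
    and add: "\<And>m m'. \<lbrakk>m \<in> carrier M; m' \<in> carrier M\<rbrakk> \<Longrightarrow> F (m \<oplus>\<^bsub>M\<^esub> m') = F m \<oplus>\<^bsub>N\<^esub> F m'"
    and smult: "\<And>h m. \<lbrakk>h \<in> carrier R; m \<in> carrier M\<rbrakk> \<Longrightarrow> F (h \<odot>\<^bsub>M\<^esub> m) = h \<odot>\<^bsub>N\<^esub> F m"
    and K: "K = {m \<in> carrier M. F m = \<zero>\<^bsub>N\<^esub>}"
  shows "module_iso R N (quotient_module M K)" and "left_module R (quotient_module M K)"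
proof -
  interpret M: left_module R M by fact
  interpret N: left_module R N by fact
  let ?\<phi> = "\<lambda>n. {m \<in> carrier M. F m = n}"
  have Fc: "F m \<in> carrier N" if "m \<in> carrier M" for m using F that by auto
  have F0: "F \<zero>\<^bsub>M\<^esub> = \<zero>\<^bsub>N\<^esub>"
    by (rule additive_zero) (use Fc add M.module_group N.module_group in auto)
  have coset: "K +>\<^bsub>M\<^esub> m = ?\<phi> (F m)" if m: "m \<in> carrier M" for m
  proof
    show "K +>\<^bsub>M\<^esub> m \<subseteq> ?\<phi> (F m)" using m by (auto simp: a_r_coset_def' K add Fc)
    show "?\<phi> (F m) \<subseteq> K +>\<^bsub>M\<^esub> m"
    proof
      fix m' assume m': "m' \<in> ?\<phi> (F m)"
      let ?d = "m' \<ominus>\<^bsub>M\<^esub> m"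
      have e: "?d \<oplus>\<^bsub>M\<^esub> m = m'" using m m' by (simp add: M.M.minus_eq M.M.a_assoc M.M.l_neg)
      then have "F ?d \<oplus>\<^bsub>N\<^esub> F m = F m'" using m m' by (metis (mono_tags) add M.M.minus_closed mem_Collect_eq)
      then have "F ?d = \<zero>\<^bsub>N\<^esub>" using m m' Fc
        by (metis (mono_tags) M.M.minus_closed N.M.add.r_cancel_one mem_Collect_eq)
      then have "?d \<in> K" using m m' by (simp add: K)
      then show "m' \<in> K +>\<^bsub>M\<^esub> m" unfolding a_r_coset_def' using e by blast
    qed
  qed
  have carr: "carrier (quotient_module M K) = ?\<phi> ` carrier N"
  proof -
    have "carrier (quotient_module M K) = (\<lambda>m. K +>\<^bsub>M\<^esub> m) ` carrier M"
      by (auto simp: quotient_module_def A_RCOSETS_def')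
    also have "\<dots> = (\<lambda>m. ?\<phi> (F m)) ` carrier M" using coset by (rule image_cong[OF refl])
    also have "\<dots> = ?\<phi> ` carrier N" by (simp only: F[symmetric] image_image)
    finally show ?thesis .
  qed
  have inj: "inj_on ?\<phi> (carrier N)"
  proof (rule inj_onI)
    fix n n' assume "n \<in> carrier N" "n' \<in> carrier N" and e: "?\<phi> n = ?\<phi> n'"
    then have "n \<in> F ` carrier M" using F by simp
    then obtain m where "m \<in> carrier M" "F m = n" by blast
    then have "m \<in> ?\<phi> n'" using e by auto
    then show "n = n'" using \<open>F m = n\<close> by simp
  qed
  have bij: "bij_betw ?\<phi> (carrier N) (carrier (quotient_module M K))"
    using inj carr by (simp add: bij_betw_def)
  have addq: "?\<phi> (n \<oplus>\<^bsub>N\<^esub> n') = ?\<phi> n \<oplus>\<^bsub>quotient_module M K\<^esub> ?\<phi> n'"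
    if n: "n \<in> carrier N" "n' \<in> carrier N" for n n'
  proof -
    have "?\<phi> n <+>\<^bsub>M\<^esub> ?\<phi> n' = ?\<phi> (n \<oplus>\<^bsub>N\<^esub> n')"
    proof
      show "?\<phi> n <+>\<^bsub>M\<^esub> ?\<phi> n' \<subseteq> ?\<phi> (n \<oplus>\<^bsub>N\<^esub> n')" by (auto simp: set_add_def' add)
      show "?\<phi> (n \<oplus>\<^bsub>N\<^esub> n') \<subseteq> ?\<phi> n <+>\<^bsub>M\<^esub> ?\<phi> n'"
      proof
        fix m assume m: "m \<in> ?\<phi> (n \<oplus>\<^bsub>N\<^esub> n')"
        obtain m1 where m1: "m1 \<in> carrier M" "F m1 = n" using n by (auto simp flip: F)
        have e: "m1 \<oplus>\<^bsub>M\<^esub> (m \<ominus>\<^bsub>M\<^esub> m1) = m"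
          using m m1 M.M.a_comm[of m1 "m \<ominus>\<^bsub>M\<^esub> m1"]
          by (simp add: M.M.minus_eq M.M.a_assoc M.M.l_neg)
        then have "n \<oplus>\<^bsub>N\<^esub> F (m \<ominus>\<^bsub>M\<^esub> m1) = n \<oplus>\<^bsub>N\<^esub> n'"
          using m m1 add[OF m1(1), of "m \<ominus>\<^bsub>M\<^esub> m1"] by simp
        moreover have "F (m \<ominus>\<^bsub>M\<^esub> m1) \<in> carrier N" by (rule Fc) (use m m1 in simp)
        ultimately have "F (m \<ominus>\<^bsub>M\<^esub> m1) = n'" using n N.M.add.l_cancel by blast
        then show "m \<in> ?\<phi> n <+>\<^bsub>M\<^esub> ?\<phi> n'"
          unfolding set_add_def' using e m m1 M.M.minus_closed by blast
      qed
    qed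
    then show ?thesis by (simp add: quotient_module_def)
  qed
  have smultq: "?\<phi> (h \<odot>\<^bsub>N\<^esub> n) = h \<odot>\<^bsub>quotient_module M K\<^esub> ?\<phi> n"
    if "h \<in> carrier R" "n \<in> carrier N" for h n
  proof -
    have "n \<in> F ` carrier M" using F that by simp
    then obtain m1 where m1: "m1 \<in> carrier M" "F m1 = n" by blast
    have "K +>\<^bsub>M\<^esub> (h \<odot>\<^bsub>M\<^esub> m) = ?\<phi> (h \<odot>\<^bsub>N\<^esub> n)" if "m \<in> ?\<phi> n" for m
      using that coset[of "h \<odot>\<^bsub>M\<^esub> m"] smult[of h m] M.smult_closed \<open>h \<in> carrier R\<close> by auto
    then show ?thesis using m1 by (auto simp: quotient_module_def)
  qed
  have zeroq: "?\<phi> \<zero>\<^bsub>N\<^esub> = \<zero>\<^bsub>quotient_module M K\<^esub>" by (simp add: quotient_module_def K)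
  show "module_iso R N (quotient_module M K)"
    by (rule module_isoI[OF bij addq smultq])
  show "left_module R (quotient_module M K)"
    by (rule left_module_transfer[OF N bij addq smultq zeroq])
qed


section \<open>Balanced tensor products\<close>

locale tensor_pair =
  fixes S :: "'s set" and M :: "('m, 'x) ring_scheme" and ra :: "'m \<Rightarrow> 's \<Rightarrow> 'm"
    and N :: "('n, 'y) ring_scheme" and la :: "'s \<Rightarrow> 'n \<Rightarrow> 'n"
  assumes M: "abelian_group M" and N: "abelian_group N"
    and ra_closed: "\<And>m s. \<lbrakk>m \<in> carrier M; s \<in> S\<rbrakk> \<Longrightarrow> ra m s \<in> carrier M"
    and la_closed: "\<And>n s. \<lbrakk>n \<in> carrier N; s \<in> S\<rbrakk> \<Longrightarrow> la s n \<in> carrier N"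
begin

abbreviation "T \<equiv> tensor_group S M ra N la"
abbreviation "K \<equiv> tensor_kernel S M ra N la"
abbreviation "FA \<equiv> free_Abelian_group (carrier M \<times> carrier N)"
abbreviation "cls \<equiv> tensor_class S M ra N la"
abbreviation "pt \<equiv> pure_tensor S M ra N la"

definition relators :: "('m \<times> 'n \<Rightarrow>\<^sub>0 int) set" where
  "relators = {frag_of (m \<oplus>\<^bsub>M\<^esub> m', n) - frag_of (m, n) - frag_of (m', n) | m m' n.
         m \<in> carrier M \<and> m' \<in> carrier M \<and> n \<in> carrier N} \<union>
      {frag_of (m, n \<oplus>\<^bsub>N\<^esub> n') - frag_of (m, n) - frag_of (m, n') | m n n'.
         m \<in> carrier M \<and> n \<in> carrier N \<and> n' \<in> carrier N} \<union>
      {frag_of (ra m s, n) - frag_of (m, la s n) | m s n.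
         m \<in> carrier M \<and> s \<in> S \<and> n \<in> carrier N}"

lemma kernel_eq: "K = generate FA relators"
  by (simp add: tensor_kernel_def relators_def)

lemma relators_closed: "relators \<subseteq> carrier FA"
proof -
  have *: "Poly_Mapping.keys (frag_of x - frag_of y - frag_of z) \<subseteq> A" if "x \<in> A" "y \<in> A" "z \<in> A"
    for x y z :: "'m \<times> 'n" and A
    using that keys_diff[of "frag_of x - frag_of y" "frag_of z"] keys_diff[of "frag_of x" "frag_of y"]
    by auto
  have **: "Poly_Mapping.keys (frag_of x - frag_of y) \<subseteq> A" if "x \<in> A" "y \<in> A"
    for x y :: "'m \<times> 'n" and A
    using that keys_diff[of "frag_of x" "frag_of y"] by auto
  note ab = abelian_monoid.a_closed[OF abelian_group.axioms(1)[OF M]]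
    abelian_monoid.a_closed[OF abelian_group.axioms(1)[OF N]]
  show ?thesis
  proof
    fix z assume "z \<in> relators"
    then show "z \<in> carrier FA" unfolding relators_def carrier_free_Abelian_group_iff
    proof (elim UnE CollectE exE conjE, goal_cases)
      case (1 m m' n)
      then show ?case by (simp only: 1(1), intro *) (simp_all add: ab)
    next
      case (2 m n n')
      then show ?case by (simp only: 2(1), intro *) (simp_all add: ab)
    next
      case (3 m s n)
      then show ?case by (simp only: 3(1), intro **) (simp_all add: ra_closed la_closed)
    qed
  qed
qed

lemma FA_group: "comm_group FA" by (rule abelian_free_Abelian_group)

lemma kernel_subgroup: "subgroup K FA"
  unfolding kernel_eq
  by (rule group.generate_is_subgroup[OF comm_group.axioms(2)[OF FA_group] relators_closed])

lemma T_group: "comm_group T"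
  unfolding tensor_group_def by (rule comm_group.abelian_FactGroup[OF FA_group kernel_subgroup])

sublocale T: comm_group T by (rule T_group)

lemma kernel_normal: "K \<lhd> FA"
  by (rule comm_group.subgroup_imp_normal[OF FA_group kernel_subgroup])

lemma cls_hom: "cls \<in> hom FA T"
  unfolding tensor_class_def tensor_group_def by (rule normal.r_coset_hom_Mod[OF kernel_normal])

lemma carrier_T: "carrier T = cls ` carrier FA"
  by (simp add: tensor_group_def tensor_class_def carrier_FactGroup)

lemma cls_closed: "z \<in> carrier FA \<Longrightarrow> cls z \<in> carrier T"
  by (auto simp: carrier_T)

lemma cls_add: "\<lbrakk>z \<in> carrier FA; z' \<in> carrier FA\<rbrakk> \<Longrightarrow> cls (z + z') = cls z \<otimes>\<^bsub>T\<^esub> cls z'"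
  using hom_mult[OF cls_hom, of z z'] by simp

lemma group_hom_cls: "group_hom FA T cls"
  by (simp add: group_hom_def group_hom_axioms_def cls_hom T.is_group)

lemma cls_diff:
  assumes "z \<in> carrier FA" "z' \<in> carrier FA"
  shows "cls (z - z') = cls z \<otimes>\<^bsub>T\<^esub> inv\<^bsub>T\<^esub> cls z'"
proof -
  have "cls (- z') = inv\<^bsub>T\<^esub> cls z'" using group_hom.hom_inv[OF group_hom_cls, of z'] assms by simp
  then show ?thesis using cls_add[of z "- z'"] assms by simp
qed

lemma cls_zero: "cls 0 = \<one>\<^bsub>T\<^esub>"
  using group_hom.hom_one[OF group_hom_cls] by simp

lemma cls_kernel: "z \<in> K \<Longrightarrow> cls z = \<one>\<^bsub>T\<^esub>"
  using group.coset_join2[OF comm_group.axioms(2)[OF FA_group] _ kernel_subgroup, of z]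
    subgroup.mem_carrier[OF kernel_subgroup, of z]
  by (simp add: tensor_class_def tensor_group_def)

lemma pt_closed: "\<lbrakk>m \<in> carrier M; n \<in> carrier N\<rbrakk> \<Longrightarrow> pt m n \<in> carrier T"
  unfolding pure_tensor_def by (rule cls_closed) simp

lemma cls_relator: "z \<in> relators \<Longrightarrow> cls z = \<one>\<^bsub>T\<^esub>"
  by (rule cls_kernel) (simp add: kernel_eq generate.incl)

lemma cls_relator2:
  assumes "z - z' - z'' \<in> relators" "z \<in> carrier FA" "z' \<in> carrier FA" "z'' \<in> carrier FA"
  shows "cls z = cls z' \<otimes>\<^bsub>T\<^esub> cls z''"
proof -
  have zz: "z' + z'' \<in> carrier FA" using assms keys_add[of z' z''] by auto
  have "cls (z - (z' + z'')) = \<one>\<^bsub>T\<^esub>" using cls_relator[OF assms(1)] by (simp add: algebra_simps)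
  then have "cls z \<otimes>\<^bsub>T\<^esub> inv\<^bsub>T\<^esub> cls (z' + z'') = \<one>\<^bsub>T\<^esub>" using cls_diff[OF assms(2) zz] by simp
  then have "cls z = cls (z' + z'')"
    using T.inv_equality[of "cls z" "inv\<^bsub>T\<^esub> cls (z' + z'')"] assms(2) zz
    by (metis T.inv_closed T.inv_inv cls_closed)
  then show ?thesis using assms cls_add by simp
qed

lemma pt_add_left:
  "\<lbrakk>m \<in> carrier M; m' \<in> carrier M; n \<in> carrier N\<rbrakk> \<Longrightarrow> pt (m \<oplus>\<^bsub>M\<^esub> m') n = pt m n \<otimes>\<^bsub>T\<^esub> pt m' n"
  unfolding pure_tensor_def
  by (rule cls_relator2) (use M in \<open>auto simp: relators_def abelian_group_def abelian_monoid.a_closed\<close>)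

lemma pt_add_right:
  "\<lbrakk>m \<in> carrier M; n \<in> carrier N; n' \<in> carrier N\<rbrakk> \<Longrightarrow> pt m (n \<oplus>\<^bsub>N\<^esub> n') = pt m n \<otimes>\<^bsub>T\<^esub> pt m n'"
  unfolding pure_tensor_def
  by (rule cls_relator2) (use N in \<open>auto simp: relators_def abelian_group_def abelian_monoid.a_closed\<close>)

lemma pt_balanced:
  assumes "m \<in> carrier M" "s \<in> S" "n \<in> carrier N"
  shows "pt (ra m s) n = pt m (la s n)"
proof -
  have "cls (frag_of (ra m s, n) - frag_of (m, la s n) - 0) = \<one>\<^bsub>T\<^esub>"
    by (simp, rule cls_relator) (use assms in \<open>auto simp: relators_def\<close>)
  then have "pt (ra m s) n \<otimes>\<^bsub>T\<^esub> inv\<^bsub>T\<^esub> pt m (la s n) = \<one>\<^bsub>T\<^esub>"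
    unfolding pure_tensor_def
    using cls_diff[of "frag_of (ra m s, n)" "frag_of (m, la s n)"] assms ra_closed la_closed by simp
  then show ?thesis
    using T.inv_equality[of "pt (ra m s) n" "inv\<^bsub>T\<^esub> pt m (la s n)"] assms ra_closed la_closed
    by (metis T.inv_closed T.inv_inv pt_closed)
qed

lemma tensor_induct [consumes 1, case_names one pure mult inv]:
  assumes "C \<in> carrier T" and one: "P \<one>\<^bsub>T\<^esub>"
    and pure: "\<And>m n. \<lbrakk>m \<in> carrier M; n \<in> carrier N\<rbrakk> \<Longrightarrow> P (pt m n)"
    and mult: "\<And>C D. \<lbrakk>C \<in> carrier T; D \<in> carrier T; P C; P D\<rbrakk> \<Longrightarrow> P (C \<otimes>\<^bsub>T\<^esub> D)"
    and inv: "\<And>C. \<lbrakk>C \<in> carrier T; P C\<rbrakk> \<Longrightarrow> P (inv\<^bsub>T\<^esub> C)"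
  shows "P C"
proof -
  have "P (cls z)" if "Poly_Mapping.keys z \<subseteq> carrier M \<times> carrier N" for z
    using that
  proof (induction z rule: free_Abelian_group_induct[consumes 1])
    case 1 then show ?case using one cls_zero by simp
  next
    case (2 x y)
    then show ?case using mult inv cls_diff[of x y] cls_closed by simp
  next
    case (3 x) then show ?case using pure by (cases x) (auto simp: pure_tensor_def)
  qed
  then show ?thesis using assms(1) by (auto simp: carrier_T)
qed

lemma hom_eqI:
  assumes A: "comm_group A" and f: "f \<in> hom T A" and g: "g \<in> hom T A"
    and eq: "\<And>m n. \<lbrakk>m \<in> carrier M; n \<in> carrier N\<rbrakk> \<Longrightarrow> f (pt m n) = g (pt m n)"
    and C: "C \<in> carrier T"
  shows "f C = g C"
proof -
  interpret A: comm_group A by fact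
  interpret f: group_hom T A f by unfold_locales (fact f)
  interpret g: group_hom T A g by unfold_locales (fact g)
  show ?thesis using C by (induction rule: tensor_induct) (auto simp: eq)
qed

text \<open>Universal property. The homomorphism that the free abelian group provides kills the
  three families of relators, so it factors through the quotient. The uniqueness half is
  \<open>hom_eqI\<close>.\<close>

lemma tensor_lift:
  assumes A: "comm_group A"
    and b: "\<And>m n. \<lbrakk>m \<in> carrier M; n \<in> carrier N\<rbrakk> \<Longrightarrow> b m n \<in> carrier A"
    and bl: "\<And>m m' n. \<lbrakk>m \<in> carrier M; m' \<in> carrier M; n \<in> carrier N\<rbrakk> \<Longrightarrow>
      b (m \<oplus>\<^bsub>M\<^esub> m') n = b m n \<otimes>\<^bsub>A\<^esub> b m' n"
    and br: "\<And>m n n'. \<lbrakk>m \<in> carrier M; n \<in> carrier N; n' \<in> carrier N\<rbrakk> \<Longrightarrow>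
      b m (n \<oplus>\<^bsub>N\<^esub> n') = b m n \<otimes>\<^bsub>A\<^esub> b m n'"
    and bb: "\<And>m s n. \<lbrakk>m \<in> carrier M; s \<in> S; n \<in> carrier N\<rbrakk> \<Longrightarrow> b (ra m s) n = b m (la s n)"
  obtains f where "f \<in> hom T A" "\<And>m n. \<lbrakk>m \<in> carrier M; n \<in> carrier N\<rbrakk> \<Longrightarrow> f (pt m n) = b m n"
proof -
  interpret A: comm_group A by fact
  have "(\<lambda>(m, n). b m n) ` (carrier M \<times> carrier N) \<subseteq> carrier A" using b by auto
  then obtain h where h: "h \<in> hom FA A"
    and hb: "\<And>x. x \<in> carrier M \<times> carrier N \<Longrightarrow> h (frag_of x) = (\<lambda>(m, n). b m n) x"
    using A.free_Abelian_group_universal by blast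
  interpret h: group_hom FA A h
    using comm_group.axioms(2)[OF FA_group] h A.is_group by (simp add: group_hom_def group_hom_axioms_def)
  have hadd: "h (x + y) = h x \<otimes>\<^bsub>A\<^esub> h y" if "x \<in> carrier FA" "y \<in> carrier FA" for x y
    using h.hom_mult[OF that] by simp
  have hdiff: "h (x - y) = h x \<otimes>\<^bsub>A\<^esub> inv\<^bsub>A\<^esub> h y" if "x \<in> carrier FA" "y \<in> carrier FA" for x y
    using hadd[of x "- y"] h.hom_inv[of y] that by simp
  have dc: "x - y \<in> carrier FA" if "x \<in> carrier FA" "y \<in> carrier FA" for x y
    using that keys_diff[of x y] by auto
  have hdiff2: "h (x - y - w) = h x \<otimes>\<^bsub>A\<^esub> inv\<^bsub>A\<^esub> h y \<otimes>\<^bsub>A\<^esub> inv\<^bsub>A\<^esub> h w"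
    if "x \<in> carrier FA" "y \<in> carrier FA" "w \<in> carrier FA" for x y w
    using hdiff[OF dc[OF that(1,2)] that(3)] hdiff[OF that(1,2)] by simp
  have rel: "relators \<subseteq> kernel FA A h"
  proof
    fix z assume z: "z \<in> relators"
    note ab = abelian_monoid.a_closed[OF abelian_group.axioms(1)[OF M]]
      abelian_monoid.a_closed[OF abelian_group.axioms(1)[OF N]]
    have "h z = \<one>\<^bsub>A\<^esub>"
      using z unfolding relators_def
    proof (elim UnE CollectE exE conjE, goal_cases)
      case (1 m m' n)
      have "h z = h (frag_of (m \<oplus>\<^bsub>M\<^esub> m', n)) \<otimes>\<^bsub>A\<^esub> inv\<^bsub>A\<^esub> h (frag_of (m, n)) \<otimes>\<^bsub>A\<^esub> inv\<^bsub>A\<^esub> h (frag_of (m', n))"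
        unfolding 1(1) by (rule hdiff2) (use 1 ab in simp_all)
      then show ?case using 1 ab b by (simp add: hb bl A.m_assoc A.m_ac(3) A.r_inv)
    next
      case (2 m n n')
      have "h z = h (frag_of (m, n \<oplus>\<^bsub>N\<^esub> n')) \<otimes>\<^bsub>A\<^esub> inv\<^bsub>A\<^esub> h (frag_of (m, n)) \<otimes>\<^bsub>A\<^esub> inv\<^bsub>A\<^esub> h (frag_of (m, n'))"
        unfolding 2(1) by (rule hdiff2) (use 2 ab in simp_all)
      then show ?case using 2 ab b by (simp add: hb br A.m_assoc A.m_ac(3) A.r_inv)
    next
      case (3 m s n)
      then show ?case
        using ra_closed la_closed b by (simp add: hdiff hb bb)
    qed
    then show "z \<in> kernel FA A h" using z relators_closed unfolding kernel_def by blast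
  qed
  have "K \<subseteq> kernel FA A h"
    unfolding kernel_eq by (rule group.generate_subgroup_incl[OF _ rel h.subgroup_kernel]) simp
  then obtain g where g: "g \<in> hom (FA Mod K) A" "\<And>x. x \<in> carrier FA \<Longrightarrow> g (K #>\<^bsub>FA\<^esub> x) = h x"
    using h.FactGroup_universal_kernel[OF kernel_normal] by metis
  show thesis
  proof (rule that[of g])
    show "g \<in> hom T A" using g(1) by (simp add: tensor_group_def)
    show "g (pt m n) = b m n" if "m \<in> carrier M" "n \<in> carrier N" for m n
      using g(2)[of "frag_of (m, n)"] that by (simp add: pure_tensor_def tensor_class_def hb)
  qed
qed

text \<open>\<open>tensor_map\<close> is a union over all representatives of a class. The universal
  property supplies a homomorphism \<open>h\<close> with the desired values on pure tensors; by
  induction over the free abelian group every representative yields the coset \<open>h C\<close>, so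
  the union of these equal cosets is again \<open>h C\<close>.\<close>

lemma tensor_map:
  assumes f: "\<And>m. m \<in> carrier M \<Longrightarrow> f m \<in> carrier M"
    "\<And>m m'. \<lbrakk>m \<in> carrier M; m' \<in> carrier M\<rbrakk> \<Longrightarrow> f (m \<oplus>\<^bsub>M\<^esub> m') = f m \<oplus>\<^bsub>M\<^esub> f m'"
    "\<And>m s. \<lbrakk>m \<in> carrier M; s \<in> S\<rbrakk> \<Longrightarrow> f (ra m s) = ra (f m) s"
    and g: "\<And>n. n \<in> carrier N \<Longrightarrow> g n \<in> carrier N"
    "\<And>n n'. \<lbrakk>n \<in> carrier N; n' \<in> carrier N\<rbrakk> \<Longrightarrow> g (n \<oplus>\<^bsub>N\<^esub> n') = g n \<oplus>\<^bsub>N\<^esub> g n'"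
    "\<And>n s. \<lbrakk>n \<in> carrier N; s \<in> S\<rbrakk> \<Longrightarrow> g (la s n) = la s (g n)"
  shows tensor_map_hom: "tensor_map S M ra N la f g \<in> hom T T"
    and tensor_map_pure: "\<And>m n. \<lbrakk>m \<in> carrier M; n \<in> carrier N\<rbrakk> \<Longrightarrow>
      tensor_map S M ra N la f g (pt m n) = pt (f m) (g n)"
proof -
  obtain h where h: "h \<in> hom T T" and hp: "\<And>m n. \<lbrakk>m \<in> carrier M; n \<in> carrier N\<rbrakk> \<Longrightarrow> h (pt m n) = pt (f m) (g n)"
    by (rule tensor_lift[OF T_group, of "\<lambda>m n. pt (f m) (g n)"])
      (auto simp: f g pt_closed pt_add_left pt_add_right pt_balanced)
  interpret h: group_hom T T h by unfold_locales (fact h)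
  let ?e = "frag_extend (\<lambda>(m, n). frag_of (f m, g n))"
  have ec: "Poly_Mapping.keys (?e z) \<subseteq> carrier M \<times> carrier N \<and> cls (?e z) = h (cls z)"
    if "Poly_Mapping.keys z \<subseteq> carrier M \<times> carrier N" for z
    using that
  proof (induction z rule: free_Abelian_group_induct[consumes 1])
    case 1 then show ?case by (simp add: cls_zero)
  next
    case (2 x y)
    then have "Poly_Mapping.keys (?e (x - y)) \<subseteq> carrier M \<times> carrier N"
      using keys_diff[of "?e x" "?e y"] by (auto simp: frag_extend_diff)
    then show ?case using 2 by (simp add: frag_extend_diff cls_diff cls_closed)
  next
    case (3 x) then show ?case using f g hp by (cases x) (auto simp: pure_tensor_def)
  qed
  have eq: "tensor_map S M ra N la f g C = h C" if C: "C \<in> carrier T" for C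
  proof -
    obtain z0 where z0: "z0 \<in> carrier FA" "C = cls z0" using C by (auto simp: carrier_T)
    have FAg: "group FA" by simp
    have zin: "z0 \<in> C" using group.rcos_self[OF FAg z0(1) kernel_subgroup] z0 by (simp add: tensor_class_def)
    have "cls (?e z) = h C" if "z \<in> C" for z
    proof -
      have zc: "z \<in> carrier FA"
        using that z0 subgroup.elemrcos_carrier[OF kernel_subgroup FAg z0(1)] by (simp add: tensor_class_def)
      have "cls z = C"
        using group.repr_independence[OF FAg _ z0(1) kernel_subgroup, of z] that z0(2)
        by (simp add: tensor_class_def)
      then show ?thesis using ec[of z] zc by simp
    qed
    then show ?thesis unfolding tensor_map_def using zin by auto
  qed
  show "tensor_map S M ra N la f g \<in> hom T T"
    using h eq by (simp add: hom_def Pi_iff)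
  show "tensor_map S M ra N la f g (pt m n) = pt (f m) (g n)" if "m \<in> carrier M" "n \<in> carrier N" for m n
    using eq[OF pt_closed[OF that]] hp[OF that] by simp
qed

end


section \<open>Modules in coordinates\<close>

definition scl :: "'k::field \<Rightarrow> ('b \<Rightarrow> 'k) \<Rightarrow> 'b \<Rightarrow> 'k" where
  "scl c f = (\<lambda>b. c * f b)"

text \<open>\<open>k\<^sup>B\<close> consists of the functions that vanish outside \<open>B\<close>; operators are linear on all functions.\<close>

definition fspace :: "'b set \<Rightarrow> ('b \<Rightarrow> 'k::field) set" where
  "fspace B = {f. \<forall>b. b \<notin> B \<longrightarrow> f b = 0}"

definition lin :: "(('b \<Rightarrow> 'k::field) \<Rightarrow> ('c \<Rightarrow> 'k)) \<Rightarrow> bool" where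
  "lin L \<longleftrightarrow> (\<forall>f g. L (f + g) = L f + L g) \<and> (\<forall>c f. L (scl c f) = scl c (L f))"

definition dl :: "'b \<Rightarrow> 'b \<Rightarrow> 'k::field" where
  "dl b = (\<lambda>b'. if b' = b then 1 else 0)"

text \<open>Sums of functions have to stay sums of vectors under simplification;
  \<open>fapply\<close> restores the pointwise view where a proof goes down to values.\<close>

declare plus_fun_apply [simp del] zero_fun_apply [simp del]

lemma scl_apply: "scl c f b = c * f b"
  by (simp add: scl_def)

lemmas fapply = plus_fun_apply zero_fun_apply scl_apply

lemma scl_scl [simp]: "scl c (scl d f) = scl (c * d) f"
  by (simp add: scl_def mult.assoc)

lemma scl_one [simp]: "scl 1 f = f" and scl_zero [simp]: "scl 0 f = 0" "scl c 0 = 0"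
  by (simp_all add: scl_def fun_eq_iff fapply)

lemma scl_add: "scl c (f + g) = scl c f + scl c g" "scl (c + d) f = scl c f + scl d f"
  by (simp_all add: fun_eq_iff fapply algebra_simps)

lemma sum_fun_apply: "(\<Sum>i\<in>A. f i) x = (\<Sum>i\<in>A. f i x)"
  by (induction A rule: infinite_finite_induct) (auto simp: fapply)

lemma scl_sum: "scl c (\<Sum>i\<in>A. f i) = (\<Sum>i\<in>A. scl c (f i))"
  by (induction A rule: infinite_finite_induct) (auto simp: scl_add)

lemma fspace_zero [simp]: "0 \<in> fspace B"
  by (simp add: fspace_def fapply)

lemma fspace_add: "\<lbrakk>f \<in> fspace B; g \<in> fspace B\<rbrakk> \<Longrightarrow> f + g \<in> fspace B"
  by (simp add: fspace_def fapply)

lemma fspace_scl: "f \<in> fspace B \<Longrightarrow> scl c f \<in> fspace B"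
  by (simp add: fspace_def fapply)

lemma fspace_uminus: "f \<in> fspace B \<Longrightarrow> - f \<in> fspace B"
  by (simp add: fspace_def)

lemma fspace_sum: "(\<And>i. i \<in> A \<Longrightarrow> f i \<in> fspace B) \<Longrightarrow> (\<Sum>i\<in>A. f i) \<in> fspace B"
  by (induction A rule: infinite_finite_induct) (auto intro: fspace_add)

lemma fspace_dl [simp]: "b \<in> B \<Longrightarrow> dl b \<in> fspace B"
  by (auto simp: fspace_def dl_def)

lemma fspaceD: "\<lbrakk>f \<in> fspace B; b \<notin> B\<rbrakk> \<Longrightarrow> f b = 0"
  by (simp add: fspace_def)

lemma fspace_expand:
  assumes "finite B" "f \<in> fspace B"
  shows "f = (\<Sum>b\<in>B. scl (f b) (dl b))"
  using assms by (auto simp: fun_eq_iff sum_fun_apply fapply dl_def fspace_def if_distrib[of "\<lambda>x. _ * x"] cong: if_cong)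

lemma lin_add: "lin L \<Longrightarrow> L (f + g) = L f + L g"
  and lin_scl: "lin L \<Longrightarrow> L (scl c f) = scl c (L f)"
  by (simp_all add: lin_def)

lemma linI: "\<lbrakk>\<And>f g. L (f + g) = L f + L g; \<And>c f. L (scl c f) = scl c (L f)\<rbrakk> \<Longrightarrow> lin L"
  by (simp add: lin_def)

lemma lin_zero [simp]: "lin L \<Longrightarrow> L 0 = 0"
  using lin_scl[of L 0 0] by simp

lemma lin_uminus: "lin L \<Longrightarrow> L (- f) = - L f"
  using lin_scl[of L "-1" f] by (simp add: scl_def fun_eq_iff fun_Compl_def)

lemma lin_sum: "lin L \<Longrightarrow> L (\<Sum>i\<in>A. f i) = (\<Sum>i\<in>A. L (f i))"
  by (induction A rule: infinite_finite_induct) (auto simp: lin_add)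

lemma lin_expand:
  assumes "lin L" "finite B" "f \<in> fspace B"
  shows "L f = (\<Sum>b\<in>B. scl (f b) (L (dl b)))"
  by (subst fspace_expand[OF assms(2,3)]) (simp add: lin_sum lin_scl assms(1))

lemma lin_eqI:
  assumes "lin L" "lin L'" "finite B" "f \<in> fspace B" "\<And>b. b \<in> B \<Longrightarrow> L (dl b) = L' (dl b)"
  shows "L f = L' f"
  using assms lin_expand[of L B f] lin_expand[of L' B f] by simp

lemma lin_id [simp]: "lin (\<lambda>f. f)"
  by (rule linI) auto

lemma lin_comp: "\<lbrakk>lin L; lin L'\<rbrakk> \<Longrightarrow> lin (\<lambda>f. L (L' f))"
  by (rule linI) (auto simp: lin_add lin_scl)

lemma lin_plus: "\<lbrakk>lin L; lin L'\<rbrakk> \<Longrightarrow> lin (\<lambda>f. L f + L' f)"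
  by (rule linI) (auto simp: lin_add lin_scl scl_add)

lemma lin_scale: "lin L \<Longrightarrow> lin (\<lambda>f. scl c (L f))"
  by (rule linI) (simp_all add: lin_add lin_scl scl_add mult.commute)

lemma lin_pow:
  fixes L :: "('b \<Rightarrow> 'k::field) \<Rightarrow> 'b \<Rightarrow> 'k"
  shows "lin L \<Longrightarrow> lin (L ^^ n)"
  by (induction n) (simp_all add: lin_def)

section \<open>Actions of a twisted monoid algebra given on its basis\<close>

definition act :: "('p \<Rightarrow> ('b \<Rightarrow> 'k::field) \<Rightarrow> 'b \<Rightarrow> 'k) \<Rightarrow> ('p \<Rightarrow>\<^sub>0 'k) \<Rightarrow> ('b \<Rightarrow> 'k) \<Rightarrow> 'b \<Rightarrow> 'k" where
  "act L h f = (\<Sum>p\<in>Poly_Mapping.keys h. scl (Poly_Mapping.lookup h p) (L p f))"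

lemma act_superset:
  assumes "finite A" "Poly_Mapping.keys h \<subseteq> A"
  shows "act L h f = (\<Sum>p\<in>A. scl (Poly_Mapping.lookup h p) (L p f))"
  unfolding act_def by (rule sum.mono_neutral_left) (use assms in \<open>auto simp: in_keys_iff\<close>)

lemma act_add: "act L (h + h') f = act L h f + act L h' f"
proof -
  let ?A = "Poly_Mapping.keys h \<union> Poly_Mapping.keys h'"
  have "Poly_Mapping.keys (h + h') \<subseteq> ?A" by (rule keys_add)
  then show ?thesis
    by (simp add: act_superset[of ?A] lookup_add scl_add sum.distrib)
qed

lemma act_zero [simp]: "act L 0 f = 0"
  by (simp add: act_def)

lemma act_sum: "act L (\<Sum>i\<in>A. h i) f = (\<Sum>i\<in>A. act L (h i) f)"
  by (induction A rule: infinite_finite_induct) (auto simp: act_add)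

lemma act_single [simp]: "act L (Poly_Mapping.single p \<alpha>) f = scl \<alpha> (L p f)"
  by (subst act_superset[of "{p}"]) auto

lemma lin_act:
  assumes "\<And>p. p \<in> Poly_Mapping.keys h \<Longrightarrow> lin (L p)"
  shows "lin (act L h)"
  using assms
  by (intro linI) (auto simp: act_def lin_add lin_scl scl_add sum.distrib scl_sum mult.commute)

lemma act_closed:
  assumes "\<And>p. p \<in> Poly_Mapping.keys h \<Longrightarrow> L p f \<in> fspace B"
  shows "act L h f \<in> fspace B"
  using assms unfolding act_def by (intro fspace_sum fspace_scl)

text \<open>A representation of the twisted monoid algebra, given by the operators of the basis
  elements. The multiplicative laws are demanded on \<open>fspace B\<close> only, but linearity on
  all functions: operators can then be applied to slices of a function on a product without looking
  at supports.\<close>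

definition operators :: "('p, 'x) monoid_scheme \<Rightarrow> ('p \<Rightarrow> 'p \<Rightarrow> 'k::field) \<Rightarrow> 'b set \<Rightarrow>
    ('p \<Rightarrow> ('b \<Rightarrow> 'k) \<Rightarrow> 'b \<Rightarrow> 'k) \<Rightarrow> bool" where
  "operators P c B L \<longleftrightarrow> finite B \<and> (\<forall>p\<in>carrier P. lin (L p)) \<and>
     (\<forall>p\<in>carrier P. \<forall>f\<in>fspace B. L p f \<in> fspace B) \<and>
     (\<forall>f\<in>fspace B. L \<one>\<^bsub>P\<^esub> f = f) \<and>
     (\<forall>p\<in>carrier P. \<forall>p'\<in>carrier P. \<forall>f\<in>fspace B.
        L p (L p' f) = scl (c p p') (L (p \<otimes>\<^bsub>P\<^esub> p') f))"

lemma act_mult: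
  assumes L: "operators P c B L" and f: "f \<in> fspace B"
    and h: "Poly_Mapping.keys h \<subseteq> carrier P" "Poly_Mapping.keys h' \<subseteq> carrier P"
  shows "act L (h \<otimes>\<^bsub>twisted_algebra P c\<^esub> h') f = act L h (act L h' f)"
proof -
  have "act L (h \<otimes>\<^bsub>twisted_algebra P c\<^esub> h') f =
     (\<Sum>p\<in>Poly_Mapping.keys h. \<Sum>p'\<in>Poly_Mapping.keys h'.
        scl (Poly_Mapping.lookup h p * Poly_Mapping.lookup h' p' * c p p') (L (p \<otimes>\<^bsub>P\<^esub> p') f))"
    by (simp add: twisted_algebra_def act_sum)
  also have "\<dots> = (\<Sum>p\<in>Poly_Mapping.keys h. \<Sum>p'\<in>Poly_Mapping.keys h'.
        scl (Poly_Mapping.lookup h p) (L p (scl (Poly_Mapping.lookup h' p') (L p' f))))"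
  proof (intro sum.cong refl)
    fix p p' assume "p \<in> Poly_Mapping.keys h" "p' \<in> Poly_Mapping.keys h'"
    then have "p \<in> carrier P" "p' \<in> carrier P" using h by auto
    then show "scl (Poly_Mapping.lookup h p * Poly_Mapping.lookup h' p' * c p p') (L (p \<otimes>\<^bsub>P\<^esub> p') f) =
      scl (Poly_Mapping.lookup h p) (L p (scl (Poly_Mapping.lookup h' p') (L p' f)))"
      using L f by (simp add: operators_def lin_scl mult.assoc)
  qed
  also have "\<dots> = act L h (act L h' f)"
    unfolding act_def using L h
    by (intro sum.cong refl) (auto simp: operators_def lin_sum scl_sum subset_iff)
  finally show ?thesis .
qed

definition cmod :: "'b set \<Rightarrow> ('p \<Rightarrow> ('b \<Rightarrow> 'k::field) \<Rightarrow> 'b \<Rightarrow> 'k) \<Rightarrow> ('p \<Rightarrow>\<^sub>0 'k, 'b \<Rightarrow> 'k) module" where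
  "cmod B L = \<lparr>carrier = fspace B, monoid.mult = undefined, monoid.one = undefined,
     ring.zero = 0, ring.add = (+), module.smult = act L\<rparr>"

lemma cmod_simps [simp]:
  "carrier (cmod B L) = fspace B" "\<zero>\<^bsub>cmod B L\<^esub> = 0" "f \<oplus>\<^bsub>cmod B L\<^esub> g = f + g"
  "h \<odot>\<^bsub>cmod B L\<^esub> f = act L h f"
  by (simp_all add: cmod_def)

lemma twisted_simps:
  "f \<in> carrier (twisted_algebra P c) \<longleftrightarrow> Poly_Mapping.keys f \<subseteq> carrier P"
  "f \<oplus>\<^bsub>twisted_algebra P c\<^esub> g = f + g" "\<zero>\<^bsub>twisted_algebra P c\<^esub> = 0"
  "\<one>\<^bsub>twisted_algebra P c\<^esub> = Poly_Mapping.single \<one>\<^bsub>P\<^esub> 1"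
  by (simp_all add: twisted_algebra_def)

lemma abelian_group_fspace: "abelian_group (cmod B L)"
proof (rule abelian_groupI)
  fix f assume "f \<in> carrier (cmod B L)"
  then show "\<exists>g\<in>carrier (cmod B L). g \<oplus>\<^bsub>cmod B L\<^esub> f = \<zero>\<^bsub>cmod B L\<^esub>"
    by (intro bexI[of _ "- f"]) (auto intro: fspace_uminus)
qed (auto intro: fspace_add simp: algebra_simps)

lemma left_module_cmod:
  assumes R: "ring (twisted_algebra P c)" and L: "operators P c B L"
  shows "left_module (twisted_algebra P c) (cmod B L)"
proof (rule left_moduleI[OF R abelian_group_fspace])
  fix h f assume "h \<in> carrier (twisted_algebra P c)" "f \<in> carrier (cmod B L)"
  then show "h \<odot>\<^bsub>cmod B L\<^esub> f \<in> carrier (cmod B L)"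
    using L by (auto simp: twisted_simps operators_def subset_iff intro!: act_closed)
next
  fix h f g assume "h \<in> carrier (twisted_algebra P c)" "f \<in> carrier (cmod B L)"
  then show "h \<odot>\<^bsub>cmod B L\<^esub> (f \<oplus>\<^bsub>cmod B L\<^esub> g) = h \<odot>\<^bsub>cmod B L\<^esub> f \<oplus>\<^bsub>cmod B L\<^esub> h \<odot>\<^bsub>cmod B L\<^esub> g"
    using L by (auto simp: twisted_simps operators_def subset_iff intro!: lin_add lin_act)
qed (use L in \<open>auto simp: twisted_simps act_add act_mult operators_def\<close>)

lemma scalar_act: "\<lbrakk>operators P c B L; f \<in> fspace B\<rbrakk> \<Longrightarrow> act L (scalar P \<alpha>) f = scl \<alpha> f"
  by (simp add: scalar_def operators_def)

section \<open>Pure tensors of functions and Kronecker products of operators\<close>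

definition tens :: "('b \<Rightarrow> 'k::field) \<Rightarrow> ('c \<Rightarrow> 'k) \<Rightarrow> 'b \<times> 'c \<Rightarrow> 'k" where
  "tens f g = (\<lambda>(x, y). f x * g y)"

text \<open>The tensor product of two operators, computed on slices (\<open>L'\<close> in the second
  variable, then \<open>L\<close> in the first), so that it is defined on every function of two
  variables and refers to no basis. \<open>kron_tens\<close> recovers the usual description.\<close>

definition kron :: "(('b \<Rightarrow> 'k::field) \<Rightarrow> ('b' \<Rightarrow> 'k)) \<Rightarrow> (('c \<Rightarrow> 'k) \<Rightarrow> ('c' \<Rightarrow> 'k)) \<Rightarrow>
    ('b \<times> 'c \<Rightarrow> 'k) \<Rightarrow> ('b' \<times> 'c' \<Rightarrow> 'k)" where
  "kron L L' \<phi> = (\<lambda>(x', y'). L (\<lambda>x. L' (\<lambda>y. \<phi> (x, y)) y') x')"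

lemma tens_add: "tens (f + f') g = tens f g + tens f' g" "tens f (g + g') = tens f g + tens f g'"
  and tens_scl: "tens (scl c f) g = scl c (tens f g)" "tens f (scl c g) = scl c (tens f g)"
  by (auto simp: tens_def fun_eq_iff fapply algebra_simps)

lemma tens_dl: "tens (dl x) (dl y) = dl (x, y)"
  by (auto simp: tens_def dl_def fun_eq_iff)

lemma tens_closed: "\<lbrakk>f \<in> fspace B; g \<in> fspace C\<rbrakk> \<Longrightarrow> tens f g \<in> fspace (B \<times> C)"
  by (auto simp: tens_def fspace_def)

lemma kron_tens:
  assumes "lin L" "lin L'"
  shows "kron L L' (tens f g) = tens (L f) (L' g)"
proof (rule ext, clarify)
  fix x' y'
  have "(\<lambda>y. f x * g y) = scl (f x) g" for x by (simp add: scl_def)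
  then have "L' (\<lambda>y. f x * g y) y' = f x * L' g y'" for x using assms(2) by (simp add: lin_scl fapply)
  moreover have "(\<lambda>x. f x * L' g y') = scl (L' g y') f" by (simp add: scl_def mult.commute)
  ultimately show "kron L L' (tens f g) (x', y') = tens (L f) (L' g) (x', y')"
    using assms(1) by (simp add: kron_def tens_def lin_scl fapply)
qed

lemma lin_kron:
  fixes L :: "('b \<Rightarrow> 'k::field) \<Rightarrow> 'b' \<Rightarrow> 'k" and L' :: "('c \<Rightarrow> 'k) \<Rightarrow> 'c' \<Rightarrow> 'k"
  assumes "lin L" "lin L'"
  shows "lin (kron L L')"
proof (rule linI)
  fix \<phi> \<psi> :: "'b \<times> 'c \<Rightarrow> 'k" and c :: 'k
  have "(\<lambda>y. (\<phi> + \<psi>) (x, y)) = (\<lambda>y. \<phi> (x, y)) + (\<lambda>y. \<psi> (x, y))" for x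
    by (simp add: fun_eq_iff fapply)
  moreover have "(\<lambda>x. (L' (\<lambda>y. \<phi> (x, y)) + L' (\<lambda>y. \<psi> (x, y))) y') =
    (\<lambda>x. L' (\<lambda>y. \<phi> (x, y)) y') + (\<lambda>x. L' (\<lambda>y. \<psi> (x, y)) y')" for y'
    by (simp add: fun_eq_iff fapply)
  ultimately show "kron L L' (\<phi> + \<psi>) = kron L L' \<phi> + kron L L' \<psi>"
    using assms by (simp add: kron_def lin_add) (simp add: fun_eq_iff fapply)
  have "(\<lambda>y. scl c \<phi> (x, y)) = scl c (\<lambda>y. \<phi> (x, y))" for x by (simp add: fun_eq_iff fapply)
  moreover have "(\<lambda>x. scl c (L' (\<lambda>y. \<phi> (x, y))) y') = scl c (\<lambda>x. L' (\<lambda>y. \<phi> (x, y)) y')" for y'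
    by (simp add: fun_eq_iff fapply)
  ultimately show "kron L L' (scl c \<phi>) = scl c (kron L L' \<phi>)"
    using assms by (simp add: kron_def lin_scl) (simp add: fun_eq_iff fapply)
qed

lemma slice_right: "\<phi> \<in> fspace (B \<times> C) \<Longrightarrow> (\<lambda>y. \<phi> (x, y)) \<in> fspace C"
  and slice_left: "\<phi> \<in> fspace (B \<times> C) \<Longrightarrow> (\<lambda>x. \<phi> (x, y)) \<in> fspace B"
  and slice_out: "\<phi> \<in> fspace (B \<times> C) \<Longrightarrow> x \<notin> B \<Longrightarrow> (\<lambda>y. \<phi> (x, y)) = 0"
  by (auto simp: fspace_def fun_eq_iff fapply)

lemma kron_closed:
  assumes "lin L" "lin L'" "\<And>f. f \<in> fspace B \<Longrightarrow> L f \<in> fspace B'" "\<And>f. f \<in> fspace C \<Longrightarrow> L' f \<in> fspace C'"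
    and \<phi>: "\<phi> \<in> fspace (B \<times> C)"
  shows "kron L L' \<phi> \<in> fspace (B' \<times> C')"
proof -
  have "kron L L' \<phi> (x', y') = 0" if n: "(x', y') \<notin> B' \<times> C'" for x' y'
  proof -
  have "(\<lambda>x. L' (\<lambda>y. \<phi> (x, y)) y') \<in> fspace B"
    using slice_out[OF \<phi>] assms(2) by (auto simp: fspace_def fapply)
  then have 1: "L (\<lambda>x. L' (\<lambda>y. \<phi> (x, y)) y') \<in> fspace B'" using assms(3) by blast
  have 2: "(\<lambda>x. L' (\<lambda>y. \<phi> (x, y)) y') = 0" if "y' \<notin> C'"
    using assms(4)[OF slice_right[OF \<phi>]] that by (auto simp: fspace_def fun_eq_iff fapply)
  show "kron L L' \<phi> (x', y') = 0"
    using n 1 2 assms(1) by (cases "y' \<in> C'") (auto simp: kron_def fspace_def fapply)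
  qed
  then show ?thesis unfolding fspace_def by (auto simp del: mem_Sigma_iff)
qed

text \<open>Pure tensors of basis functions form a basis, so two linear maps may be compared on pure
  tensors. Nearly every commutation relation between Kronecker products below is checked in this
  way.\<close>

lemma kron_eqI:
  assumes "lin K" "lin K'" "finite B" "finite C" "\<phi> \<in> fspace (B \<times> C)"
    and "\<And>f g. \<lbrakk>f \<in> fspace B; g \<in> fspace C\<rbrakk> \<Longrightarrow> K (tens f g) = K' (tens f g)"
  shows "K \<phi> = K' \<phi>"
proof -
  have 1: "K (dl (x, y)) = K' (dl (x, y))" if "x \<in> B" "y \<in> C" for x y
    using assms(6)[of "dl x" "dl y"] that by (simp add: tens_dl)
  have fin: "finite (B \<times> C)" using assms by simp
  show ?thesis by (rule lin_eqI[OF assms(1,2) fin assms(5)]) (use 1 in blast)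
qed

lemma kron_comp:
  fixes L1 :: "('b2 \<Rightarrow> 'k::field) \<Rightarrow> 'b3 \<Rightarrow> 'k" and L2 :: "('b1 \<Rightarrow> 'k) \<Rightarrow> 'b2 \<Rightarrow> 'k"
    and L1' :: "('c2 \<Rightarrow> 'k) \<Rightarrow> 'c3 \<Rightarrow> 'k" and L2' :: "('c1 \<Rightarrow> 'k) \<Rightarrow> 'c2 \<Rightarrow> 'k"
  assumes "lin L1" "lin L1'" "lin L2" "lin L2'" "finite B" "finite C" "\<phi> \<in> fspace (B \<times> C)"
  shows "kron L1 L1' (kron L2 L2' \<phi>) = kron (\<lambda>f. L1 (L2 f)) (\<lambda>f. L1' (L2' f)) \<phi>"
proof (rule kron_eqI[OF _ _ assms(5-7)])
  show "lin (\<lambda>\<phi>. kron L1 L1' (kron L2 L2' \<phi>))"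
    by (rule lin_comp[OF lin_kron[OF assms(1,2)] lin_kron[OF assms(3,4)]])
  show "lin (kron (\<lambda>f. L1 (L2 f)) (\<lambda>f. L1' (L2' f)))"
    by (rule lin_kron[OF lin_comp[OF assms(1,3)] lin_comp[OF assms(2,4)]])
  show "kron L1 L1' (kron L2 L2' (tens f g)) = kron (\<lambda>f. L1 (L2 f)) (\<lambda>f. L1' (L2' f)) (tens f g)" for f g
    using kron_tens[OF assms(1,2)] kron_tens[OF assms(3,4)]
      kron_tens[OF lin_comp[OF assms(1,3)] lin_comp[OF assms(2,4)]] by simp
qed

text \<open>For \<open>P = P'\<close> and \<open>c = c'\<close> this is the action of
  \<open>twisted_square\<close>, in which the comultiplication takes its values.\<close>

lemma operators_kron:
  fixes L :: "'p \<Rightarrow> ('b \<Rightarrow> 'k::field) \<Rightarrow> 'b \<Rightarrow> 'k" and L' :: "'q \<Rightarrow> ('c \<Rightarrow> 'k) \<Rightarrow> 'c \<Rightarrow> 'k"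
  assumes "operators P c B L" "operators P' c' B' L'" and P: "monoid P" "monoid P'"
  shows "operators (P \<times>\<times> P') (\<lambda>(b, b') (d, d'). c b d * c' b' d') (B \<times> B') (\<lambda>(b, b'). kron (L b) (L' b'))"
proof -
  note L = assms(1,2)[unfolded operators_def]
  have fin: "finite B" "finite B'" using L by auto
  have lL: "lin (L b)" if "b \<in> carrier P" for b using L that by blast
  have lL': "lin (L' b)" if "b \<in> carrier P'" for b using L that by blast
  note mc = monoid.m_closed[OF P(1)] monoid.m_closed[OF P(2)]
  have 1: "kron (L \<one>\<^bsub>P\<^esub>) (L' \<one>\<^bsub>P'\<^esub>) \<phi> = \<phi>" if "\<phi> \<in> fspace (B \<times> B')" for \<phi> :: "'b \<times> 'c \<Rightarrow> 'k"
  proof -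
    have "L' \<one>\<^bsub>P'\<^esub> (\<lambda>y. \<phi> (x, y)) = (\<lambda>y. \<phi> (x, y))" for x using L slice_right[OF that] by blast
    moreover have "L \<one>\<^bsub>P\<^esub> (\<lambda>x. \<phi> (x, y)) = (\<lambda>x. \<phi> (x, y))" for y using L slice_left[OF that] by blast
    ultimately show ?thesis by (simp add: kron_def)
  qed
  have 2: "kron (L b) (L' b') (kron (L d) (L' d') \<phi>) =
      scl (c b d * c' b' d') (kron (L (b \<otimes>\<^bsub>P\<^esub> d)) (L' (b' \<otimes>\<^bsub>P'\<^esub> d')) \<phi>)"
    if b: "b \<in> carrier P" "d \<in> carrier P" "b' \<in> carrier P'" "d' \<in> carrier P'"
      and \<phi>: "\<phi> \<in> fspace (B \<times> B')" for b d b' d' \<phi>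
  proof (rule kron_eqI[OF _ _ fin \<phi>])
    show "lin (\<lambda>\<phi>. kron (L b) (L' b') (kron (L d) (L' d') \<phi>))"
      by (rule lin_comp[OF lin_kron[OF lL[OF b(1)] lL'[OF b(3)]] lin_kron[OF lL[OF b(2)] lL'[OF b(4)]]])
    show "lin (\<lambda>\<phi>. scl (c b d * c' b' d') (kron (L (b \<otimes>\<^bsub>P\<^esub> d)) (L' (b' \<otimes>\<^bsub>P'\<^esub> d')) \<phi>))"
      by (intro lin_scale lin_kron lL lL' mc b)
    show "kron (L b) (L' b') (kron (L d) (L' d') (tens f g)) =
      scl (c b d * c' b' d') (kron (L (b \<otimes>\<^bsub>P\<^esub> d)) (L' (b' \<otimes>\<^bsub>P'\<^esub> d')) (tens f g))"
      if "f \<in> fspace B" "g \<in> fspace B'" for f g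
      using that b L mc by (simp add: kron_tens lL lL' tens_scl mult.commute)
  qed
  show ?thesis
    unfolding operators_def
  proof (intro conjI ballI)
    show "finite (B \<times> B')" using fin by simp
    fix p assume "p \<in> carrier (P \<times>\<times> P')"
    then obtain b b' where p: "p = (b, b')" "b \<in> carrier P" "b' \<in> carrier P'" by (auto simp: DirProd_def)
    show "lin (case p of (b, b') \<Rightarrow> kron (L b) (L' b'))" using p by (simp add: lin_kron lL lL')
    fix \<phi> :: "'b \<times> 'c \<Rightarrow> 'k" assume \<phi>: "\<phi> \<in> fspace (B \<times> B')"
    show "(case p of (b, b') \<Rightarrow> kron (L b) (L' b')) \<phi> \<in> fspace (B \<times> B')"
      using p L \<phi> by (auto intro!: kron_closed[of _ _ B B B' B'])
  next
    fix \<phi> :: "'b \<times> 'c \<Rightarrow> 'k" assume "\<phi> \<in> fspace (B \<times> B')"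
    then show "(case \<one>\<^bsub>P \<times>\<times> P'\<^esub> of (b, b') \<Rightarrow> kron (L b) (L' b')) \<phi> = \<phi>"
      by (simp add: DirProd_def 1)
  next
    fix p p' and \<phi> :: "'b \<times> 'c \<Rightarrow> 'k" assume "p \<in> carrier (P \<times>\<times> P')" "p' \<in> carrier (P \<times>\<times> P')" "\<phi> \<in> fspace (B \<times> B')"
    then show "(case p of (b, b') \<Rightarrow> kron (L b) (L' b')) ((case p' of (b, b') \<Rightarrow> kron (L b) (L' b')) \<phi>) =
       scl ((case p of (b, b') \<Rightarrow> \<lambda>(d, d'). c b d * c' b' d') p')
         ((case p \<otimes>\<^bsub>P \<times>\<times> P'\<^esub> p' of (b, b') \<Rightarrow> kron (L b) (L' b')) \<phi>)"
      by (auto simp: DirProd_def 2)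
  qed
qed

text \<open>The tensor group is written multiplicatively, so homomorphisms from it into a space of
  functions need that space as a \<open>monoid\<close> record.\<close>

definition fgroup :: "'b set \<Rightarrow> ('b \<Rightarrow> 'k::field) monoid" where
  "fgroup B = \<lparr>carrier = fspace B, monoid.mult = (+), monoid.one = 0\<rparr>"

lemma fgroup_simps [simp]:
  "carrier (fgroup B) = fspace B" "f \<otimes>\<^bsub>fgroup B\<^esub> g = f + g" "\<one>\<^bsub>fgroup B\<^esub> = 0"
  by (simp_all add: fgroup_def)

lemma comm_group_fgroup: "comm_group (fgroup B :: ('b \<Rightarrow> 'k::field) monoid)"
proof (rule comm_groupI)
  fix f :: "'b \<Rightarrow> 'k" assume "f \<in> carrier (fgroup B)"
  then show "\<exists>g\<in>carrier (fgroup B). g \<otimes>\<^bsub>fgroup B\<^esub> f = \<one>\<^bsub>fgroup B\<^esub>"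
    by (intro bexI[of _ "- f"]) (auto intro: fspace_uminus)
qed (auto intro: fspace_add simp: algebra_simps)

lemma hom_finprod_sum:
  assumes T: "comm_group T" and F: "F \<in> hom T (fgroup B)" and g: "g \<in> A \<rightarrow> carrier T" and A: "finite A"
  shows "F (finprod T g A) = (\<Sum>a\<in>A. F (g a))"
proof -
  interpret T: comm_group T by fact
  interpret F: group_hom T "fgroup B" F
    using T F comm_group.axioms(2)[OF comm_group_fgroup[of B]] by (simp add: group_hom_def group_hom_axioms_def comm_group_def)
  show ?thesis using A g
  proof (induction A rule: finite_induct)
    case empty then show ?case using F.hom_one by simp
  next
    case (insert a A)
    then have "finprod T g (insert a A) = g a \<otimes>\<^bsub>T\<^esub> finprod T g A" by (intro T.finprod_insert) auto
    then show ?case using insert F.hom_mult[of "g a" "finprod T g A"] by (simp add: Pi_iff)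
  qed
qed

lemma finprod_expand:
  assumes T: "comm_group T" and a: "a \<in> hom (fgroup B) T" and B: "finite B" and f: "f \<in> fspace B"
  shows "a f = finprod T (\<lambda>b. a (scl (f b) (dl b))) B"
proof -
  interpret T: comm_group T by fact
  interpret a: group_hom "fgroup B" T a
    using T a comm_group.axioms(2)[OF comm_group_fgroup[of B]] by (simp add: group_hom_def group_hom_axioms_def comm_group_def)
  have ac: "a (scl (f b) (dl b)) \<in> carrier T" if "b \<in> B" for b
    using a.hom_closed[of "scl (f b) (dl b)"] that by (simp add: fspace_scl)
  have "a (\<Sum>b\<in>S. scl (f b) (dl b)) = finprod T (\<lambda>b. a (scl (f b) (dl b))) S" if "finite S" "S \<subseteq> B" for S
    using that
  proof (induction S rule: finite_induct)
    case empty then show ?case using a.hom_one by simp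
  next
    case (insert b S)
    then have "finprod T (\<lambda>b. a (scl (f b) (dl b))) (insert b S) =
      a (scl (f b) (dl b)) \<otimes>\<^bsub>T\<^esub> finprod T (\<lambda>b. a (scl (f b) (dl b))) S"
      using ac by (intro T.finprod_insert) auto
    moreover have "(\<Sum>b\<in>S. scl (f b) (dl b)) \<in> fspace B"
      using insert by (intro fspace_sum fspace_scl fspace_dl) auto
    ultimately show ?case
      using insert a.hom_mult[of "scl (f b) (dl b)" "\<Sum>b\<in>S. scl (f b) (dl b)"] by (simp add: fspace_scl)
  qed
  then have "a (\<Sum>b\<in>B. scl (f b) (dl b)) = finprod T (\<lambda>b. a (scl (f b) (dl b))) B" using B by blast
  then show ?thesis using arg_cong[OF fspace_expand[OF B f], of a] by (rule trans[rotated])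
qed

lemma (in comm_monoid) finprod_Times:
  assumes "finite A" "finite B" "\<And>x y. \<lbrakk>x \<in> A; y \<in> B\<rbrakk> \<Longrightarrow> f x y \<in> carrier G"
  shows "finprod G (\<lambda>x. finprod G (f x) B) A = finprod G (\<lambda>(x, y). f x y) (A \<times> B)"
  using assms(1,3)
proof (induction A rule: finite_induct)
  case empty then show ?case by simp
next
  case (insert a A)
  have "finprod G (\<lambda>x. finprod G (f x) B) (insert a A) =
      finprod G (f a) B \<otimes> finprod G (\<lambda>x. finprod G (f x) B) A"
    using insert by (intro finprod_insert) (auto intro!: finprod_closed)
  also have "finprod G (f a) B = finprod G (\<lambda>(x, y). f x y) ((\<lambda>y. (a, y)) ` B)"
    using insert by (subst finprod_reindex) (auto intro!: inj_onI)
  also have "finprod G (\<lambda>x. finprod G (f x) B) A = finprod G (\<lambda>(x, y). f x y) (A \<times> B)"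
    using insert by auto
  also have "finprod G (\<lambda>(x, y). f x y) ((\<lambda>y. (a, y)) ` B) \<otimes> finprod G (\<lambda>(x, y). f x y) (A \<times> B) =
      finprod G (\<lambda>(x, y). f x y) ((\<lambda>y. (a, y)) ` B \<union> A \<times> B)"
    using insert assms(2) by (intro finprod_Un_disjoint[symmetric]) auto
  also have "(\<lambda>y. (a, y)) ` B \<union> A \<times> B = insert a A \<times> B" by auto
  finally show ?case .
qed

text \<open>The two mutually inverse maps are kept as parameters, because the isomorphism of a
  tensor product with a space of functions and its inverse are written in terms of them.\<close>

definition coordinates :: "('p, 'x) monoid_scheme \<Rightarrow> ('p \<Rightarrow> 'p \<Rightarrow> 'k::field) \<Rightarrow> ('p \<Rightarrow>\<^sub>0 'k, 'm) module \<Rightarrow>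
    'b set \<Rightarrow> ('p \<Rightarrow> ('b \<Rightarrow> 'k) \<Rightarrow> 'b \<Rightarrow> 'k) \<Rightarrow> ('m \<Rightarrow> 'b \<Rightarrow> 'k) \<Rightarrow> (('b \<Rightarrow> 'k) \<Rightarrow> 'm) \<Rightarrow> bool" where
  "coordinates P c M B L \<theta> \<eta> \<longleftrightarrow> left_module (twisted_algebra P c) M \<and> operators P c B L \<and>
     \<theta> \<in> carrier M \<rightarrow> fspace B \<and> \<eta> \<in> fspace B \<rightarrow> carrier M \<and>
     (\<forall>m\<in>carrier M. \<eta> (\<theta> m) = m) \<and> (\<forall>f\<in>fspace B. \<theta> (\<eta> f) = f) \<and>
     (\<forall>m\<in>carrier M. \<forall>m'\<in>carrier M. \<theta> (m \<oplus>\<^bsub>M\<^esub> m') = \<theta> m + \<theta> m') \<and>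
     (\<forall>h\<in>carrier (twisted_algebra P c). \<forall>m\<in>carrier M. \<theta> (h \<odot>\<^bsub>M\<^esub> m) = act L h (\<theta> m))"

lemma coordinates_exist:
  assumes "module_iso (twisted_algebra P c) M (cmod B L)" "left_module (twisted_algebra P c) M"
    and L: "operators P c B L"
  obtains \<theta> \<eta> where "coordinates P c M B L \<theta> \<eta>"
proof -
  have "left_module (twisted_algebra P c) (cmod B L)"
    by (rule left_module_cmod[OF left_module.module_ring[OF assms(2)] L])
  from assms(1,2) this show thesis
  proof (rule module_isoE)
    fix f g
    assume "f \<in> carrier M \<rightarrow> carrier (cmod B L)" "g \<in> carrier (cmod B L) \<rightarrow> carrier M"
      "\<And>m. m \<in> carrier M \<Longrightarrow> g (f m) = m" "\<And>n. n \<in> carrier (cmod B L) \<Longrightarrow> f (g n) = n"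
      "\<And>m m'. \<lbrakk>m \<in> carrier M; m' \<in> carrier M\<rbrakk> \<Longrightarrow> f (m \<oplus>\<^bsub>M\<^esub> m') = f m \<oplus>\<^bsub>cmod B L\<^esub> f m'"
      "\<And>h m. \<lbrakk>h \<in> carrier (twisted_algebra P c); m \<in> carrier M\<rbrakk> \<Longrightarrow> f (h \<odot>\<^bsub>M\<^esub> m) = h \<odot>\<^bsub>cmod B L\<^esub> f m"
    then show thesis using assms(2) L by (intro that[of f g]) (simp add: coordinates_def)
  qed
qed

locale coord =
  fixes P :: "('p, 'x) monoid_scheme" and c :: "'p \<Rightarrow> 'p \<Rightarrow> 'k::field" and M :: "('p \<Rightarrow>\<^sub>0 'k, 'm) module"
    and B :: "'b set" and L \<theta> \<eta>
  assumes co: "coordinates P c M B L \<theta> \<eta>" and P: "monoid P"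
begin

abbreviation "A \<equiv> twisted_algebra P c"

lemma M: "left_module A M" and L: "operators P c B L"
  using co by (auto simp: coordinates_def)

lemma theta [simp]: "m \<in> carrier M \<Longrightarrow> \<theta> m \<in> fspace B"
  "f \<in> fspace B \<Longrightarrow> \<eta> f \<in> carrier M"
  "m \<in> carrier M \<Longrightarrow> \<eta> (\<theta> m) = m" "f \<in> fspace B \<Longrightarrow> \<theta> (\<eta> f) = f"
  "\<lbrakk>m \<in> carrier M; m' \<in> carrier M\<rbrakk> \<Longrightarrow> \<theta> (m \<oplus>\<^bsub>M\<^esub> m') = \<theta> m + \<theta> m'"
  "\<lbrakk>Poly_Mapping.keys h \<subseteq> carrier P; m \<in> carrier M\<rbrakk> \<Longrightarrow> \<theta> (h \<odot>\<^bsub>M\<^esub> m) = act L h (\<theta> m)"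
  using co by (auto simp: coordinates_def twisted_simps)

lemma Mc [simp]: "\<lbrakk>m \<in> carrier M; m' \<in> carrier M\<rbrakk> \<Longrightarrow> m \<oplus>\<^bsub>M\<^esub> m' \<in> carrier M"
  "\<lbrakk>Poly_Mapping.keys h \<subseteq> carrier P; m \<in> carrier M\<rbrakk> \<Longrightarrow> h \<odot>\<^bsub>M\<^esub> m \<in> carrier M"
  using left_module_closed[OF M] by (auto simp: closed_module_def twisted_simps)

lemma theta_inj: "\<lbrakk>m \<in> carrier M; m' \<in> carrier M; \<theta> m = \<theta> m'\<rbrakk> \<Longrightarrow> m = m'"
  by (metis theta(3))

lemma Lp: "finite B" "p \<in> carrier P \<Longrightarrow> lin (L p)" "\<lbrakk>p \<in> carrier P; f \<in> fspace B\<rbrakk> \<Longrightarrow> L p f \<in> fspace B"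
  using L by (auto simp: operators_def)

lemma keys_scalar: "Poly_Mapping.keys (scalar P (\<alpha>::'k)) \<subseteq> carrier P"
  using monoid.one_closed[OF P] by (simp add: scalar_def)

lemma keys_single': "p \<in> carrier P \<Longrightarrow> Poly_Mapping.keys (Poly_Mapping.single p \<alpha>) \<subseteq> carrier P"
  by simp

lemma scalar_theta [simp]: "m \<in> carrier M \<Longrightarrow> \<theta> (scalar P \<alpha> \<odot>\<^bsub>M\<^esub> m) = scl \<alpha> (\<theta> m)"
  using keys_scalar scalar_act[OF L] by simp

lemma scalar_closed [simp]: "m \<in> carrier M \<Longrightarrow> scalar P \<alpha> \<odot>\<^bsub>M\<^esub> m \<in> carrier M"
  using keys_scalar by simp

lemma eta_add: "\<lbrakk>f \<in> fspace B; g \<in> fspace B\<rbrakk> \<Longrightarrow> \<eta> (f + g) = \<eta> f \<oplus>\<^bsub>M\<^esub> \<eta> g"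
  by (rule theta_inj) (simp_all add: fspace_add)

lemma eta_scl: "f \<in> fspace B \<Longrightarrow> \<eta> (scl \<alpha> f) = scalar P \<alpha> \<odot>\<^bsub>M\<^esub> \<eta> f"
  by (rule theta_inj) (simp_all add: fspace_scl)

end

section \<open>The tensor product of two modules with coordinates\<close>

locale coord_pair = M: coord P c M B1 L1 \<theta>1 \<eta>1 + N: coord P c N B2 L2 \<theta>2 \<eta>2
  for P :: "('p, 'x) monoid_scheme" and c :: "'p \<Rightarrow> 'p \<Rightarrow> 'k::field" and M :: "('p \<Rightarrow>\<^sub>0 'k, 'm) module"
    and B1 :: "'b set" and L1 \<theta>1 \<eta>1 and N :: "('p \<Rightarrow>\<^sub>0 'k, 'n) module" and B2 :: "'c set" and L2 \<theta>2 \<eta>2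
begin

sublocale tensor_pair "UNIV :: 'k set" M "\<lambda>m \<alpha>. scalar P \<alpha> \<odot>\<^bsub>M\<^esub> m" N "\<lambda>\<alpha> n. scalar P \<alpha> \<odot>\<^bsub>N\<^esub> n"
  using left_module.module_group[OF M.M] left_module.module_group[OF N.M]
  by (simp add: tensor_pair_def)

abbreviation "V \<equiv> fgroup (B1 \<times> B2)"

lemma ex_F: "\<exists>F. F \<in> hom T V \<and> (\<forall>m\<in>carrier M. \<forall>n\<in>carrier N. F (pt m n) = tens (\<theta>1 m) (\<theta>2 n))"
  by (rule tensor_lift[OF comm_group_fgroup[of "B1 \<times> B2"], of "\<lambda>m n. tens (\<theta>1 m) (\<theta>2 n)"])
    (auto simp: tens_closed tens_add tens_scl)

definition F where "F = (SOME F. F \<in> hom T V \<and> (\<forall>m\<in>carrier M. \<forall>n\<in>carrier N. F (pt m n) = tens (\<theta>1 m) (\<theta>2 n)))"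

lemma F_hom: "F \<in> hom T V" and F_pt: "\<lbrakk>m \<in> carrier M; n \<in> carrier N\<rbrakk> \<Longrightarrow> F (pt m n) = tens (\<theta>1 m) (\<theta>2 n)"
  using someI_ex[OF ex_F] unfolding F_def by blast+

lemma F_closed: "C \<in> carrier T \<Longrightarrow> F C \<in> fspace (B1 \<times> B2)"
  using F_hom by (auto simp: hom_def)

lemma F_mult: "\<lbrakk>C \<in> carrier T; D \<in> carrier T\<rbrakk> \<Longrightarrow> F (C \<otimes>\<^bsub>T\<^esub> D) = F C + F D"
  using F_hom by (auto simp: hom_def)

text \<open>One summand of the inverse of \<open>F\<close>: a basis tensor with its coefficient. The
  tensor group \<open>T\<close> is only an abelian group, so the coefficient is put into the left
  factor.\<close>

definition E where "E \<phi> = (\<lambda>(x, y). pt (\<eta>1 (scl (\<phi> (x, y)) (dl x))) (\<eta>2 (dl y)))"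

definition Gm where "Gm \<phi> = finprod T (E \<phi>) (B1 \<times> B2)"

lemma E_closed: "E \<phi> \<in> B1 \<times> B2 \<rightarrow> carrier T"
  by (auto simp: E_def fspace_scl intro!: pt_closed)

lemma Gm_hom: "Gm \<in> hom V T"
proof (rule homI)
  fix \<phi> \<psi>
  have "E (\<phi> + \<psi>) p = E \<phi> p \<otimes>\<^bsub>T\<^esub> E \<psi> p" if "p \<in> B1 \<times> B2" for p
    using that by (cases p) (simp add: E_def fapply scl_add M.eta_add fspace_scl pt_add_left)
  then have "finprod T (E (\<phi> + \<psi>)) (B1 \<times> B2) = finprod T (\<lambda>p. E \<phi> p \<otimes>\<^bsub>T\<^esub> E \<psi> p) (B1 \<times> B2)"
    using E_closed by (intro T.finprod_cong' Pi_I T.m_closed) (auto intro!: funcset_mem[OF E_closed])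
  also have "\<dots> = Gm \<phi> \<otimes>\<^bsub>T\<^esub> Gm \<psi>" unfolding Gm_def by (rule T.finprod_multf[OF E_closed E_closed])
  finally show "Gm (\<phi> \<otimes>\<^bsub>V\<^esub> \<psi>) = Gm \<phi> \<otimes>\<^bsub>T\<^esub> Gm \<psi>" by (simp add: Gm_def)
  show "Gm \<phi> \<in> carrier T" unfolding Gm_def by (rule T.finprod_closed[OF E_closed])
qed

text \<open>Both vectors are expanded in their bases. Balancedness then moves the coefficient of the
  right vector into the left factor, where \<open>E\<close> expects the product of the two.\<close>

lemma Gm_tens:
  assumes m: "m \<in> carrier M" and n: "n \<in> carrier N"
  shows "Gm (tens (\<theta>1 m) (\<theta>2 n)) = pt m n"
proof -
  define f g where "f = \<theta>1 m" and "g = \<theta>2 n"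
  have f: "f \<in> fspace B1" "\<eta>1 f = m" and g: "g \<in> fspace B2" "\<eta>2 g = n" using m n by (simp_all add: f_def g_def)
  have 1: "(\<lambda>f. pt (\<eta>1 f) n) \<in> hom (fgroup B1) T"
    by (rule homI) (auto simp: n pt_closed M.eta_add pt_add_left)
  have 2: "(\<lambda>g. pt m' (\<eta>2 g)) \<in> hom (fgroup B2) T" if "m' \<in> carrier M" for m'
    by (rule homI) (auto simp: that pt_closed N.eta_add pt_add_right)
  have "pt m n = finprod T (\<lambda>x. pt (\<eta>1 (scl (f x) (dl x))) n) B1"
    using finprod_expand[OF T_group 1 M.Lp(1) f(1)] f(2) by simp
  also have "\<dots> = finprod T (\<lambda>x. finprod T (\<lambda>y. pt (\<eta>1 (scl (f x) (dl x))) (\<eta>2 (scl (g y) (dl y)))) B2) B1"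
  proof (rule T.finprod_cong')
    fix x assume "x \<in> B1"
    then have "\<eta>1 (scl (f x) (dl x)) \<in> carrier M" by (simp add: fspace_scl)
    then show "pt (\<eta>1 (scl (f x) (dl x))) n = finprod T (\<lambda>y. pt (\<eta>1 (scl (f x) (dl x))) (\<eta>2 (scl (g y) (dl y)))) B2"
      using finprod_expand[OF T_group 2 N.Lp(1) g(1)] g(2) by simp
  qed (auto intro!: T.finprod_closed pt_closed simp: fspace_scl)
  also have "\<dots> = finprod T (\<lambda>(x, y). pt (\<eta>1 (scl (f x) (dl x))) (\<eta>2 (scl (g y) (dl y)))) (B1 \<times> B2)"
    by (rule T.finprod_Times) (auto intro!: pt_closed simp: fspace_scl M.Lp N.Lp)
  also have "\<dots> = Gm (tens f g)" unfolding Gm_def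
  proof (rule T.finprod_cong'[OF refl E_closed])
    fix p assume "p \<in> B1 \<times> B2"
    then obtain x y where p: "p = (x, y)" "x \<in> B1" "y \<in> B2" by auto
    have "pt (\<eta>1 (scl (f x) (dl x))) (\<eta>2 (scl (g y) (dl y))) = pt (\<eta>1 (scl (g y) (scl (f x) (dl x)))) (\<eta>2 (dl y))"
      using p by (subst N.eta_scl, simp, subst M.eta_scl[of "scl (f x) (dl x)"], simp add: fspace_scl)
        (rule pt_balanced[symmetric], simp_all add: fspace_scl)
    then show "(case p of (x, y) \<Rightarrow> pt (\<eta>1 (scl (f x) (dl x))) (\<eta>2 (scl (g y) (dl y)))) = E (tens f g) p"
      by (simp add: p E_def tens_def mult.commute)
  qed
  finally show ?thesis by (simp add: f_def g_def)
qed

lemma Gm_F: "C \<in> carrier T \<Longrightarrow> Gm (F C) = C"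
proof (rule hom_eqI[OF T_group, where g = "\<lambda>C. C"])
  show "(\<lambda>C. Gm (F C)) \<in> hom T T" using hom_compose[OF F_hom Gm_hom] by (simp add: comp_def)
  show "(\<lambda>C. C) \<in> hom T T" by (simp add: hom_def)
qed (simp_all add: F_pt Gm_tens)

lemma F_Gm:
  assumes "\<phi> \<in> fspace (B1 \<times> B2)"
  shows "F (Gm \<phi>) = \<phi>"
proof -
  have fin: "finite (B1 \<times> B2)" using M.Lp N.Lp by simp
  have "F (Gm \<phi>) = (\<Sum>p\<in>B1 \<times> B2. F (E \<phi> p))"
    unfolding Gm_def by (rule hom_finprod_sum[OF T_group F_hom E_closed fin])
  also have "\<dots> = (\<Sum>p\<in>B1 \<times> B2. scl (\<phi> p) (dl p))"
    by (rule sum.cong[OF refl]) (auto simp: E_def F_pt fspace_scl tens_scl tens_dl)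
  also have "\<dots> = \<phi>" by (rule fspace_expand[OF fin assms, symmetric])
  finally show ?thesis .
qed

lemma F_bij: "bij_betw F (carrier T) (fspace (B1 \<times> B2))"
  by (rule bij_betw_byWitness[where f' = Gm])
    (use Gm_hom in \<open>auto simp: Gm_F F_Gm F_closed hom_def\<close>)

lemma
  fixes \<alpha> :: 'k
  assumes b: "b \<in> carrier P" "b' \<in> carrier P"
  defines "tm \<equiv> tensor_map (UNIV :: 'k set) M (\<lambda>m \<alpha>. scalar P \<alpha> \<odot>\<^bsub>M\<^esub> m) N (\<lambda>\<alpha> n. scalar P \<alpha> \<odot>\<^bsub>N\<^esub> n)
    (\<lambda>m. Poly_Mapping.single b \<alpha> \<odot>\<^bsub>M\<^esub> m) (\<lambda>n. Poly_Mapping.single b' 1 \<odot>\<^bsub>N\<^esub> n)"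
  shows tm_hom: "tm \<in> hom T T"
    and F_tm: "C \<in> carrier T \<Longrightarrow> F (tm C) = scl \<alpha> (kron (L1 b) (L2 b') (F C))"
proof -
  note ks = M.keys_single'[OF b(1)] M.keys_single'[OF b(2)]
  note ll = M.Lp(2)[OF b(1)] N.Lp(2)[OF b(2)]
  have f: "Poly_Mapping.single b \<alpha> \<odot>\<^bsub>M\<^esub> (m \<oplus>\<^bsub>M\<^esub> m') = Poly_Mapping.single b \<alpha> \<odot>\<^bsub>M\<^esub> m \<oplus>\<^bsub>M\<^esub> Poly_Mapping.single b \<alpha> \<odot>\<^bsub>M\<^esub> m'"
    if "m \<in> carrier M" "m' \<in> carrier M" for m m'
    by (rule M.theta_inj) (use that ks b ll in \<open>simp_all add: lin_add scl_add\<close>)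
  have f': "Poly_Mapping.single b \<alpha> \<odot>\<^bsub>M\<^esub> (scalar P s \<odot>\<^bsub>M\<^esub> m) = scalar P s \<odot>\<^bsub>M\<^esub> (Poly_Mapping.single b \<alpha> \<odot>\<^bsub>M\<^esub> m)"
    if "m \<in> carrier M" for m s
    by (rule M.theta_inj) (use that ks b ll in \<open>simp_all add: lin_scl mult.commute\<close>)
  have g: "Poly_Mapping.single b' 1 \<odot>\<^bsub>N\<^esub> (m \<oplus>\<^bsub>N\<^esub> m') = Poly_Mapping.single b' 1 \<odot>\<^bsub>N\<^esub> m \<oplus>\<^bsub>N\<^esub> Poly_Mapping.single b' 1 \<odot>\<^bsub>N\<^esub> m'"
    if "m \<in> carrier N" "m' \<in> carrier N" for m m'
    by (rule N.theta_inj) (use that ks b ll in \<open>simp_all add: lin_add scl_add\<close>)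
  have g': "Poly_Mapping.single b' 1 \<odot>\<^bsub>N\<^esub> (scalar P s \<odot>\<^bsub>N\<^esub> m) = scalar P s \<odot>\<^bsub>N\<^esub> (Poly_Mapping.single b' 1 \<odot>\<^bsub>N\<^esub> m)"
    if "m \<in> carrier N" for m s
    by (rule N.theta_inj) (use that ks b ll in \<open>simp_all add: lin_scl mult.commute\<close>)
  show tm: "tm \<in> hom T T" unfolding tm_def
    by (rule tensor_map_hom) (use b f f' g g' in auto)
  have tmp: "tm (pt m n) = pt (Poly_Mapping.single b \<alpha> \<odot>\<^bsub>M\<^esub> m) (Poly_Mapping.single b' 1 \<odot>\<^bsub>N\<^esub> n)"
    if "m \<in> carrier M" "n \<in> carrier N" for m n
    unfolding tm_def by (rule tensor_map_pure) (use b f f' g g' that in auto)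
  have lk: "lin (kron (L1 b) (L2 b'))" by (rule lin_kron[OF ll])
  have kc: "kron (L1 b) (L2 b') \<phi> \<in> fspace (B1 \<times> B2)" if "\<phi> \<in> fspace (B1 \<times> B2)" for \<phi>
    by (rule kron_closed[OF ll _ _ that]) (use b M.Lp N.Lp in auto)
  show "F (tm C) = scl \<alpha> (kron (L1 b) (L2 b') (F C))" if "C \<in> carrier T"
  proof (rule hom_eqI[OF comm_group_fgroup[of "B1 \<times> B2"] _ _ _ that])
    show "(\<lambda>C. F (tm C)) \<in> hom T V" using hom_compose[OF tm F_hom] by (simp add: comp_def)
    show "(\<lambda>C. scl \<alpha> (kron (L1 b) (L2 b') (F C))) \<in> hom T V"
      by (rule homI) (auto simp: F_mult lin_add[OF lk] scl_add fspace_scl kc F_closed)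
    show "F (tm (pt m n)) = scl \<alpha> (kron (L1 b) (L2 b') (F (pt m n)))"
      if "m \<in> carrier M" "n \<in> carrier N" for m n
      using that b by (simp add: tmp F_pt kron_tens[OF ll] tens_scl)
  qed
qed

lemma tensor_module_simps:
  "carrier (tensor_module P \<Delta> M N) = carrier T" "C \<oplus>\<^bsub>tensor_module P \<Delta> M N\<^esub> D = C \<otimes>\<^bsub>T\<^esub> D"
  by (simp_all add: tensor_module_def Let_def)

lemma
  assumes \<Delta>: "Poly_Mapping.keys (\<Delta> h) \<subseteq> carrier P \<times> carrier P" and C: "C \<in> carrier T"
  shows tensor_smult_closed: "h \<odot>\<^bsub>tensor_module P \<Delta> M N\<^esub> C \<in> carrier T"
    and F_smult: "F (h \<odot>\<^bsub>tensor_module P \<Delta> M N\<^esub> C) = act (\<lambda>(b, b'). kron (L1 b) (L2 b')) (\<Delta> h) (F C)"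
proof -
  let ?tm = "\<lambda>(b, b'). tensor_map (UNIV :: 'k set) M (\<lambda>m \<alpha>. scalar P \<alpha> \<odot>\<^bsub>M\<^esub> m) N (\<lambda>\<alpha> n. scalar P \<alpha> \<odot>\<^bsub>N\<^esub> n)
    (\<lambda>m. Poly_Mapping.single b (Poly_Mapping.lookup (\<Delta> h) (b, b')) \<odot>\<^bsub>M\<^esub> m) (\<lambda>n. Poly_Mapping.single b' 1 \<odot>\<^bsub>N\<^esub> n) C"
  have e: "h \<odot>\<^bsub>tensor_module P \<Delta> M N\<^esub> C = finprod T ?tm (Poly_Mapping.keys (\<Delta> h))"
    by (simp add: tensor_module_def Let_def)
  have tmc: "?tm \<in> Poly_Mapping.keys (\<Delta> h) \<rightarrow> carrier T"
  proof (rule Pi_I)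
    fix p assume "p \<in> Poly_Mapping.keys (\<Delta> h)"
    then obtain b b' where p: "p = (b, b')" "b \<in> carrier P" "b' \<in> carrier P" using \<Delta> by auto
    show "?tm p \<in> carrier T" using hom_in_carrier[OF tm_hom[OF p(2,3)] C] p(1) by simp
  qed
  show "h \<odot>\<^bsub>tensor_module P \<Delta> M N\<^esub> C \<in> carrier T" unfolding e by (rule T.finprod_closed[OF tmc])
  have "F (finprod T ?tm (Poly_Mapping.keys (\<Delta> h))) = (\<Sum>p\<in>Poly_Mapping.keys (\<Delta> h). F (?tm p))"
    by (rule hom_finprod_sum[OF T_group F_hom tmc]) simp
  also have "\<dots> = act (\<lambda>(b, b'). kron (L1 b) (L2 b')) (\<Delta> h) (F C)"
    unfolding act_def using \<Delta> C by (intro sum.cong refl) (auto simp: F_tm)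
  finally show "F (h \<odot>\<^bsub>tensor_module P \<Delta> M N\<^esub> C) = act (\<lambda>(b, b'). kron (L1 b) (L2 b')) (\<Delta> h) (F C)"
    by (simp add: e)
qed

text \<open>The comultiplication enters only through the action of \<open>\<Delta> h\<close> by
  Kronecker products. For \<open>kG\<close> and for \<open>H\<close> it therefore remains to
  identify this action with a family \<open>L\<close> on the basis of the algebra itself.\<close>

lemma tensor_module_iso:
  assumes \<Delta>: "\<And>h. Poly_Mapping.keys h \<subseteq> carrier P \<Longrightarrow> Poly_Mapping.keys (\<Delta> h) \<subseteq> carrier P \<times> carrier P"
    and L: "\<And>h \<phi>. \<lbrakk>Poly_Mapping.keys h \<subseteq> carrier P; \<phi> \<in> fspace (B1 \<times> B2)\<rbrakk> \<Longrightarrow>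
      act (\<lambda>(b, b'). kron (L1 b) (L2 b')) (\<Delta> h) \<phi> = act L h \<phi>"
  shows "module_iso (twisted_algebra P c) (tensor_module P \<Delta> M N) (cmod (B1 \<times> B2) L)"
    and "closed_module (twisted_algebra P c) (tensor_module P \<Delta> M N)"
proof -
  show "module_iso (twisted_algebra P c) (tensor_module P \<Delta> M N) (cmod (B1 \<times> B2) L)"
    by (rule module_isoI[where f = F])
      (use F_bij F_closed \<Delta> L in \<open>auto simp: tensor_module_simps F_mult F_smult twisted_simps\<close>)
  show "closed_module (twisted_algebra P c) (tensor_module P \<Delta> M N)"
    using \<Delta> by (auto simp: closed_module_def tensor_module_simps twisted_simps tensor_smult_closed)
qed

end

section \<open>Coordinates of tensor products over \<open>kG\<close> and \<open>H\<close>\<close>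

text \<open>The operators of a representation obey the group laws on \<open>fspace\<close> only.
  With this rule the operator of the unit element can be replaced by the identity inside a Kronecker
  product.\<close>

lemma kron_cong:
  assumes "\<And>f. f \<in> fspace B \<Longrightarrow> L f = K f" "\<And>g. g \<in> fspace C \<Longrightarrow> L' g = K' g" "lin L'"
    and \<phi>: "\<phi> \<in> fspace (B \<times> C)"
  shows "kron L L' \<phi> = kron K K' \<phi>"
proof (rule ext, clarify)
  fix x' y'
  have "(\<lambda>x. L' (\<lambda>y. \<phi> (x, y)) y') \<in> fspace B"
    using slice_out[OF \<phi>] assms(3) by (auto simp: fspace_def fapply)
  moreover have "L' (\<lambda>y. \<phi> (x, y)) = K' (\<lambda>y. \<phi> (x, y))" for x
    by (rule assms(2)[OF slice_right[OF \<phi>]])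
  ultimately show "kron L L' \<phi> (x', y') = kron K K' \<phi> (x', y')"
    using assms(1) by (simp add: kron_def)
qed

lemma group_comult_keys:
  "Poly_Mapping.keys h \<subseteq> A \<Longrightarrow> Poly_Mapping.keys (group_comult h) \<subseteq> A \<times> A"
  unfolding group_comult_def by (rule order_trans[OF keys_sum]) auto

lemma group_comult_act:
  "act (\<lambda>(b, b'). kron (L b) (L' b')) (group_comult h) \<phi> = act (\<lambda>g. kron (L g) (L' g)) h \<phi>"
  unfolding group_comult_def act_sum by (simp add: act_def[of "\<lambda>g. kron (L g) (L' g)"])

abbreviation grep :: "('g, 'x) monoid_scheme \<Rightarrow> 'b set \<Rightarrow> ('g \<Rightarrow> ('b \<Rightarrow> 'k::field) \<Rightarrow> 'b \<Rightarrow> 'k) \<Rightarrow> bool" where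
  "grep G \<equiv> operators G (\<lambda>_ _. 1)"

lemma grep_kron:
  assumes "group G" "grep G B \<rho>" "grep G C \<sigma>"
  shows "grep G (B \<times> C) (\<lambda>g. kron (\<rho> g) (\<sigma> g))"
proof -
  interpret group G by fact
  show ?thesis
    using operators_kron[OF assms(2,3) is_monoid is_monoid]
    by (auto simp: operators_def DirProd_def split_beta)
qed

lemma group_tensor_iso:
  assumes G: "group G" and M: "coordinates G (\<lambda>_ _. 1) M B \<rho> \<theta> \<eta>" and N: "coordinates G (\<lambda>_ _. 1) N C \<sigma> \<theta>' \<eta>'"
  shows "module_iso (group_algebra G) (group_tensor G M N) (cmod (B \<times> C) (\<lambda>g. kron (\<rho> g) (\<sigma> g)))"
    and "closed_module (group_algebra G) (group_tensor G M N)"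
proof -
  interpret coord_pair G "\<lambda>_ _. 1" M B \<rho> \<theta> \<eta> N C \<sigma> \<theta>' \<eta>'
    using M N group.is_monoid[OF G] by (simp add: coord_pair_def coord_def)
  show "module_iso (group_algebra G) (group_tensor G M N) (cmod (B \<times> C) (\<lambda>g. kron (\<rho> g) (\<sigma> g)))"
    unfolding group_tensor_def
    by (rule tensor_module_iso(1)) (simp_all only: group_comult_keys group_comult_act)
  show "closed_module (group_algebra G) (group_tensor G M N)"
    unfolding group_tensor_def
    by (rule tensor_module_iso(2)[where L = "\<lambda>g. kron (\<rho> g) (\<sigma> g)"])
      (simp_all only: group_comult_keys group_comult_act)
qed

section \<open>Representations of \<open>H\<close>: one of \<open>G\<close> together with one
  operator for \<open>x\<close>\<close>

definition hact :: "('g \<Rightarrow> ('b \<Rightarrow> 'k::field) \<Rightarrow> 'b \<Rightarrow> 'k) \<Rightarrow> (('b \<Rightarrow> 'k) \<Rightarrow> 'b \<Rightarrow> 'k) \<Rightarrow>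
    'g \<times> nat \<Rightarrow> ('b \<Rightarrow> 'k) \<Rightarrow> 'b \<Rightarrow> 'k" where
  "hact \<rho> xx = (\<lambda>(g, i) f. \<rho> g ((xx ^^ i) f))"

abbreviation hops :: "('g, 'x) monoid_scheme \<Rightarrow> ('g \<Rightarrow> 'k::field) \<Rightarrow> 'b set \<Rightarrow>
    ('g \<times> nat \<Rightarrow> ('b \<Rightarrow> 'k) \<Rightarrow> 'b \<Rightarrow> 'k) \<Rightarrow> bool" where
  "hops G \<chi> \<equiv> operators (ore_basis G) (ore_twist \<chi>)"

definition hrep :: "('g, 'x) monoid_scheme \<Rightarrow> ('g \<Rightarrow> 'k::field) \<Rightarrow> 'b set \<Rightarrow>
    ('g \<Rightarrow> ('b \<Rightarrow> 'k) \<Rightarrow> 'b \<Rightarrow> 'k) \<Rightarrow> (('b \<Rightarrow> 'k) \<Rightarrow> 'b \<Rightarrow> 'k) \<Rightarrow> bool" where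
  "hrep G \<chi> B \<rho> xx \<longleftrightarrow> grep G B \<rho> \<and> lin xx \<and> (\<forall>f\<in>fspace B. xx f \<in> fspace B) \<and>
     (\<forall>g\<in>carrier G. \<forall>f\<in>fspace B. xx (\<rho> g f) = scl (inverse (\<chi> g)) (\<rho> g (xx f)))"

lemma ore_basis_simps [simp]:
  "carrier (ore_basis G) = carrier G \<times> UNIV" "\<one>\<^bsub>ore_basis G\<^esub> = (\<one>\<^bsub>G\<^esub>, 0)"
  "(g, i) \<otimes>\<^bsub>ore_basis G\<^esub> (h, j) = (g \<otimes>\<^bsub>G\<^esub> h, i + j)"
  by (simp_all add: ore_basis_def DirProd_def)

lemma ore_twist_apply [simp]: "ore_twist \<chi> (g, i) (h, j) = inverse (\<chi> h) ^ i"
  by (simp add: ore_twist_def)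

lemma funpow_closed: "(\<And>f. f \<in> S \<Longrightarrow> xx f \<in> S) \<Longrightarrow> f \<in> S \<Longrightarrow> (xx ^^ i) f \<in> S"
  by (induction i) auto

text \<open>Iterating the relation between \<open>x\<close> and \<open>g\<close> yields the factor
  \<open>inverse (\<chi> g) ^ i\<close> for \<open>x ^ i\<close>, which is the value of
  \<open>ore_twist\<close>.\<close>

lemma hops_hact:
  fixes \<rho> :: "'g \<Rightarrow> ('b \<Rightarrow> 'k::field) \<Rightarrow> 'b \<Rightarrow> 'k"
  assumes "hrep G \<chi> B \<rho> xx"
  shows "hops G \<chi> B (hact \<rho> xx)"
proof -
  note h = assms[unfolded hrep_def operators_def]
  have xx: "lin xx" "\<And>f. f \<in> fspace B \<Longrightarrow> xx f \<in> fspace B" using h by auto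
  have \<rho>: "lin (\<rho> g)" "\<And>f. f \<in> fspace B \<Longrightarrow> \<rho> g f \<in> fspace B" if "g \<in> carrier G" for g using h that by auto
  have Xi: "(xx ^^ i) f \<in> fspace B" if "f \<in> fspace B" for f i using funpow_closed[of "fspace B" xx f i] xx that by blast
  have c: "(xx ^^ i) (\<rho> g f) = scl (inverse (\<chi> g) ^ i) (\<rho> g ((xx ^^ i) f))"
    if "g \<in> carrier G" "f \<in> fspace B" for g f i
  proof (induction i)
    case 0 then show ?case by simp
  next
    case (Suc i)
    then show ?case using h that Xi[OF that(2)] xx by (simp add: lin_scl mult.commute)
  qed
  show ?thesis
    unfolding operators_def
  proof (intro conjI ballI)
    show "finite B" using h by auto
  next
    fix p assume "p \<in> carrier (ore_basis G)"
    then show "lin (hact \<rho> xx p)"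
      by (cases p) (auto simp: hact_def intro!: lin_comp[OF \<rho>(1) lin_pow[OF xx(1)]])
  next
    fix p and f :: "'b \<Rightarrow> 'k" assume "p \<in> carrier (ore_basis G)" "f \<in> fspace B"
    then show "hact \<rho> xx p f \<in> fspace B" using \<rho> Xi by (cases p) (auto simp: hact_def)
  next
    fix f :: "'b \<Rightarrow> 'k" assume "f \<in> fspace B"
    then show "hact \<rho> xx \<one>\<^bsub>ore_basis G\<^esub> f = f" using h by (simp add: hact_def)
  next
    fix p p' and f :: "'b \<Rightarrow> 'k" assume "p \<in> carrier (ore_basis G)" "p' \<in> carrier (ore_basis G)" and f: "f \<in> fspace B"
    then obtain g i g' i' where p: "p = (g, i)" "p' = (g', i')" "g \<in> carrier G" "g' \<in> carrier G" by auto
    show "hact \<rho> xx p (hact \<rho> xx p' f) = scl (ore_twist \<chi> p p') (hact \<rho> xx (p \<otimes>\<^bsub>ore_basis G\<^esub> p') f)"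
      using p f \<rho> Xi h c by (simp add: hact_def funpow_add lin_scl)
  qed
qed

lemma ring_twisted_square:
  assumes P: "monoid P"
    and unit: "\<And>b. b \<in> carrier P \<Longrightarrow> c \<one>\<^bsub>P\<^esub> b = 1 \<and> c b \<one>\<^bsub>P\<^esub> = (1::'k::field)"
    and cocycle: "\<And>b b' b''. \<lbrakk>b \<in> carrier P; b' \<in> carrier P; b'' \<in> carrier P\<rbrakk> \<Longrightarrow>
      c b b' * c (b \<otimes>\<^bsub>P\<^esub> b') b'' = c b' b'' * c b (b' \<otimes>\<^bsub>P\<^esub> b'')"
  shows "ring (twisted_square P c)"
  unfolding twisted_square_def
proof (rule ring_twisted_algebra[OF DirProd_monoid[OF P P]])
  fix x y z assume "x \<in> carrier (P \<times>\<times> P)" "y \<in> carrier (P \<times>\<times> P)" "z \<in> carrier (P \<times>\<times> P)"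
  then obtain b b' d d' e e' where x: "x = (b, b')" "y = (d, d')" "z = (e, e')"
    "b \<in> carrier P" "b' \<in> carrier P" "d \<in> carrier P" "d' \<in> carrier P" "e \<in> carrier P" "e' \<in> carrier P"
    by (auto simp: DirProd_def)
  have "(c b d * c (b \<otimes>\<^bsub>P\<^esub> d) e) * (c b' d' * c (b' \<otimes>\<^bsub>P\<^esub> d') e') =
    (c d e * c b (d \<otimes>\<^bsub>P\<^esub> e)) * (c d' e' * c b' (d' \<otimes>\<^bsub>P\<^esub> e'))"
    using x by (simp add: cocycle)
  then show "(case x of (b, b') \<Rightarrow> \<lambda>(d, d'). c b d * c b' d') y *
      (case x \<otimes>\<^bsub>P \<times>\<times> P\<^esub> y of (b, b') \<Rightarrow> \<lambda>(d, d'). c b d * c b' d') z =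
      (case y of (b, b') \<Rightarrow> \<lambda>(d, d'). c b d * c b' d') z *
      (case x of (b, b') \<Rightarrow> \<lambda>(d, d'). c b d * c b' d') (y \<otimes>\<^bsub>P \<times>\<times> P\<^esub> z)"
    by (simp add: x DirProd_def ac_simps)
qed (auto simp: DirProd_def unit)

lemma monoid_ore_basis: "group G \<Longrightarrow> monoid (ore_basis G)"
  unfolding ore_basis_def by (rule DirProd_monoid[OF group.is_monoid]) (auto intro: monoidI)

lemma ring_ore_square:
  assumes "group G" and "\<chi> \<in> carrier (character_group G)"
  shows "ring (twisted_square (ore_basis G) (ore_twist \<chi>))"
proof -
  interpret group G by fact
  show ?thesis
    by (rule ring_twisted_square[OF monoid_ore_basis[OF assms(1)]])
      (auto simp: character_mult[OF assms(2)] character_one[OF assms] power_add power_mult_distrib algebra_simps)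
qed

text \<open>The action of the twisted square is multiplicative and \<open>\<Delta> (g x^i)\<close>
  is by definition a product. Hence it acts as \<open>g \<otimes> g\<close> after the
  \<open>i\<close>-th iterate of the operator of \<open>\<Delta> x\<close>, and this operator is
  \<open>x \<otimes> a + 1 \<otimes> x\<close>.\<close>

lemma
  fixes G :: "('g, 'x) monoid_scheme" and \<chi> :: "'g \<Rightarrow> 'k::field"
  assumes G: "group G" and \<chi>: "\<chi> \<in> carrier (character_group G)" and a: "a \<in> carrier G"
    and B: "hrep G \<chi> B \<rho> xx" and C: "hrep G \<chi> C \<sigma> Y"
    and h: "Poly_Mapping.keys h \<subseteq> carrier (ore_basis G)"
  shows ore_comult_keys: "Poly_Mapping.keys (ore_comult G \<chi> a h) \<subseteq> carrier (ore_basis G) \<times> carrier (ore_basis G)"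
    and ore_comult_act: "\<phi> \<in> fspace (B \<times> C) \<Longrightarrow>
      act (\<lambda>(b, b'). kron (hact \<rho> xx b) (hact \<sigma> Y b')) (ore_comult G \<chi> a h) \<phi> =
      act (hact (\<lambda>g. kron (\<rho> g) (\<sigma> g)) (\<lambda>\<phi>. kron xx (\<sigma> a) \<phi> + kron (\<lambda>f. f) Y \<phi>)) h \<phi>"
proof -
  interpret G: group G by fact
  let ?P = "ore_basis G \<times>\<times> ore_basis G"
  let ?c = "\<lambda>(b, b') (d, d'). ore_twist \<chi> b d * ore_twist \<chi> b' d'"
  let ?HH = "twisted_square (ore_basis G) (ore_twist \<chi>)"
  let ?K = "\<lambda>(b, b'). kron (hact \<rho> xx b) (hact \<sigma> Y b')"
  let ?xx = "\<lambda>\<phi>. kron xx (\<sigma> a) \<phi> + kron (\<lambda>f. f) Y \<phi>"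
  let ?d = "ore_comult_x G a :: ('g \<times> nat) \<times> ('g \<times> nat) \<Rightarrow>\<^sub>0 'k"
  interpret HH: ring ?HH by (rule ring_ore_square[OF G \<chi>])
  have HHe: "?HH = twisted_algebra ?P ?c" by (simp add: twisted_square_def)
  have HHc: "D \<in> carrier ?HH \<longleftrightarrow> Poly_Mapping.keys D \<subseteq> carrier ?P" for D
    by (simp add: HHe twisted_simps)
  have Pc: "carrier ?P = carrier (ore_basis G) \<times> carrier (ore_basis G)" by (simp add: DirProd_def)
  note b = B[unfolded hrep_def operators_def] and c = C[unfolded hrep_def operators_def]
  have ops: "operators ?P ?c (B \<times> C) ?K"
    by (rule operators_kron[OF hops_hact[OF B] hops_hact[OF C]]) (rule monoid_ore_basis[OF G])+
  have dc: "?d \<in> carrier ?HH"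
    unfolding HHc ore_comult_x_def by (rule order_trans[OF keys_add]) (auto simp: Pc a)
  have dic: "?d [^]\<^bsub>?HH\<^esub> (i::nat) \<in> carrier ?HH" for i by (rule HH.nat_pow_closed[OF dc])
  have sc: "Poly_Mapping.single ((g, 0), (g, 0)) \<alpha> \<in> carrier ?HH" if "g \<in> carrier G" for g \<alpha>
    using that by (simp add: HHc Pc)
  have actm: "act ?K (D \<otimes>\<^bsub>?HH\<^esub> D') \<phi> = act ?K D (act ?K D' \<phi>)"
    if "D \<in> carrier ?HH" "D' \<in> carrier ?HH" "\<phi> \<in> fspace (B \<times> C)" for D D' \<phi>
    using act_mult[OF ops that(3) that(1)[unfolded HHc] that(2)[unfolded HHc]] by (simp only: HHe)
  have lC: "lin (hact \<sigma> Y p)" if "p \<in> carrier (ore_basis G)" for p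
    using hops_hact[OF C] that unfolding operators_def by blast
  have d1: "act ?K ?d \<phi> = ?xx \<phi>" if \<phi>: "\<phi> \<in> fspace (B \<times> C)" for \<phi>
  proof -
    have "kron (hact \<rho> xx (\<one>\<^bsub>G\<^esub>, 1)) (hact \<sigma> Y (a, 0)) \<phi> = kron xx (\<sigma> a) \<phi>"
      by (rule kron_cong[OF _ _ lC \<phi>]) (use b c a in \<open>auto simp: hact_def\<close>)
    moreover have "kron (hact \<rho> xx (\<one>\<^bsub>G\<^esub>, 0)) (hact \<sigma> Y (\<one>\<^bsub>G\<^esub>, 1)) \<phi> = kron (\<lambda>f. f) Y \<phi>"
      by (rule kron_cong[OF _ _ lC \<phi>]) (use b c in \<open>auto simp: hact_def\<close>)
    ultimately show ?thesis by (simp add: ore_comult_x_def act_add)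
  qed
  have Xc: "?xx \<phi> \<in> fspace (B \<times> C)" if "\<phi> \<in> fspace (B \<times> C)" for \<phi>
    using b c a that by (intro fspace_add kron_closed[of _ _ B B C C]) auto
  have di: "act ?K (?d [^]\<^bsub>?HH\<^esub> (i::nat)) \<phi> = (?xx ^^ i) \<phi>" if \<phi>: "\<phi> \<in> fspace (B \<times> C)" for \<phi> i
    using \<phi>
  proof (induction i arbitrary: \<phi>)
    case 0
    have "act ?K \<one>\<^bsub>?HH\<^esub> \<phi> = \<phi>" using ops 0 by (simp add: HHe twisted_simps operators_def)
    then show ?case by simp
  next
    case (Suc i)
    have "act ?K (?d [^]\<^bsub>?HH\<^esub> Suc i) \<phi> = act ?K (?d [^]\<^bsub>?HH\<^esub> i) (act ?K ?d \<phi>)"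
      using actm[OF dic dc Suc.prems] by simp
    also have "\<dots> = (?xx ^^ i) (?xx \<phi>)" using Suc Xc[OF Suc.prems] by (simp only: d1)
    finally show ?case by (simp only: funpow_Suc_right comp_def)
  qed
  have e: "ore_comult G \<chi> a h = (\<Sum>p\<in>Poly_Mapping.keys h.
      Poly_Mapping.single ((fst p, 0), (fst p, 0)) (Poly_Mapping.lookup h p) \<otimes>\<^bsub>?HH\<^esub> (?d [^]\<^bsub>?HH\<^esub> snd p))"
    by (simp add: ore_comult_def Let_def split_beta)
  have hc: "fst p \<in> carrier G" if "p \<in> Poly_Mapping.keys h" for p using h that by auto
  show "Poly_Mapping.keys (ore_comult G \<chi> a h) \<subseteq> carrier (ore_basis G) \<times> carrier (ore_basis G)"
    unfolding e Pc[symmetric]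
    by (rule order_trans[OF keys_sum], rule UN_least) (use HH.m_closed[OF sc dic] hc in \<open>simp add: HHc\<close>)
  assume \<phi>: "\<phi> \<in> fspace (B \<times> C)"
  have "act ?K (ore_comult G \<chi> a h) \<phi> = (\<Sum>p\<in>Poly_Mapping.keys h.
      act ?K (Poly_Mapping.single ((fst p, 0), (fst p, 0)) (Poly_Mapping.lookup h p)) ((?xx ^^ snd p) \<phi>))"
    unfolding e act_sum by (rule sum.cong[OF refl]) (simp add: actm sc hc dic \<phi> di)
  also have "\<dots> = act (hact (\<lambda>g. kron (\<rho> g) (\<sigma> g)) ?xx) h \<phi>"
    unfolding act_def[of "hact (\<lambda>g. kron (\<rho> g) (\<sigma> g)) ?xx"]
    by (rule sum.cong[OF refl]) (simp add: hact_def split_beta)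
  finally show "act ?K (ore_comult G \<chi> a h) \<phi> = act (hact (\<lambda>g. kron (\<rho> g) (\<sigma> g)) ?xx) h \<phi>" .
qed

lemma ore_tensor_iso:
  assumes G: "group G" and \<chi>: "\<chi> \<in> carrier (character_group G)" and a: "a \<in> carrier G"
    and B: "hrep G \<chi> B \<rho> xx" and C: "hrep G \<chi> C \<sigma> Y"
    and M: "coordinates (ore_basis G) (ore_twist \<chi>) M B (hact \<rho> xx) \<theta> \<eta>"
    and N: "coordinates (ore_basis G) (ore_twist \<chi>) N C (hact \<sigma> Y) \<theta>' \<eta>'"
  shows "module_iso (ore_algebra G \<chi>) (ore_tensor G \<chi> a M N)
    (cmod (B \<times> C) (hact (\<lambda>g. kron (\<rho> g) (\<sigma> g)) (\<lambda>\<phi>. kron xx (\<sigma> a) \<phi> + kron (\<lambda>f. f) Y \<phi>)))"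
proof -
  interpret coord_pair "ore_basis G" "ore_twist \<chi>" M B "hact \<rho> xx" \<theta> \<eta> N C "hact \<sigma> Y" \<theta>' \<eta>'
    using M N monoid_ore_basis[OF G] by (simp add: coord_pair_def coord_def)
  show ?thesis unfolding ore_tensor_def ore_algebra_def
    by (rule tensor_module_iso(1)) (use ore_comult_keys[OF G \<chi> a B C] ore_comult_act[OF G \<chi> a B C] in blast)+
qed

text \<open>The action of a scalar \<open>z\<close> on a graded space, by \<open>z ^ c\<close> on
  degree \<open>c\<close>. For \<open>z = \<chi> g\<close> it is the action of \<open>g\<close> on
  the graded factor; with \<open>s\<close>-th roots of unity as the only arguments it depends on the
  degrees modulo \<open>s\<close>.\<close>

definition Dg :: "('e \<Rightarrow> nat) \<Rightarrow> 'k::field \<Rightarrow> ('e \<Rightarrow> 'k) \<Rightarrow> 'e \<Rightarrow> 'k" where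
  "Dg d z f = (\<lambda>e. z ^ d e * f e)"

lemma lin_Dg [simp]: "lin (Dg d z)"
  by (rule linI) (auto simp: Dg_def fun_eq_iff fapply algebra_simps)

lemma Dg_closed: "f \<in> fspace E \<Longrightarrow> Dg d z f \<in> fspace E"
  by (simp add: Dg_def fspace_def)

text \<open>That \<open>xx\<close> raises the degree by 1 modulo \<open>s\<close> is expressed by
  its commutation with the grading. For \<open>z = \<chi> g\<close> this is the defining relation
  between \<open>x\<close> and \<open>g\<close>.\<close>

definition graded :: "nat \<Rightarrow> 'e set \<Rightarrow> ('e \<Rightarrow> nat) \<Rightarrow> (('e \<Rightarrow> 'k::field) \<Rightarrow> 'e \<Rightarrow> 'k) \<Rightarrow> bool" where
  "graded s E d xx \<longleftrightarrow> finite E \<and> lin xx \<and> (\<forall>f\<in>fspace E. xx f \<in> fspace E) \<and>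
     (\<forall>z. z ^ s = 1 \<longrightarrow> (\<forall>f\<in>fspace E. xx (Dg d z f) = scl (inverse z) (Dg d z (xx f))))"

text \<open>\<open>W \<otimes> U\<close> for a \<open>kG\<close>-module \<open>W\<close> and a graded space \<open>U\<close> on which \<open>x\<close> has degree \<open>1\<close>.\<close>

definition tenrep :: "('g \<Rightarrow> 'k::field) \<Rightarrow> ('e \<Rightarrow> nat) \<Rightarrow> ('g \<Rightarrow> ('b \<Rightarrow> 'k) \<Rightarrow> 'b \<Rightarrow> 'k) \<Rightarrow>
    'g \<Rightarrow> ('e \<times> 'b \<Rightarrow> 'k) \<Rightarrow> 'e \<times> 'b \<Rightarrow> 'k" where
  "tenrep \<chi> d \<rho> g = kron (Dg d (\<chi> g)) (\<rho> g)"

definition ten :: "('g \<Rightarrow> 'k::field) \<Rightarrow> ('e \<Rightarrow> nat) \<Rightarrow> (('e \<Rightarrow> 'k) \<Rightarrow> 'e \<Rightarrow> 'k) \<Rightarrow> ('g \<Rightarrow> ('b \<Rightarrow> 'k) \<Rightarrow> 'b \<Rightarrow> 'k) \<Rightarrow>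
    'g \<times> nat \<Rightarrow> ('e \<times> 'b \<Rightarrow> 'k) \<Rightarrow> 'e \<times> 'b \<Rightarrow> 'k" where
  "ten \<chi> d xx \<rho> = hact (tenrep \<chi> d \<rho>) (kron xx (\<lambda>f. f))"

lemma grep_Dg:
  assumes "group G" "\<chi> \<in> carrier (character_group G)" "finite E"
  shows "grep G E (\<lambda>g. Dg d (\<chi> g))"
proof -
  have 1: "Dg d (\<chi> g) f \<in> fspace E" if "f \<in> fspace E" for g f by (rule Dg_closed[OF that])
  have 2: "Dg d (\<chi> g) (Dg d (\<chi> h) f) = Dg d (\<chi> (g \<otimes>\<^bsub>G\<^esub> h)) f" if "g \<in> carrier G" "h \<in> carrier G" for g h f
    using character_mult[OF assms(2) that] by (simp add: Dg_def power_mult_distrib mult.assoc)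
  have 3: "Dg d (\<chi> \<one>\<^bsub>G\<^esub>) f = f" for f using character_one[OF assms(1,2)] by (simp add: Dg_def)
  show ?thesis unfolding operators_def using assms(3) 1 2 3 by simp
qed

lemma hrep_ten:
  fixes \<chi> :: "'g \<Rightarrow> 'k::field" and E :: "'e set" and B :: "'b set"
  assumes G: "group G" and \<chi>: "\<chi> \<in> carrier (character_group G)"
    and s: "\<And>g. g \<in> carrier G \<Longrightarrow> \<chi> g ^ s = 1"
    and xx: "graded s E d xx" and B: "grep G B \<rho>"
  shows "hrep G \<chi> (E \<times> B) (tenrep \<chi> d \<rho>) (kron xx (\<lambda>f. f))"
proof -
  note x = xx[unfolded graded_def]
  note b = B[unfolded operators_def]
  have "xx (Dg d (\<chi> g) f) = scl (inverse (\<chi> g)) (Dg d (\<chi> g) (xx f))" if "g \<in> carrier G" "f \<in> fspace E" for g f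
    using x s that by blast
  note c0 = this
  have c: "kron xx (\<lambda>f. f) (kron (Dg d (\<chi> g)) (\<rho> g) \<phi>) =
      scl (inverse (\<chi> g)) (kron (Dg d (\<chi> g)) (\<rho> g) (kron xx (\<lambda>f. f) \<phi>))"
    if g: "g \<in> carrier G" and \<phi>: "\<phi> \<in> fspace (E \<times> B)" for g \<phi>
  proof (rule kron_eqI[OF _ _ _ _ \<phi>])
    have l: "lin xx" "lin (\<rho> g)" "lin (Dg d (\<chi> g))" using x b g by auto
    show "lin (\<lambda>\<phi>. kron xx (\<lambda>f. f) (kron (Dg d (\<chi> g)) (\<rho> g) \<phi>))"
      by (rule lin_comp[OF lin_kron[OF l(1) lin_id] lin_kron[OF l(3,2)]])
    show "lin (\<lambda>\<phi>. scl (inverse (\<chi> g)) (kron (Dg d (\<chi> g)) (\<rho> g) (kron xx (\<lambda>f. f) \<phi>)))"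
      by (rule lin_scale[OF lin_comp[OF lin_kron[OF l(3,2)] lin_kron[OF l(1) lin_id]]])
    fix f :: "'e \<Rightarrow> 'k" and h :: "'b \<Rightarrow> 'k" assume "f \<in> fspace E" "h \<in> fspace B"
    then show "kron xx (\<lambda>f. f) (kron (Dg d (\<chi> g)) (\<rho> g) (tens f h)) =
      scl (inverse (\<chi> g)) (kron (Dg d (\<chi> g)) (\<rho> g) (kron xx (\<lambda>f. f) (tens f h)))"
      using c0[OF g] l by (simp add: kron_tens tens_scl)
  qed (use x b in auto)
  have E: "finite E" using x by blast
  show ?thesis
    unfolding hrep_def tenrep_def
    using c x b by (auto intro!: grep_kron[OF G grep_Dg[OF G \<chi> E] B] lin_kron kron_closed[of xx _ E E B B])
qed

section \<open>Clebsch-Gordan strings\<close>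

definition rect :: "nat \<Rightarrow> nat \<Rightarrow> (nat \<times> nat) set" where
  "rect u t = {..<u} \<times> {..<t}"

text \<open>
  The operators \<open>y + z\<close> (with \<open>y\<close> rescaled by \<open>\<kappa>\<close>) on \<open>k[y, z]/(y\<^sup>u, z\<^sup>t)\<close> and its lowering
  partner: together they generate the action of \<open>sl\<^sub>2\<close> on a product of two irreducible modules.
\<close>

definition raising :: "nat \<Rightarrow> nat \<Rightarrow> 'k::field_char_0 \<Rightarrow> (nat \<times> nat \<Rightarrow> 'k) \<Rightarrow> nat \<times> nat \<Rightarrow> 'k" where
  "raising u t \<kappa> \<phi> = (\<lambda>(a, b). if a < u \<and> b < t then
     (if a > 0 then \<kappa> * \<phi> (a - 1, b) else 0) + (if b > 0 then \<phi> (a, b - 1) else 0) else 0)"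

definition lowering :: "nat \<Rightarrow> nat \<Rightarrow> 'k::field_char_0 \<Rightarrow> (nat \<times> nat \<Rightarrow> 'k) \<Rightarrow> nat \<times> nat \<Rightarrow> 'k" where
  "lowering u t \<kappa> \<phi> = (\<lambda>(a, b). if a < u \<and> b < t then
     inverse \<kappa> * of_nat (Suc a) * (of_nat u - 1 - of_nat a) * \<phi> (Suc a, b) +
     of_nat (Suc b) * (of_nat t - 1 - of_nat b) * \<phi> (a, Suc b) else 0)"

definition homogeneous :: "nat \<Rightarrow> nat \<Rightarrow> nat \<Rightarrow> (nat \<times> nat \<Rightarrow> 'k::field_char_0) \<Rightarrow> bool" where
  "homogeneous u t d \<phi> \<longleftrightarrow> (\<forall>a b. \<phi> (a, b) \<noteq> 0 \<longrightarrow> a < u \<and> b < t \<and> a + b = d)"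

text \<open>The solution of \<open>lowering \<phi> = 0\<close> in degree \<open>j\<close>, from the recurrence along the antidiagonal.\<close>

definition lowest :: "nat \<Rightarrow> nat \<Rightarrow> 'k::field_char_0 \<Rightarrow> nat \<Rightarrow> nat \<times> nat \<Rightarrow> 'k" where
  "lowest u t \<kappa> j = (\<lambda>(a, b). if a + b = j then
     (- \<kappa>) ^ a * fact (t - 1 - b) * fact (u - 1 - a) / (fact a * fact b) else 0)"

lemma lin_raising: "lin (raising u t \<kappa>)"
  by (rule linI) (auto simp: raising_def fun_eq_iff fapply algebra_simps)

lemma lin_lowering: "lin (lowering u t \<kappa>)"
  by (rule linI) (auto simp: lowering_def fun_eq_iff fapply algebra_simps)

lemma homogeneous_raising: "homogeneous u t d \<phi> \<Longrightarrow> homogeneous u t (Suc d) (raising u t \<kappa> \<phi>)"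
proof -
  assume h: "homogeneous u t d \<phi>"
  have "a < u \<and> b < t \<and> a + b = Suc d" if n: "raising u t \<kappa> \<phi> (a, b) \<noteq> 0" for a b
  proof -
    have "a < u \<and> b < t" "(a > 0 \<and> \<phi> (a - 1, b) \<noteq> 0) \<or> (b > 0 \<and> \<phi> (a, b - 1) \<noteq> 0)"
      using n by (auto simp: raising_def split: if_splits)
    moreover have "a - 1 + b = d" if "\<phi> (a - 1, b) \<noteq> 0" using h that by (auto simp: homogeneous_def)
    moreover have "a + (b - 1) = d" if "\<phi> (a, b - 1) \<noteq> 0" using h that by (auto simp: homogeneous_def)
    ultimately show ?thesis by auto
  qed
  then show ?thesis by (simp add: homogeneous_def)
qed

lemma homogeneous_lowest: "j < min u t \<Longrightarrow> homogeneous u t j (lowest u t \<kappa> j)"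
  by (auto simp: homogeneous_def lowest_def split: if_splits)

text \<open>The commutator relation of \<open>sl\<^sub>2\<close>: the scalar
  \<open>(u - 1) + (t - 1) - 2 d\<close> is the weight, up to sign, of degree \<open>d\<close> in
  the product of the irreducible modules of dimensions \<open>u\<close> and \<open>t\<close>. The
  rescaling of \<open>raising\<close> by \<open>\<kappa>\<close> is compensated by
  \<open>inverse \<kappa>\<close> in \<open>lowering\<close>.\<close>

lemma lowering_raising:
  fixes \<phi> :: "nat \<times> nat \<Rightarrow> 'k::field_char_0"
  assumes h: "homogeneous u t d \<phi>" and \<kappa>: "\<kappa> \<noteq> 0"
  shows "lowering u t \<kappa> (raising u t \<kappa> \<phi>) =
    raising u t \<kappa> (lowering u t \<kappa> \<phi>) + scl (of_nat u + of_nat t - 2 - 2 * of_nat d) \<phi>"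
proof (rule ext, clarify)
  fix a b
  have deg: "\<phi> (a, b) \<noteq> 0 \<Longrightarrow> of_nat d = (of_nat a + of_nat b :: 'k)"
    using h by (auto simp: homogeneous_def simp flip: of_nat_add)
  have deg': "(of_nat u + of_nat t - 2 - 2 * of_nat d) * \<phi> (a, b) =
      (of_nat u + of_nat t - 2 - 2 * of_nat a - 2 * of_nat b) * \<phi> (a, b)"
    using deg by (cases "\<phi> (a, b) = 0") (auto simp: algebra_simps)
  show "lowering u t \<kappa> (raising u t \<kappa> \<phi>) (a, b) =
    (raising u t \<kappa> (lowering u t \<kappa> \<phi>) + scl (of_nat u + of_nat t - 2 - 2 * of_nat d) \<phi>) (a, b)"
  proof (cases "a < u \<and> b < t")
    case False
    then have "\<phi> (a, b) = 0" using h by (auto simp: homogeneous_def)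
    then show ?thesis using False by (auto simp: lowering_def raising_def fapply)
  next
    case True
    \<comment> \<open>At the edge \<open>u = Suc a\<close> the truncated \<open>raising\<close> does
      not follow the general formula, but there the coefficient \<open>u - 1 - a\<close> vanishes.
      The same happens for \<open>b\<close> below.\<close>
    have 1: "inverse \<kappa> * of_nat (Suc a) * (of_nat u - 1 - of_nat a) * raising u t \<kappa> \<phi> (Suc a, b) =
      of_nat (Suc a) * (of_nat u - 1 - of_nat a) * (\<phi> (a, b) + inverse \<kappa> * (if b > 0 then \<phi> (Suc a, b - 1) else 0))"
    proof (cases "Suc a < u")
      case True
      then show ?thesis using \<open>a < u \<and> b < t\<close> \<kappa> by (simp add: raising_def field_simps)
    next
      case False
      then have "u = Suc a" using \<open>a < u \<and> b < t\<close> by auto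
      then have "of_nat u - 1 - of_nat a = (0::'k)" by simp
      then show ?thesis by (simp only: mult_zero_left mult_zero_right)
    qed
    have 2: "of_nat (Suc b) * (of_nat t - 1 - of_nat b) * raising u t \<kappa> \<phi> (a, Suc b) =
      of_nat (Suc b) * (of_nat t - 1 - of_nat b) * (\<phi> (a, b) + (if a > 0 then \<kappa> * \<phi> (a - 1, Suc b) else 0))"
    proof (cases "Suc b < t")
      case True
      then show ?thesis using \<open>a < u \<and> b < t\<close> by (simp add: raising_def add.commute)
    next
      case False
      then have "t = Suc b" using \<open>a < u \<and> b < t\<close> by auto
      then have "of_nat t - 1 - of_nat b = (0::'k)" by simp
      then show ?thesis by (simp only: mult_zero_left mult_zero_right)
    qed
    have 3: "(if a > 0 then \<kappa> * lowering u t \<kappa> \<phi> (a - 1, b) else 0) =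
      of_nat a * (of_nat u - of_nat a) * \<phi> (a, b) +
      (if a > 0 then \<kappa> * (of_nat (Suc b) * (of_nat t - 1 - of_nat b) * \<phi> (a - 1, Suc b)) else 0)"
      using True \<kappa> by (cases a) (auto simp: lowering_def field_simps)
    have 4: "(if b > 0 then lowering u t \<kappa> \<phi> (a, b - 1) else 0) =
      of_nat b * (of_nat t - of_nat b) * \<phi> (a, b) +
      (if b > 0 then inverse \<kappa> * of_nat (Suc a) * (of_nat u - 1 - of_nat a) * \<phi> (Suc a, b - 1) else 0)"
      using True by (cases b) (auto simp: lowering_def field_simps)
    have "lowering u t \<kappa> (raising u t \<kappa> \<phi>) (a, b) =
      inverse \<kappa> * of_nat (Suc a) * (of_nat u - 1 - of_nat a) * raising u t \<kappa> \<phi> (Suc a, b) +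
      of_nat (Suc b) * (of_nat t - 1 - of_nat b) * raising u t \<kappa> \<phi> (a, Suc b)"
      using True by (simp only: lowering_def) simp
    moreover have "(raising u t \<kappa> (lowering u t \<kappa> \<phi>) + scl (of_nat u + of_nat t - 2 - 2 * of_nat d) \<phi>) (a, b) =
      (if a > 0 then \<kappa> * lowering u t \<kappa> \<phi> (a - 1, b) else 0) + (if b > 0 then lowering u t \<kappa> \<phi> (a, b - 1) else 0) +
      (of_nat u + of_nat t - 2 - 2 * of_nat a - 2 * of_nat b) * \<phi> (a, b)"
      using True by (simp only: fapply deg') (simp add: raising_def)
    ultimately show ?thesis
      by (simp only: 1 2 3 4) (cases "a > 0"; cases "b > 0"; simp add: algebra_simps)
  qed
qed

text \<open>Going from \<open>(a, b + 1)\<close> to \<open>(a + 1, b)\<close> multiplies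
  \<open>lowest\<close> by \<open>- \<kappa> (b + 1) (t - 1 - b) / ((a + 1) (u - 1 - a))\<close>, so
  the two terms of \<open>lowering\<close> at \<open>(a, b)\<close> cancel.\<close>

lemma lowering_lowest:
  fixes \<kappa> :: "'k::field_char_0"
  assumes j: "j < min u t" and \<kappa>: "\<kappa> \<noteq> 0"
  shows "lowering u t \<kappa> (lowest u t \<kappa> j) = 0"
proof (rule ext, clarify)
  fix a b
  show "lowering u t \<kappa> (lowest u t \<kappa> j) (a, b) = 0 (a, b)"
  proof (cases "Suc (a + b) = j")
    case False
    then show ?thesis by (simp add: lowering_def lowest_def fapply)
  next
    case True
    \<comment> \<open>Since \<open>a + b + 1 = j < min u t\<close>, both
      \<open>a + 2 \<le> u\<close> and \<open>b + 2 \<le> t\<close>, so these differences are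
      genuine and the factorials can be unfolded.\<close>
    define p q where "p = u - 2 - a" and "q = t - 2 - b"
    have u: "u = p + a + 2" and t: "t = q + b + 2" using True j by (auto simp: p_def q_def)
    have f: "1 + of_nat n \<noteq> (0 :: 'k)" for n
      by (metis of_nat_Suc of_nat_neq_0 add.commute)
    show ?thesis using True
      by (simp add: lowering_def lowest_def u t fapply) (simp add: field_simps f \<kappa>)
  qed
qed

definition string :: "nat \<Rightarrow> nat \<Rightarrow> 'k::field_char_0 \<Rightarrow> nat \<Rightarrow> nat \<Rightarrow> nat \<times> nat \<Rightarrow> 'k" where
  "string u t \<kappa> j i = (raising u t \<kappa> ^^ i) (lowest u t \<kappa> j)"

lemma string_Suc: "string u t \<kappa> j (Suc i) = raising u t \<kappa> (string u t \<kappa> j i)"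
  by (simp add: string_def)

lemma homogeneous_string: "j < min u t \<Longrightarrow> homogeneous u t (j + i) (string u t \<kappa> j i)"
proof (induction i)
  case 0 then show ?case using homogeneous_lowest by (simp add: string_def)
next
  case (Suc i) then show ?case using homogeneous_raising by (simp add: string_Suc)
qed

lemma homogeneous_fspace: "homogeneous u t d \<phi> \<Longrightarrow> \<phi> \<in> fspace (rect u t)"
  by (auto simp: homogeneous_def fspace_def rect_def)

text \<open>The coefficient is the sum of the scalars \<open>u + t - 2 - 2 (j + k)\<close> over
  \<open>k < i\<close>: one commutator for each of the \<open>i\<close> raising steps, above a
  vector that \<open>lowering\<close> kills.\<close>

lemma lowering_string:
  fixes \<kappa> :: "'k::field_char_0"
  assumes j: "j < min u t" and \<kappa>: "\<kappa> \<noteq> 0"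
  shows "lowering u t \<kappa> (string u t \<kappa> j i) =
    scl (of_nat i * (of_nat u + of_nat t - 1 - 2 * of_nat j - of_nat i)) (string u t \<kappa> j (i - 1))"
proof (induction i)
  case 0 then show ?case using lowering_lowest[OF assms] by (simp add: string_def)
next
  case (Suc i)
  \<comment> \<open>For \<open>i = 0\<close> the truncated index \<open>i - 1\<close> is 0 as well,
    but the factor \<open>of_nat i\<close> removes the term.\<close>
  have e: "raising u t \<kappa> (scl (of_nat i * c) (string u t \<kappa> j (i - 1))) = scl (of_nat i * c) (string u t \<kappa> j i)" for c
    by (cases i) (simp_all add: lin_scl[OF lin_raising] string_Suc lin_zero[OF lin_raising])
  have "lowering u t \<kappa> (string u t \<kappa> j (Suc i)) =
    scl (of_nat i * (of_nat u + of_nat t - 1 - 2 * of_nat j - of_nat i)) (string u t \<kappa> j i) +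
    scl (of_nat u + of_nat t - 2 - 2 * of_nat (j + i)) (string u t \<kappa> j i)"
    by (simp only: string_Suc lowering_raising[OF homogeneous_string[OF j] \<kappa>] Suc.IH e)
  then show ?case by (simp only: scl_add(2)[symmetric]) (simp add: algebra_simps)
qed

text \<open>A function of degree \<open>d \<ge> t\<close> vanishes in column \<open>a = 0\<close>.
  The value of \<open>lowering\<close> at \<open>(a, b)\<close> combines an entry of column
  \<open>a\<close>, zero by induction, with the entry at \<open>(a + 1, b)\<close>, whose
  coefficient is nonzero in characteristic zero.\<close>

lemma lowering_inj:
  assumes h: "homogeneous u t d \<phi>" and d: "u \<le> d" "t \<le> d" and l: "lowering u t \<kappa> \<phi> = 0" and \<kappa>: "\<kappa> \<noteq> 0"
  shows "\<phi> = (0 :: nat \<times> nat \<Rightarrow> 'k::field_char_0)"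
proof -
  have "\<phi> (a, b) = 0" for a b
  proof (induction a arbitrary: b)
    case 0
    then show ?case using h d by (metis add_0 homogeneous_def linorder_not_less)
  next
    case (Suc a)
    show ?case
    proof (rule ccontr)
      assume n: "\<phi> (Suc a, b) \<noteq> 0"
      then have b: "Suc a < u" "b < t" using h by (auto simp: homogeneous_def)
      have "lowering u t \<kappa> \<phi> (a, b) = 0" using l by (simp add: fapply)
      then have "inverse \<kappa> * of_nat (Suc a) * (of_nat u - 1 - of_nat a) * \<phi> (Suc a, b) = 0"
        using b Suc by (simp add: lowering_def)
      moreover have "of_nat u - 1 - of_nat a \<noteq> (0::'k)"
        using b(1) by (metis add.commute diff_diff_eq eq_iff_diff_eq_0 nat_neq_iff of_nat_Suc of_nat_eq_iff)
      moreover have "of_nat (Suc a) \<noteq> (0::'k)" by (rule of_nat_neq_0)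
      ultimately show False using n \<kappa> by simp
    qed
  qed
  then show ?thesis by (auto simp: fun_eq_iff fapply)
qed

text \<open>At \<open>i = u + t - 1 - 2 j\<close> the coefficient in \<open>lowering_string\<close>
  is zero. The degree there is \<open>u + t - 1 - j\<close>, at least both \<open>u\<close> and
  \<open>t\<close>, so \<open>lowering_inj\<close> applies.\<close>

lemma string_top:
  fixes \<kappa> :: "'k::field_char_0"
  assumes j: "j < min u t" and \<kappa>: "\<kappa> \<noteq> 0"
  shows "string u t \<kappa> j (u + t - 1 - 2 * j) = 0"
proof (rule lowering_inj[OF homogeneous_string[OF j] _ _ _ \<kappa>])
  have "of_nat (u + t - 1 - 2 * j) = (of_nat u + of_nat t - 1 - 2 * of_nat j :: 'k)"
    using j by (simp add: of_nat_diff)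
  then show "lowering u t \<kappa> (string u t \<kappa> j (u + t - 1 - 2 * j)) = 0"
    by (simp add: lowering_string[OF j \<kappa>])
qed (use j in auto)

lemma lowest_nonzero:
  fixes \<kappa> :: "'k::field_char_0"
  assumes "\<kappa> \<noteq> 0"
  shows "lowest u t \<kappa> j \<noteq> 0"
proof
  assume "lowest u t \<kappa> j = 0"
  then have "lowest u t \<kappa> j (j, 0) = 0" by (simp add: fapply)
  then show False using assms by (simp add: lowest_def)
qed

text \<open>In a given degree each string has at most one vector. Lowering a relation in degree
  \<open>d + 1\<close> multiplies the coefficients of the strings that start earlier by nonzero
  numbers and kills the string that starts there. By induction the former coefficients vanish, and
  what remains is a multiple of one nonzero lowest vector.\<close>

lemma string_independent_degree:
  fixes \<kappa> :: "'k::field_char_0"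
  assumes \<kappa>: "\<kappa> \<noteq> 0"
    and "(\<Sum>j\<in>{j. j < min u t \<and> j \<le> d \<and> d - j < u + t - 1 - 2 * j}. scl (c j) (string u t \<kappa> j (d - j))) = 0"
    and "j < min u t" "j \<le> d" "d - j < u + t - 1 - 2 * j"
  shows "c j = 0"
  using assms(2-5)
proof (induction d arbitrary: c j)
  case 0
  have "{j. j < min u t \<and> j \<le> 0 \<and> 0 - j < u + t - 1 - 2 * j} = {0}" using 0 by auto
  then have "scl (c 0) (lowest u t \<kappa> 0) = 0" using 0 by (simp add: string_def)
  then show ?case using lowest_nonzero[OF \<kappa>, of u t 0] 0
    by (auto simp: fun_eq_iff fapply)
next
  case (Suc d)
  let ?J = "\<lambda>d. {j. j < min u t \<and> j \<le> d \<and> d - j < u + t - 1 - 2 * j}"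
  have finJ: "finite (?J d)" for d by (rule finite_subset[of _ "{..d}"]) auto
  let ?w = "\<lambda>j. of_nat (Suc d - j) * (of_nat u + of_nat t - 1 - 2 * of_nat j - of_nat (Suc d - j)) :: 'k"
  \<comment> \<open>The index set for \<open>d\<close> may contain strings that end in degree
    \<open>d\<close> and have no vector in degree \<open>Suc d\<close>; they get coefficient
    0.\<close>
  let ?c = "\<lambda>j. if j \<in> ?J (Suc d) then c j * ?w j else 0"
  have "0 = lowering u t \<kappa> (\<Sum>j\<in>?J (Suc d). scl (c j) (string u t \<kappa> j (Suc d - j)))"
    using Suc.prems(1) by (simp add: lin_zero[OF lin_lowering])
  also have "\<dots> = (\<Sum>j\<in>?J (Suc d). scl (c j * ?w j) (string u t \<kappa> j (Suc d - j - 1)))"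
    by (auto simp: lin_sum[OF lin_lowering] lin_scl[OF lin_lowering] lowering_string[OF _ \<kappa>] intro!: sum.cong)
  also have "\<dots> = (\<Sum>j\<in>?J (Suc d) - {Suc d}. scl (c j * ?w j) (string u t \<kappa> j (Suc d - j - 1)))"
    by (rule sum.mono_neutral_right) (auto simp: finJ)
  also have "\<dots> = (\<Sum>j\<in>?J (Suc d) - {Suc d}. scl (?c j) (string u t \<kappa> j (d - j)))"
    by (rule sum.cong) (auto simp: Suc_diff_le)
  also have "\<dots> = (\<Sum>j\<in>?J d. scl (?c j) (string u t \<kappa> j (d - j)))"
  proof (rule sum.mono_neutral_left[OF finJ])
    show "?J (Suc d) - {Suc d} \<subseteq> ?J d" by auto
    show "\<forall>j\<in>?J d - (?J (Suc d) - {Suc d}). scl (?c j) (string u t \<kappa> j (d - j)) = 0" by auto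
  qed
  finally have s0: "(\<Sum>j\<in>?J d. scl (?c j) (string u t \<kappa> j (d - j))) = 0" by simp
  have low: "c j = 0" if j: "j \<in> ?J (Suc d)" "j \<le> d" for j
  proof -
    have "j < min u t" "d - j < u + t - 1 - 2 * j" using j by auto
    from Suc.IH[OF s0 this(1) j(2) this(2)] have "?c j = 0" .
    then have "c j * ?w j = 0" using j by simp
    moreover have "?w j \<noteq> 0"
    proof -
      \<comment> \<open>The second factor of \<open>?w j\<close>: the length of the string minus the
        position \<open>Suc d - j\<close>, positive because the string reaches degree
        \<open>Suc d\<close>.\<close>
      define r where "r = u + t - 2 - j - d"
      have r: "u + t = r + 2 + j + d" "0 < r" using j by (auto simp: r_def)
      have "of_nat u + of_nat t = (of_nat r + 2 + of_nat j + of_nat d :: 'k)"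
        using arg_cong[OF r(1), of "of_nat :: nat \<Rightarrow> 'k"] by simp
      moreover have "of_nat (Suc d - j) = (1 + of_nat d - of_nat j :: 'k)" using j by (simp add: of_nat_diff)
      ultimately have "of_nat u + of_nat t - 1 - 2 * of_nat j - of_nat (Suc d - j) = (of_nat r :: 'k)"
        by (simp add: algebra_simps)
      then show ?thesis using j r(2) by (simp del: of_nat_Suc)
    qed
    ultimately show ?thesis by (metis mult_eq_0_iff)
  qed
  show ?case
  proof (cases "j \<le> d")
    case True then show ?thesis using low Suc.prems by auto
  next
    case False
    then have j: "j = Suc d" using Suc.prems by simp
    have "(\<Sum>j\<in>?J (Suc d). scl (c j) (string u t \<kappa> j (Suc d - j))) =
        (\<Sum>j\<in>{Suc d}. scl (c j) (string u t \<kappa> j (Suc d - j)))"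
      by (rule sum.mono_neutral_right) (use Suc.prems j low finJ in \<open>auto simp: le_Suc_eq\<close>)
    then have "scl (c (Suc d)) (lowest u t \<kappa> (Suc d)) = 0"
      using Suc.prems(1) by (simp add: string_def)
    then show ?thesis using lowest_nonzero[OF \<kappa>, of u t "Suc d"] j
      by (auto simp: fun_eq_iff fapply)
  qed
qed

text \<open>A vector at position \<open>i\<close> of string \<open>j\<close> is supported on the
  antidiagonal \<open>a + b = j + i\<close>, so evaluation at the points of one antidiagonal
  isolates the relation of one degree.\<close>

lemma string_independent:
  fixes \<kappa> :: "'k::field_char_0"
  assumes \<kappa>: "\<kappa> \<noteq> 0"
    and s: "(\<Sum>j<min u t. \<Sum>i<u + t - 1 - 2 * j. scl (c j i) (string u t \<kappa> j i)) = 0"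
    and j: "j < min u t" "i < u + t - 1 - 2 * j"
  shows "c j i = 0"
proof -
  define d where "d = j + i"
  let ?J = "{j. j < min u t \<and> j \<le> d \<and> d - j < u + t - 1 - 2 * j}"
  have "(\<Sum>j\<in>?J. scl (c j (d - j)) (string u t \<kappa> j (d - j))) = 0"
  proof (rule ext, clarify)
    fix a b
    have z: "string u t \<kappa> j i (a, b) = 0" if "j < min u t" "a + b \<noteq> j + i" for j i
      using homogeneous_string[OF that(1), of i \<kappa>] that(2) by (auto simp: homogeneous_def)
    show "(\<Sum>j\<in>?J. scl (c j (d - j)) (string u t \<kappa> j (d - j))) (a, b) = 0 (a, b)"
    proof (cases "a + b = d")
      case False
      then show ?thesis using z by (auto simp: sum_fun_apply fapply intro!: sum.neutral)
    next
      case True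
      have "0 = (\<Sum>j<min u t. \<Sum>i<u + t - 1 - 2 * j. c j i * string u t \<kappa> j i (a, b))"
        using s by (simp add: fun_eq_iff sum_fun_apply fapply)
      also have "\<dots> = (\<Sum>j<min u t. if j \<in> ?J then c j (d - j) * string u t \<kappa> j (d - j) (a, b) else 0)"
      proof (rule sum.cong[OF refl])
        fix j assume "j \<in> {..<min u t}"
        then have jm: "j < min u t" by simp
        show "(\<Sum>i<u + t - 1 - 2 * j. c j i * string u t \<kappa> j i (a, b)) =
          (if j \<in> ?J then c j (d - j) * string u t \<kappa> j (d - j) (a, b) else 0)"
        proof (cases "j \<in> ?J")
          case False
          have "string u t \<kappa> j i (a, b) = 0" if "i < u + t - 1 - 2 * j" for i
            using z[OF jm, of i] False jm True that by auto
          then show ?thesis using False by simp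
        next
          case J: True
          have "(\<Sum>i<u + t - 1 - 2 * j. c j i * string u t \<kappa> j i (a, b)) =
            (\<Sum>i\<in>{d - j}. c j i * string u t \<kappa> j i (a, b))"
            by (rule sum.mono_neutral_right) (use J True z[OF jm] in auto)
          then show ?thesis using J by simp
        qed
      qed
      also have "\<dots> = (\<Sum>j\<in>{..<min u t} \<inter> ?J. c j (d - j) * string u t \<kappa> j (d - j) (a, b))"
        by (subst sum.inter_restrict) auto
      also have "{..<min u t} \<inter> ?J = ?J" by auto
      finally show ?thesis by (simp add: sum_fun_apply fapply)
    qed
  qed
  from string_independent_degree[OF \<kappa> this, of j] j show ?thesis by (simp add: d_def)
qed

text \<open>For \<open>k = min u t\<close> the value is \<open>min u t * max u t = u * t\<close>:
  the strings have as many vectors as the rectangle has points.\<close>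

lemma string_count: "(k::nat) \<le> min u t \<Longrightarrow> (\<Sum>j<k. u + t - 1 - 2 * j) = k * (u + t - k)"
proof (induction k)
  case (Suc k)
  then obtain p q where "u = p + Suc k" "t = q + Suc k" by (metis add.commute le_Suc_ex min.boundedE)
  then show ?case using Suc by (simp add: algebra_simps)
qed simp

lemma string_count_all: "(\<Sum>j<min u t. u + t - 1 - 2 * j) = u * (t::nat)"
  by (subst string_count) (auto simp: min_def algebra_simps)

section \<open>Gaussian binomial coefficients and powers of a sum of \<open>q\<close>-commuting
  operators\<close>

fun qbinom :: "'k::field \<Rightarrow> nat \<Rightarrow> nat \<Rightarrow> 'k" where
  "qbinom q n 0 = 1"
| "qbinom q 0 (Suc i) = 0"
| "qbinom q (Suc n) (Suc i) = q ^ (n - i) * qbinom q n i + qbinom q n (Suc i)"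

lemma qbinom_beyond: "n < i \<Longrightarrow> qbinom q n i = 0"
  by (induction q n i rule: qbinom.induct) auto

lemma qbinom_diag: "qbinom q n n = 1"
  by (induction n) (auto simp: qbinom_beyond)

text \<open>The quotient of neighbouring coefficients, freed of denominators because these may
  vanish at a root of unity. For the upper index \<open>Suc n\<close> both sides equal
  \<open>(1 - q ^ Suc n) * qbinom q n i\<close>, by two different uses of the recursion.\<close>

lemma qbinom_step: "i \<le> n \<Longrightarrow> (1 - q ^ Suc i) * qbinom q n (Suc i) = (1 - q ^ (n - i)) * qbinom q n i"
proof (induction n arbitrary: i)
  case 0 then show ?case by simp
next
  case (Suc n)
  show ?case
  proof (cases "i = Suc n")
    case True then show ?thesis by (simp add: qbinom_beyond)
  next
    case False
    then have i: "i \<le> n" using Suc.prems by simp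
    have L: "(1 - q ^ Suc i) * qbinom q (Suc n) (Suc i) = (1 - q ^ Suc n) * qbinom q n i"
    proof -
      have "(1 - q ^ Suc i) * qbinom q (Suc n) (Suc i) =
        q ^ (n - i) * (1 - q ^ Suc i) * qbinom q n i + (1 - q ^ Suc i) * qbinom q n (Suc i)"
        by (simp add: algebra_simps)
      also have "\<dots> = (q ^ (n - i) - q ^ (n - i) * q ^ Suc i) * qbinom q n i + (1 - q ^ (n - i)) * qbinom q n i"
        by (simp only: Suc.IH[OF i]) (simp add: algebra_simps)
      also have "q ^ (n - i) * q ^ Suc i = q ^ Suc n" using i by (simp flip: power_add)
      finally show ?thesis by (simp add: algebra_simps)
    qed
    show ?thesis
    proof (cases i)
      case 0 then show ?thesis using L by simp
    next
      case (Suc i')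
      then have i': "i' \<le> n" using i by simp
      have e: "q ^ (n - i') * q ^ Suc i' = q ^ Suc n" using i' by (simp flip: power_add)
      have "(1 - q ^ (n - i')) * qbinom q (Suc n) (Suc i') =
        q ^ (n - i') * ((1 - q ^ (n - i')) * qbinom q n i') + (1 - q ^ (n - i')) * qbinom q n (Suc i')"
        by (simp add: algebra_simps)
      also have "\<dots> = (1 - q ^ (n - i') * q ^ Suc i') * qbinom q n (Suc i')"
        by (simp only: Suc.IH[OF i', symmetric]) (simp add: algebra_simps)
      finally show ?thesis using L Suc by (simp only: e) simp
    qed
  qed
qed

text \<open>\<open>qbinom_step\<close> propagates zero upwards from \<open>i = 1\<close>, where the
  right side has the factor \<open>1 - q ^ s = 0\<close>. The factor \<open>1 - q ^ Suc i\<close> on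
  the left is nonzero as long as \<open>Suc i < s\<close>.\<close>

lemma qbinom_vanish:
  assumes q: "q ^ s = 1" "\<And>i. \<lbrakk>0 < i; i < s\<rbrakk> \<Longrightarrow> q ^ i \<noteq> 1" and "0 < i" "i < s"
  shows "qbinom q s i = 0"
  using assms(3,4)
proof (induction i)
  case (Suc i)
  have "(1 - q ^ Suc i) * qbinom q s (Suc i) = 0"
  proof (cases "i = 0")
    case True then show ?thesis using qbinom_step[of 0 s q] q by simp
  next
    case False then show ?thesis using qbinom_step[of i s q] Suc by simp
  qed
  then show ?case using q(2)[of "Suc i"] Suc.prems by simp
qed simp

text \<open>Moving a new \<open>A\<close> to the right past \<open>B ^^ (n - i)\<close> costs
  \<open>q ^ (n - i)\<close>. This is the weight in the recursion of \<open>qbinom\<close>.\<close>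

lemma qbinom_power:
  fixes A B :: "('b \<Rightarrow> 'k::field) \<Rightarrow> 'b \<Rightarrow> 'k"
  assumes lA: "lin A" and lB: "lin B" and cA: "\<And>v. v \<in> fspace U \<Longrightarrow> A v \<in> fspace U"
    and cB: "\<And>v. v \<in> fspace U \<Longrightarrow> B v \<in> fspace U"
    and AB: "\<And>v. v \<in> fspace U \<Longrightarrow> A (B v) = scl q (B (A v))" and v: "v \<in> fspace U"
  shows "((\<lambda>v. A v + B v) ^^ n) v = (\<Sum>i\<le>n. scl (qbinom q n i) ((B ^^ (n - i)) ((A ^^ i) v)))"
proof (induction n)
  case 0 then show ?case by simp
next
  case (Suc n)
  have Ai: "(A ^^ i) v \<in> fspace U" for i using funpow_closed[of "fspace U" A v i] cA v by blast
  have Bm: "(B ^^ m) w \<in> fspace U" if "w \<in> fspace U" for m w using funpow_closed[of "fspace U" B w m] cB that by blast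
  have ABm: "A ((B ^^ m) w) = scl (q ^ m) ((B ^^ m) (A w))" if "w \<in> fspace U" for m w
  proof (induction m)
    case 0 then show ?case by simp
  next
    case (Suc m)
    then show ?case using AB[OF Bm[OF that, of m]] by (simp add: lin_scl[OF lB])
  qed
  let ?t = "\<lambda>i. (B ^^ (Suc n - i)) ((A ^^ i) v)"
  have 1: "A ((B ^^ (n - i)) ((A ^^ i) v)) = scl (q ^ (n - i)) (?t (Suc i))" for i
    using ABm[OF Ai] by simp
  have "B ((B ^^ (n - i)) ((A ^^ i) v)) = ?t i" if "i \<le> n" for i
    using that by (simp add: Suc_diff_le)
  then have 2: "(\<Sum>i\<le>n. scl (qbinom q n i) (B ((B ^^ (n - i)) ((A ^^ i) v)))) = (\<Sum>i\<le>n. scl (qbinom q n i) (?t i))"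
    by (intro sum.cong refl) (simp only: atMost_iff)
  have "((\<lambda>v. A v + B v) ^^ Suc n) v = (\<Sum>i\<le>n. scl (qbinom q n i * q ^ (n - i)) (?t (Suc i))) + (\<Sum>i\<le>n. scl (qbinom q n i) (?t i))"
    by (simp add: Suc.IH lin_sum[OF lA] lin_sum[OF lB] lin_scl[OF lA] lin_scl[OF lB] 1 2)
  also have "(\<Sum>i\<le>n. scl (qbinom q n i) (?t i)) = (\<Sum>i\<le>Suc n. scl (qbinom q n i) (?t i))"
    by (simp add: qbinom_beyond)
  also have "\<dots> = scl 1 (?t 0) + (\<Sum>i\<le>n. scl (qbinom q n (Suc i)) (?t (Suc i)))"
    by (subst sum.atMost_Suc_shift) simp
  also have "(\<Sum>i\<le>n. scl (qbinom q n i * q ^ (n - i)) (?t (Suc i))) + \<dots> =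
    scl 1 (?t 0) + (\<Sum>i\<le>n. scl (qbinom q (Suc n) (Suc i)) (?t (Suc i)))"
    by (simp add: scl_add sum.distrib mult.commute algebra_simps)
  also have "\<dots> = (\<Sum>i\<le>Suc n. scl (qbinom q (Suc n) i) (?t i))"
    by (subst sum.atMost_Suc_shift) simp
  finally show ?case .
qed

text \<open>The inner \<open>q\<close>-binomial coefficients vanish at a primitive \<open>s\<close>-th root of unity.\<close>

lemma qbinom_power_root:
  fixes A B :: "('b \<Rightarrow> 'k::field) \<Rightarrow> 'b \<Rightarrow> 'k"
  assumes AB: "lin A" "lin B" "\<And>v. v \<in> fspace U \<Longrightarrow> A v \<in> fspace U" "\<And>v. v \<in> fspace U \<Longrightarrow> B v \<in> fspace U"
    "\<And>v. v \<in> fspace U \<Longrightarrow> A (B v) = scl q (B (A v))" and v: "v \<in> fspace U"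
    and q: "q ^ s = 1" "\<And>i. \<lbrakk>0 < i; i < s\<rbrakk> \<Longrightarrow> q ^ i \<noteq> 1" and s: "0 < s"
  shows "((\<lambda>v. A v + B v) ^^ s) v = (A ^^ s) v + (B ^^ s) v"
proof -
  have "((\<lambda>v. A v + B v) ^^ s) v = (\<Sum>i\<le>s. scl (qbinom q s i) ((B ^^ (s - i)) ((A ^^ i) v)))"
    by (rule qbinom_power[OF AB v])
  also have "\<dots> = (\<Sum>i\<in>{0, s}. scl (qbinom q s i) ((B ^^ (s - i)) ((A ^^ i) v)))"
    by (rule sum.mono_neutral_right) (auto simp: qbinom_vanish[OF q])
  also have "\<dots> = (A ^^ s) v + (B ^^ s) v" using s by (simp add: qbinom_diag add.commute)
  finally show ?thesis .
qed

section \<open>Dimension counts in spaces of functions\<close>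

lemma vector_space_scl: "vector_space (scl :: 'k::field \<Rightarrow> ('b \<Rightarrow> 'k) \<Rightarrow> 'b \<Rightarrow> 'k)"
  by unfold_locales (simp_all add: scl_add)

lemma subspace_fspace: "module.subspace scl (fspace B)"
proof -
  interpret vector_space "scl :: 'a \<Rightarrow> ('b \<Rightarrow> 'a) \<Rightarrow> 'b \<Rightarrow> 'a" by (rule vector_space_scl)
  show ?thesis by (simp add: subspace_def fspace_add fspace_scl)
qed

lemma span_dl:
  assumes "finite B"
  shows "module.span scl (dl ` B) = (fspace B :: ('b \<Rightarrow> 'k::field) set)"
proof -
  interpret vector_space "scl :: 'k \<Rightarrow> ('b \<Rightarrow> 'k) \<Rightarrow> 'b \<Rightarrow> 'k" by (rule vector_space_scl)
  show ?thesis
  proof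
    show "span (dl ` B) \<subseteq> fspace B" by (rule span_minimal[OF _ subspace_fspace]) auto
    show "fspace B \<subseteq> span (dl ` B)"
    proof
      fix f :: "'b \<Rightarrow> 'k" assume f: "f \<in> fspace B"
      have "(\<Sum>b\<in>B. scl (f b) (dl b)) \<in> span (dl ` B)" by (intro span_sum span_scale span_base) auto
      then show "f \<in> span (dl ` B)" using fspace_expand[OF assms f] by simp
    qed
  qed
qed

lemma dl_inj: "inj (dl :: 'b \<Rightarrow> 'b \<Rightarrow> 'k::field)"
  by (rule injI) (metis dl_def zero_neq_one)

text \<open>The images of the basis functions are independent and as many as the basis functions of
  the target. A vector outside their span could be added to them, giving an independent set larger
  than a spanning set.\<close>

lemma lin_injective_surjective:
  fixes Q :: "('c \<Rightarrow> 'k::field) \<Rightarrow> 'b \<Rightarrow> 'k"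
  assumes Q: "lin Q" and C: "finite C" and B: "finite B" and card: "card C = card B"
    and cl: "\<And>f. f \<in> fspace C \<Longrightarrow> Q f \<in> fspace B"
    and inj: "\<And>f. \<lbrakk>f \<in> fspace C; Q f = 0\<rbrakk> \<Longrightarrow> f = 0"
    and g: "g \<in> fspace B"
  shows "\<exists>f\<in>fspace C. Q f = g"
proof -
  interpret V: vector_space "scl :: 'k \<Rightarrow> ('b \<Rightarrow> 'k) \<Rightarrow> 'b \<Rightarrow> 'k" by (rule vector_space_scl)
  let ?q = "\<lambda>c. Q (dl c)"
  have qi: "inj_on ?q C"
  proof (rule inj_onI)
    fix c d assume cd: "c \<in> C" "d \<in> C" "Q (dl c) = Q (dl d)"
    have "dl c + scl (-1) (dl d) = (0 :: 'c \<Rightarrow> 'k)"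
    proof (rule inj)
      show "dl c + scl (-1) (dl d) \<in> fspace C" by (intro fspace_add fspace_scl fspace_dl cd)
      show "Q (dl c + scl (-1) (dl d)) = 0"
        by (simp add: lin_add[OF Q] lin_scl[OF Q] cd(3) fun_eq_iff fapply)
    qed
    then have "dl c = (dl d :: 'c \<Rightarrow> 'k)" by (simp add: fun_eq_iff fapply)
    then show "c = d" by (rule injD[OF dl_inj])
  qed
  let ?S = "?q ` C"
  have ind: "V.independent ?S"
  proof
    assume "V.dependent ?S"
    then obtain w v where wv: "v \<in> ?S" "w v \<noteq> 0" "(\<Sum>v\<in>?S. scl (w v) v) = 0"
      using V.dependent_finite[of ?S] C by auto
    let ?f = "\<Sum>c\<in>C. scl (w (?q c)) (dl c)"
    have "Q ?f = 0" using wv(3) by (simp add: lin_sum[OF Q] lin_scl[OF Q] sum.reindex[OF qi])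
    moreover have "?f \<in> fspace C" by (intro fspace_sum fspace_scl fspace_dl)
    ultimately have "?f = 0" using inj by blast
    moreover obtain c where "c \<in> C" "v = ?q c" using wv by auto
    ultimately have "?f c = 0" by (simp add: fapply)
    moreover have "?f c = w (?q c)" using C \<open>c \<in> C\<close>
      by (simp add: sum_fun_apply fapply dl_def if_distrib[of "\<lambda>x. _ * x"] cong: if_cong)
    ultimately show False using wv \<open>v = ?q c\<close> by simp
  qed
  have sp: "?S \<subseteq> V.span (dl ` B)" using cl by (auto simp: span_dl[OF B])
  have cS: "card ?S = card (dl ` B :: ('b \<Rightarrow> 'k) set)"
    using card by (simp add: card_image[OF qi] card_image[OF inj_on_subset[OF dl_inj]])
  have "g \<in> V.span ?S"
  proof (rule ccontr)
    assume ng: "g \<notin> V.span ?S"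
    have 1: "V.independent (insert g ?S)" by (rule V.independent_insertI[OF ng ind])
    have 2: "insert g ?S \<subseteq> V.span (dl ` B)" using sp g by (simp add: span_dl[OF B])
    have 3: "finite (dl ` B :: ('b \<Rightarrow> 'k) set)" using B by simp
    have "card (insert g ?S) \<le> card (dl ` B :: ('b \<Rightarrow> 'k) set)"
      using V.independent_span_bound[OF 3 1 2] by (rule conjunct2)
    moreover have "g \<notin> ?S" using ng V.span_base[of g ?S] by (rule contrapos_nn)
    then have "card (insert g ?S) = Suc (card ?S)" using C by (intro card_insert_disjoint finite_imageI)
    ultimately show False using cS by linarith
  qed
  moreover have "V.span ?S \<subseteq> Q ` fspace C"
  proof (rule V.span_minimal)
    show "V.subspace (Q ` fspace C)"
      unfolding V.subspace_def
    proof (intro conjI ballI allI)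
      show "0 \<in> Q ` fspace C" using lin_zero[OF Q] by (metis fspace_zero imageI)
      show "x + y \<in> Q ` fspace C" if "x \<in> Q ` fspace C" "y \<in> Q ` fspace C" for x y
        using that by (auto simp: lin_add[OF Q, symmetric] intro!: imageI fspace_add)
      show "scl c x \<in> Q ` fspace C" if "x \<in> Q ` fspace C" for c x
        using that by (auto simp: lin_scl[OF Q, symmetric] intro!: imageI fspace_scl)
    qed
  qed auto
  ultimately show ?thesis by auto
qed

section \<open>The action of \<open>x\<close> on a tensor product\<close>

text \<open>
  Basis of \<open>k[x]/(x\<^sup>p)\<close> (\<open>\<beta> = 0\<close>) and of \<open>k[x]/((x\<^sup>s - \<beta>)\<^sup>t)\<close>: the pair \<open>(c, m)\<close> with \<open>c < s\<close> and
  \<open>m < n c\<close> stands for \<open>x\<^sup>c (x\<^sup>s - \<beta>)\<^sup>m\<close>.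
\<close>

definition sdom :: "nat \<Rightarrow> (nat \<Rightarrow> nat) \<Rightarrow> (nat \<times> nat) set" where
  "sdom s n = Sigma {..<s} (\<lambda>c. {..<n c})"

text \<open>The exponents \<open>c + s * m\<close> for \<open>(c, m)\<close> in
  \<open>sdom s n\<close> form an initial segment of the natural numbers: the columns do not grow
  with \<open>c\<close>, and column 0 is at most one longer than column \<open>s - 1\<close>. For
  nonzero \<open>\<beta>\<close> the quotient is by a power of \<open>x^s - \<beta>\<close>, so all
  columns have the same length.\<close>

definition shape :: "nat \<Rightarrow> (nat \<Rightarrow> nat) \<Rightarrow> 'k::field \<Rightarrow> bool" where
  "shape s n \<beta> \<longleftrightarrow> 0 < s \<and> (\<forall>c. Suc c < s \<longrightarrow> n (Suc c) \<le> n c) \<and> n 0 \<le> Suc (n (s - 1)) \<and>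
     (\<beta> \<noteq> 0 \<longrightarrow> (\<forall>c<s. n c = n 0))"

text \<open>Multiplication by \<open>x\<close> on coefficient functions. With
  \<open>y = x^s - \<beta>\<close> the case \<open>c = 0\<close> reflects
  \<open>x * x^(s - 1) y^m = y^(m + 1) + \<beta> y^m\<close>; \<open>shift\<close> below is
  multiplication by \<open>y\<close>.\<close>

definition xop :: "nat \<Rightarrow> (nat \<Rightarrow> nat) \<Rightarrow> 'k::field \<Rightarrow> (nat \<times> nat \<Rightarrow> 'k) \<Rightarrow> nat \<times> nat \<Rightarrow> 'k" where
  "xop s n \<beta> f = (\<lambda>(c, m). if (c, m) \<in> sdom s n then
     (if c > 0 then f (c - 1, m) else (if m > 0 then f (s - 1, m - 1) else 0) + \<beta> * f (s - 1, m)) else 0)"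

definition shift :: "nat \<Rightarrow> (nat \<Rightarrow> nat) \<Rightarrow> (nat \<times> nat \<Rightarrow> 'k::field) \<Rightarrow> nat \<times> nat \<Rightarrow> 'k" where
  "shift s n f = (\<lambda>(c, m). if (c, m) \<in> sdom s n \<and> m > 0 then f (c, m - 1) else 0)"

lemma finite_sdom: "finite (sdom s n)"
  by (simp add: sdom_def)

lemma card_sdom: "card (sdom s n) = (\<Sum>c<s. n c)"
  by (simp add: sdom_def)

lemma lin_xop: "lin (xop s n \<beta>)"
  by (rule linI) (auto simp: xop_def fun_eq_iff fapply algebra_simps)

lemma lin_shift: "lin (shift s n)"
  by (rule linI) (auto simp: shift_def fun_eq_iff fapply algebra_simps)

lemma xop_closed: "xop s n \<beta> f \<in> fspace (sdom s n)"
  by (auto simp: xop_def fspace_def)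

lemma shift_closed: "shift s n f \<in> fspace (sdom s n)"
  by (auto simp: shift_def fspace_def)

text \<open>Up to \<open>s\<close> steps wrap around from degree \<open>s - 1\<close> to degree 0 at
  most once, whence two cases and no higher power of \<open>\<beta>\<close>. The case
  \<open>i = s\<close> is \<open>xop_power_s\<close>.\<close>

lemma xop_power:
  assumes sh: "shape s n \<beta>" and f: "f \<in> fspace (sdom s n)" and "i \<le> s"
  shows "(xop s n \<beta> ^^ i) f = (\<lambda>(c, m). if (c, m) \<in> sdom s n then
     (if c \<ge> i then f (c - i, m) else (if m > 0 then f (c + s - i, m - 1) else 0) + \<beta> * f (c + s - i, m)) else 0)"
  using assms(3)
proof (induction i)
  case 0
  then show ?case using f by (auto simp: fun_eq_iff fspace_def)
next
  case (Suc i)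
  note h = sh[unfolded shape_def]
  define g where "g = (xop s n \<beta> ^^ i) f"
  have ih: "g (c, m) = (if (c, m) \<in> sdom s n then
     (if c \<ge> i then f (c - i, m) else (if m > 0 then f (c + s - i, m - 1) else 0) + \<beta> * f (c + s - i, m)) else 0)" for c m
    using Suc by (simp add: g_def)
  have gS: "(xop s n \<beta> ^^ Suc i) f = xop s n \<beta> g" by (simp add: g_def)
  show ?case unfolding gS
  proof (rule ext, clarify)
    fix c m
    show "xop s n \<beta> g (c, m) = (if (c, m) \<in> sdom s n then
      (if c \<ge> Suc i then f (c - Suc i, m) else (if m > 0 then f (c + s - Suc i, m - 1) else 0) + \<beta> * f (c + s - Suc i, m)) else 0)"
    proof (cases "(c, m) \<in> sdom s n")
      case False then show ?thesis by (simp add: xop_def)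
    next
      case True
      then have cm: "c < s" "m < n c" by (auto simp: sdom_def)
      show ?thesis
      proof (cases c)
        case (Suc c')
        then have "n c \<le> n c'" using h cm by blast
        then have "(c', m) \<in> sdom s n" using cm Suc by (auto simp: sdom_def)
        then show ?thesis using True Suc Suc.prems by (simp add: xop_def ih)
      next
        case 0
        \<comment> \<open>The value in degree 0 is read off column \<open>s - 1\<close>. The bound
          on \<open>n 0\<close> puts \<open>(s - 1, m - 1)\<close> into the domain; the entry at
          \<open>(s - 1, m)\<close> matters only for nonzero \<open>\<beta>\<close>, when both
          columns have equal length.\<close>
        have "n 0 \<le> Suc (n (s - 1))" "0 < s" using h by blast+
        then have 1: "(s - 1, m - 1) \<in> sdom s n" if "m > 0" using that cm 0 by (auto simp: sdom_def)
        have 2: "(s - 1, m) \<in> sdom s n" if "\<beta> \<noteq> 0"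
        proof -
          have "n (s - 1) = n 0" using h that by (metis diff_less zero_less_one)
          then show ?thesis using cm 0 by (auto simp: sdom_def)
        qed
        have "xop s n \<beta> g (c, m) = (if m > 0 then g (s - 1, m - 1) else 0) + \<beta> * g (s - 1, m)"
          using True 0 by (simp add: xop_def)
        also have "\<dots> = (if m > 0 then f (s - Suc i, m - 1) else 0) + \<beta> * f (s - Suc i, m)"
          proof -
          have 3: "i \<le> s - 1" "s - 1 - i = s - Suc i" using Suc.prems by auto
          have "g (s - 1, m - 1) = f (s - Suc i, m - 1)" if "m > 0" using 1[OF that] 3 by (simp add: ih)
          moreover have "\<beta> * g (s - 1, m) = \<beta> * f (s - Suc i, m)" using 2 3 by (cases "\<beta> = 0") (simp_all add: ih)
          ultimately show ?thesis by (cases m) auto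
        qed
        finally show ?thesis using True 0 by simp
      qed
    qed
  qed
qed

lemma xop_power_s:
  assumes "shape s n \<beta>" "f \<in> fspace (sdom s n)"
  shows "(xop s n \<beta> ^^ s) f = scl \<beta> f + shift s n f"
  using assms(2) by (subst xop_power[OF assms order_refl])
    (auto simp: fun_eq_iff fapply shift_def sdom_def fspace_def)

text \<open>The step from degree \<open>s - 1\<close> to degree 0 raises the degree by 1 only modulo
  \<open>s\<close>; on the grading this is \<open>z ^ (s - 1) = inverse z\<close>.\<close>

lemma graded_xop:
  assumes sh: "shape s n \<beta>"
  shows "graded s (sdom s n) fst (xop s n \<beta>)"
  unfolding graded_def
proof (intro conjI ballI allI impI)
  fix z :: 'a and f assume z: "z ^ s = 1"
  have s: "0 < s" using sh by (simp add: shape_def)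
  have z0: "z \<noteq> 0" using z s by (metis power_0_left zero_neq_one less_irrefl)
  have "z ^ (s - 1) = inverse z"
  proof -
    have "z * z ^ (s - 1) = 1" using z s by (metis power_eq_if less_irrefl)
    then show ?thesis by (metis inverse_unique)
  qed
  moreover have "z ^ (c - 1) = inverse z * z ^ c" if "0 < c" for c
    using z0 that by (cases c) auto
  ultimately show "xop s n \<beta> (Dg fst z f) = scl (inverse z) (Dg fst z (xop s n \<beta> f))"
    by (auto simp: fun_eq_iff fapply xop_def Dg_def algebra_simps)
qed (auto simp: finite_sdom lin_xop xop_closed)

lemma xop_dl:
  assumes sh: "shape s n \<beta>" and cm: "(c, m) \<in> sdom s n"
  shows "xop s n \<beta> (dl (c, m)) = (if Suc c < s then (if (Suc c, m) \<in> sdom s n then dl (Suc c, m) else 0)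
    else (if (0, Suc m) \<in> sdom s n then dl (0, Suc m) else 0) + scl \<beta> (dl (0, m)))"
proof -
  note h = sh[unfolded shape_def]
  have z: "(0, m) \<in> sdom s n" if "\<beta> \<noteq> 0"
  proof -
    have "c < s" "m < n c" using cm by (auto simp: sdom_def)
    moreover from this have "n c = n 0" using h that by blast
    ultimately show ?thesis by (simp add: sdom_def)
  qed
  have cs: "c < s" "m < n c" using cm by (auto simp: sdom_def)
  show ?thesis
  proof (rule ext, clarify)
    fix c' m'
    show "xop s n \<beta> (dl (c, m)) (c', m') = (if Suc c < s then (if (Suc c, m) \<in> sdom s n then dl (Suc c, m) else 0)
      else (if (0, Suc m) \<in> sdom s n then dl (0, Suc m) else 0) + scl \<beta> (dl (0, m))) (c', m')"
    proof (cases c')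
      case (Suc c'')
      have "xop s n \<beta> (dl (c, m)) (c', m') = (if (c', m') \<in> sdom s n \<and> c'' = c \<and> m' = m then 1 else 0)"
        by (simp add: xop_def dl_def Suc)
      moreover have "(if (Suc c, m) \<in> sdom s n then dl (Suc c, m) else 0) (c', m') =
          (if (c', m') \<in> sdom s n \<and> c'' = c \<and> m' = m then 1 else 0 :: 'a)"
        by (auto simp: dl_def Suc fapply)
      moreover have "((if (0, Suc m) \<in> sdom s n then dl (0, Suc m) else 0) + scl \<beta> (dl (0, m))) (c', m') = 0"
        by (simp add: dl_def Suc fapply)
      moreover have "(c', m') \<notin> sdom s n" if "\<not> Suc c < s" "c'' = c" using that Suc by (simp add: sdom_def)
      ultimately show ?thesis by (cases "Suc c < s") auto
    next
      case 0
      show ?thesis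
      proof (cases "Suc c < s")
        case True
        then have "s - Suc 0 \<noteq> c" by simp
        then show ?thesis using 0 True by (auto simp: xop_def dl_def fapply)
      next
        case False
        then have c: "c = s - 1" using cs by simp
        show ?thesis
        proof (cases "(0, m') \<in> sdom s n")
          case True
          then show ?thesis using 0 False c by (cases m') (auto simp: xop_def dl_def fapply)
        next
          case F: False
          then show ?thesis using 0 False z by (auto simp: xop_def dl_def fapply)
        qed
      qed
    qed
  qed
qed

lemma Dg_Dg: "Dg d z (Dg d w f) = Dg d (z * w) f"
  by (simp add: Dg_def power_mult_distrib mult.assoc)

text \<open>
  The assumption \<open>count\<close> says that the degree \<open>0\<close> part modulo \<open>s\<close> has \<open>1/s\<close> of the total dimension. It
  holds if \<open>n1\<close> or \<open>n2\<close> is constant, and it makes the translates of the strings a basis.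
\<close>

locale two_factors =
  fixes s :: nat and n1 n2 :: "nat \<Rightarrow> nat" and \<beta>1 \<beta>2 \<omega> q :: "'k::field_char_0"
  assumes sh1: "shape s n1 \<beta>1" and sh2: "shape s n2 \<beta>2" and \<omega>: "\<omega> \<noteq> 0"
    and q: "q ^ s = 1" "\<And>i. \<lbrakk>0 < i; i < s\<rbrakk> \<Longrightarrow> q ^ i \<noteq> 1"
    and \<gamma>: "\<omega> ^ s * \<beta>1 + \<beta>2 \<noteq> 0"
    and count: "s * (\<Sum>c<s. n1 c * n2 ((s - c) mod s)) = (\<Sum>c<s. n1 c) * (\<Sum>c<s. n2 c)"
begin

abbreviation "E1 \<equiv> sdom s n1"
abbreviation "E2 \<equiv> sdom s n2"
abbreviation "x1 \<equiv> xop s n1 \<beta>1"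
abbreviation "x2 \<equiv> xop s n2 \<beta>2"
abbreviation "\<kappa> \<equiv> \<omega> ^ s"
abbreviation "E \<equiv> E1 \<times> E2"

definition "\<gamma> = \<kappa> * \<beta>1 + \<beta>2"
text \<open>The action of \<open>a\<close> on the second factor, moved to its graded part:
  \<open>a\<close> acts by \<omega> on the simple module and by \<open>\<chi> a ^ c = q ^ c\<close>
  on degree \<open>c\<close>. As \<open>q ^ s = 1\<close>, its \<open>s\<close>-th power is the
  scalar \<kappa>.\<close>

definition "twist = (\<lambda>f. scl \<omega> (Dg fst q f) :: nat \<times> nat \<Rightarrow> 'k)"
definition "opA = kron x1 twist"
definition "opB = kron (\<lambda>f. f) x2"
definition "xt = (\<lambda>\<phi>. opA \<phi> + opB \<phi>)"
definition "dg = (\<lambda>(e1, e2). fst e1 + fst e2 :: nat)"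
definition "nil = (\<lambda>\<phi>. scl \<kappa> (kron (shift s n1) (\<lambda>f. f) \<phi>) + kron (\<lambda>f. f) (shift s n2) \<phi>)"

lemma s0: "0 < s" using sh1 by (simp add: shape_def)

lemma finE: "finite E1" "finite E2" "finite E" by (simp_all add: finite_sdom)

lemma lin_twist: "lin twist"
  unfolding twist_def by (rule lin_scale[OF lin_Dg])

lemma twist_closed: "f \<in> fspace S \<Longrightarrow> twist f \<in> fspace S"
  by (simp add: twist_def fspace_scl Dg_closed)

lemma lins: "lin opA" "lin opB" "lin xt" "lin nil"
  unfolding opA_def opB_def xt_def nil_def
  by (rule lin_kron[OF lin_xop lin_twist], rule lin_kron[OF lin_id lin_xop],
    rule lin_plus[OF lin_kron[OF lin_xop lin_twist] lin_kron[OF lin_id lin_xop]],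
    rule lin_plus[OF lin_scale[OF lin_kron[OF lin_shift lin_id]] lin_kron[OF lin_id lin_shift]])

lemma op_tens: "opA (tens f g) = tens (x1 f) (twist g)" "opB (tens f g) = tens f (x2 g)"
  unfolding opA_def opB_def by (rule kron_tens[OF lin_xop lin_twist], rule kron_tens[OF lin_id lin_xop])

lemma opA_closed: "\<phi> \<in> fspace E \<Longrightarrow> opA \<phi> \<in> fspace E"
  unfolding opA_def by (rule kron_closed[OF lin_xop lin_twist xop_closed twist_closed])

lemma opB_closed: "\<phi> \<in> fspace E \<Longrightarrow> opB \<phi> \<in> fspace E"
  unfolding opB_def by (rule kron_closed[OF lin_id lin_xop _ xop_closed])

lemma xt_closed: "\<phi> \<in> fspace E \<Longrightarrow> xt \<phi> \<in> fspace E"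
  unfolding xt_def by (intro fspace_add opA_closed opB_closed)

lemma q0: "q \<noteq> 0"
  using q(1) s0 by (metis power_0_left zero_neq_one less_irrefl)

lemma x2_Dg: "\<lbrakk>z ^ s = 1; f \<in> fspace E2\<rbrakk> \<Longrightarrow> x2 (Dg fst z f) = scl (inverse z) (Dg fst z (x2 f))"
  and x1_Dg: "\<lbrakk>z ^ s = 1; f \<in> fspace E1\<rbrakk> \<Longrightarrow> x1 (Dg fst z f) = scl (inverse z) (Dg fst z (x1 f))"
  using graded_xop[OF sh1] graded_xop[OF sh2] by (auto simp: graded_def)

text \<open>\<open>x2\<close> raises the degree in the second factor by 1, so exchanging it with
  \<open>twist\<close> produces one factor \<open>q\<close>.\<close>

lemma AB: "\<phi> \<in> fspace E \<Longrightarrow> opA (opB \<phi>) = scl q (opB (opA \<phi>))"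
proof (rule kron_eqI[OF _ _ finE(1,2), of "\<lambda>\<phi>. opA (opB \<phi>)" "\<lambda>\<phi>. scl q (opB (opA \<phi>))"])
  have qq: "q * (\<omega> * inverse q) = \<omega>" using q0 by simp
  show "lin (\<lambda>\<phi>. opA (opB \<phi>))" by (rule lin_comp[OF lins(1,2)])
  show "lin (\<lambda>\<phi>. scl q (opB (opA \<phi>)))" by (rule lin_scale[OF lin_comp[OF lins(2,1)]])
  show "opA (opB (tens f g)) = scl q (opB (opA (tens f g)))" if "f \<in> fspace E1" "g \<in> fspace E2" for f g
    using that by (simp add: op_tens twist_def lin_scl[OF lin_xop] x2_Dg[OF q(1)] tens_scl lin_scl[OF lins(2)] mult.commute)
        (simp only: qq)
qed

lemma funpow_tens:
  fixes K :: "('a \<Rightarrow> 'k) \<Rightarrow> 'a \<Rightarrow> 'k" and K' :: "('b \<Rightarrow> 'k) \<Rightarrow> 'b \<Rightarrow> 'k"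
  assumes L: "\<And>f g. L (tens f g) = tens (K f) (K' g)"
  shows "(L ^^ i) (tens f g) = tens ((K ^^ i) f) ((K' ^^ i) g)"
  by (induction i) (simp_all add: L)

lemma twist_power: "(twist ^^ i) g = scl (\<omega> ^ i) (Dg fst (q ^ i) g)"
proof (induction i)
  case 0 then show ?case by (simp add: Dg_def)
next
  case (Suc i) then show ?case by (simp add: twist_def lin_scl[OF lin_Dg] Dg_Dg)
qed

lemma id_power: "((\<lambda>f. f) ^^ i) f = f"
  by (induction i) auto

lemma xt_power: "\<phi> \<in> fspace E \<Longrightarrow> (xt ^^ s) \<phi> = scl \<gamma> \<phi> + nil \<phi>"
proof -
  assume \<phi>: "\<phi> \<in> fspace E"
  have "(xt ^^ s) \<phi> = (opA ^^ s) \<phi> + (opB ^^ s) \<phi>"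
    unfolding xt_def by (rule qbinom_power_root[OF lins(1,2) opA_closed opB_closed AB \<phi> q s0])
  also have "\<dots> = scl \<gamma> \<phi> + nil \<phi>"
  proof (rule kron_eqI[OF _ _ finE(1,2) \<phi>])
    show "lin (\<lambda>\<phi>. (opA ^^ s) \<phi> + (opB ^^ s) \<phi>)" by (rule lin_plus[OF lin_pow[OF lins(1)] lin_pow[OF lins(2)]])
    show "lin (\<lambda>\<phi>. scl \<gamma> \<phi> + nil \<phi>)" by (rule lin_plus[OF lin_scale[OF lin_id] lins(4)])
    fix f g :: "nat \<times> nat \<Rightarrow> 'k" assume fg: "f \<in> fspace E1" "g \<in> fspace E2"
    \<comment> \<open>The graded part of the \<open>s\<close>-th power of \<open>twist\<close> is
      \<open>Dg\<close> at \<open>q ^ s = 1\<close>.\<close>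
    have "Dg fst 1 g = g" by (simp add: Dg_def)
    then have "(opA ^^ s) (tens f g) = scl \<kappa> (tens (scl \<beta>1 f + shift s n1 f) g)"
      by (simp add: funpow_tens[where L = opA and K = x1 and K' = twist, OF op_tens(1)]
        twist_power q xop_power_s[OF sh1 fg(1)] tens_scl)
    moreover have "(opB ^^ s) (tens f g) = tens f (scl \<beta>2 g + shift s n2 g)"
      by (simp add: funpow_tens[where L = opB and K = "\<lambda>f. f" and K' = x2, OF op_tens(2)]
        id_power xop_power_s[OF sh2 fg(2)])
    ultimately show "(opA ^^ s) (tens f g) + (opB ^^ s) (tens f g) = scl \<gamma> (tens f g) + nil (tens f g)"
      by (simp add: nil_def kron_tens[OF lin_shift lin_id] kron_tens[OF lin_id lin_shift] tens_add tens_scl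
        scl_add \<gamma>_def)
  qed
  finally show ?thesis .
qed

lemma Dg_dg: "Dg dg z = kron (Dg fst z) (Dg fst z)"
  by (auto simp: fun_eq_iff kron_def Dg_def dg_def power_add)

lemma graded_xt: "graded s E dg xt"
  unfolding graded_def
proof (intro conjI ballI allI impI)
  fix z :: 'k and \<phi> :: "(nat \<times> nat) \<times> nat \<times> nat \<Rightarrow> 'k" assume z: "z ^ s = 1" and \<phi>: "\<phi> \<in> fspace E"
  have l: "lin (kron (Dg fst z) (Dg fst z) :: (_ \<Rightarrow> 'k) \<Rightarrow> _)" by (rule lin_kron[OF lin_Dg lin_Dg])
  have t: "twist (Dg fst z g) = Dg fst z (twist g)" for g
    by (simp add: twist_def lin_scl[OF lin_Dg] Dg_Dg mult.commute)
  show "xt (Dg dg z \<phi>) = scl (inverse z) (Dg dg z (xt \<phi>))"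
    unfolding Dg_dg
  proof (rule kron_eqI[OF _ _ finE(1,2) \<phi>])
    show "lin (\<lambda>\<phi>. xt (kron (Dg fst z) (Dg fst z) \<phi>))" by (rule lin_comp[OF lins(3) l])
    show "lin (\<lambda>\<phi>. scl (inverse z) (kron (Dg fst z) (Dg fst z) (xt \<phi>)))" by (rule lin_scale[OF lin_comp[OF l lins(3)]])
    show "xt (kron (Dg fst z) (Dg fst z) (tens f g)) = scl (inverse z) (kron (Dg fst z) (Dg fst z) (xt (tens f g)))"
      if "f \<in> fspace E1" "g \<in> fspace E2" for f g
      using that by (simp add: xt_def kron_tens op_tens lin_add[OF l] x1_Dg[OF z] x2_Dg[OF z] tens_scl scl_add t)
  qed
qed (use lins finE xt_closed in auto)

lemma nil_apply: "nil \<phi> ((a1, m1), (a2, m2)) =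
  \<kappa> * (if (a1, m1) \<in> E1 \<and> m1 > 0 then \<phi> ((a1, m1 - 1), (a2, m2)) else 0) +
  (if (a2, m2) \<in> E2 \<and> m2 > 0 then \<phi> ((a1, m1), (a2, m2 - 1)) else 0)"
  by (simp add: nil_def kron_def shift_def fapply)

text \<open>If \<open>xt\<close> kills \<phi>, so does \<open>xt ^^ s\<close>, that is, \<gamma>
  plus \<open>nil\<close>. At a point with second coordinates \<open>m1\<close>, \<open>m2\<close>
  the value of \<open>nil \<phi>\<close> involves only points with a smaller sum
  \<open>m1 + m2\<close>; by induction on this sum \<phi> vanishes, since \<gamma> is
  nonzero.\<close>

lemma xt_inj:
  assumes \<phi>: "\<phi> \<in> fspace E" "xt \<phi> = 0"
  shows "\<phi> = 0"
proof -
  have "(xt ^^ s) \<phi> = (xt ^^ (s - 1)) (xt \<phi>)" using s0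
    by (metis Suc_diff_1 comp_apply funpow_Suc_right)
  then have e: "scl \<gamma> \<phi> + nil \<phi> = 0" using xt_power[OF \<phi>(1)] \<phi>(2) lin_zero[OF lin_pow[OF lins(3)]] by simp
  have g0: "\<gamma> \<noteq> 0" using \<gamma> by (simp add: \<gamma>_def)
  have "\<phi> ((a1, m1), (a2, m2)) = 0" for a1 m1 a2 m2
  proof (induction "m1 + m2" arbitrary: m1 m2 rule: less_induct)
    case less
    have "nil \<phi> ((a1, m1), (a2, m2)) = 0" using less by (simp add: nil_apply)
    moreover have "\<gamma> * \<phi> ((a1, m1), (a2, m2)) + nil \<phi> ((a1, m1), (a2, m2)) = 0"
      using fun_cong[OF e, of "((a1, m1), (a2, m2))"] by (simp add: fapply)
    ultimately show ?case using g0 by simp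
  qed
  then show ?thesis by (auto simp: fun_eq_iff fapply)
qed

lemma xt_pow_closed: "\<phi> \<in> fspace E \<Longrightarrow> (xt ^^ i) \<phi> \<in> fspace E"
  using funpow_closed[of "fspace E" xt \<phi> i] xt_closed by blast

lemma xt_pow_inj: "\<lbrakk>\<phi> \<in> fspace E; (xt ^^ i) \<phi> = 0\<rbrakk> \<Longrightarrow> \<phi> = 0"
proof (induction i arbitrary: \<phi>)
  case (Suc i)
  then show ?case using xt_inj[OF xt_pow_closed[OF Suc.prems(1), of i]] by simp
qed simp

section \<open>Strings in the tensor product and the change of basis \<open>Q\<close>\<close>

definition "neg c = (s - c) mod s"

definition emb :: "nat \<Rightarrow> nat \<Rightarrow> (nat \<times> nat \<Rightarrow> 'k) \<Rightarrow> (nat \<times> nat) \<times> (nat \<times> nat) \<Rightarrow> 'k" where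
  "emb c1 c2 \<phi> = (\<lambda>((a1, m1), (a2, m2)). if a1 = c1 \<and> a2 = c2 then \<phi> (m1, m2) else 0)"

lemma lin_emb: "lin (emb c1 c2)"
  by (rule linI) (auto simp: emb_def fun_eq_iff fapply)

lemma neg_less: "neg c < s" using s0 by (simp add: neg_def)

lemma emb_closed: "\<lbrakk>\<phi> \<in> fspace (rect (n1 c1) (n2 c2)); c1 < s; c2 < s\<rbrakk> \<Longrightarrow> emb c1 c2 \<phi> \<in> fspace E"
  by (auto simp: fspace_def emb_def rect_def sdom_def)

lemma nil_emb:
  assumes "\<phi> \<in> fspace (rect (n1 c1) (n2 c2))" "c1 < s" "c2 < s"
  shows "nil (emb c1 c2 \<phi>) = emb c1 c2 (raising (n1 c1) (n2 c2) \<kappa> \<phi>)"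
proof (rule ext, clarify)
  fix a1 m1 a2 m2
  have z: "\<phi> (a, b) = 0" if "\<not> (a < n1 c1 \<and> b < n2 c2)" for a b
    using assms(1) that by (auto simp: fspace_def rect_def)
  show "nil (emb c1 c2 \<phi>) ((a1, m1), (a2, m2)) = emb c1 c2 (raising (n1 c1) (n2 c2) \<kappa> \<phi>) ((a1, m1), (a2, m2))"
    using assms(2,3) z[of "m1 - 1" m2] z[of m1 "m2 - 1"]
    by (auto simp: nil_apply emb_def raising_def sdom_def)
qed

text \<open>The source of \<open>Q\<close>: for every string a copy of
  \<open>k[x]/((x^s - \<gamma>)^len)\<close> with the basis used before. A string is named by its
  bidegree \<open>(c, neg c)\<close> and the degree \<open>j\<close> of its lowest vector. The basis
  elements with \<open>c = 0\<close> go to the vectors of the string, and the others are forced by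
  compatibility with \<open>x\<close>.\<close>

definition "idx = Sigma {..<s} (\<lambda>c. {..<min (n1 c) (n2 (neg c))})"
definition "len = (\<lambda>(c, j). n1 c + n2 (neg c) - 1 - 2 * j)"
definition "vec = (\<lambda>(c, j) m. emb c (neg c) (string (n1 c) (n2 (neg c)) \<kappa> j m))"
definition "E' = Sigma idx (\<lambda>l. sdom s (\<lambda>_. len l))"
definition deg' :: "(nat \<times> nat) \<times> (nat \<times> nat) \<Rightarrow> nat" where "deg' = (\<lambda>(l, e). fst e)"
definition "x' f = (\<lambda>(l, e). xop s (\<lambda>_. len l) \<gamma> (\<lambda>e. f (l, e)) e)"
definition "bas = (\<lambda>(l, (c, m)). (xt ^^ c) (vec l m))"
definition "Q f = (\<Sum>p\<in>E'. scl (f p) (bas p))"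

lemma idxD: "(c, j) \<in> idx \<longleftrightarrow> c < s \<and> j < min (n1 c) (n2 (neg c))"
  by (auto simp: idx_def)

lemma finE': "finite E'"
  by (auto simp: E'_def idx_def finite_sdom)

text \<open>The lengths of the strings in bidegree \<open>(c, neg c)\<close> add up to
  \<open>n1 c * n2 (neg c)\<close>, each vector has \<open>s\<close> translates, and
  \<open>count\<close> identifies the total with the dimension of the tensor product.\<close>

lemma card_E': "card E' = card E"
proof -
  have "card E' = (\<Sum>l\<in>idx. s * len l)"
    unfolding E'_def by (subst card_SigmaI) (auto simp: idx_def finite_sdom card_sdom)
  also have "\<dots> = (\<Sum>c<s. \<Sum>j<min (n1 c) (n2 (neg c)). s * (n1 c + n2 (neg c) - 1 - 2 * j))"
    unfolding idx_def by (subst sum.Sigma) (auto simp: len_def split_beta)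
  also have "\<dots> = (\<Sum>c<s. s * (n1 c * n2 (neg c)))"
    by (simp only: sum_distrib_left[symmetric] string_count_all)
  also have "\<dots> = s * (\<Sum>c<s. n1 c * n2 (neg c))" by (simp add: sum_distrib_left)
  also have "\<dots> = card E" using count by (simp add: card_cartesian_product card_sdom neg_def)
  finally show ?thesis .
qed

lemma vec_closed: "l \<in> idx \<Longrightarrow> vec l m \<in> fspace E"
  by (cases l) (auto simp: vec_def idxD neg_less intro!: emb_closed homogeneous_fspace homogeneous_string)

lemma nil_vec: "l \<in> idx \<Longrightarrow> nil (vec l m) = vec l (Suc m)"
proof -
  assume l: "l \<in> idx"
  obtain c j where cj: "l = (c, j)" "c < s" "j < min (n1 c) (n2 (neg c))" using l by (cases l) (auto simp: idxD)
  show ?thesis unfolding cj(1) vec_def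
    using nil_emb[OF homogeneous_fspace[OF homogeneous_string[OF cj(3), of m \<kappa>]] cj(2) neg_less]
    by (simp add: string_Suc)
qed

lemma kappa: "\<kappa> \<noteq> 0" using \<omega> by simp

lemma vec_top: "l \<in> idx \<Longrightarrow> vec l (len l) = 0"
proof -
  assume l: "l \<in> idx"
  obtain c j where cj: "l = (c, j)" "j < min (n1 c) (n2 (neg c))" using l by (cases l) (auto simp: idxD)
  show ?thesis using string_top[OF cj(2) kappa] by (simp add: cj(1) vec_def len_def lin_zero[OF lin_emb])
qed

lemma bas_closed: "p \<in> E' \<Longrightarrow> bas p \<in> fspace E"
  by (auto simp: E'_def bas_def intro!: xt_pow_closed vec_closed)

lemma lin_Q: "lin Q"
  by (rule linI) (simp_all add: Q_def fapply scl_add sum.distrib scl_sum)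

lemma Q_closed: "Q f \<in> fspace E"
  unfolding Q_def by (intro fspace_sum fspace_scl bas_closed)

lemma Q_dl: "p \<in> E' \<Longrightarrow> Q (dl p) = bas p"
proof -
  assume p: "p \<in> E'"
  have "Q (dl p) = (\<Sum>p'\<in>E'. if p' = p then bas p' else 0)"
    unfolding Q_def by (rule sum.cong[OF refl]) (simp add: dl_def)
  then show ?thesis using p finE' by simp
qed

lemma lin_x': "lin x'"
  unfolding x'_def by (rule linI) (auto simp: fun_eq_iff xop_def fapply algebra_simps)

lemma shape': "shape s (\<lambda>_. k) \<gamma>"
  using s0 by (simp add: shape_def)

lemma x'_dl:
  assumes "(l, (c, m)) \<in> E'"
  shows "x' (dl (l, (c, m))) = (if Suc c < s then dl (l, (Suc c, m))
    else (if Suc m < len l then dl (l, (0, Suc m)) else 0) + scl \<gamma> (dl (l, (0, m))))"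
proof (rule ext, clarify)
  fix l' :: "nat \<times> nat" and c' m' :: nat
  have lc: "c < s" "m < len l" "l \<in> idx" using assms by (auto simp: E'_def sdom_def)
  have d: "(\<lambda>e. dl (l, (c, m)) (l', e)) = (if l' = l then dl (c, m) else 0)"
    by (auto simp: dl_def fun_eq_iff fapply)
  show "x' (dl (l, (c, m))) (l', c', m') = (if Suc c < s then dl (l, (Suc c, m))
    else (if Suc m < len l then dl (l, (0, Suc m)) else 0) + scl \<gamma> (dl (l, (0, m)))) (l', c', m')"
  proof (cases "l' = l")
    case True
    have "(c, m) \<in> sdom s (\<lambda>_. len l)" using lc by (simp add: sdom_def)
    from xop_dl[OF shape' this] show ?thesis using True lc s0
      by (auto simp: x'_def d sdom_def dl_def fapply)
  next
    case False
    then show ?thesis by (simp add: x'_def d lin_zero[OF lin_xop]) (simp add: dl_def fapply)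
  qed
qed

text \<open>The point is the wrap-around at \<open>c = s - 1\<close>: there \<open>x'\<close> takes
  the value of \<open>xt_power\<close> on a vector of the string, because \<open>nil\<close> moves
  to the next vector. After the last vector the truncation in \<open>x'\<close> agrees with
  \<open>vec_top\<close>.\<close>

lemma Q_x':
  assumes f: "f \<in> fspace E'"
  shows "Q (x' f) = xt (Q f)"
proof (rule lin_eqI[OF lin_comp[OF lin_Q lin_x'] lin_comp[OF lins(3) lin_Q] finE' f])
  fix p assume p: "p \<in> E'"
  then obtain l c m where lcm: "p = (l, (c, m))" by (metis surj_pair)
  have lc: "c < s" "m < len l" "l \<in> idx" using p lcm by (auto simp: E'_def sdom_def)
  show "Q (x' (dl p)) = xt (Q (dl p))"
  proof (cases "Suc c < s")
    case True
    then have "(l, (Suc c, m)) \<in> E'" using lc by (simp add: E'_def sdom_def)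
    then show ?thesis using p True by (simp add: lcm x'_dl Q_dl bas_def)
  next
    case False
    then have sc: "s = Suc c" using lc by simp
    have 1: "Q (if Suc m < len l then dl (l, (0, Suc m)) else 0) = vec l (Suc m)"
    proof (cases "Suc m < len l")
      case True
      then have "(l, (0, Suc m)) \<in> E'" using lc by (simp add: E'_def sdom_def)
      then show ?thesis using True by (simp add: Q_dl bas_def)
    next
      case False
      then have "Suc m = len l" using lc by simp
      then show ?thesis using vec_top[OF lc(3)] by (simp add: lin_zero[OF lin_Q])
    qed
    have "(l, (0, m)) \<in> E'" using lc by (simp add: E'_def sdom_def)
    then have 2: "Q (dl (l, (0, m))) = vec l m" by (simp add: Q_dl bas_def)
    have "xt ((xt ^^ c) (vec l m)) = (xt ^^ s) (vec l m)"
      using arg_cong[OF sc, of "\<lambda>k. (xt ^^ k) (vec l m)"] by simp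
    then have "xt (Q (dl p)) = (xt ^^ s) (vec l m)" using p by (simp add: lcm Q_dl bas_def)
    then show ?thesis using p False
      by (simp add: lcm x'_dl lin_add[OF lin_Q] lin_scl[OF lin_Q] 1 2 xt_power[OF vec_closed[OF lc(3)]]
        nil_vec[OF lc(3)] add.commute)
  qed
qed

text \<open>This is the reason for \<open>neg\<close>: the two degrees of a string add up to 0 or to
  \<open>s\<close>, so the strings lie in total degree 0 modulo \<open>s\<close>.\<close>

lemma Dg_vec:
  assumes z: "z ^ s = 1" and l: "l \<in> idx"
  shows "Dg dg z (vec l m) = vec l m"
proof -
  obtain c j where cj: "l = (c, j)" "c < s" using l by (cases l) (auto simp: idxD)
  have "z ^ (c + neg c) = 1"
    using cj(2) z by (cases "c = 0") (simp_all add: neg_def)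
  then show ?thesis by (auto simp: cj vec_def emb_def Dg_def dg_def fun_eq_iff)
qed

lemma Dg_bas:
  assumes z: "z ^ s = 1" and p: "p \<in> E'"
  shows "Dg dg z (bas p) = scl (z ^ deg' p) (bas p)"
proof -
  obtain l c m where lcm: "p = (l, (c, m))" by (metis surj_pair)
  have l: "l \<in> idx" using p lcm by (auto simp: E'_def)
  have z0: "z \<noteq> 0" using z s0 by (metis power_0_left zero_neq_one less_irrefl)
  have "Dg dg z ((xt ^^ c) (vec l m)) = scl (z ^ c) ((xt ^^ c) (vec l m))"
  proof (induction c)
    case 0 then show ?case using Dg_vec[OF z l] by simp
  next
    case (Suc c)
    have "xt (Dg dg z ((xt ^^ c) (vec l m))) = scl (inverse z) (Dg dg z (xt ((xt ^^ c) (vec l m))))"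
      using graded_xt xt_pow_closed[OF vec_closed[OF l]] z unfolding graded_def by blast
    then have "scl z (xt (scl (z ^ c) ((xt ^^ c) (vec l m)))) = Dg dg z (xt ((xt ^^ c) (vec l m)))"
      using z0 by (simp add: Suc)
    then show ?case by (simp add: lin_scl[OF lins(3)])
  qed
  then show ?thesis by (simp add: lcm bas_def deg'_def)
qed

lemma Q_Dg:
  assumes z: "z ^ s = 1" and f: "f \<in> fspace E'"
  shows "Q (Dg deg' z f) = Dg dg z (Q f)"
proof (rule lin_eqI[OF lin_comp[OF lin_Q lin_Dg] lin_comp[OF lin_Dg lin_Q] finE' f])
  fix p assume p: "p \<in> E'"
  have "Dg deg' z (dl p) = scl (z ^ deg' p) (dl p)" by (auto simp: Dg_def dl_def fun_eq_iff fapply)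
  then show "Q (Dg deg' z (dl p)) = Dg dg z (Q (dl p))"
    using p by (simp add: lin_scl[OF lin_Q] Q_dl Dg_bas[OF z])
qed

lemma q_inj:
  assumes "c < s" "c' < s" "q ^ c = q ^ c'"
  shows "c = c'"
proof -
  have "c = c'" if "c \<le> c'" "c' < s" "q ^ c = q ^ c'" for c c'
  proof (rule ccontr)
    assume "c \<noteq> c'"
    then have "q ^ (c' - c) \<noteq> 1" using that q(2)[of "c' - c"] by simp
    moreover have "q ^ c * q ^ (c' - c) = q ^ c'" by (metis le_add_diff_inverse power_add that(1))
    then have "q ^ c * q ^ (c' - c) = q ^ c" using that(3) by simp
    ultimately show False using q0 by simp
  qed
  then show ?thesis using assms by (metis nle_le)
qed

text \<open>\<open>Q f\<close> is sorted by the power of \<open>xt\<close>. The summand with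
  \<open>xt ^^ c\<close> is an eigenvector of \<open>Dg dg q\<close> for \<open>q ^ c\<close>, and
  these eigenvalues are distinct, so every summand vanishes. Injectivity of \<open>xt\<close>
  removes the power. Restricted to one bidegree, the remaining relation is one between the strings
  of a rectangle, where \<open>string_independent\<close> applies.\<close>

lemma Q_inj:
  assumes f: "f \<in> fspace E'" and z: "Q f = 0"
  shows "f = 0"
proof -
  define part where "part c = (\<Sum>l\<in>idx. \<Sum>m<len l. scl (f (l, (c, m))) (vec l m))" for c
  have part_closed: "part c \<in> fspace E" for c
    unfolding part_def by (intro fspace_sum fspace_scl vec_closed)
  have fidx: "finite idx" by (simp add: idx_def)
  have Qf: "Q f = (\<Sum>c<s. (xt ^^ c) (part c))"
  proof -
    have "Q f = (\<Sum>l\<in>idx. \<Sum>e\<in>sdom s (\<lambda>_. len l). scl (f (l, e)) (bas (l, e)))"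
      unfolding Q_def E'_def by (subst sum.Sigma) (auto simp: fidx finite_sdom split_beta)
    also have "\<dots> = (\<Sum>l\<in>idx. \<Sum>c<s. \<Sum>m<len l. scl (f (l, (c, m))) (bas (l, (c, m))))"
      unfolding sdom_def by (rule sum.cong[OF refl], subst sum.Sigma) (auto simp: split_beta)
    also have "\<dots> = (\<Sum>c<s. \<Sum>l\<in>idx. \<Sum>m<len l. scl (f (l, (c, m))) (bas (l, (c, m))))"
      by (rule sum.swap)
    also have "\<dots> = (\<Sum>c<s. (xt ^^ c) (part c))"
      by (simp add: part_def bas_def lin_sum[OF lin_pow[OF lins(3)]] lin_scl[OF lin_pow[OF lins(3)]])
    finally show ?thesis .
  qed
  have Dpart: "Dg dg q ((xt ^^ c) (part c)) = scl (q ^ c) ((xt ^^ c) (part c))" if "c < s" for c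
  proof -
    have "Dg dg q ((xt ^^ c) (vec l m)) = scl (q ^ c) ((xt ^^ c) (vec l m))" if "l \<in> idx" "m < len l" for l m
      using Dg_bas[OF q(1), of "(l, (c, m))"] that \<open>c < s\<close> by (simp add: bas_def deg'_def E'_def sdom_def)
    then show ?thesis
      by (simp add: part_def lin_sum[OF lin_pow[OF lins(3)]] lin_scl[OF lin_pow[OF lins(3)]] lin_sum[OF lin_Dg]
        lin_scl[OF lin_Dg] scl_sum mult.commute)
  qed
  have "(xt ^^ c) (part c) = 0" if c: "c < s" for c
  proof (rule ext)
    fix e
    show "(xt ^^ c) (part c) e = 0 e"
    proof (rule ccontr)
      assume n: "(xt ^^ c) (part c) e \<noteq> 0 e"
      \<comment> \<open>\<open>Dg\<close> multiplies pointwise, so eigenvectors for distinct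
        eigenvalues have disjoint supports: a summand that is nonzero at \<open>e\<close> has the
        eigenvalue \<open>q ^ dg e\<close>. Evaluation at \<open>e\<close> thus leaves at most one
        summand.\<close>
      have ec: "q ^ dg e = q ^ c'" if "c' < s" "(xt ^^ c') (part c') e \<noteq> 0" for c'
        using fun_cong[OF Dpart[OF that(1)], of e] that(2) by (simp add: Dg_def fapply)
      have "(xt ^^ c') (part c') e = 0" if "c' < s" "c' \<noteq> c" for c'
        using ec[OF that(1)] ec[OF c] n q_inj[OF c that(1)] that(2) by (auto simp: fapply)
      then have "(\<Sum>c<s. (xt ^^ c) (part c)) e = (\<Sum>c'\<in>{c}. (xt ^^ c') (part c') e)"
        unfolding sum_fun_apply by (intro sum.mono_neutral_right) (use c in auto)
      then show False using n z Qf by (simp add: fapply)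
    qed
  qed
  then have part0: "part c = 0" if "c < s" for c
    using xt_pow_inj[OF part_closed] that by blast
  have "f (l, (c, m)) = 0" if lcm: "(l, (c, m)) \<in> E'" for l c m
  proof -
    have lc: "c < s" "m < len l" "l \<in> idx" using lcm by (auto simp: E'_def sdom_def)
    obtain c1 j where cj: "l = (c1, j)" "c1 < s" "j < min (n1 c1) (n2 (neg c1))"
      using lc by (cases l) (auto simp: idxD)
    let ?u = "n1 c1" and ?t = "n2 (neg c1)"
    let ?v = "\<Sum>j<min ?u ?t. \<Sum>m<?u + ?t - 1 - 2 * j. scl (f ((c1, j), (c, m))) (string ?u ?t \<kappa> j m)"
    have "?v = 0"
    proof (rule ext, clarify)
      fix a b
      have "0 = part c ((c1, a), (neg c1, b))" using part0[OF lc(1)] by (simp add: fapply)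
      also have "\<dots> = (\<Sum>l\<in>idx. \<Sum>m<len l. f (l, (c, m)) * vec l m ((c1, a), (neg c1, b)))"
        by (simp add: part_def sum_fun_apply fapply)
      also have "\<dots> = (\<Sum>c'<s. \<Sum>j<min (n1 c') (n2 (neg c')). \<Sum>m<len (c', j).
          f ((c', j), (c, m)) * vec (c', j) m ((c1, a), (neg c1, b)))"
        unfolding idx_def by (subst sum.Sigma) (auto simp: split_beta)
      also have "\<dots> = (\<Sum>c'\<in>{c1}. \<Sum>j<min (n1 c') (n2 (neg c')). \<Sum>m<len (c', j).
          f ((c', j), (c, m)) * vec (c', j) m ((c1, a), (neg c1, b)))"
        by (rule sum.mono_neutral_right) (use cj(2) in \<open>auto simp: vec_def emb_def\<close>)
      also have "\<dots> = ?v (a, b)"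
        by (simp add: sum_fun_apply fapply vec_def emb_def len_def)
      finally show "?v (a, b) = 0 (a, b)" by (simp add: fapply)
    qed
    from string_independent[OF kappa this cj(3), of m] show ?thesis using lc(2) cj(1) by (simp add: len_def)
  qed
  note f0 = this
  have "f p = 0" for p
  proof (cases "p \<in> E'")
    case True
    obtain l c m where "p = (l, (c, m))" by (metis surj_pair)
    then show ?thesis using f0 True by blast
  next
    case False then show ?thesis by (rule fspaceD[OF f])
  qed
  then show ?thesis by (auto simp: fun_eq_iff fapply)
qed

lemma Q_surj: "g \<in> fspace E \<Longrightarrow> \<exists>f\<in>fspace E'. Q f = g"
  by (rule lin_injective_surjective[OF lin_Q finE' finE(3) card_E' Q_closed Q_inj])

lemma Q_bij: "bij_betw Q (fspace E') (fspace E)"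
  unfolding bij_betw_def
proof
  show "inj_on Q (fspace E')"
  proof (rule inj_onI)
    fix f g assume fg: "f \<in> fspace E'" "g \<in> fspace E'" "Q f = Q g"
    have "f + scl (-1) g = 0"
      by (rule Q_inj) (use fg in \<open>auto simp: lin_add[OF lin_Q] lin_scl[OF lin_Q] fun_eq_iff fapply intro!: fspace_add fspace_scl\<close>)
    then show "f = g" by (auto simp: fun_eq_iff fapply)
  qed
  show "Q ` fspace E' = fspace E" using Q_surj Q_closed by blast
qed

end

section \<open>From operator identities to isomorphisms of \<open>H\<close>-modules\<close>

lemma cmod_isoI:
  assumes T: "lin T" "bij_betw T (fspace B) (fspace C)"
    and L: "\<And>p f. \<lbrakk>p \<in> carrier P; f \<in> fspace B\<rbrakk> \<Longrightarrow> T (L p f) = L' p (T f)"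
  shows "module_iso (twisted_algebra P c) (cmod B L) (cmod C L')"
proof (rule module_isoI[where f = T])
  fix h f assume "h \<in> carrier (twisted_algebra P c)" "f \<in> carrier (cmod B L)"
  then show "T (h \<odot>\<^bsub>cmod B L\<^esub> f) = h \<odot>\<^bsub>cmod C L'\<^esub> T f"
    using L by (auto simp: act_def lin_sum[OF T(1)] lin_scl[OF T(1)] twisted_simps subset_iff intro!: sum.cong)
qed (use T in \<open>simp_all add: lin_add\<close>)

lemma hact_isoI:
  fixes T :: "('b \<Rightarrow> 'k::field) \<Rightarrow> 'c \<Rightarrow> 'k"
  assumes T: "lin T" "bij_betw T (fspace B) (fspace C)" and B: "hrep G \<chi> B \<rho> xx"
    and \<rho>: "\<And>g f. \<lbrakk>g \<in> carrier G; f \<in> fspace B\<rbrakk> \<Longrightarrow> T (\<rho> g f) = \<rho>' g (T f)"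
    and xx: "\<And>f. f \<in> fspace B \<Longrightarrow> T (xx f) = xx' (T f)"
  shows "module_iso (ore_algebra G \<chi>) (cmod B (hact \<rho> xx)) (cmod C (hact \<rho>' xx'))"
  unfolding ore_algebra_def
proof (rule cmod_isoI[OF T])
  fix p and f :: "'b \<Rightarrow> 'k" assume "p \<in> carrier (ore_basis G)" and f: "f \<in> fspace B"
  then obtain g i where p: "p = (g, i)" "g \<in> carrier G" by auto
  have cl: "xx f \<in> fspace B" if "f \<in> fspace B" for f :: "'b \<Rightarrow> 'k" using B that by (simp add: hrep_def)
  then have cli: "(xx ^^ i) f \<in> fspace B" for i using funpow_closed[of "fspace B" xx f i] f by blast
  have "T ((xx ^^ i) f) = (xx' ^^ i) (T f)" for i
    by (induction i) (simp_all add: xx cli)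
  then show "T (hact \<rho> xx p f) = hact \<rho>' xx' p (T f)" using p cli \<rho> by (simp add: hact_def)
qed

lemma ring_ore: "\<lbrakk>group G; \<chi> \<in> carrier (character_group G)\<rbrakk> \<Longrightarrow> ring (twisted_algebra (ore_basis G) (ore_twist \<chi>))"
  using ring_ore_algebra by (simp add: ore_algebra_def)

lemma left_module_hact:
  assumes "group G" "\<chi> \<in> carrier (character_group G)" "hrep G \<chi> B \<rho> xx"
  shows "left_module (ore_algebra G \<chi>) (cmod B (hact \<rho> xx))"
  unfolding ore_algebra_def by (rule left_module_cmod[OF ring_ore[OF assms(1,2)] hops_hact[OF assms(3)]])

definition regroup :: "(('e \<times> 'b) \<times> ('f \<times> 'c) \<Rightarrow> 'k::field) \<Rightarrow> ('e \<times> 'f) \<times> ('b \<times> 'c) \<Rightarrow> 'k" where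
  "regroup \<phi> = (\<lambda>((e, f), (b, c)). \<phi> ((e, b), (f, c)))"

lemma lin_regroup: "lin regroup"
  by (rule linI) (auto simp: regroup_def fun_eq_iff fapply)

lemma regroup_tens: "regroup (tens (tens f u) (tens g v)) = tens (tens f g) (tens u v)"
  by (auto simp: regroup_def tens_def fun_eq_iff)

lemma regroup_bij: "bij_betw regroup (fspace ((E1 \<times> B) \<times> (E2 \<times> C))) (fspace ((E1 \<times> E2) \<times> (B \<times> C)))"
  by (rule bij_betw_byWitness[where f' = regroup]) (auto simp: regroup_def fspace_def fun_eq_iff)

lemma regroup_eqI:
  assumes "lin K" "lin K'" and fin: "finite E1" "finite B" "finite E2" "finite C"
    and \<phi>: "\<phi> \<in> fspace ((E1 \<times> B) \<times> (E2 \<times> C))"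
    and eq: "\<And>f u g v. \<lbrakk>f \<in> fspace E1; u \<in> fspace B; g \<in> fspace E2; v \<in> fspace C\<rbrakk> \<Longrightarrow>
      K (tens (tens f u) (tens g v)) = K' (tens (tens f u) (tens g v))"
  shows "K \<phi> = K' \<phi>"
proof (rule lin_eqI[OF assms(1,2) _ \<phi>])
  show "finite ((E1 \<times> B) \<times> (E2 \<times> C))" using fin by simp
  fix p assume "p \<in> (E1 \<times> B) \<times> (E2 \<times> C)"
  then obtain e b f c where p: "p = ((e, b), (f, c))" "e \<in> E1" "b \<in> B" "f \<in> E2" "c \<in> C" by auto
  then show "K (dl p) = K' (dl p)"
    using eq[of "dl e" "dl b" "dl f" "dl c"] by (simp add: tens_dl)
qed

text \<open>After exchanging the two middle factors, \<open>x \<otimes> a\<close> involves the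
  second simple module only through the scalar \<omega>, which is moved to the graded part. So
  \<open>x\<close> acts on the product of the graded parts alone, and the simple modules contribute
  an ordinary tensor product of representations of \<open>G\<close>.\<close>

lemma ten_tensor_iso:
  fixes G :: "('g, 'x) monoid_scheme" and \<chi> :: "'g \<Rightarrow> 'k::field"
    and E1 :: "'e set" and E2 :: "'f set" and B :: "'b set" and C :: "'c set"
  assumes G: "group G" and \<chi>: "\<chi> \<in> carrier (character_group G)"
    and s: "\<And>g. g \<in> carrier G \<Longrightarrow> \<chi> g ^ s = 1"
    and a: "a \<in> carrier G" and x1: "graded s E1 d1 x1" and x2: "graded s E2 d2 x2"
    and B: "grep G B \<rho>" and C: "grep G C \<sigma>"
    and \<omega>: "\<And>v. v \<in> fspace C \<Longrightarrow> \<sigma> a v = scl \<omega> v"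
    and big: "hrep G \<chi> ((E1 \<times> B) \<times> (E2 \<times> C)) (\<lambda>g. kron (tenrep \<chi> d1 \<rho> g) (tenrep \<chi> d2 \<sigma> g))
      (\<lambda>\<phi>. kron (kron x1 (\<lambda>f. f)) (tenrep \<chi> d2 \<sigma> a) \<phi> + kron (\<lambda>f. f) (kron x2 (\<lambda>f. f)) \<phi>)"
  shows "module_iso (ore_algebra G \<chi>)
    (cmod ((E1 \<times> B) \<times> (E2 \<times> C)) (hact (\<lambda>g. kron (tenrep \<chi> d1 \<rho> g) (tenrep \<chi> d2 \<sigma> g))
      (\<lambda>\<phi>. kron (kron x1 (\<lambda>f. f)) (tenrep \<chi> d2 \<sigma> a) \<phi> + kron (\<lambda>f. f) (kron x2 (\<lambda>f. f)) \<phi>)))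
    (cmod ((E1 \<times> E2) \<times> (B \<times> C)) (ten \<chi> (\<lambda>(e, f). d1 e + d2 f)
      (\<lambda>\<psi>. kron x1 (\<lambda>f. scl \<omega> (Dg d2 (\<chi> a) f)) \<psi> + kron (\<lambda>f. f) x2 \<psi>) (\<lambda>g. kron (\<rho> g) (\<sigma> g))))"
  unfolding ten_def
proof (rule hact_isoI[OF lin_regroup regroup_bij big])
  have fin: "finite E1" "finite B" "finite E2" "finite C"
    using x1 x2 B C by (auto simp: graded_def operators_def)
  have lx: "lin x1" "lin x2" using x1 x2 by (auto simp: graded_def)
  have l\<rho>: "lin (\<rho> g)" "lin (\<sigma> g)" if "g \<in> carrier G" for g using B C that by (auto simp: operators_def)
  have D: "Dg (\<lambda>(e, f). d1 e + d2 f) z = kron (Dg d1 z) (Dg d2 z)" for z :: 'k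
    by (auto simp: fun_eq_iff kron_def Dg_def power_add)
  note ll = lin_kron lin_Dg lin_id lin_comp lin_plus lin_scale
  {
    fix g and \<phi> :: "('e \<times> 'b) \<times> ('f \<times> 'c) \<Rightarrow> 'k"
    assume g: "g \<in> carrier G" and \<phi>: "\<phi> \<in> fspace ((E1 \<times> B) \<times> (E2 \<times> C))"
    have l1: "lin (tenrep \<chi> d1 \<rho> g)" "lin (tenrep \<chi> d2 \<sigma> g)"
      unfolding tenrep_def using l\<rho>[OF g] by (simp_all add: lin_kron)
    have l2: "lin (tenrep \<chi> (\<lambda>(e, f). d1 e + d2 f) (\<lambda>g. kron (\<rho> g) (\<sigma> g)) g)"
      unfolding tenrep_def by (rule lin_kron[OF lin_Dg lin_kron[OF l\<rho>[OF g]]])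
    show "regroup (kron (tenrep \<chi> d1 \<rho> g) (tenrep \<chi> d2 \<sigma> g) \<phi>) =
      tenrep \<chi> (\<lambda>(e, f). d1 e + d2 f) (\<lambda>g. kron (\<rho> g) (\<sigma> g)) g (regroup \<phi>)"
    proof (rule regroup_eqI[OF _ _ fin \<phi>])
      show "lin (\<lambda>\<phi>. regroup (kron (tenrep \<chi> d1 \<rho> g) (tenrep \<chi> d2 \<sigma> g) \<phi>))"
        by (rule lin_comp[OF lin_regroup lin_kron[OF l1]])
      show "lin (\<lambda>\<phi>. tenrep \<chi> (\<lambda>(e, f). d1 e + d2 f) (\<lambda>g. kron (\<rho> g) (\<sigma> g)) g (regroup \<phi>))"
        by (rule lin_comp[OF l2 lin_regroup])
      fix f :: "'e \<Rightarrow> 'k" and u :: "'b \<Rightarrow> 'k" and g' :: "'f \<Rightarrow> 'k" and v :: "'c \<Rightarrow> 'k"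
      show "regroup (kron (tenrep \<chi> d1 \<rho> g) (tenrep \<chi> d2 \<sigma> g) (tens (tens f u) (tens g' v))) =
        tenrep \<chi> (\<lambda>(e, f). d1 e + d2 f) (\<lambda>g. kron (\<rho> g) (\<sigma> g)) g (regroup (tens (tens f u) (tens g' v)))"
        using l\<rho>[OF g] by (simp add: tenrep_def D kron_tens lin_kron regroup_tens)
    qed
  }
  fix \<phi> :: "('e \<times> 'b) \<times> ('f \<times> 'c) \<Rightarrow> 'k" assume \<phi>: "\<phi> \<in> fspace ((E1 \<times> B) \<times> (E2 \<times> C))"
  have l1: "lin (kron x1 (\<lambda>f. f) :: ('e \<times> 'b \<Rightarrow> 'k) \<Rightarrow> _)" "lin (kron x2 (\<lambda>f. f) :: ('f \<times> 'c \<Rightarrow> 'k) \<Rightarrow> _)"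
    "lin (tenrep \<chi> d2 \<sigma> a)"
    unfolding tenrep_def by (rule lin_kron[OF lx(1) lin_id], rule lin_kron[OF lx(2) lin_id],
        rule lin_kron[OF lin_Dg l\<rho>(2)[OF a]])
  have l2: "lin (\<lambda>f. scl \<omega> (Dg d2 (\<chi> a) f))" by (rule lin_scale[OF lin_Dg])
  have l3: "lin (\<lambda>\<psi>. kron x1 (\<lambda>f. scl \<omega> (Dg d2 (\<chi> a) f)) \<psi> + kron (\<lambda>f. f) x2 \<psi>)"
    by (rule lin_plus[OF lin_kron[OF lx(1) l2] lin_kron[OF lin_id lx(2)]])
  show "regroup (kron (kron x1 (\<lambda>f. f)) (tenrep \<chi> d2 \<sigma> a) \<phi> + kron (\<lambda>f. f) (kron x2 (\<lambda>f. f)) \<phi>) =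
    kron (\<lambda>\<psi>. kron x1 (\<lambda>f. scl \<omega> (Dg d2 (\<chi> a) f)) \<psi> + kron (\<lambda>f. f) x2 \<psi>) (\<lambda>f. f) (regroup \<phi>)"
  proof (rule regroup_eqI[OF _ _ fin \<phi>])
    show "lin (\<lambda>\<phi> :: ('e \<times> 'b) \<times> ('f \<times> 'c) \<Rightarrow> 'k. regroup (kron (kron x1 (\<lambda>f. f)) (tenrep \<chi> d2 \<sigma> a) \<phi> + kron (\<lambda>f. f) (kron x2 (\<lambda>f. f)) \<phi>))"
      by (rule lin_comp[OF lin_regroup lin_plus[OF lin_kron[OF l1(1,3)] lin_kron[OF lin_id l1(2)]]])
    show "lin (\<lambda>\<phi> :: ('e \<times> 'b) \<times> ('f \<times> 'c) \<Rightarrow> 'k. kron (\<lambda>\<psi>. kron x1 (\<lambda>f. scl \<omega> (Dg d2 (\<chi> a) f)) \<psi> + kron (\<lambda>f. f) x2 \<psi>) (\<lambda>f. f) (regroup \<phi>))"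
      by (rule lin_comp[OF lin_kron[OF l3 lin_id] lin_regroup])
    fix f :: "'e \<Rightarrow> 'k" and u :: "'b \<Rightarrow> 'k" and g :: "'f \<Rightarrow> 'k" and v :: "'c \<Rightarrow> 'k" assume "v \<in> fspace C"
    then show "regroup (kron (kron x1 (\<lambda>f. f)) (tenrep \<chi> d2 \<sigma> a) (tens (tens f u) (tens g v)) +
        kron (\<lambda>f. f) (kron x2 (\<lambda>f. f)) (tens (tens f u) (tens g v))) =
      kron (\<lambda>\<psi>. kron x1 (\<lambda>f. scl \<omega> (Dg d2 (\<chi> a) f)) \<psi> + kron (\<lambda>f. f) x2 \<psi>) (\<lambda>f. f) (regroup (tens (tens f u) (tens g v)))"
      using l1 lx l2 l3 l\<rho>[OF a]
      by (simp add: tenrep_def kron_tens regroup_tens lin_add[OF lin_regroup] lin_scl[OF lin_regroup] tens_scl tens_add \<omega>)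
  qed
qed

lemma kron_bij:
  fixes Q :: "('e \<Rightarrow> 'k::field) \<Rightarrow> 'f \<Rightarrow> 'k" and B :: "'b set"
  assumes Q: "lin Q" "bij_betw Q (fspace E') (fspace E)"
  shows "bij_betw (kron Q (\<lambda>f. f)) (fspace (E' \<times> B)) (fspace (E \<times> B))"
  unfolding bij_betw_def
proof
  have Qi: "inj_on Q (fspace E')" and Qs: "Q ` fspace E' = fspace E" using Q(2) by (auto simp: bij_betw_def)
  have k: "kron Q (\<lambda>f. f) \<phi> (e, b) = Q (\<lambda>e. \<phi> (e, b)) e" for \<phi> e b by (simp add: kron_def)
  show "inj_on (kron Q (\<lambda>f. f)) (fspace (E' \<times> B))"
  proof (rule inj_onI, rule ext, clarify)
    fix \<phi> \<psi> e b assume h: "\<phi> \<in> fspace (E' \<times> B)" "\<psi> \<in> fspace (E' \<times> B)" "kron Q (\<lambda>f. f) \<phi> = kron Q (\<lambda>f. f) \<psi>"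
    have "Q (\<lambda>e. \<phi> (e, b)) = Q (\<lambda>e. \<psi> (e, b))"
    proof
      fix e show "Q (\<lambda>e. \<phi> (e, b)) e = Q (\<lambda>e. \<psi> (e, b)) e"
        using fun_cong[OF h(3), of "(e, b)"] by (simp add: k)
    qed
    then have "(\<lambda>e. \<phi> (e, b)) = (\<lambda>e. \<psi> (e, b))" by (rule inj_onD[OF Qi _ slice_left[OF h(1)] slice_left[OF h(2)]])
    then show "\<phi> (e, b) = \<psi> (e, b)" by (rule fun_cong)
  qed
  show "kron Q (\<lambda>f. f) ` fspace (E' \<times> B) = fspace (E \<times> B)"
  proof
    show "kron Q (\<lambda>f. f) ` fspace (E' \<times> B) \<subseteq> fspace (E \<times> B)"
      using Qs by (auto intro!: kron_closed[OF Q(1) lin_id])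
    show "fspace (E \<times> B) \<subseteq> kron Q (\<lambda>f. f) ` fspace (E' \<times> B)"
    proof
      fix \<psi> :: "'f \<times> 'b \<Rightarrow> 'k" assume \<psi>: "\<psi> \<in> fspace (E \<times> B)"
      define h where "h b = inv_into (fspace E') Q (\<lambda>e. \<psi> (e, b))" for b
      have h: "h b \<in> fspace E'" "Q (h b) = (\<lambda>e. \<psi> (e, b))" for b
        unfolding h_def using Qs slice_left[OF \<psi>] by (metis inv_into_into, metis f_inv_into_f)
      let ?\<phi> = "\<lambda>(e, b). if b \<in> B then h b e else 0"
      have "?\<phi> \<in> fspace (E' \<times> B)" using h(1) by (auto simp: fspace_def)
      moreover have "kron Q (\<lambda>f. f) ?\<phi> = \<psi>"
      proof (rule ext, clarify)
        fix e b
        show "kron Q (\<lambda>f. f) ?\<phi> (e, b) = \<psi> (e, b)"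
        proof (cases "b \<in> B")
          case True then show ?thesis using h(2)[of b] by (simp add: k)
        next
          case False
          have "(\<lambda>e. 0) = (0 :: 'e \<Rightarrow> 'k)" by (simp add: fun_eq_iff fapply)
          then show ?thesis using False \<psi> lin_zero[OF Q(1)] by (simp add: k fspace_def fapply)
        qed
      qed
      ultimately show "\<psi> \<in> kron Q (\<lambda>f. f) ` fspace (E' \<times> B)" by blast
    qed
  qed
qed

text \<open>Compatibility of \<open>Q\<close> with \<open>Dg\<close> at all \<open>s\<close>-th
  roots of unity covers every \<open>g\<close>, since \<open>\<chi> g ^ s = 1\<close>. So an
  isomorphism of graded spaces with \<open>x\<close> remains one after tensoring with any
  representation of \<open>G\<close>.\<close>

lemma ten_change_basis:
  fixes \<chi> :: "'g \<Rightarrow> 'k::field" and E' :: "'e set" and E :: "'f set" and B :: "'b set"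
  assumes G: "group G" and \<chi>: "\<chi> \<in> carrier (character_group G)"
    and s: "\<And>g. g \<in> carrier G \<Longrightarrow> \<chi> g ^ s = 1"
    and x': "graded s E' d' x'" and x: "graded s E d x" and B: "grep G B \<rho>"
    and Q: "lin Q" "bij_betw Q (fspace E') (fspace E)"
    and Qx: "\<And>f. f \<in> fspace E' \<Longrightarrow> Q (x' f) = x (Q f)"
    and QD: "\<And>z f. \<lbrakk>z ^ s = 1; f \<in> fspace E'\<rbrakk> \<Longrightarrow> Q (Dg d' z f) = Dg d z (Q f)"
  shows "module_iso (ore_algebra G \<chi>) (cmod (E' \<times> B) (ten \<chi> d' x' \<rho>)) (cmod (E \<times> B) (ten \<chi> d x \<rho>))"
  unfolding ten_def
proof (rule hact_isoI[OF lin_kron[OF Q(1) lin_id] kron_bij[OF Q] hrep_ten[OF G \<chi> s x' B]])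
  have fin: "finite E'" "finite B" using x' B by (auto simp: graded_def operators_def)
  have lx: "lin x'" "lin x" using x x' by (auto simp: graded_def)
  {
    fix g and \<phi> :: "'e \<times> 'b \<Rightarrow> 'k" assume g: "g \<in> carrier G" and \<phi>: "\<phi> \<in> fspace (E' \<times> B)"
    have l: "lin (\<rho> g)" using B g by (simp add: operators_def)
    show "kron Q (\<lambda>f. f) (tenrep \<chi> d' \<rho> g \<phi>) = tenrep \<chi> d \<rho> g (kron Q (\<lambda>f. f) \<phi>)"
      unfolding tenrep_def
    proof (rule kron_eqI[OF _ _ fin \<phi>])
      show "lin (\<lambda>\<phi>. kron Q (\<lambda>f. f) (kron (Dg d' (\<chi> g)) (\<rho> g) \<phi>))"
        by (rule lin_comp[OF lin_kron[OF Q(1) lin_id] lin_kron[OF lin_Dg l]])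
      show "lin (\<lambda>\<phi>. kron (Dg d (\<chi> g)) (\<rho> g) (kron Q (\<lambda>f. f) \<phi>))"
        by (rule lin_comp[OF lin_kron[OF lin_Dg l] lin_kron[OF Q(1) lin_id]])
    qed (simp add: kron_tens l Q(1) QD[OF s[OF g]])
  }
  fix \<phi> :: "'e \<times> 'b \<Rightarrow> 'k" assume \<phi>: "\<phi> \<in> fspace (E' \<times> B)"
  show "kron Q (\<lambda>f. f) (kron x' (\<lambda>f. f) \<phi>) = kron x (\<lambda>f. f) (kron Q (\<lambda>f. f) \<phi>)"
  proof (rule kron_eqI[OF _ _ fin \<phi>])
    show "lin (\<lambda>\<phi> :: 'e \<times> 'b \<Rightarrow> 'k. kron Q (\<lambda>f. f) (kron x' (\<lambda>f. f) \<phi>))"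
      by (rule lin_comp[OF lin_kron[OF Q(1) lin_id] lin_kron[OF lx(1) lin_id]])
    show "lin (\<lambda>\<phi> :: 'e \<times> 'b \<Rightarrow> 'k. kron x (\<lambda>f. f) (kron Q (\<lambda>f. f) \<phi>))"
      by (rule lin_comp[OF lin_kron[OF lx(2) lin_id] lin_kron[OF Q(1) lin_id]])
  qed (simp add: kron_tens lx Q(1) Qx)
qed

lemma grep_left_module: "\<lbrakk>group G; grep G B \<rho>\<rbrakk> \<Longrightarrow> left_module (group_algebra G) (cmod B \<rho>)"
  by (rule left_module_cmod[OF ring_group_algebra])

text \<open>Two decompositions act independently: the graded part splits along \<Lambda> because
  \<open>x'\<close> respects the first index, and the representation of \<open>G\<close> splits
  along \<open>J\<close>. The component for \<open>(j, l)\<close> slices at \<open>l\<close> and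
  then applies the projection \<open>\<pi> j\<close> to the second variable.\<close>

lemma ten_decompose:
  fixes \<chi> :: "'g \<Rightarrow> 'k::field" and El :: "'l \<Rightarrow> (nat \<times> nat) set" and B :: "'b set"
    and Bj :: "'j \<Rightarrow> 'c set"
  assumes G: "group G" and \<chi>: "\<chi> \<in> carrier (character_group G)"
    and s: "\<And>g. g \<in> carrier G \<Longrightarrow> \<chi> g ^ s = 1"
    and xl: "\<And>l. l \<in> \<Lambda> \<Longrightarrow> graded s (El l) fst (xl l)" and \<Lambda>: "finite \<Lambda>"
    and B: "grep G B \<rho>" and Bj: "\<And>j. j \<in> J \<Longrightarrow> grep G (Bj j) (\<rho>j j)"
    and iso: "module_iso (group_algebra G) (cmod B \<rho>) (direct_sum J (\<lambda>j. cmod (Bj j) (\<rho>j j)))"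
    and x': "x' = (\<lambda>f (l, e). xl l (\<lambda>e. f (l, e)) e)" and d': "d' = (\<lambda>(l, e). fst e)"
    and big: "graded s (Sigma \<Lambda> El) d' x'"
  shows "module_iso (ore_algebra G \<chi>) (cmod (Sigma \<Lambda> El \<times> B) (ten \<chi> d' x' \<rho>))
    (direct_sum (J \<times> \<Lambda>) (\<lambda>(j, l). cmod (El l \<times> Bj j) (ten \<chi> fst (xl l) (\<rho>j j))))"
proof -
  let ?W = "direct_sum J (\<lambda>j. cmod (Bj j) (\<rho>j j))"
  let ?E = "Sigma \<Lambda> El"
  interpret G: group G by fact
  have rG: "ring (group_algebra G)" by (rule ring_group_algebra[OF G])
  have lmW: "left_module (group_algebra G) ?W"
    by (rule left_module_direct_sum[OF rG]) (rule grep_left_module[OF G Bj])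
  from iso grep_left_module[OF G B] lmW obtain \<psi> \<eta> where
    \<psi>c: "\<psi> \<in> carrier (cmod B \<rho>) \<rightarrow> carrier ?W" and \<eta>c: "\<eta> \<in> carrier ?W \<rightarrow> carrier (cmod B \<rho>)"
    and \<eta>\<psi>: "\<And>m. m \<in> carrier (cmod B \<rho>) \<Longrightarrow> \<eta> (\<psi> m) = m" and \<psi>\<eta>: "\<And>n. n \<in> carrier ?W \<Longrightarrow> \<psi> (\<eta> n) = n"
    and \<psi>a: "\<And>m m'. \<lbrakk>m \<in> carrier (cmod B \<rho>); m' \<in> carrier (cmod B \<rho>)\<rbrakk> \<Longrightarrow> \<psi> (m \<oplus>\<^bsub>cmod B \<rho>\<^esub> m') = \<psi> m \<oplus>\<^bsub>?W\<^esub> \<psi> m'"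
    and \<psi>s: "\<And>h m. \<lbrakk>h \<in> carrier (group_algebra G); m \<in> carrier (cmod B \<rho>)\<rbrakk> \<Longrightarrow> \<psi> (h \<odot>\<^bsub>cmod B \<rho>\<^esub> m) = h \<odot>\<^bsub>?W\<^esub> \<psi> m"
    and \<eta>0: "\<eta> \<zero>\<^bsub>?W\<^esub> = \<zero>\<^bsub>cmod B \<rho>\<^esub>"
    by (rule module_isoE) blast
  \<comment> \<open>The isomorphism \<psi> is controlled on \<open>fspace B\<close> only, while
    \<open>kron\<close> asks for maps that are linear on all functions. Cutting off outside
    \<open>B\<close> first provides such an extension.\<close>
  define rst where "rst f = (\<lambda>b. if b \<in> B then f b else 0)" for f :: "'b \<Rightarrow> 'k"
  have rst: "rst f \<in> fspace B" for f by (simp add: rst_def fspace_def)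
  have rst_id: "rst f = f" if "f \<in> fspace B" for f using that by (auto simp: rst_def fspace_def fun_eq_iff)
  define \<pi> where "\<pi> j f = \<psi> (rst f) j" for j f
  have \<psi>j: "\<psi> f j \<in> fspace (Bj j)" if "f \<in> fspace B" "j \<in> J" for f j
    using funcset_mem[OF \<psi>c, of f] that by (auto simp: direct_sum_def)
  have \<pi>c: "\<pi> j f \<in> fspace (Bj j)" if "j \<in> J" for j f using \<psi>j[OF rst that] by (simp add: \<pi>_def)
  have \<pi>lin: "lin (\<pi> j)" if j: "j \<in> J" for j
  proof (rule linI)
    fix f g
    have "rst (f + g) = rst f + rst g" by (auto simp: rst_def fun_eq_iff fapply)
    then show "\<pi> j (f + g) = \<pi> j f + \<pi> j g"
      using \<psi>a[of "rst f" "rst g"] rst j by (simp add: \<pi>_def direct_sum_def)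
  next
    fix c f
    \<comment> \<open>Linearity over \<open>k\<close> is a case of linearity over \<open>kG\<close>,
      in which the scalars are multiples of the unit element.\<close>
    have "rst (scl c f) = act \<rho> (scalar G c) (rst f)"
      using scalar_act[OF B rst] by (auto simp: rst_def fun_eq_iff fapply)
    moreover have "scalar G c \<in> carrier (group_algebra G)" by (simp add: twisted_simps scalar_def)
    ultimately show "\<pi> j (scl c f) = scl c (\<pi> j f)"
      using \<psi>s[of "scalar G c" "rst f"] rst j scalar_act[OF Bj[OF j] \<psi>j[OF rst j]]
      by (simp add: \<pi>_def direct_sum_def)
  qed
  have \<pi>\<rho>: "\<pi> j (\<rho> g f) = \<rho>j j g (\<pi> j f)" if "j \<in> J" "g \<in> carrier G" "f \<in> fspace B" for j g f
  proof -
    have "\<rho> g f \<in> fspace B" using B that by (simp add: operators_def)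
    then show ?thesis
      using \<psi>s[of "Poly_Mapping.single g 1" f] that by (simp add: \<pi>_def direct_sum_def rst_id twisted_simps)
  qed
  define sl where "sl l \<phi> = (\<lambda>(e, b). \<phi> ((l, e), b))" for l and \<phi> :: "('l \<times> nat \<times> nat) \<times> 'b \<Rightarrow> 'k"
  have slc: "sl l \<phi> \<in> fspace (El l \<times> B)" if "\<phi> \<in> fspace (?E \<times> B)" for l \<phi>
    using that by (auto simp: sl_def fspace_def)
  let ?\<Phi> = "\<lambda>\<phi>. \<lambda>(j, l)\<in>J \<times> \<Lambda>. kron (\<lambda>f. f) (\<pi> j) (sl l \<phi>)"
  let ?\<Psi> = "\<lambda>F. \<lambda>((l, e), b). if l \<in> \<Lambda> then \<eta> (\<lambda>j\<in>J. \<lambda>b. F (j, l) (e, b)) b else 0"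
  let ?M = "\<lambda>(j, l). cmod (El l \<times> Bj j) (ten \<chi> fst (xl l) (\<rho>j j))"
  have finE: "finite ?E" "finite B" using big B by (auto simp: graded_def operators_def)
  have finl: "finite (El l)" "lin (xl l)" if "l \<in> \<Lambda>" for l using xl[OF that] by (auto simp: graded_def)
  have hr: "hrep G \<chi> (?E \<times> B) (tenrep \<chi> d' \<rho>) (kron x' (\<lambda>f. f))" by (rule hrep_ten[OF G \<chi> s big B])
  have comp: "(\<lambda>b. F (j, l) (e, b)) \<in> fspace (Bj j)" if "F \<in> carrier (direct_sum (J \<times> \<Lambda>) ?M)" "j \<in> J" "l \<in> \<Lambda>" for F j l e
  proof -
    have "F (j, l) \<in> fspace (El l \<times> Bj j)" using that PiE_mem[of F "J \<times> \<Lambda>" "\<lambda>p. carrier (?M p)" "(j, l)"] by (auto simp: direct_sum_def)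
    then show ?thesis by (rule slice_right)
  qed
  have Wmem: "(\<lambda>j\<in>J. \<lambda>b. F (j, l) (e, b)) \<in> carrier ?W" if F: "F \<in> carrier (direct_sum (J \<times> \<Lambda>) ?M)" and l: "l \<in> \<Lambda>" for F l e
  proof -
    have "finite {p \<in> J \<times> \<Lambda>. F p \<noteq> \<zero>\<^bsub>?M p\<^esub>}" using F by (simp add: direct_sum_def)
    then have "finite (fst ` {p \<in> J \<times> \<Lambda>. F p \<noteq> \<zero>\<^bsub>?M p\<^esub>})" by (rule finite_imageI)
    moreover have "{j \<in> J. (\<lambda>b. F (j, l) (e, b)) \<noteq> 0} \<subseteq> fst ` {p \<in> J \<times> \<Lambda>. F p \<noteq> \<zero>\<^bsub>?M p\<^esub>}"
    proof
      fix j assume "j \<in> {j \<in> J. (\<lambda>b. F (j, l) (e, b)) \<noteq> 0}"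
      then obtain b where b: "j \<in> J" "F (j, l) (e, b) \<noteq> 0" by (auto simp: fun_eq_iff fapply)
      then have "j \<in> J" "F (j, l) \<noteq> 0" by (simp, metis zero_fun_apply)
      then show "j \<in> fst ` {p \<in> J \<times> \<Lambda>. F p \<noteq> \<zero>\<^bsub>?M p\<^esub>}" using l by (intro image_eqI[of _ _ "(j, l)"]) auto
    qed
    ultimately have "finite {j \<in> J. (\<lambda>b. F (j, l) (e, b)) \<noteq> 0}" by (rule finite_subset[rotated])
    then show ?thesis using comp[OF F _ l] by (auto simp: direct_sum_def cong: conj_cong)
  qed
  have ki: "kron (\<lambda>f. f) (\<pi> j) \<phi> (e, b) = \<pi> j (\<lambda>b. \<phi> (e, b)) b" for j \<phi> and e :: "nat \<times> nat" and b
    by (simp add: kron_def)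
  have \<Phi>c: "?\<Phi> \<phi> \<in> carrier (direct_sum (J \<times> \<Lambda>) ?M)" if \<phi>: "\<phi> \<in> fspace (?E \<times> B)" for \<phi>
  proof -
    have c1: "kron (\<lambda>f. f) (\<pi> j) (sl l \<phi>) \<in> fspace (El l \<times> Bj j)" if "j \<in> J" for j l
      by (rule kron_closed[OF lin_id \<pi>lin[OF that] _ \<pi>c[OF that] slc[OF \<phi>]])
    \<comment> \<open>The support in \<open>J\<close> is finite because there are finitely many
      points \<open>(l, e)\<close> and each slice is sent by \<psi> to an element of finite
      support.\<close>
    have "finite (\<Union>(l, e)\<in>?E. {j \<in> J. \<psi> (\<lambda>b. \<phi> ((l, e), b)) j \<noteq> 0} \<times> {l})"
    proof (rule finite_UN_I[OF finE(1)], clarify)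
      fix l e
      have "\<psi> (\<lambda>b. \<phi> ((l, e), b)) \<in> carrier ?W" using funcset_mem[OF \<psi>c] slice_right[OF \<phi>] by simp
      then have "finite {j \<in> J. \<psi> (\<lambda>b. \<phi> ((l, e), b)) j \<noteq> 0}" by (simp add: direct_sum_def)
      then show "finite ({j \<in> J. \<psi> (\<lambda>b. \<phi> ((l, e), b)) j \<noteq> 0} \<times> {l})" by simp
    qed
    moreover have "{p \<in> J \<times> \<Lambda>. ?\<Phi> \<phi> p \<noteq> \<zero>\<^bsub>?M p\<^esub>} \<subseteq> (\<Union>(l, e)\<in>?E. {j \<in> J. \<psi> (\<lambda>b. \<phi> ((l, e), b)) j \<noteq> 0} \<times> {l})"
    proof
      fix p assume p: "p \<in> {p \<in> J \<times> \<Lambda>. ?\<Phi> \<phi> p \<noteq> \<zero>\<^bsub>?M p\<^esub>}"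
      then obtain j l where jl: "p = (j, l)" "j \<in> J" "l \<in> \<Lambda>" "kron (\<lambda>f. f) (\<pi> j) (sl l \<phi>) \<noteq> 0" by auto
      then obtain e b where eb: "\<pi> j (\<lambda>b. \<phi> ((l, e), b)) b \<noteq> 0" by (auto simp: fun_eq_iff fapply ki sl_def)
      have "(l, e) \<in> ?E"
      proof (rule ccontr)
        assume "(l, e) \<notin> ?E"
        then have "(\<lambda>b. \<phi> ((l, e), b)) = 0" by (rule slice_out[OF \<phi>])
        then show False using eb lin_zero[OF \<pi>lin[OF jl(2)]] by (simp add: fapply)
      qed
      moreover have "\<psi> (\<lambda>b. \<phi> ((l, e), b)) j \<noteq> 0"
        using eb rst_id[OF slice_right[OF \<phi>]] by (auto simp: \<pi>_def fapply)
      ultimately show "p \<in> (\<Union>(l, e)\<in>?E. {j \<in> J. \<psi> (\<lambda>b. \<phi> ((l, e), b)) j \<noteq> 0} \<times> {l})"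
        using jl by (intro UN_I[of "(l, e)"]) auto
    qed
    ultimately have "finite {p \<in> J \<times> \<Lambda>. ?\<Phi> \<phi> p \<noteq> \<zero>\<^bsub>?M p\<^esub>}" by (rule finite_subset[rotated])
    moreover have "?\<Phi> \<phi> \<in> (\<Pi>\<^sub>E p\<in>J \<times> \<Lambda>. carrier (?M p))"
      by (rule PiE_I) (use c1 in auto)
    ultimately show ?thesis by (simp add: direct_sum_def)
  qed
  have \<Psi>c: "?\<Psi> F \<in> fspace (?E \<times> B)" if F: "F \<in> carrier (direct_sum (J \<times> \<Lambda>) ?M)" for F
  proof -
    have "?\<Psi> F ((l, e), b) = 0" if n: "((l, e), b) \<notin> ?E \<times> B" for l e b
    proof (cases "l \<in> \<Lambda>")
      case True
      have w: "\<eta> (\<lambda>j\<in>J. \<lambda>b. F (j, l) (e, b)) \<in> fspace B" using funcset_mem[OF \<eta>c Wmem[OF F True]] by simp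
      show ?thesis
      proof (cases "e \<in> El l")
        case e: True
        then have "b \<notin> B" using n True by auto
        then show ?thesis using w by (simp add: fspace_def)
      next
        case False
        have "(\<lambda>b. F (j, l) (e, b)) = 0" if "j \<in> J" for j
        proof -
          have "F (j, l) \<in> fspace (El l \<times> Bj j)" using F that True PiE_mem[of F "J \<times> \<Lambda>" "\<lambda>p. carrier (?M p)" "(j, l)"] by (auto simp: direct_sum_def)
          then show ?thesis by (rule slice_out[OF _ False])
        qed
        then have "(\<lambda>j\<in>J. \<lambda>b. F (j, l) (e, b)) = \<zero>\<^bsub>?W\<^esub>" by (auto simp: direct_sum_def intro!: restrict_ext)
        then show ?thesis using \<eta>0 True by (simp add: fapply)
      qed
    qed simp
    then show ?thesis unfolding fspace_def by (auto simp del: mem_Sigma_iff)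
  qed
  show ?thesis
  proof (rule module_isoI[where f = ?\<Phi>])
    show "bij_betw ?\<Phi> (carrier (cmod (?E \<times> B) (ten \<chi> d' x' \<rho>))) (carrier (direct_sum (J \<times> \<Lambda>) ?M))"
    proof (rule bij_betw_byWitness[where f' = ?\<Psi>])
      show "\<forall>\<phi>\<in>carrier (cmod (?E \<times> B) (ten \<chi> d' x' \<rho>)). ?\<Psi> (?\<Phi> \<phi>) = \<phi>"
      proof (rule ballI, rule ext)
        fix \<phi> :: "('l \<times> nat \<times> nat) \<times> 'b \<Rightarrow> 'k" and p :: "('l \<times> nat \<times> nat) \<times> 'b" assume "\<phi> \<in> carrier (cmod (?E \<times> B) (ten \<chi> d' x' \<rho>))"
        then have \<phi>: "\<phi> \<in> fspace (?E \<times> B)" by simp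
        obtain l e1 e2 b where p: "p = ((l, (e1, e2)), b)" by (metis surj_pair)
        let ?f = "\<lambda>b. \<phi> ((l, (e1, e2)), b)"
        have f: "?f \<in> fspace B" by (rule slice_right[OF \<phi>])
        have "(\<lambda>j\<in>J. \<pi> j ?f) = restrict (\<psi> ?f) J" by (rule restrict_ext) (simp add: \<pi>_def rst_id[OF f])
        also have "\<dots> = \<psi> ?f" using funcset_mem[OF \<psi>c, of ?f] f by (intro extensional_restrict) (auto simp: direct_sum_def PiE_def)
        finally have "\<eta> (\<lambda>j\<in>J. \<pi> j ?f) = ?f" using \<eta>\<psi> f by simp
        moreover have "(\<lambda>j\<in>J. \<lambda>b. ?\<Phi> \<phi> (j, l) ((e1, e2), b)) = (\<lambda>j\<in>J. \<pi> j ?f)" if "l \<in> \<Lambda>"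
          using that by (intro restrict_ext) (auto simp: ki sl_def)
        moreover have "\<phi> ((l, (e1, e2)), b) = 0" if "l \<notin> \<Lambda>" using \<phi> that by (auto simp: fspace_def)
        ultimately show "?\<Psi> (?\<Phi> \<phi>) p = \<phi> p" unfolding p by simp
      qed
      show "\<forall>F\<in>carrier (direct_sum (J \<times> \<Lambda>) ?M). ?\<Phi> (?\<Psi> F) = F"
      proof
        fix F assume F: "F \<in> carrier (direct_sum (J \<times> \<Lambda>) ?M)"
        have "F \<in> extensional (J \<times> \<Lambda>)" using F by (simp add: direct_sum_def PiE_def)
        then show "?\<Phi> (?\<Psi> F) = F"
        proof (rule extensionalityI[rotated])
          fix p assume "p \<in> J \<times> \<Lambda>"
          then obtain j l where p: "p = (j, l)" "j \<in> J" "l \<in> \<Lambda>" by auto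
          have "kron (\<lambda>f. f) (\<pi> j) (sl l (?\<Psi> F)) (e, b) = F (j, l) (e, b)" for e b
          proof -
            let ?w = "\<lambda>j\<in>J. \<lambda>b. F (j, l) (e, b)"
            have w: "?w \<in> carrier ?W" by (rule Wmem[OF F p(3)])
            have "(\<lambda>b. sl l (?\<Psi> F) (e, b)) = \<eta> ?w" using p by (cases e) (simp add: sl_def)
            then have "kron (\<lambda>f. f) (\<pi> j) (sl l (?\<Psi> F)) (e, b) = \<psi> (\<eta> ?w) j b"
              using funcset_mem[OF \<eta>c w] by (simp add: ki \<pi>_def rst_id)
            then show ?thesis using \<psi>\<eta>[OF w] p by simp
          qed
          then show "?\<Phi> (?\<Psi> F) p = F p" using p by (simp add: fun_eq_iff)
        qed simp
      qed
      show "?\<Phi> ` carrier (cmod (?E \<times> B) (ten \<chi> d' x' \<rho>)) \<subseteq> carrier (direct_sum (J \<times> \<Lambda>) ?M)"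
        using \<Phi>c by (auto simp del: restrict_apply)
      show "?\<Psi> ` carrier (direct_sum (J \<times> \<Lambda>) ?M) \<subseteq> carrier (cmod (?E \<times> B) (ten \<chi> d' x' \<rho>))"
        using \<Psi>c by auto
    qed
  next
    fix \<phi> \<phi>' assume "\<phi> \<in> carrier (cmod (?E \<times> B) (ten \<chi> d' x' \<rho>))" "\<phi>' \<in> carrier (cmod (?E \<times> B) (ten \<chi> d' x' \<rho>))"
    have "sl l (\<phi> + \<phi>') = sl l \<phi> + sl l \<phi>'" for l by (auto simp: sl_def fun_eq_iff fapply)
    then show "?\<Phi> (\<phi> \<oplus>\<^bsub>cmod (?E \<times> B) (ten \<chi> d' x' \<rho>)\<^esub> \<phi>') = ?\<Phi> \<phi> \<oplus>\<^bsub>direct_sum (J \<times> \<Lambda>) ?M\<^esub> ?\<Phi> \<phi>'"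
      by (auto simp: direct_sum_def lin_add[OF lin_kron[OF lin_id \<pi>lin]] intro!: restrict_ext)
  next
    fix h \<phi> assume h: "h \<in> carrier (ore_algebra G \<chi>)" and "\<phi> \<in> carrier (cmod (?E \<times> B) (ten \<chi> d' x' \<rho>))"
    then have \<phi>: "\<phi> \<in> fspace (?E \<times> B)" by simp
    have hk: "Poly_Mapping.keys h \<subseteq> carrier (ore_basis G)" using h by (simp add: ore_algebra_def twisted_simps)
    have main: "kron (\<lambda>f. f) (\<pi> j) (sl l (act (ten \<chi> d' x' \<rho>) h \<phi>)) =
        act (ten \<chi> fst (xl l) (\<rho>j j)) h (kron (\<lambda>f. f) (\<pi> j) (sl l \<phi>))" if j: "j \<in> J" and l: "l \<in> \<Lambda>" for j l
    proof -
      let ?k = "\<lambda>\<phi>. kron (\<lambda>f. f) (\<pi> j) (sl l \<phi>)"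
      have lk: "lin ?k"
      proof -
        have "lin (sl l)" by (rule linI) (auto simp: sl_def fun_eq_iff fapply)
        then show ?thesis by (rule lin_comp[OF lin_kron[OF lin_id \<pi>lin[OF j]]])
      qed
      have kg: "?k (tenrep \<chi> d' \<rho> g \<phi>) = tenrep \<chi> fst (\<rho>j j) g (?k \<phi>)" if g: "g \<in> carrier G" and \<phi>: "\<phi> \<in> fspace (?E \<times> B)" for g \<phi>
      proof -
        have lg: "lin (\<rho> g)" "lin (\<rho>j j g)" using B Bj[OF j] g by (auto simp: operators_def)
        have "sl l (tenrep \<chi> d' \<rho> g \<phi>) = kron (Dg fst (\<chi> g)) (\<rho> g) (sl l \<phi>)"
          by (auto simp: sl_def tenrep_def kron_def Dg_def d' fun_eq_iff)
        then have "?k (tenrep \<chi> d' \<rho> g \<phi>) = kron (Dg fst (\<chi> g)) (\<lambda>f. \<pi> j (\<rho> g f)) (sl l \<phi>)"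
          using kron_comp[OF lin_id \<pi>lin[OF j] lin_Dg lg(1) finl(1)[OF l] finE(2) slc[OF \<phi>]] by simp
        also have "\<dots> = kron (Dg fst (\<chi> g)) (\<lambda>f. \<rho>j j g (\<pi> j f)) (sl l \<phi>)"
          by (rule kron_cong[OF refl \<pi>\<rho>[OF j g] lin_comp[OF \<pi>lin[OF j] lg(1)] slc[OF \<phi>]])
        also have "\<dots> = tenrep \<chi> fst (\<rho>j j) g (?k \<phi>)"
          using kron_comp[OF lin_Dg lg(2) lin_id \<pi>lin[OF j] finl(1)[OF l] finE(2) slc[OF \<phi>]] by (simp add: tenrep_def)
        finally show ?thesis .
      qed
      have kx: "?k (kron x' (\<lambda>f. f) \<phi>) = kron (xl l) (\<lambda>f. f) (?k \<phi>)" if \<phi>: "\<phi> \<in> fspace (?E \<times> B)" for \<phi>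
      proof -
        have "sl l (kron x' (\<lambda>f. f) \<phi>) = kron (xl l) (\<lambda>f. f) (sl l \<phi>)"
          by (auto simp: sl_def kron_def x' fun_eq_iff)
        then have "?k (kron x' (\<lambda>f. f) \<phi>) = kron (xl l) (\<pi> j) (sl l \<phi>)"
          using kron_comp[OF lin_id \<pi>lin[OF j] finl(2)[OF l] lin_id finl(1)[OF l] finE(2) slc[OF \<phi>]] by simp
        also have "\<dots> = kron (xl l) (\<lambda>f. f) (?k \<phi>)"
          using kron_comp[OF finl(2)[OF l] lin_id lin_id \<pi>lin[OF j] finl(1)[OF l] finE(2) slc[OF \<phi>]] by simp
        finally show ?thesis .
      qed
      have xc: "(kron x' (\<lambda>f. f) ^^ i) \<phi> \<in> fspace (?E \<times> B)" for i
        using funpow_closed[of "fspace (?E \<times> B)" "kron x' (\<lambda>f. f)" \<phi> i] hr \<phi> by (auto simp: hrep_def)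
      have kxi: "?k ((kron x' (\<lambda>f. f) ^^ i) \<phi>) = (kron (xl l) (\<lambda>f. f) ^^ i) (?k \<phi>)" for i
        by (induction i) (simp_all add: kx xc)
      have "?k (ten \<chi> d' x' \<rho> p \<phi>) = ten \<chi> fst (xl l) (\<rho>j j) p (?k \<phi>)" if "p \<in> carrier (ore_basis G)" for p
        using that by (cases p) (simp add: ten_def hact_def kg xc kxi)
      then show ?thesis using hk by (auto simp: act_def lin_sum[OF lk] lin_scl[OF lk] subset_iff intro!: sum.cong)
    qed
    show "?\<Phi> (h \<odot>\<^bsub>cmod (?E \<times> B) (ten \<chi> d' x' \<rho>)\<^esub> \<phi>) = h \<odot>\<^bsub>direct_sum (J \<times> \<Lambda>) ?M\<^esub> ?\<Phi> \<phi>"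
      by (auto simp: direct_sum_def main intro!: restrict_ext)
  qed
qed

section \<open>Quotients of the induced modules\<close>

context tensor_pair
begin

lemma pt_zero_right: "m \<in> carrier M \<Longrightarrow> pt m \<zero>\<^bsub>N\<^esub> = \<one>\<^bsub>T\<^esub>"
  using pt_add_right[of m "\<zero>\<^bsub>N\<^esub>" "\<zero>\<^bsub>N\<^esub>"] pt_closed[of m "\<zero>\<^bsub>N\<^esub>"] N
  by (simp add: abelian_group_def abelian_monoid.zero_closed abelian_monoid.l_zero)

lemma pt_zero_left: "n \<in> carrier N \<Longrightarrow> pt \<zero>\<^bsub>M\<^esub> n = \<one>\<^bsub>T\<^esub>"
  using pt_add_left[of "\<zero>\<^bsub>M\<^esub>" "\<zero>\<^bsub>M\<^esub>" n] pt_closed[of "\<zero>\<^bsub>M\<^esub>" n] M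
  by (simp add: abelian_group_def abelian_monoid.zero_closed abelian_monoid.l_zero)

lemma pt_minus:
  assumes "m \<in> carrier M" "n \<in> carrier N"
  shows "pt m (\<ominus>\<^bsub>N\<^esub> n) = inv\<^bsub>T\<^esub> pt m n"
proof -
  have n: "\<ominus>\<^bsub>N\<^esub> n \<in> carrier N" by (rule abelian_group.a_inv_closed[OF N assms(2)])
  have "pt m (\<ominus>\<^bsub>N\<^esub> n) \<otimes>\<^bsub>T\<^esub> pt m n = \<one>\<^bsub>T\<^esub>"
    using pt_add_right[OF assms(1) n assms(2)] abelian_group.l_neg[OF N assms(2)] pt_zero_right[OF assms(1)] by simp
  then show ?thesis using T.inv_equality[of "pt m (\<ominus>\<^bsub>N\<^esub> n)" "pt m n"] pt_closed assms n by simp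
qed

text \<open>Inverses need no separate case, because the inverse of a pure tensor is again pure by
  \<open>pt_minus\<close>; the property is proved for an element and its inverse together.\<close>

lemma tensor_induct_pure [consumes 1, case_names one pure mult]:
  assumes "C \<in> carrier T" and one: "P \<one>\<^bsub>T\<^esub>"
    and pure: "\<And>m n. \<lbrakk>m \<in> carrier M; n \<in> carrier N\<rbrakk> \<Longrightarrow> P (pt m n)"
    and mult: "\<And>C D. \<lbrakk>C \<in> carrier T; D \<in> carrier T; P C; P D\<rbrakk> \<Longrightarrow> P (C \<otimes>\<^bsub>T\<^esub> D)"
  shows "P C"
proof -
  have "P C \<and> P (inv\<^bsub>T\<^esub> C)" using assms(1)
  proof (induction rule: tensor_induct)
    case one then show ?case using \<open>P \<one>\<^bsub>T\<^esub>\<close> by simp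
  next
    case (pure m n)
    have "\<ominus>\<^bsub>N\<^esub> n \<in> carrier N" by (rule abelian_group.a_inv_closed[OF N pure(2)])
    then have "P (pt m (\<ominus>\<^bsub>N\<^esub> n))" using assms(3) pure(1) by blast
    then show ?case using assms(3)[OF pure] pt_minus[OF pure] by simp
  next
    case (mult C D)
    then show ?case using assms(4)[of C D] assms(4)[of "inv\<^bsub>T\<^esub> C" "inv\<^bsub>T\<^esub> D"] by (simp add: T.inv_mult)
  next
    case (inv C) then show ?case by simp
  qed
  then show ?thesis by simp
qed

end

lemma ore_embed_keys: "Poly_Mapping.keys y \<subseteq> carrier G \<Longrightarrow> Poly_Mapping.keys (ore_embed y) \<subseteq> carrier (ore_basis G)"
  unfolding ore_embed_def by (rule order_trans[OF keys_sum]) auto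

lemma ore_embed_single: "ore_embed (Poly_Mapping.single g \<alpha>) = Poly_Mapping.single (g, 0) \<alpha>"
  by (cases "\<alpha> = 0") (simp_all add: ore_embed_def)

lemma shift_power: "(shift s n ^^ i) f = (\<lambda>(c, m). if (c, m) \<in> sdom s n then (if m \<ge> i then f (c, m - i) else 0) else
   (if i = 0 then f (c, m) else 0))"
proof (induction i)
  case 0 then show ?case by (auto simp: fun_eq_iff)
next
  case (Suc i)
  show ?case unfolding funpow.simps comp_apply Suc
    by (auto simp: fun_eq_iff shift_def sdom_def)
qed

section \<open>The map from an induced module to its coordinate model\<close>

locale induced =
  fixes G :: "('g, 'x) monoid_scheme" and \<chi> :: "'g \<Rightarrow> 'k::field" and V :: "('g \<Rightarrow>\<^sub>0 'k, 'v) module"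
    and B :: "'b set" and \<rho> \<theta> \<eta> and s :: nat and n :: "nat \<Rightarrow> nat" and \<beta> :: 'k
  assumes G: "group G" and \<chi>: "\<chi> \<in> carrier (character_group G)"
    and chis: "\<And>g. g \<in> carrier G \<Longrightarrow> \<chi> g ^ s = 1"
    and co: "coordinates G (\<lambda>_ _. 1) V B \<rho> \<theta> \<eta>" and sh: "shape s n \<beta>" and n0: "0 < n 0"
begin

sublocale G: group G by (rule G)
sublocale C: coord G "\<lambda>_ _. 1" V B \<rho> \<theta> \<eta> using co G.is_monoid by (simp add: coord_def)

abbreviation "H \<equiv> ore_algebra G \<chi>"
abbreviation "D \<equiv> sdom s n"
abbreviation "xo \<equiv> xop s n \<beta>"
abbreviation "L \<equiv> ten \<chi> fst xo \<rho>"
abbreviation "IM \<equiv> induced_module G \<chi> V"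

sublocale H: ring H by (rule ring_ore_algebra[OF G \<chi>])

lemma carrier_H: "h \<in> carrier H \<longleftrightarrow> Poly_Mapping.keys h \<subseteq> carrier (ore_basis G)"
  by (simp add: ore_algebra_def twisted_simps)

lemma Hadd: "h \<oplus>\<^bsub>H\<^esub> h' = h + h'" and Hzero: "\<zero>\<^bsub>H\<^esub> = 0" and Hone: "\<one>\<^bsub>H\<^esub> = Poly_Mapping.single (\<one>\<^bsub>G\<^esub>, 0) 1"
  by (simp_all add: ore_algebra_def twisted_simps)

lemma embed_closed: "y \<in> carrier (group_algebra G) \<Longrightarrow> ore_embed y \<in> carrier H"
  using ore_embed_keys by (simp add: carrier_H twisted_simps)

sublocale tensor_pair "carrier (group_algebra G)" H "\<lambda>h y. h \<otimes>\<^bsub>H\<^esub> ore_embed y" V "module.smult V"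
  using left_module.module_group[OF C.M] left_module.smult_closed[OF C.M] H.abelian_group_axioms embed_closed
  by (auto simp: tensor_pair_def)

lemma IM_simps: "carrier IM = carrier T" "a \<oplus>\<^bsub>IM\<^esub> b = a \<otimes>\<^bsub>T\<^esub> b" "\<zero>\<^bsub>IM\<^esub> = \<one>\<^bsub>T\<^esub>"
  by (simp_all add: induced_module_def Let_def)

lemma smult_IM: "h \<odot>\<^bsub>IM\<^esub> a = tensor_map (carrier (group_algebra G)) H (\<lambda>h y. h \<otimes>\<^bsub>H\<^esub> ore_embed y) V (module.smult V)
    (\<lambda>h'. h \<otimes>\<^bsub>H\<^esub> h') (\<lambda>w. w) a"
  by (simp add: induced_module_def Let_def)

lemma
  assumes h: "h \<in> carrier H"
  shows smult_hom: "(\<lambda>a. h \<odot>\<^bsub>IM\<^esub> a) \<in> hom T T"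
    and smult_pt: "\<lbrakk>a \<in> carrier H; v \<in> carrier V\<rbrakk> \<Longrightarrow> h \<odot>\<^bsub>IM\<^esub> pt a v = pt (h \<otimes>\<^bsub>H\<^esub> a) v"
proof -
  have 1: "h \<otimes>\<^bsub>H\<^esub> (m \<otimes>\<^bsub>H\<^esub> ore_embed y) = h \<otimes>\<^bsub>H\<^esub> m \<otimes>\<^bsub>H\<^esub> ore_embed y"
    if "m \<in> carrier H" "y \<in> carrier (group_algebra G)" for m y
    using H.m_assoc[OF h that(1) embed_closed[OF that(2)]] by simp
  show "(\<lambda>a. h \<odot>\<^bsub>IM\<^esub> a) \<in> hom T T" unfolding smult_IM
    by (rule tensor_map_hom) (use h 1 H.r_distr in auto)
  show "h \<odot>\<^bsub>IM\<^esub> pt a v = pt (h \<otimes>\<^bsub>H\<^esub> a) v" if "a \<in> carrier H" "v \<in> carrier V"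
    unfolding smult_IM by (rule tensor_map_pure) (use h 1 H.r_distr that in auto)
qed

lemma smult_closed: "\<lbrakk>h \<in> carrier H; a \<in> carrier T\<rbrakk> \<Longrightarrow> h \<odot>\<^bsub>IM\<^esub> a \<in> carrier T"
  by (rule hom_in_carrier[OF smult_hom])

lemma smult_mult: "\<lbrakk>h \<in> carrier H; a \<in> carrier T; b \<in> carrier T\<rbrakk> \<Longrightarrow> h \<odot>\<^bsub>IM\<^esub> (a \<otimes>\<^bsub>T\<^esub> b) = (h \<odot>\<^bsub>IM\<^esub> a) \<otimes>\<^bsub>T\<^esub> (h \<odot>\<^bsub>IM\<^esub> b)"
  by (rule hom_mult[OF smult_hom])

lemma abelian_IM: "abelian_group IM"
proof (rule abelian_groupI, unfold IM_simps)
  fix a assume "a \<in> carrier T"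
  then show "\<exists>b\<in>carrier T. b \<otimes>\<^bsub>T\<^esub> a = \<one>\<^bsub>T\<^esub>" using T.l_inv T.inv_closed by blast
qed (simp_all add: T.m_ac)

lemma left_module_IM: "left_module H IM"
proof (rule left_moduleI[OF H.ring_axioms abelian_IM])
  fix h a assume "h \<in> carrier H" "a \<in> carrier IM"
  then show "h \<odot>\<^bsub>IM\<^esub> a \<in> carrier IM" by (simp add: IM_simps smult_closed)
next
  fix h h' a assume h: "h \<in> carrier H" "h' \<in> carrier H" and a: "a \<in> carrier IM"
  have a': "a \<in> carrier T" using a by (simp add: IM_simps)
  have hh: "h \<oplus>\<^bsub>H\<^esub> h' \<in> carrier H" "h \<otimes>\<^bsub>H\<^esub> h' \<in> carrier H" using h by simp_all
  have "(\<lambda>a. (h \<odot>\<^bsub>IM\<^esub> a) \<otimes>\<^bsub>T\<^esub> (h' \<odot>\<^bsub>IM\<^esub> a)) \<in> hom T T"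
    by (rule homI) (simp_all add: h smult_closed smult_mult T.m_ac)
  then show "(h \<oplus>\<^bsub>H\<^esub> h') \<odot>\<^bsub>IM\<^esub> a = h \<odot>\<^bsub>IM\<^esub> a \<oplus>\<^bsub>IM\<^esub> h' \<odot>\<^bsub>IM\<^esub> a"
    unfolding IM_simps by (rule hom_eqI[OF T_group smult_hom[OF hh(1)] _ _ a'])
      (simp add: smult_pt h hh H.l_distr pt_add_left)
  have "(\<lambda>a. h \<odot>\<^bsub>IM\<^esub> (h' \<odot>\<^bsub>IM\<^esub> a)) \<in> hom T T"
    by (rule homI) (simp_all add: h smult_closed smult_mult)
  then show "h \<otimes>\<^bsub>H\<^esub> h' \<odot>\<^bsub>IM\<^esub> a = h \<odot>\<^bsub>IM\<^esub> (h' \<odot>\<^bsub>IM\<^esub> a)"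
    by (rule hom_eqI[OF T_group smult_hom[OF hh(2)] _ _ a'])
      (simp add: smult_pt h hh H.m_assoc)
next
  fix h a b assume "h \<in> carrier H" "a \<in> carrier IM" "b \<in> carrier IM"
  then show "h \<odot>\<^bsub>IM\<^esub> (a \<oplus>\<^bsub>IM\<^esub> b) = h \<odot>\<^bsub>IM\<^esub> a \<oplus>\<^bsub>IM\<^esub> h \<odot>\<^bsub>IM\<^esub> b" by (simp add: IM_simps smult_mult)
next
  fix a assume "a \<in> carrier IM"
  then have a: "a \<in> carrier T" by (simp add: IM_simps)
  show "\<one>\<^bsub>H\<^esub> \<odot>\<^bsub>IM\<^esub> a = a"
    by (rule hom_eqI[OF T_group smult_hom[OF H.one_closed] _ _ a]) (simp_all add: smult_pt hom_def)
qed

lemma hrep_target: "hrep G \<chi> (D \<times> B) (tenrep \<chi> fst \<rho>) (kron xo (\<lambda>f. f))"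
  by (rule hrep_ten[OF G \<chi> chis graded_xop[OF sh] C.L])

lemma hops_target: "hops G \<chi> (D \<times> B) L" unfolding ten_def by (rule hops_hact[OF hrep_target])

lemma left_module_target: "left_module H (cmod (D \<times> B) L)"
  unfolding ten_def by (rule left_module_hact[OF G \<chi> hrep_target])

lemma act_H_mult: "\<lbrakk>h \<in> carrier H; h' \<in> carrier H; \<phi> \<in> fspace (D \<times> B)\<rbrakk> \<Longrightarrow>
  act L (h \<otimes>\<^bsub>H\<^esub> h') \<phi> = act L h (act L h' \<phi>)"
  by (simp only: carrier_H) (simp add: act_mult[OF hops_target] ore_algebra_def)

lemma act_H_closed: "\<lbrakk>h \<in> carrier H; \<phi> \<in> fspace (D \<times> B)\<rbrakk> \<Longrightarrow> act L h \<phi> \<in> fspace (D \<times> B)"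
  using left_module.smult_closed[OF left_module_target, of h \<phi>] by simp

lemma act_H_lin: "h \<in> carrier H \<Longrightarrow> lin (act L h)"
  using hops_target by (intro lin_act) (auto simp: carrier_H operators_def subset_iff)

abbreviation "d0 \<equiv> (dl (0, 0) :: nat \<times> nat \<Rightarrow> 'k)"

text \<open>The image of \<open>1 \<otimes> v\<close>. The basis vector at \<open>(0, 0)\<close> has
  degree 0, so \<open>G\<close> acts on \<open>e0 v\<close> through \<open>v\<close> alone and
  \<open>e0\<close> is compatible with \<open>kG\<close>.\<close>

definition "e0 v = tens d0 (\<theta> v)"

lemma e0D: "(0, 0) \<in> D"
  using n0 sh by (simp add: sdom_def shape_def)

lemma e0_closed: "v \<in> carrier V \<Longrightarrow> e0 v \<in> fspace (D \<times> B)"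
  using e0D by (simp add: e0_def tens_closed)

lemma act_embed: "\<lbrakk>y \<in> carrier (group_algebra G); v \<in> carrier V\<rbrakk> \<Longrightarrow> act L (ore_embed y) (e0 v) = e0 (y \<odot>\<^bsub>V\<^esub> v)"
proof -
  assume y: "y \<in> carrier (group_algebra G)" and v: "v \<in> carrier V"
  have yk: "Poly_Mapping.keys y \<subseteq> carrier G" using y by (simp add: twisted_simps)
  have "act L (ore_embed y) (e0 v) = (\<Sum>g\<in>Poly_Mapping.keys y. scl (Poly_Mapping.lookup y g) (L (g, 0) (e0 v)))"
    unfolding ore_embed_def act_sum by simp
  also have "\<dots> = (\<Sum>g\<in>Poly_Mapping.keys y. tens d0 (scl (Poly_Mapping.lookup y g) (\<rho> g (\<theta> v))))"
  proof (rule sum.cong[OF refl])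
    fix g assume "g \<in> Poly_Mapping.keys y"
    then have g: "g \<in> carrier G" using yk by auto
    have "Dg fst (\<chi> g) d0 = d0"
      by (auto simp: Dg_def dl_def fun_eq_iff)
    then show "scl (Poly_Mapping.lookup y g) (L (g, 0) (e0 v)) = tens d0 (scl (Poly_Mapping.lookup y g) (\<rho> g (\<theta> v)))"
      using C.Lp(2)[OF g] by (simp add: ten_def hact_def tenrep_def e0_def kron_tens tens_scl)
  qed
  also have "\<dots> = tens d0 (act \<rho> y (\<theta> v))"
  proof -
    have "lin (tens d0 :: ('b \<Rightarrow> 'k) \<Rightarrow> _)" by (rule linI) (simp_all add: tens_add tens_scl)
    then show ?thesis by (simp only: act_def lin_sum)
  qed
  finally show ?thesis using v yk by (simp add: e0_def)
qed

text \<open>Frobenius reciprocity: the \<open>kG\<close>-linear map \<open>e0\<close> extends to the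
  induced module by \<open>h \<otimes> v \<mapsto> h (e0 v)\<close>.\<close>

lemma ex_F: "\<exists>F. F \<in> hom T (fgroup (D \<times> B)) \<and> (\<forall>h\<in>carrier H. \<forall>v\<in>carrier V. F (pt h v) = act L h (e0 v))"
proof (rule tensor_lift[OF comm_group_fgroup[of "D \<times> B"], of "\<lambda>h v. act L h (e0 v)"])
  fix h v and y :: "'g \<Rightarrow>\<^sub>0 'k" assume "h \<in> carrier H" "y \<in> carrier (group_algebra G)" "v \<in> carrier V"
  then show "act L (h \<otimes>\<^bsub>H\<^esub> ore_embed y) (e0 v) = act L h (e0 (y \<odot>\<^bsub>V\<^esub> v))"
    by (simp add: act_H_mult embed_closed e0_closed act_embed)
next
  fix h v v' assume "h \<in> carrier H" "v \<in> carrier V" "v' \<in> carrier V"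
  then show "act L h (e0 (v \<oplus>\<^bsub>V\<^esub> v')) = act L h (e0 v) \<otimes>\<^bsub>fgroup (D \<times> B)\<^esub> act L h (e0 v')"
    by (simp add: e0_def tens_add lin_add[OF act_H_lin])
qed (auto simp: act_H_closed e0_closed Hadd act_add)

definition F where "F = (SOME F. F \<in> hom T (fgroup (D \<times> B)) \<and> (\<forall>h\<in>carrier H. \<forall>v\<in>carrier V. F (pt h v) = act L h (e0 v)))"

lemma F_hom: "F \<in> hom T (fgroup (D \<times> B))" and F_pt: "\<lbrakk>h \<in> carrier H; v \<in> carrier V\<rbrakk> \<Longrightarrow> F (pt h v) = act L h (e0 v)"
  using someI_ex[OF ex_F] unfolding F_def by blast+

lemma F_closed: "a \<in> carrier T \<Longrightarrow> F a \<in> fspace (D \<times> B)"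
  using F_hom by (auto simp: hom_def)

lemma F_mult: "\<lbrakk>a \<in> carrier T; b \<in> carrier T\<rbrakk> \<Longrightarrow> F (a \<otimes>\<^bsub>T\<^esub> b) = F a + F b"
  using F_hom by (auto simp: hom_def)

lemma F_smult:
  assumes h: "h \<in> carrier H" and a: "a \<in> carrier T"
  shows "F (h \<odot>\<^bsub>IM\<^esub> a) = act L h (F a)"
proof (rule hom_eqI[OF comm_group_fgroup[of "D \<times> B"] _ _ _ a])
  show "(\<lambda>a. F (h \<odot>\<^bsub>IM\<^esub> a)) \<in> hom T (fgroup (D \<times> B))"
    using hom_compose[OF smult_hom[OF h] F_hom] by (simp add: comp_def)
  show "(\<lambda>a. act L h (F a)) \<in> hom T (fgroup (D \<times> B))"
    by (rule homI) (simp_all add: h F_closed act_H_closed F_mult lin_add[OF act_H_lin])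
  show "F (h \<odot>\<^bsub>IM\<^esub> pt m v) = act L h (F (pt m v))" if "m \<in> carrier H" "v \<in> carrier V" for m v
    using that h by (simp add: smult_pt F_pt act_H_mult e0_closed)
qed

definition "x = ore_x G"
definition "z = (x [^]\<^bsub>H\<^esub> s) \<ominus>\<^bsub>H\<^esub> scalar (ore_basis G) \<beta>"
definition "y c m = (z [^]\<^bsub>H\<^esub> (m::nat)) \<otimes>\<^bsub>H\<^esub> (x [^]\<^bsub>H\<^esub> (c::nat))"

lemma x_closed [simp]: "x \<in> carrier H" by (simp add: x_def ore_x_def carrier_H)

lemma scalar_closed [simp]: "scalar (ore_basis G) \<alpha> \<in> carrier H" by (simp add: scalar_def carrier_H)

lemma z_closed [simp]: "z \<in> carrier H" by (simp add: z_def)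

lemma y_closed [simp]: "y c m \<in> carrier H" by (simp add: y_def)

lemma x_power: "x [^]\<^bsub>H\<^esub> (i::nat) = Poly_Mapping.single (\<one>\<^bsub>G\<^esub>, i) 1"
proof -
  have "ore_g \<one>\<^bsub>G\<^esub> \<otimes>\<^bsub>H\<^esub> (x [^]\<^bsub>H\<^esub> i) = Poly_Mapping.single (\<one>\<^bsub>G\<^esub>, i) 1"
    unfolding x_def by (rule ore_normal_form[OF G \<chi> G.one_closed])
  moreover have "ore_g \<one>\<^bsub>G\<^esub> = \<one>\<^bsub>H\<^esub>" by (simp add: ore_g_def Hone)
  ultimately show ?thesis by simp
qed

lemma scalar_comm: "x \<otimes>\<^bsub>H\<^esub> scalar (ore_basis G) \<beta> = scalar (ore_basis G) \<beta> \<otimes>\<^bsub>H\<^esub> x"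
  by (simp add: x_def ore_x_def scalar_def ore_algebra_def twisted_mult_single character_one[OF G \<chi>] del: One_nat_def)

lemma x_z_commute: "x \<otimes>\<^bsub>H\<^esub> z = z \<otimes>\<^bsub>H\<^esub> x"
proof -
  have "x \<otimes>\<^bsub>H\<^esub> (x [^]\<^bsub>H\<^esub> s) = (x [^]\<^bsub>H\<^esub> s) \<otimes>\<^bsub>H\<^esub> x" by (metis H.nat_pow_Suc H.nat_pow_Suc2 x_closed)
  then show ?thesis
    by (simp add: z_def H.minus_eq H.r_distr H.l_distr H.r_minus H.l_minus scalar_comm)
qed

lemma x_z_power_commute: "x \<otimes>\<^bsub>H\<^esub> (z [^]\<^bsub>H\<^esub> (m::nat)) = (z [^]\<^bsub>H\<^esub> m) \<otimes>\<^bsub>H\<^esub> x"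
proof (induction m)
  case 0 then show ?case by simp
next
  case (Suc m)
  have "x \<otimes>\<^bsub>H\<^esub> (z [^]\<^bsub>H\<^esub> Suc m) = (x \<otimes>\<^bsub>H\<^esub> (z [^]\<^bsub>H\<^esub> m)) \<otimes>\<^bsub>H\<^esub> z" by (simp add: H.m_assoc)
  also have "\<dots> = (z [^]\<^bsub>H\<^esub> m) \<otimes>\<^bsub>H\<^esub> (x \<otimes>\<^bsub>H\<^esub> z)" by (simp add: Suc H.m_assoc)
  also have "\<dots> = (z [^]\<^bsub>H\<^esub> Suc m) \<otimes>\<^bsub>H\<^esub> x" by (simp add: x_z_commute H.m_assoc)
  finally show ?case .
qed

lemma x_mult_y: "x \<otimes>\<^bsub>H\<^esub> y c m = y (Suc c) m"
proof -
  have "x \<otimes>\<^bsub>H\<^esub> y c m = (z [^]\<^bsub>H\<^esub> m) \<otimes>\<^bsub>H\<^esub> (x \<otimes>\<^bsub>H\<^esub> (x [^]\<^bsub>H\<^esub> c))"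
    by (simp add: y_def x_z_power_commute H.m_assoc[symmetric])
  then show ?thesis by (simp only: y_def H.nat_pow_Suc2[OF x_closed])
qed

text \<open>The wrap-around inside \<open>H\<close>, from \<open>x^s = z + \<beta>\<close>. The
  scalar stands on the right as an element of the embedded \<open>kG\<close>, so that it can cross
  the tensor sign and act on \<open>V\<close>.\<close>

lemma y_s: "y s m = y 0 (Suc m) \<oplus>\<^bsub>H\<^esub> (z [^]\<^bsub>H\<^esub> m) \<otimes>\<^bsub>H\<^esub> ore_embed (scalar G \<beta>)"
proof -
  have "x [^]\<^bsub>H\<^esub> s = z \<oplus>\<^bsub>H\<^esub> scalar (ore_basis G) \<beta>"
    by (simp add: z_def H.minus_eq H.a_assoc H.l_neg)
  moreover have "ore_embed (scalar G \<beta>) = scalar (ore_basis G) \<beta>" by (simp add: scalar_def ore_embed_single)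
  ultimately show ?thesis by (simp add: y_def H.r_distr)
qed

lemma act_x: "\<phi> \<in> fspace (D \<times> B) \<Longrightarrow> act L x \<phi> = kron xo (\<lambda>f. f) \<phi>"
  using hrep_target by (simp add: x_def ore_x_def ten_def hact_def hrep_def operators_def)

lemma act_x_tens: "\<lbrakk>f \<in> fspace D; w \<in> fspace B\<rbrakk> \<Longrightarrow> act L x (tens f w) = tens (xo f) w"
  by (simp add: act_x tens_closed kron_tens lin_xop)

lemma act_power:
  assumes h: "h \<in> carrier H" and kk: "\<And>f. f \<in> fspace D \<Longrightarrow> kk f \<in> fspace D"
    and hkk: "\<And>f. f \<in> fspace D \<Longrightarrow> act L h (tens f w) = tens (kk f) w" and w: "w \<in> fspace B" and f: "f \<in> fspace D"
  shows "act L (h [^]\<^bsub>H\<^esub> (i::nat)) (tens f w) = tens ((kk ^^ i) f) w"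
  using f
proof (induction i arbitrary: f)
  case 0 then show ?case using hops_target by (simp add: Hone operators_def tens_closed w)
next
  case (Suc i)
  have "act L (h [^]\<^bsub>H\<^esub> Suc i) (tens f w) = act L (h [^]\<^bsub>H\<^esub> i) (act L h (tens f w))"
    using h Suc.prems w by (simp add: act_H_mult tens_closed)
  also have "\<dots> = tens ((kk ^^ i) (kk f)) w" using Suc kk hkk by simp
  finally show ?case by (simp only: funpow_Suc_right comp_def)
qed

lemma act_x_power: "\<lbrakk>f \<in> fspace D; w \<in> fspace B\<rbrakk> \<Longrightarrow> act L (x [^]\<^bsub>H\<^esub> (i::nat)) (tens f w) = tens ((xo ^^ i) f) w"
  by (rule act_power) (simp_all add: xop_closed act_x_tens)

lemma act_z: "\<lbrakk>f \<in> fspace D; w \<in> fspace B\<rbrakk> \<Longrightarrow> act L z (tens f w) = tens (shift s n f) w"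
proof -
  assume f: "f \<in> fspace D" and w: "w \<in> fspace B"
  have "act L (x [^]\<^bsub>H\<^esub> s) (tens f w) = act L (z \<oplus>\<^bsub>H\<^esub> scalar (ore_basis G) \<beta>) (tens f w)"
    by (simp add: z_def H.minus_eq H.a_assoc H.l_neg)
  also have "\<dots> = act L z (tens f w) + scl \<beta> (tens f w)"
    using scalar_act[OF hops_target tens_closed[OF f w]] by (simp only: Hadd act_add)
  finally have "tens (scl \<beta> f + shift s n f) w = act L z (tens f w) + scl \<beta> (tens f w)"
    using f w by (simp add: act_x_power xop_power_s[OF sh f])
  then show ?thesis by (simp add: tens_add tens_scl add.commute)
qed

lemma act_z_power: "\<lbrakk>f \<in> fspace D; w \<in> fspace B\<rbrakk> \<Longrightarrow> act L (z [^]\<^bsub>H\<^esub> (i::nat)) (tens f w) = tens ((shift s n ^^ i) f) w"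
  by (rule act_power) (simp_all add: shift_closed act_z)

lemma sdom_less: "(c, m) \<in> D \<Longrightarrow> c < s" by (simp add: sdom_def)

text \<open>Starting at degree 0, fewer than \<open>s\<close> steps with \<open>x\<close> do not
  wrap around, and \<open>z\<close> acts as \<open>shift\<close>. So \<open>y c m\<close> reaches
  the basis vector at \<open>(c, m)\<close>, or falls out of the domain.\<close>

lemma F_y:
  assumes c: "c < s" and v: "v \<in> carrier V"
  shows "F (pt (y c m) v) = (if (c, m) \<in> D then tens (dl (c, m)) (\<theta> v) else 0)"
proof -
  have d: "d0 \<in> fspace D" using e0D by simp
  have xc: "(xo ^^ c) d0 \<in> fspace D" using funpow_closed[of "fspace D" xo d0 c] d xop_closed by blast
  have "F (pt (y c m) v) = act L (z [^]\<^bsub>H\<^esub> m) (act L (x [^]\<^bsub>H\<^esub> c) (tens d0 (\<theta> v)))"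
    using v e0_closed[OF v] by (simp add: F_pt y_def act_H_mult e0_def)
  also have "\<dots> = tens ((shift s n ^^ m) ((xo ^^ c) d0)) (\<theta> v)"
    using d v xc by (simp add: act_x_power act_z_power)
  also have "(shift s n ^^ m) ((xo ^^ c) d0) = (if (c, m) \<in> D then dl (c, m) else 0)"
  proof -
    have "(xo ^^ c) d0 = (if (c, 0) \<in> D then dl (c, 0) else 0)"
      using c by (subst xop_power[OF sh d]) (auto simp: fun_eq_iff dl_def fapply)
    then show ?thesis by (auto simp: shift_power fun_eq_iff dl_def fapply sdom_def)
  qed
  finally show ?thesis by (auto simp: tens_def fun_eq_iff fapply)
qed

definition "comb f = finprod T (\<lambda>(c, m). pt (y c m) (f (c, m))) D"

lemma V_zero_closed: "\<zero>\<^bsub>V\<^esub> \<in> carrier V" and V_add_closed: "\<lbrakk>v \<in> carrier V; w \<in> carrier V\<rbrakk> \<Longrightarrow> v \<oplus>\<^bsub>V\<^esub> w \<in> carrier V"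
  using left_module.module_group[OF C.M] by (auto simp: abelian_group_def abelian_monoid.zero_closed)

lemma comb_closed: "f \<in> D \<rightarrow> carrier V \<Longrightarrow> comb f \<in> carrier T"
  unfolding comb_def by (rule T.finprod_closed) (auto intro!: pt_closed)

lemma F_comb:
  assumes f: "f \<in> D \<rightarrow> carrier V"
  shows "F (comb f) ((c, m), b) = (if (c, m) \<in> D then \<theta> (f (c, m)) b else 0)"
proof -
  have "F (comb f) = (\<Sum>(c, m)\<in>D. F (pt (y c m) (f (c, m))))"
    unfolding comb_def using f
    by (subst hom_finprod_sum[OF T_group F_hom _ finite_sdom]) (auto intro!: pt_closed simp: split_beta)
  also have "\<dots> = (\<Sum>p\<in>D. tens (dl p) (\<theta> (f p)))"
  proof (intro sum.cong refl, clarify)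
    fix c m assume cm: "(c, m) \<in> D"
    then have "f (c, m) \<in> carrier V" using f by blast
    then show "F (pt (y c m) (f (c, m))) = tens (dl (c, m)) (\<theta> (f (c, m)))"
      using F_y[OF sdom_less[OF cm], of "f (c, m)" m] cm by simp
  qed
  finally have e: "F (comb f) = (\<Sum>p\<in>D. tens (dl p) (\<theta> (f p)))" .
  have "F (comb f) ((c, m), b) = (\<Sum>p\<in>D. if p = (c, m) then \<theta> (f p) b else 0)"
    unfolding e sum_fun_apply by (intro sum.cong refl) (auto simp: tens_def dl_def)
  then show ?thesis using finite_sdom[of s n] by simp
qed

lemma comb_zero: "(\<And>p. p \<in> D \<Longrightarrow> f p = \<zero>\<^bsub>V\<^esub>) \<Longrightarrow> comb f = \<one>\<^bsub>T\<^esub>"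
  unfolding comb_def by (rule T.finprod_one_eqI) (auto simp: pt_zero_right)

lemma comb_single:
  assumes "p \<in> D" "v \<in> carrier V"
  shows "comb (\<lambda>p'. if p' = p then v else \<zero>\<^bsub>V\<^esub>) = pt (y (fst p) (snd p)) v"
proof -
  have "comb (\<lambda>p'. if p' = p then v else \<zero>\<^bsub>V\<^esub>) = finprod T (\<lambda>p'. if p = p' then pt (y (fst p') (snd p')) v else \<one>\<^bsub>T\<^esub>) D"
    unfolding comb_def using assms V_zero_closed by (intro T.finprod_cong') (auto intro!: pt_closed simp: pt_zero_right)
  also have "\<dots> = pt (y (fst p) (snd p)) v"
    using assms finite_sdom[of s n] by (intro T.finprod_singleton) (auto intro!: pt_closed)
  finally show ?thesis .
qed

lemma comb_add:
  assumes f: "f \<in> D \<rightarrow> carrier V" and g: "g \<in> D \<rightarrow> carrier V"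
  shows "comb (\<lambda>p. f p \<oplus>\<^bsub>V\<^esub> g p) = comb f \<otimes>\<^bsub>T\<^esub> comb g"
proof -
  have "comb (\<lambda>p. f p \<oplus>\<^bsub>V\<^esub> g p) = finprod T (\<lambda>p. (case p of (c, m) \<Rightarrow> pt (y c m) (f (c, m))) \<otimes>\<^bsub>T\<^esub>
      (case p of (c, m) \<Rightarrow> pt (y c m) (g (c, m)))) D"
    unfolding comb_def using f g
    by (intro T.finprod_cong' refl) (auto simp: Pi_iff pt_add_right intro!: pt_closed T.m_closed)
  also have "\<dots> = comb f \<otimes>\<^bsub>T\<^esub> comb g"
    unfolding comb_def using f g by (intro T.finprod_multf) (auto intro!: pt_closed)
  finally show ?thesis .
qed

text \<open>
  \<open>F\<close> is injective on the combinations \<open>comb f\<close>. Hence a submodule \<open>KK\<close> that \<open>F\<close> kills is the whole kernel as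
  soon as it contains the elements \<open>y c m \<otimes> v\<close> with \<open>(c, m)\<close> outside \<open>D\<close>, for then these combinations and
  \<open>KK\<close> span the induced module.
\<close>

definition "decomp KK a \<longleftrightarrow> (\<exists>f\<in>D \<rightarrow> carrier V. \<exists>k\<in>KK. a = comb f \<otimes>\<^bsub>T\<^esub> k)"

context
  fixes KK
  assumes K: "KK \<subseteq> carrier T" and Kone: "\<one>\<^bsub>T\<^esub> \<in> KK" and Kmult: "\<And>a b. \<lbrakk>a \<in> KK; b \<in> KK\<rbrakk> \<Longrightarrow> a \<otimes>\<^bsub>T\<^esub> b \<in> KK"
    and Kx: "\<And>a. a \<in> KK \<Longrightarrow> x \<odot>\<^bsub>IM\<^esub> a \<in> KK"
    and Ky: "\<And>c m v. \<lbrakk>c < s; (c, m) \<notin> D; v \<in> carrier V\<rbrakk> \<Longrightarrow> pt (y c m) v \<in> KK"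
    and KF: "\<And>a. a \<in> KK \<Longrightarrow> F a = 0"
begin

lemma decomp_mult:
  assumes "decomp KK a" "decomp KK b"
  shows "decomp KK (a \<otimes>\<^bsub>T\<^esub> b)"
proof -
  obtain f k g l where f: "f \<in> D \<rightarrow> carrier V" "k \<in> KK" "a = comb f \<otimes>\<^bsub>T\<^esub> k"
    and g: "g \<in> D \<rightarrow> carrier V" "l \<in> KK" "b = comb g \<otimes>\<^bsub>T\<^esub> l"
    using assms unfolding decomp_def by blast
  have kl: "k \<in> carrier T" "l \<in> carrier T" using f g K by auto
  have "a \<otimes>\<^bsub>T\<^esub> b = comb (\<lambda>p. f p \<oplus>\<^bsub>V\<^esub> g p) \<otimes>\<^bsub>T\<^esub> (k \<otimes>\<^bsub>T\<^esub> l)"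
    using f g kl by (simp add: comb_add comb_closed T.m_ac)
  moreover have "(\<lambda>p. f p \<oplus>\<^bsub>V\<^esub> g p) \<in> D \<rightarrow> carrier V" using f g V_add_closed by (auto simp: Pi_iff)
  ultimately show ?thesis using Kmult f g unfolding decomp_def by blast
qed

lemma decomp_K: "k \<in> KK \<Longrightarrow> decomp KK k"
  unfolding decomp_def using K V_zero_closed by (intro bexI[of _ "\<lambda>_. \<zero>\<^bsub>V\<^esub>"] bexI[of _ k]) (auto simp: comb_zero)

lemma decomp_y: "\<lbrakk>c < s; v \<in> carrier V\<rbrakk> \<Longrightarrow> decomp KK (pt (y c m) v)"
proof (cases "(c, m) \<in> D")
  case True
  assume v: "v \<in> carrier V"
  let ?f = "\<lambda>p'. if p' = (c, m) then v else \<zero>\<^bsub>V\<^esub>"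
  have "pt (y c m) v = comb ?f \<otimes>\<^bsub>T\<^esub> \<one>\<^bsub>T\<^esub>" using comb_single[OF True v] v by (simp add: pt_closed)
  moreover have "?f \<in> D \<rightarrow> carrier V" using v V_zero_closed by auto
  ultimately show ?thesis using Kone unfolding decomp_def by blast
next
  case False
  assume "c < s" "v \<in> carrier V"
  then show ?thesis using Ky False decomp_K by blast
qed

lemma decomp_x_y: "\<lbrakk>c < s; v \<in> carrier V\<rbrakk> \<Longrightarrow> decomp KK (x \<odot>\<^bsub>IM\<^esub> pt (y c m) v)"
proof -
  assume c: "c < s" and v: "v \<in> carrier V"
  have s0: "0 < s" using c by simp
  have e: "x \<odot>\<^bsub>IM\<^esub> pt (y c m) v = pt (y (Suc c) m) v" using v by (simp add: smult_pt x_mult_y)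
  show ?thesis
  proof (cases "Suc c < s")
    case True then show ?thesis unfolding e using v by (rule decomp_y)
  next
    case False
    then have "Suc c = s" using c by simp
    moreover have sg: "scalar G \<beta> \<in> carrier (group_algebra G)" by (simp add: scalar_def twisted_simps)
    ultimately have "pt (y (Suc c) m) v = pt (y 0 (Suc m)) v \<otimes>\<^bsub>T\<^esub> pt (z [^]\<^bsub>H\<^esub> m) (scalar G \<beta> \<odot>\<^bsub>V\<^esub> v)"
      using v embed_closed[OF sg] by (simp add: y_s pt_add_left pt_balanced)
    moreover have "z [^]\<^bsub>H\<^esub> m = y 0 m" by (simp add: y_def)
    ultimately show ?thesis unfolding e using decomp_y[OF s0] v C.scalar_closed by (simp add: decomp_mult)
  qed
qed

lemma decomp_finprod:
  assumes "finite A" "\<And>p. p \<in> A \<Longrightarrow> decomp KK (g p)" "g \<in> A \<rightarrow> carrier T"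
  shows "decomp KK (finprod T g A)"
  using assms
proof (induction A rule: finite_induct)
  case empty then show ?case using decomp_K[OF Kone] by simp
next
  case (insert p A)
  then have "finprod T g (insert p A) = g p \<otimes>\<^bsub>T\<^esub> finprod T g A" by (intro T.finprod_insert) auto
  then show ?case using insert by (simp add: decomp_mult Pi_iff)
qed

lemma decomp_x: "decomp KK a \<Longrightarrow> decomp KK (x \<odot>\<^bsub>IM\<^esub> a)"
proof -
  assume "decomp KK a"
  then obtain f k where f: "f \<in> D \<rightarrow> carrier V" "k \<in> KK" "a = comb f \<otimes>\<^bsub>T\<^esub> k" unfolding decomp_def by blast
  have k: "k \<in> carrier T" using f K by auto
  interpret hx: group_hom T T "\<lambda>a. x \<odot>\<^bsub>IM\<^esub> a" by unfold_locales (rule smult_hom[OF x_closed])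
  let ?g = "\<lambda>(c, m). pt (y c m) (f (c, m))"
  have gc: "?g \<in> D \<rightarrow> carrier T" using f by (auto intro!: pt_closed)
  have "x \<odot>\<^bsub>IM\<^esub> finprod T ?g A = finprod T (\<lambda>p. x \<odot>\<^bsub>IM\<^esub> ?g p) A" if "finite A" "A \<subseteq> D" for A
    using that
  proof (induction A rule: finite_induct)
    case empty then show ?case using hx.hom_one by simp
  next
    case (insert p A)
    then have p: "?g p \<in> carrier T" and A: "?g \<in> A \<rightarrow> carrier T" using gc by (auto simp: Pi_iff)
    have "x \<odot>\<^bsub>IM\<^esub> finprod T ?g (insert p A) = x \<odot>\<^bsub>IM\<^esub> (?g p \<otimes>\<^bsub>T\<^esub> finprod T ?g A)"
      using insert p A by (subst T.finprod_insert) auto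
    also have "\<dots> = (x \<odot>\<^bsub>IM\<^esub> ?g p) \<otimes>\<^bsub>T\<^esub> finprod T (\<lambda>p. x \<odot>\<^bsub>IM\<^esub> ?g p) A"
      using insert p T.finprod_closed[OF A] by (simp add: smult_mult)
    also have "\<dots> = finprod T (\<lambda>p. x \<odot>\<^bsub>IM\<^esub> ?g p) (insert p A)"
      using insert p A by (intro T.finprod_insert[symmetric]) (auto simp: Pi_iff intro!: smult_closed)
    finally show ?case .
  qed
  then have e: "x \<odot>\<^bsub>IM\<^esub> comb f = finprod T (\<lambda>p. x \<odot>\<^bsub>IM\<^esub> ?g p) D" using finite_sdom by (simp add: comb_def)
  have "decomp KK (finprod T (\<lambda>p. x \<odot>\<^bsub>IM\<^esub> ?g p) D)"
    using f gc by (intro decomp_finprod finite_sdom) (auto simp: Pi_iff dest: sdom_less intro!: decomp_x_y smult_closed)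
  then have "decomp KK ((x \<odot>\<^bsub>IM\<^esub> comb f) \<otimes>\<^bsub>T\<^esub> (x \<odot>\<^bsub>IM\<^esub> k))"
    using Kx[OF f(2)] by (simp add: e decomp_mult decomp_K)
  then show ?thesis using f k by (simp add: smult_mult comb_closed)
qed

lemma decomp_x_power: "v \<in> carrier V \<Longrightarrow> decomp KK (pt (x [^]\<^bsub>H\<^esub> (i::nat)) v)"
proof (induction i)
  case 0
  have "0 < s" using sh by (simp add: shape_def)
  then show ?case using decomp_y[of 0 v 0] 0 by (simp add: y_def)
next
  case (Suc i)
  then show ?case using decomp_x[of "pt (x [^]\<^bsub>H\<^esub> i) v"] by (simp only: smult_pt x_closed H.nat_pow_closed H.nat_pow_Suc2)
qed

text \<open>Stability under \<open>x\<close> suffices for this: every basis element of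
  \<open>H\<close> is a power of \<open>x\<close> times an element of \<open>kG\<close>, and the
  latter is absorbed by \<open>V\<close>.\<close>

lemma decomp_all: "a \<in> carrier T \<Longrightarrow> decomp KK a"
proof (induction rule: tensor_induct_pure)
  case one then show ?case by (rule decomp_K[OF Kone])
next
  case (mult a b) then show ?case by (simp add: decomp_mult)
next
  case (pure h v)
  have "decomp KK (pt (\<Sum>p\<in>A. Poly_Mapping.single p (Poly_Mapping.lookup h p)) v)"
    if "finite A" "A \<subseteq> carrier (ore_basis G)" for A
    using that
  proof (induction A rule: finite_induct)
    case empty then show ?case using decomp_K[OF Kone] pt_zero_left[OF pure(2)] by (simp add: Hzero)
  next
    case (insert p A)
    obtain g i where p: "p = (g, i)" "g \<in> carrier G" using insert by (cases p) auto
    let ?\<alpha> = "Poly_Mapping.lookup h p"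
    \<comment> \<open>A basis element \<open>g x^i\<close> has \<open>g\<close> on the wrong side;
      \<open>g x^i = \<chi>(g)^i x^i g\<close> brings it next to the tensor sign.\<close>
    let ?w = "Poly_Mapping.single g (?\<alpha> * \<chi> g ^ i)"
    have w: "?w \<in> carrier (group_algebra G)" using p by (simp add: twisted_simps)
    have "Poly_Mapping.single p ?\<alpha> = (x [^]\<^bsub>H\<^esub> i) \<otimes>\<^bsub>H\<^esub> ore_embed ?w"
      using p character_nonzero[OF \<chi> p(2)]
      unfolding x_power by (simp add: ore_embed_single ore_algebra_def twisted_mult_single mult.assoc flip: power_mult_distrib)
    then have "pt (Poly_Mapping.single p ?\<alpha>) v = pt (x [^]\<^bsub>H\<^esub> i) (?w \<odot>\<^bsub>V\<^esub> v)"
      using pt_balanced[OF _ w pure(2), of "x [^]\<^bsub>H\<^esub> i"] by simp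
    then have 1: "decomp KK (pt (Poly_Mapping.single p ?\<alpha>) v)"
      using decomp_x_power w pure(2) left_module.smult_closed[OF C.M] by simp
    have sc: "Poly_Mapping.single q (Poly_Mapping.lookup h q) \<in> carrier H" if "q \<in> carrier (ore_basis G)" for q
      using that by (simp add: carrier_H)
    have "(\<Sum>p\<in>A. Poly_Mapping.single p (Poly_Mapping.lookup h p)) \<in> carrier H"
      unfolding carrier_H by (rule order_trans[OF keys_sum]) (use insert in auto)
    then have "pt (\<Sum>p\<in>insert p A. Poly_Mapping.single p (Poly_Mapping.lookup h p)) v =
      pt (Poly_Mapping.single p ?\<alpha>) v \<otimes>\<^bsub>T\<^esub> pt (\<Sum>p\<in>A. Poly_Mapping.single p (Poly_Mapping.lookup h p)) v"
      using insert sc pure(2) by (simp add: pt_add_left flip: Hadd)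
    then show ?case using 1 insert by (simp add: decomp_mult)
  qed
  from this[of "Poly_Mapping.keys h"] show ?case
    using pure(1) by (simp add: carrier_H flip: poly_mapping_sum_single)
qed

lemma kernel_F: "KK = {a \<in> carrier IM. F a = \<zero>\<^bsub>cmod (D \<times> B) L\<^esub>}"
proof
  show "KK \<subseteq> {a \<in> carrier IM. F a = \<zero>\<^bsub>cmod (D \<times> B) L\<^esub>}" using K KF by (auto simp: IM_simps)
  show "{a \<in> carrier IM. F a = \<zero>\<^bsub>cmod (D \<times> B) L\<^esub>} \<subseteq> KK"
  proof
    fix a assume "a \<in> {a \<in> carrier IM. F a = \<zero>\<^bsub>cmod (D \<times> B) L\<^esub>}"
    then have a: "a \<in> carrier T" "F a = 0" by (auto simp: IM_simps)
    obtain f k where f: "f \<in> D \<rightarrow> carrier V" "k \<in> KK" "a = comb f \<otimes>\<^bsub>T\<^esub> k"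
      using decomp_all[OF a(1)] unfolding decomp_def by blast
    have k: "k \<in> carrier T" using f K by auto
    have "F (comb f) = 0" using a(2) f k KF[OF f(2)] by (simp add: F_mult comb_closed)
    have "f p = \<zero>\<^bsub>V\<^esub>" if p: "p \<in> D" for p
    proof -
      obtain c m where cm: "p = (c, m)" by (cases p)
      have "\<theta> (f p) b = 0" for b
        using F_comb[OF f(1), of c m b] p \<open>F (comb f) = 0\<close> by (simp add: cm fapply)
      then have t: "\<theta> (f p) = 0" by (simp add: fun_eq_iff fapply)
      have "\<zero>\<^bsub>V\<^esub> \<oplus>\<^bsub>V\<^esub> \<zero>\<^bsub>V\<^esub> = \<zero>\<^bsub>V\<^esub>"
        using left_module.module_group[OF C.M] V_zero_closed by (intro abelian_monoid.l_zero) (simp_all add: abelian_group_def)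
      then have "\<theta> \<zero>\<^bsub>V\<^esub> = 0" using C.theta(5)[OF V_zero_closed V_zero_closed] by simp
      then show ?thesis using C.theta_inj[of "f p" "\<zero>\<^bsub>V\<^esub>"] f(1) p t V_zero_closed by auto
    qed
    then show "a \<in> KK" using f k by (simp add: comb_zero)
  qed
qed

lemma F_surj: "F ` carrier IM = carrier (cmod (D \<times> B) L)"
proof
  show "F ` carrier IM \<subseteq> carrier (cmod (D \<times> B) L)" using F_closed by (auto simp: IM_simps)
  show "carrier (cmod (D \<times> B) L) \<subseteq> F ` carrier IM"
  proof
    fix \<phi> assume "\<phi> \<in> carrier (cmod (D \<times> B) L)"
    then have \<phi>: "\<phi> \<in> fspace (D \<times> B)" by simp
    let ?f = "\<lambda>p. \<eta> (\<lambda>b. \<phi> (p, b))"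
    have f: "?f \<in> D \<rightarrow> carrier V" using slice_right[OF \<phi>] by simp
    have "F (comb ?f) = \<phi>"
    proof (rule ext, clarify)
      fix c m b
      show "F (comb ?f) ((c, m), b) = \<phi> ((c, m), b)"
        using F_comb[OF f, of c m b] slice_right[OF \<phi>] \<phi> by (auto simp: fspace_def)
    qed
    then have "\<phi> = F (comb ?f)" by (rule sym)
    moreover have "comb ?f \<in> carrier IM" using comb_closed[OF f] unfolding IM_simps .
    ultimately show "\<phi> \<in> F ` carrier IM" by (rule image_eqI)
  qed
qed

lemma quotient_iso:
  "module_iso H (cmod (D \<times> B) L) (quotient_module IM KK) \<and> left_module H (quotient_module IM KK)"
proof -
  have add: "F (a \<oplus>\<^bsub>IM\<^esub> b) = F a \<oplus>\<^bsub>cmod (D \<times> B) L\<^esub> F b" if "a \<in> carrier IM" "b \<in> carrier IM" for a b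
    using that by (simp add: IM_simps F_mult)
  have smult: "F (h \<odot>\<^bsub>IM\<^esub> a) = h \<odot>\<^bsub>cmod (D \<times> B) L\<^esub> F a" if "h \<in> carrier H" "a \<in> carrier IM" for h a
    using that by (simp add: IM_simps F_smult)
  show ?thesis
    using quotient_module_kernel[OF left_module_IM left_module_target F_surj add smult kernel_F] by blast
qed

end

lemma smult_one: "h \<in> carrier H \<Longrightarrow> h \<odot>\<^bsub>IM\<^esub> \<one>\<^bsub>T\<^esub> = \<one>\<^bsub>T\<^esub>"
proof -
  assume h: "h \<in> carrier H"
  interpret hh: group_hom T T "\<lambda>a. h \<odot>\<^bsub>IM\<^esub> a" by unfold_locales (rule smult_hom[OF h])
  show ?thesis by (rule hh.hom_one)
qed

lemma F_one: "F \<one>\<^bsub>T\<^esub> = 0"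
  using F_mult[of "\<one>\<^bsub>T\<^esub>" "\<one>\<^bsub>T\<^esub>"] by simp

lemma submoduleI:
  assumes "N \<subseteq> carrier T" "\<one>\<^bsub>T\<^esub> \<in> N" "\<And>a b. \<lbrakk>a \<in> N; b \<in> N\<rbrakk> \<Longrightarrow> a \<otimes>\<^bsub>T\<^esub> b \<in> N" "\<And>a. a \<in> N \<Longrightarrow> inv\<^bsub>T\<^esub> a \<in> N"
    and "\<And>h a. \<lbrakk>h \<in> carrier H; a \<in> N\<rbrakk> \<Longrightarrow> h \<odot>\<^bsub>IM\<^esub> a \<in> N"
  shows "submodule N H IM"
proof -
  have "inv\<^bsub>add_monoid IM\<^esub> a = inv\<^bsub>T\<^esub> a" if "a \<in> carrier T" for a
    by (simp add: m_inv_def IM_simps)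
  then show ?thesis using assms
    by (auto simp: submodule_def submodule_axioms_def subgroup_def IM_simps subset_iff)
qed

lemma submoduleD:
  assumes "submodule N H IM"
  shows "\<one>\<^bsub>T\<^esub> \<in> N" "\<And>a b. \<lbrakk>a \<in> N; b \<in> N\<rbrakk> \<Longrightarrow> a \<otimes>\<^bsub>T\<^esub> b \<in> N" "\<And>h a. \<lbrakk>h \<in> carrier H; a \<in> N\<rbrakk> \<Longrightarrow> h \<odot>\<^bsub>IM\<^esub> a \<in> N"
  using assms by (auto simp: submodule_def submodule_axioms_def subgroup_def IM_simps)

lemma submodule_carrier: "submodule (carrier T) H IM"
  by (rule submoduleI) (simp_all add: smult_closed)

lemma submodule_ker: "submodule {a \<in> carrier T. F a = 0} H IM"
proof (rule submoduleI)
  fix a assume a: "a \<in> {a \<in> carrier T. F a = 0}"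
  then have "F (inv\<^bsub>T\<^esub> a) = 0" using F_mult[of a "inv\<^bsub>T\<^esub> a"] F_one by simp
  then show "inv\<^bsub>T\<^esub> a \<in> {a \<in> carrier T. F a = 0}" using a by simp
qed (auto simp: F_one F_mult F_smult smult_closed lin_zero[OF act_H_lin])

text \<open>For \<open>\<beta> = 0\<close> the element \<open>y c m\<close> is
  \<open>x ^ (s * m + c)\<close>, and \<open>D\<close> collects the exponents below
  \<open>p\<close>. Each larger power is a multiple of \<open>x ^ p\<close>, so it produces an
  element of the generated submodule; conversely the kernel of \<open>F\<close> is a submodule
  containing the generators.\<close>

lemma nilpotent_quotient:
  assumes b0: "\<beta> = 0" and n: "n = (\<lambda>c. u + (if c < r then 1 else 0))" and p: "p = u * s + r" and r: "r < s"
  shows "module_iso H (cmod (D \<times> B) L) (nilpotent_module G \<chi> p V)" and "left_module H (nilpotent_module G \<chi> p V)"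
proof -
  let ?P = "{pt (x [^]\<^bsub>H\<^esub> p) w | w. w \<in> carrier V}"
  let ?K = "generated_submodule H IM ?P"
  have Kin: "a \<in> ?K \<longleftrightarrow> (\<forall>N. submodule N H IM \<and> ?P \<subseteq> N \<longrightarrow> a \<in> N)" for a
    by (auto simp: generated_submodule_def)
  have "scalar (ore_basis G) \<beta> = \<zero>\<^bsub>H\<^esub>" by (simp add: b0 scalar_def Hzero)
  then have z: "z = x [^]\<^bsub>H\<^esub> s" by (simp add: z_def H.minus_eq)
  have y: "y c m = x [^]\<^bsub>H\<^esub> (s * m + c)" for c m by (simp add: y_def z H.nat_pow_pow H.nat_pow_mult)
  have P: "?P \<subseteq> carrier T" by (auto intro!: pt_closed)
  have ker: "?P \<subseteq> {a \<in> carrier T. F a = 0}"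
  proof -
    \<comment> \<open>\<open>x ^ p\<close> is \<open>y r u\<close>, and \<open>(r, u)\<close> is the
      first point of column \<open>r\<close> outside \<open>D\<close>.\<close>
    have "F (pt (x [^]\<^bsub>H\<^esub> p) w) = 0" if "w \<in> carrier V" for w
      using F_y[OF r that, of u] by (simp add: y p n sdom_def mult.commute)
    then show ?thesis using P by auto
  qed
  have N: "module_iso H (cmod (D \<times> B) L) (quotient_module IM ?K) \<and> left_module H (quotient_module IM ?K)"
  proof (rule quotient_iso)
    show "?K \<subseteq> carrier T" using submodule_carrier P unfolding generated_submodule_def by blast
    show "\<one>\<^bsub>T\<^esub> \<in> ?K" unfolding Kin using submoduleD(1) by blast
    show "a \<otimes>\<^bsub>T\<^esub> b \<in> ?K" if "a \<in> ?K" "b \<in> ?K" for a b using that unfolding Kin using submoduleD(2) by blast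
    show "x \<odot>\<^bsub>IM\<^esub> a \<in> ?K" if "a \<in> ?K" for a using that unfolding Kin using submoduleD(3) x_closed by blast
    show "pt (y c m) v \<in> ?K" if c: "c < s" and m: "(c, m) \<notin> D" and v: "v \<in> carrier V" for c m v
    proof -
      have nm: "n c \<le> m" using c m by (simp add: sdom_def)
      have "p \<le> s * m + c"
      proof (cases "c < r")
        case True
        then have "u + 1 \<le> m" using nm by (simp add: n)
        then have "s * (u + 1) \<le> s * m" by (rule mult_le_mono2)
        then show ?thesis using r by (simp add: p algebra_simps)
      next
        case False
        then have "u \<le> m" using nm by (simp add: n)
        then have "s * u \<le> s * m" by (rule mult_le_mono2)
        then show ?thesis using False unfolding p mult.commute[of u s] by linarith
      qed
      then have "y c m = (x [^]\<^bsub>H\<^esub> (s * m + c - p)) \<otimes>\<^bsub>H\<^esub> (x [^]\<^bsub>H\<^esub> p)" by (simp add: y H.nat_pow_mult)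
      then have e: "pt (y c m) v = (x [^]\<^bsub>H\<^esub> (s * m + c - p)) \<odot>\<^bsub>IM\<^esub> pt (x [^]\<^bsub>H\<^esub> p) v" using v by (simp add: smult_pt)
      show ?thesis unfolding Kin
      proof (intro allI impI)
        fix N assume N: "submodule N H IM \<and> ?P \<subseteq> N"
        then have "pt (x [^]\<^bsub>H\<^esub> p) v \<in> N" using v by blast
        then show "pt (y c m) v \<in> N" unfolding e by (intro submoduleD(3)[OF conjunct1[OF N]]) simp_all
      qed
    qed
    show "F a = 0" if "a \<in> ?K" for a using that submodule_ker ker unfolding Kin by blast
  qed
  have "nilpotent_module G \<chi> p V = quotient_module IM ?K"
    by (simp add: nilpotent_module_def Let_def induced_tensor_def x_def)
  then show "module_iso H (cmod (D \<times> B) L) (nilpotent_module G \<chi> p V)" "left_module H (nilpotent_module G \<chi> p V)"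
    using N by simp_all
qed

text \<open>The image of \<open>z ^ t\<close> is stable under \<open>x\<close> because
  \<open>z\<close> commutes with \<open>x\<close>. It contains the \<open>y c m\<close> with
  \<open>m \<ge> t\<close>, which have the factor \<open>z ^ t\<close>, and \<open>F\<close> kills
  it because \<open>shift\<close> has \<open>t\<close>-th power zero when all columns have length
  \<open>t\<close>.\<close>

lemma eigen_quotient:
  assumes n: "n = (\<lambda>_. t)"
  shows "module_iso H (cmod (D \<times> B) L) (eigen_module G \<chi> s t V \<beta>)" and "left_module H (eigen_module G \<chi> s t V \<beta>)"
proof -
  let ?zt = "z [^]\<^bsub>H\<^esub> t"
  let ?K = "(\<lambda>m. ?zt \<odot>\<^bsub>IM\<^esub> m) ` carrier IM"
  have zt: "?zt \<in> carrier H" by simp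
  have ca: "carrier IM = carrier T" by (simp add: IM_simps)
  have N: "module_iso H (cmod (D \<times> B) L) (quotient_module IM ?K) \<and> left_module H (quotient_module IM ?K)"
  proof (rule quotient_iso)
    show "?K \<subseteq> carrier T" unfolding ca using smult_closed[OF zt] by blast
    show "\<one>\<^bsub>T\<^esub> \<in> ?K" unfolding ca using smult_one[OF zt] by (intro image_eqI[of _ _ "\<one>\<^bsub>T\<^esub>"]) simp_all
    show "a \<otimes>\<^bsub>T\<^esub> b \<in> ?K" if "a \<in> ?K" "b \<in> ?K" for a b
    proof -
      obtain a' where a': "a' \<in> carrier T" "a = ?zt \<odot>\<^bsub>IM\<^esub> a'" using \<open>a \<in> ?K\<close> unfolding ca by (rule imageE)
      obtain b' where b': "b' \<in> carrier T" "b = ?zt \<odot>\<^bsub>IM\<^esub> b'" using \<open>b \<in> ?K\<close> unfolding ca by (rule imageE)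
      show ?thesis unfolding ca a'(2) b'(2)
        by (rule image_eqI[where x = "a' \<otimes>\<^bsub>T\<^esub> b'"], rule smult_mult[OF zt a'(1) b'(1), symmetric], rule T.m_closed[OF a'(1) b'(1)])
    qed
    show "x \<odot>\<^bsub>IM\<^esub> a \<in> ?K" if "a \<in> ?K" for a
    proof -
      obtain a' where a: "a' \<in> carrier T" "a = ?zt \<odot>\<^bsub>IM\<^esub> a'" using \<open>a \<in> ?K\<close> unfolding ca by (rule imageE)
      have "x \<odot>\<^bsub>IM\<^esub> (?zt \<odot>\<^bsub>IM\<^esub> a') = ?zt \<odot>\<^bsub>IM\<^esub> (x \<odot>\<^bsub>IM\<^esub> a')"
        using a left_module.smult_assoc[OF left_module_IM, of x ?zt a'] left_module.smult_assoc[OF left_module_IM, of ?zt x a'] x_z_power_commute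
        by (simp add: ca)
      then show ?thesis unfolding ca a(2) using a smult_closed by (intro image_eqI[of _ _ "x \<odot>\<^bsub>IM\<^esub> a'"]) simp_all
    qed
    show "pt (y c m) v \<in> ?K" if c: "c < s" and m: "(c, m) \<notin> D" and v: "v \<in> carrier V" for c m v
    proof -
      have "t \<le> m" using c m by (simp add: sdom_def n)
      then have "z [^]\<^bsub>H\<^esub> m = ?zt \<otimes>\<^bsub>H\<^esub> (z [^]\<^bsub>H\<^esub> (m - t))" by (simp add: H.nat_pow_mult)
      then have "pt (y c m) v = ?zt \<odot>\<^bsub>IM\<^esub> pt (y c (m - t)) v" using v by (simp add: smult_pt y_def H.m_assoc)
      then show ?thesis unfolding ca using v by (intro image_eqI[of _ _ "pt (y c (m - t)) v"]) (simp_all add: pt_closed)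
    qed
    show "F a = 0" if "a \<in> ?K" for a
    proof -
      obtain a' where a: "a' \<in> carrier T" "a = ?zt \<odot>\<^bsub>IM\<^esub> a'" using \<open>a \<in> ?K\<close> unfolding ca by (rule imageE)
      have "act L ?zt \<phi> = (\<lambda>_. 0) \<phi>" if \<phi>: "\<phi> \<in> fspace (D \<times> B)" for \<phi>
      proof (rule kron_eqI[OF act_H_lin[OF zt] _ finite_sdom C.Lp(1) \<phi>])
        show "lin (\<lambda>_. 0 :: (nat \<times> nat) \<times> 'b \<Rightarrow> 'k)" by (rule linI) simp_all
        fix f :: "nat \<times> nat \<Rightarrow> 'k" and w :: "'b \<Rightarrow> 'k" assume f: "f \<in> fspace D" and w: "w \<in> fspace B"
        have "(shift s n ^^ t) f = 0"
          using f unfolding shift_power by (auto simp: fun_eq_iff fapply sdom_def n fspace_def)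
        then show "act L ?zt (tens f w) = 0" using act_z_power[OF f w, of t] by (simp add: tens_def fun_eq_iff fapply)
      qed
      then show ?thesis using a F_smult[OF zt a(1)] F_closed[OF a(1)] by simp
    qed
  qed
  have "eigen_module G \<chi> s t V \<beta> = quotient_module IM ?K"
    by (simp add: eigen_module_def Let_def x_def z_def)
  then show "module_iso H (cmod (D \<times> B) L) (eigen_module G \<chi> s t V \<beta>)" "left_module H (eigen_module G \<chi> s t V \<beta>)"
    using N by simp_all
qed

end

text \<open>For \<open>c < s\<close> and \<open>r \<le> s\<close> this is the number of
  \<open>m\<close> with \<open>c + s * m < u * s + r\<close>.\<close>

definition nil_shape :: "nat \<Rightarrow> nat \<Rightarrow> nat \<Rightarrow> nat" where
  "nil_shape u r c = u + (if c < r then 1 else 0)"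


section \<open>Representations of the finite group\<close>

text \<open>The analogue of \<open>cmod\<close> for a subspace that has no distinguished basis;
  invariant subspaces appear in this form until \<open>basis_coordinates\<close> chooses
  one.\<close>

definition smod :: "('b \<Rightarrow> 'k::field) set \<Rightarrow> ('p \<Rightarrow> ('b \<Rightarrow> 'k) \<Rightarrow> 'b \<Rightarrow> 'k) \<Rightarrow> ('p \<Rightarrow>\<^sub>0 'k, 'b \<Rightarrow> 'k) module" where
  "smod U L = \<lparr>carrier = U, monoid.mult = undefined, monoid.one = undefined,
     ring.zero = 0, ring.add = (+), module.smult = act L\<rparr>"

lemma smod_simps [simp]:
  "carrier (smod U L) = U" "\<zero>\<^bsub>smod U L\<^esub> = 0" "f \<oplus>\<^bsub>smod U L\<^esub> g = f + g"
  "h \<odot>\<^bsub>smod U L\<^esub> f = act L h f"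
  by (simp_all add: smod_def)

lemma cmod_smod: "cmod B L = smod (fspace B) L"
  by (simp add: cmod_def smod_def)

lemma lin_iff_linear: "lin L \<longleftrightarrow> Vector_Spaces.linear scl scl L"
  by (simp only: lin_def Vector_Spaces.linear_iff vector_space_scl simp_thms)

lemma lin_setsum: "(\<And>i. i \<in> A \<Longrightarrow> lin (L i)) \<Longrightarrow> lin (\<lambda>f. \<Sum>i\<in>A. L i f)"
  by (rule linI) (simp_all add: lin_add lin_scl sum.distrib scl_sum)

lemma sum_const_scl: "(\<Sum>g\<in>A. u) = scl (of_nat (card A)) u"
  by (simp add: fun_eq_iff sum_fun_apply scl_apply)

lemma lin_left_inverse:
  fixes L :: "('b \<Rightarrow> 'k::field) \<Rightarrow> 'c \<Rightarrow> 'k"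
  assumes "lin L" "module.subspace scl U" "inj_on L U"
  obtains L' where "lin L'" "\<And>f. L' f \<in> U" "\<And>u. u \<in> U \<Longrightarrow> L' (L u) = u"
proof -
  interpret vector_space_pair "scl :: 'k \<Rightarrow> ('b \<Rightarrow> 'k) \<Rightarrow> 'b \<Rightarrow> 'k" "scl :: 'k \<Rightarrow> ('c \<Rightarrow> 'k) \<Rightarrow> 'c \<Rightarrow> 'k"
    by (simp add: vector_space_pair_def vector_space_scl)
  obtain g where "g ` UNIV \<subseteq> U" "Vector_Spaces.linear scl scl g" "\<forall>v\<in>U. g (L v) = v"
    using linear_exists_left_inverse_on[of L U] assms by (auto simp: lin_iff_linear)
  then show ?thesis using that[of g] by (auto simp: lin_iff_linear)
qed

lemma finite_basis:
  fixes U :: "('b \<Rightarrow> 'k::field) set"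
  assumes "module.subspace scl U" "U \<subseteq> fspace E" "finite E"
  obtains B where "finite B" "B \<subseteq> U" "\<not> module.dependent scl B" "module.span scl B = U" "card B = vector_space.dim scl U"
proof -
  interpret vector_space "scl :: 'k \<Rightarrow> ('b \<Rightarrow> 'k) \<Rightarrow> 'b \<Rightarrow> 'k" by (rule vector_space_scl)
  obtain B where B: "B \<subseteq> U" "independent B" "U \<subseteq> span B" "card B = dim U" by (rule basis_exists)
  have "B \<subseteq> span (dl ` E)" using B(1) assms(2) by (simp add: span_dl[OF assms(3)])
  then have "finite B" using independent_span_bound[of "dl ` E" B] B(2) assms(3) by simp
  moreover have "span B = U" using B span_minimal[OF B(1) assms(1)] by blast
  ultimately show ?thesis using that B by blast
qed

lemma dim_strict_mono:
  fixes U :: "('b \<Rightarrow> 'k::field) set"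
  assumes "module.subspace scl U" "module.subspace scl U'" "U \<subset> U'" "U' \<subseteq> fspace E" "finite E"
  shows "vector_space.dim scl U < vector_space.dim scl U'"
proof -
  interpret vector_space "scl :: 'k \<Rightarrow> ('b \<Rightarrow> 'k) \<Rightarrow> 'b \<Rightarrow> 'k" by (rule vector_space_scl)
  obtain B where B: "finite B" "B \<subseteq> U" "independent B" "span B = U" "card B = dim U"
    using assms by (auto intro: finite_basis[of U E])
  obtain B' where B': "finite B'" "span B' = U'" "card B' = dim U'"
    using assms by (auto intro: finite_basis[of U' E])
  obtain v where v: "v \<in> U'" "v \<notin> U" using assms(3) by blast
  have "independent (insert v B)" using v B by (intro independent_insertI) auto
  moreover have "insert v B \<subseteq> span B'" using v B B' assms(3) by auto
  ultimately have "card (insert v B) \<le> card B'" using independent_span_bound[OF B'(1)] by blast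
  moreover have "v \<notin> B" using v B by auto
  ultimately show ?thesis using B B' by simp
qed

lemma simple_transfer:
  assumes M: "simple_module R M" and N: "left_module R N" and iso: "module_iso R M N"
  shows "simple_module R N"
proof -
  have Ml: "left_module R M" using M by (simp add: simple_module_def)
  from iso Ml N obtain f g where f: "f \<in> carrier M \<rightarrow> carrier N" and g: "g \<in> carrier N \<rightarrow> carrier M"
    and gf: "\<And>m. m \<in> carrier M \<Longrightarrow> g (f m) = m" and fg: "\<And>n. n \<in> carrier N \<Longrightarrow> f (g n) = n"
    and fa: "\<And>m m'. \<lbrakk>m \<in> carrier M; m' \<in> carrier M\<rbrakk> \<Longrightarrow> f (m \<oplus>\<^bsub>M\<^esub> m') = f m \<oplus>\<^bsub>N\<^esub> f m'"
    and fs: "\<And>h m. \<lbrakk>h \<in> carrier R; m \<in> carrier M\<rbrakk> \<Longrightarrow> f (h \<odot>\<^bsub>M\<^esub> m) = h \<odot>\<^bsub>N\<^esub> f m"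
    and f0: "f \<zero>\<^bsub>M\<^esub> = \<zero>\<^bsub>N\<^esub>" and g0: "g \<zero>\<^bsub>N\<^esub> = \<zero>\<^bsub>M\<^esub>"
    by (rule module_isoE) blast
  interpret M: left_module R M by (rule Ml)
  interpret N: left_module R N by (rule N)
  have "carrier N \<noteq> {\<zero>\<^bsub>N\<^esub>}"
  proof
    assume N0: "carrier N = {\<zero>\<^bsub>N\<^esub>}"
    have "m = \<zero>\<^bsub>M\<^esub>" if "m \<in> carrier M" for m
    proof -
      have "f m = \<zero>\<^bsub>N\<^esub>" using f that N0 by blast
      then show ?thesis using gf[OF that] g0 by simp
    qed
    then have "carrier M = {\<zero>\<^bsub>M\<^esub>}" by blast
    then show False using M by (simp add: simple_module_def)
  qed
  moreover have "N' = {\<zero>\<^bsub>N\<^esub>} \<or> N' = carrier N" if N': "submodule N' R N" for N'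
  proof -
    interpret N': submodule N' R N by (rule N')
    have sub: "n \<in> carrier N" if "n \<in> N'" for n using N'.subset that by auto
    let ?M = "{m \<in> carrier M. f m \<in> N'}"
    have inv: "f (\<ominus>\<^bsub>M\<^esub> m) = \<ominus>\<^bsub>N\<^esub> f m" if "m \<in> carrier M" for m
    proof -
      have "f (\<ominus>\<^bsub>M\<^esub> m) \<oplus>\<^bsub>N\<^esub> f m = \<zero>\<^bsub>N\<^esub>"
        using fa[of "\<ominus>\<^bsub>M\<^esub> m" m] that f0 by (simp add: M.l_neg)
      moreover have "f (\<ominus>\<^bsub>M\<^esub> m) \<in> carrier N" "f m \<in> carrier N" using f that by auto
      ultimately show ?thesis using N.minus_equality by metis
    qed
    have ns: "\<ominus>\<^bsub>N\<^esub> n \<in> N'" if "n \<in> N'" for n using N'.m_inv_closed[OF that] by (simp add: a_inv_def)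
    have "submodule ?M R M"
      unfolding submodule_def submodule_axioms_def subgroup_def a_inv_def[symmetric]
    proof (intro conjI allI impI)
      fix m m' assume m: "m \<in> ?M" "m' \<in> ?M"
      then have "f m \<oplus>\<^bsub>N\<^esub> f m' \<in> N'" using N'.m_closed[of "f m" "f m'"] by simp
      then have "f (m \<oplus>\<^bsub>M\<^esub> m') \<in> N'" using m fa[of m m'] by simp
      moreover have "m \<oplus>\<^bsub>M\<^esub> m' \<in> carrier M" using m M.a_closed by blast
      ultimately show "m \<otimes>\<^bsub>add_monoid M\<^esub> m' \<in> ?M" by simp
    next
      fix h m assume h: "h \<in> carrier R" and m: "m \<in> ?M"
      have "h \<odot>\<^bsub>N\<^esub> f m \<in> N'" by (rule N'.smult_closed[OF h]) (use m in blast)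
      then have "f (h \<odot>\<^bsub>M\<^esub> m) \<in> N'" using m fs[OF h, of m] by simp
      moreover have "h \<odot>\<^bsub>M\<^esub> m \<in> carrier M" by (rule M.smult_closed[OF h]) (use m in blast)
      ultimately show "h \<odot>\<^bsub>M\<^esub> m \<in> ?M" by blast
    next
      fix m assume m: "m \<in> ?M"
      then have mc: "m \<in> carrier M" and "\<ominus>\<^bsub>N\<^esub> f m \<in> N'" using ns by blast+
      then have "f (\<ominus>\<^bsub>M\<^esub> m) \<in> N'" using inv[OF mc] by simp
      then show "\<ominus>\<^bsub>M\<^esub> m \<in> ?M" using M.a_inv_closed[OF mc] by blast
    next
      have "f \<zero>\<^bsub>M\<^esub> \<in> N'" using N'.one_closed f0 by simp
      then show "\<one>\<^bsub>add_monoid M\<^esub> \<in> ?M" by simp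
    qed auto
    then consider "?M = {\<zero>\<^bsub>M\<^esub>}" | "?M = carrier M" using M by (auto simp: simple_module_def)
    then show ?thesis
    proof cases
      case 1
      have "n = \<zero>\<^bsub>N\<^esub>" if "n \<in> N'" for n
      proof -
        have "g n \<in> ?M" using g fg sub[OF that] that by auto
        then have "g n = \<zero>\<^bsub>M\<^esub>" using 1 by blast
        then show ?thesis using fg[OF sub[OF that]] f0 by simp
      qed
      then have "N' \<subseteq> {\<zero>\<^bsub>N\<^esub>}" by blast
      moreover have "\<zero>\<^bsub>N\<^esub> \<in> N'" using N'.one_closed by simp
      ultimately show ?thesis by blast
    next
      case 2
      have "n \<in> N'" if "n \<in> carrier N" for n
      proof -
        have "g n \<in> ?M" using 2 g that by auto
        then show ?thesis using fg[OF that] by simp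
      qed
      then show ?thesis using sub by blast
    qed
  qed
  ultimately show ?thesis using N by (simp add: simple_module_def)
qed

lemma direct_sum_singleton: "module_iso R M (direct_sum {x} (\<lambda>_. M))"
proof (rule module_isoI[where f = "\<lambda>m. \<lambda>j\<in>{x}. m"])
  show "bij_betw (\<lambda>m. \<lambda>j\<in>{x}. m) (carrier M) (carrier (direct_sum {x} (\<lambda>_. M)))"
  proof (rule bij_betw_byWitness[where f' = "\<lambda>f. f x"])
    show "(\<lambda>m. \<lambda>j\<in>{x}. m) ` carrier M \<subseteq> carrier (direct_sum {x} (\<lambda>_. M))"
      by (auto simp: direct_sum_def split: if_splits)
    show "\<forall>f\<in>carrier (direct_sum {x} (\<lambda>_. M)). (\<lambda>j\<in>{x}. f x) = f"
    proof (intro ballI ext)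
      fix f j assume "f \<in> carrier (direct_sum {x} (\<lambda>_. M))"
      then have "f \<in> PiE {x} (\<lambda>_. carrier M)" by (simp add: direct_sum_def)
      from PiE_arb[OF this, of j] show "(\<lambda>j\<in>{x}. f x) j = f j" by auto
    qed
  qed (auto simp: direct_sum_def)
qed (auto simp: direct_sum_def fun_eq_iff)

text \<open>Numbering each fibre of \<open>k\<close> turns a direct sum over \<open>A\<close>, whose
  summand at \<open>a\<close> depends on \<open>k a\<close> only, into one with
  multiplicities.\<close>

lemma fibre_bij:
  assumes "\<And>l. l \<in> I \<Longrightarrow> finite {a \<in> A. k a = l}" "\<And>a. a \<in> A \<Longrightarrow> k a \<in> I"
  obtains h where "bij_betw h A (Sigma I (\<lambda>l. {..<card {a \<in> A. k a = l}}))" "\<And>a. a \<in> A \<Longrightarrow> fst (h a) = k a"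
proof -
  have "\<exists>e. bij_betw e {a \<in> A. k a = l} {..<card {a \<in> A. k a = l}}" if "l \<in> I" for l
    using ex_bij_betw_finite_nat[OF assms(1)[OF that]] by (simp add: atLeast0LessThan)
  then obtain e where e: "\<And>l. l \<in> I \<Longrightarrow> bij_betw (e l) {a \<in> A. k a = l} {..<card {a \<in> A. k a = l}}" by metis
  have "bij_betw (\<lambda>a. (k a, e (k a) a)) A (Sigma I (\<lambda>l. {..<card {a \<in> A. k a = l}}))"
    unfolding bij_betw_def
  proof
    show "inj_on (\<lambda>a. (k a, e (k a) a)) A"
    proof (rule inj_onI)
      fix a b assume ab: "a \<in> A" "b \<in> A" "(k a, e (k a) a) = (k b, e (k b) b)"
      then have "e (k a) a = e (k a) b" "a \<in> {x \<in> A. k x = k a}" "b \<in> {x \<in> A. k x = k a}" by auto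
      then show "a = b" using e[OF assms(2)[OF ab(1)]] unfolding bij_betw_def inj_on_def by blast
    qed
    show "(\<lambda>a. (k a, e (k a) a)) ` A = Sigma I (\<lambda>l. {..<card {a \<in> A. k a = l}})"
    proof
      show "(\<lambda>a. (k a, e (k a) a)) ` A \<subseteq> Sigma I (\<lambda>l. {..<card {a \<in> A. k a = l}})"
      proof clarify
        fix a assume a: "a \<in> A"
        have "e (k a) a \<in> {..<card {a' \<in> A. k a' = k a}}"
          by (rule bij_betwE[OF e[OF assms(2)[OF a]], rule_format]) (simp add: a)
        then show "k a \<in> I \<and> e (k a) a \<in> {..<card {a' \<in> A. k a' = k a}}" using assms(2)[OF a] by simp
      qed
      show "Sigma I (\<lambda>l. {..<card {a \<in> A. k a = l}}) \<subseteq> (\<lambda>a. (k a, e (k a) a)) ` A"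
      proof clarify
        fix l i assume l: "l \<in> I" and i: "i < card {a \<in> A. k a = l}"
        then have "i \<in> e l ` {a \<in> A. k a = l}" using e[OF l] by (simp add: bij_betw_def)
        then obtain a where "a \<in> A" "k a = l" "i = e l a" by blast
        then show "(l, i) \<in> (\<lambda>a. (k a, e (k a) a)) ` A" by force
      qed
    qed
  qed
  then show ?thesis using that[of "\<lambda>a. (k a, e (k a) a)"] by simp
qed

section \<open>Maschke's theorem and irreducible subspaces\<close>

locale group_rep =
  fixes G :: "('g, 'x) monoid_scheme" and E :: "'b set" and \<sigma> :: "'g \<Rightarrow> ('b \<Rightarrow> 'k::field_char_0) \<Rightarrow> 'b \<Rightarrow> 'k"
  assumes G: "group G" and fin: "finite (carrier G)" and rep: "grep G E \<sigma>"
begin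

sublocale G: group G by (rule G)
sublocale V: vector_space "scl :: 'k \<Rightarrow> ('b \<Rightarrow> 'k) \<Rightarrow> 'b \<Rightarrow> 'k" by (rule vector_space_scl)

abbreviation "kG \<equiv> group_algebra G :: ('g \<Rightarrow>\<^sub>0 'k) ring"

lemma finE: "finite E" and lin_rep: "g \<in> carrier G \<Longrightarrow> lin (\<sigma> g)"
  and rep_closed: "\<lbrakk>g \<in> carrier G; f \<in> fspace E\<rbrakk> \<Longrightarrow> \<sigma> g f \<in> fspace E"
  and rep_one: "f \<in> fspace E \<Longrightarrow> \<sigma> \<one>\<^bsub>G\<^esub> f = f"
  and rep_mult: "\<lbrakk>g \<in> carrier G; h \<in> carrier G; f \<in> fspace E\<rbrakk> \<Longrightarrow> \<sigma> g (\<sigma> h f) = \<sigma> (g \<otimes>\<^bsub>G\<^esub> h) f"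
  using rep by (simp_all add: operators_def)

definition "invariant U \<longleftrightarrow> V.subspace U \<and> U \<subseteq> fspace E \<and> (\<forall>g\<in>carrier G. \<forall>f\<in>U. \<sigma> g f \<in> U)"

lemma invariantD:
  assumes "invariant U"
  shows "V.subspace U" "U \<subseteq> fspace E" "f \<in> U \<Longrightarrow> f \<in> fspace E" "\<lbrakk>g \<in> carrier G; f \<in> U\<rbrakk> \<Longrightarrow> \<sigma> g f \<in> U"
    "0 \<in> U" "\<lbrakk>f \<in> U; f' \<in> U\<rbrakk> \<Longrightarrow> f + f' \<in> U" "f \<in> U \<Longrightarrow> scl c f \<in> U" "f \<in> U \<Longrightarrow> - f \<in> U"
  using assms V.subspace_neg by (auto simp: invariant_def V.subspace_0 V.subspace_add V.subspace_scale)

lemma invariant_fspace: "invariant (fspace E)"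
  by (simp add: invariant_def subspace_fspace rep_closed)

lemma act_invariant:
  assumes U: "invariant U" and h: "h \<in> carrier kG" and f: "f \<in> U"
  shows "act \<sigma> h f \<in> U"
  unfolding act_def using h f invariantD[OF U]
  by (intro V.subspace_sum) (auto simp: twisted_simps subset_iff)

lemma act_rep_mult: "\<lbrakk>h \<in> carrier kG; h' \<in> carrier kG; f \<in> fspace E\<rbrakk> \<Longrightarrow> act \<sigma> (h \<otimes>\<^bsub>kG\<^esub> h') f = act \<sigma> h (act \<sigma> h' f)"
  by (rule act_mult[OF rep]) (simp_all add: twisted_simps)

lemma lin_act_rep: "h \<in> carrier kG \<Longrightarrow> lin (act \<sigma> h)"
  by (rule lin_act) (auto simp: twisted_simps lin_rep)

lemma left_module_smod:
  assumes U: "invariant U"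
  shows "left_module kG (smod U \<sigma>)"
proof (rule left_moduleI[OF ring_group_algebra[OF G]])
  show "abelian_group (smod U \<sigma>)"
  proof (rule abelian_groupI)
    fix f assume "f \<in> carrier (smod U \<sigma>)"
    then show "\<exists>g\<in>carrier (smod U \<sigma>). g \<oplus>\<^bsub>smod U \<sigma>\<^esub> f = \<zero>\<^bsub>smod U \<sigma>\<^esub>"
      using invariantD[OF U] by (intro bexI[of _ "- f"]) auto
  qed (use invariantD[OF U] in \<open>auto simp: algebra_simps\<close>)
  show "\<And>m. m \<in> carrier (smod U \<sigma>) \<Longrightarrow> \<one>\<^bsub>kG\<^esub> \<odot>\<^bsub>smod U \<sigma>\<^esub> m = m"
    using invariantD[OF U] by (simp add: twisted_simps rep_one)
qed (use act_invariant[OF U] act_rep_mult invariantD[OF U] in \<open>auto simp: lin_add lin_act_rep\<close>, simp add: twisted_simps act_add)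

text \<open>Maschke's theorem: a linear projection onto \<open>U\<close> is averaged over the group,
  the group order being invertible in characteristic zero. The average \<open>P\<close> commutes
  with \<open>G\<close> and is still the identity on \<open>U\<close>, so its kernel in
  \<open>U'\<close> is an invariant complement.\<close>

lemma complement:
  assumes U: "invariant U" and U': "invariant U'" and sub: "U \<subseteq> U'"
  obtains W where "invariant W" "W \<subseteq> U'" "U \<inter> W = {0}" "\<And>f. f \<in> U' \<Longrightarrow> \<exists>u\<in>U. \<exists>w\<in>W. f = u + w"
proof -
  obtain \<pi> where \<pi>: "lin \<pi>" "\<And>f. \<pi> f \<in> U" "\<And>u. u \<in> U \<Longrightarrow> \<pi> u = u"
    using lin_left_inverse[of "\<lambda>f. f" U] invariantD(1)[OF U] by auto
  let ?N = "of_nat (card (carrier G)) :: 'k"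
  have N: "?N \<noteq> 0" using fin G.one_closed by (simp add: card_eq_0_iff) blast
  define Q where "Q g f = \<sigma> g (\<pi> (\<sigma> (inv\<^bsub>G\<^esub> g) f))" for g f
  define P where "P f = scl (inverse ?N) (\<Sum>g\<in>carrier G. Q g f)" for f
  have linQ: "lin (Q g)" if "g \<in> carrier G" for g
    unfolding Q_def by (rule lin_comp[OF lin_rep[OF that]], rule lin_comp[OF \<pi>(1)], rule lin_rep) (simp add: that)
  have linP: "lin P" unfolding P_def by (rule lin_scale, rule lin_setsum, rule linQ)
  have PU: "P f \<in> U" for f
    unfolding P_def Q_def by (intro invariantD(7)[OF U] V.subspace_sum invariantD(1)[OF U] invariantD(4)[OF U] \<pi>)
  have Pu: "P u = u" if u: "u \<in> U" for u
  proof -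
    have "Q g u = u" if g: "g \<in> carrier G" for g
      using g u invariantD(3,4)[OF U] by (simp add: Q_def \<pi>(3) rep_mult rep_one)
    then have "P u = scl (inverse ?N) (\<Sum>g\<in>carrier G. u)" by (simp add: P_def)
    then show ?thesis using N by (simp add: sum_const_scl del: sum_constant)
  qed
  have Ph: "P (\<sigma> h f) = \<sigma> h (P f)" if h: "h \<in> carrier G" and f: "f \<in> fspace E" for h f
  proof -
    have "(\<Sum>g\<in>carrier G. Q g (\<sigma> h f)) = (\<Sum>k\<in>carrier G. Q (h \<otimes>\<^bsub>G\<^esub> k) (\<sigma> h f))"
    proof (rule sum.reindex_bij_betw[symmetric])
      show "bij_betw (\<lambda>k. h \<otimes>\<^bsub>G\<^esub> k) (carrier G) (carrier G)"
        by (rule bij_betw_byWitness[where f' = "\<lambda>k. inv\<^bsub>G\<^esub> h \<otimes>\<^bsub>G\<^esub> k"]) (auto simp: h G.inv_solve_left' G.m_assoc[symmetric])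
    qed
    also have "\<dots> = (\<Sum>k\<in>carrier G. \<sigma> h (Q k f))"
    proof (rule sum.cong[OF refl])
      fix k assume k: "k \<in> carrier G"
      have "inv\<^bsub>G\<^esub> (h \<otimes>\<^bsub>G\<^esub> k) \<otimes>\<^bsub>G\<^esub> h = inv\<^bsub>G\<^esub> k" using h k by (simp add: G.inv_mult_group G.m_assoc)
      then have "\<sigma> (inv\<^bsub>G\<^esub> (h \<otimes>\<^bsub>G\<^esub> k)) (\<sigma> h f) = \<sigma> (inv\<^bsub>G\<^esub> k) f" using h k f by (simp add: rep_mult)
      then show "Q (h \<otimes>\<^bsub>G\<^esub> k) (\<sigma> h f) = \<sigma> h (Q k f)"
        using h k invariantD(3)[OF U \<pi>(2)] by (simp add: Q_def rep_mult)
    qed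
    finally show ?thesis using h by (simp add: P_def lin_scl lin_rep lin_sum)
  qed
  let ?W = "{f \<in> U'. P f = 0}"
  have "invariant ?W"
    unfolding invariant_def using invariantD[OF U'] linP
    by (auto simp: V.subspace_def lin_add lin_scl Ph lin_zero[OF lin_rep])
  moreover have "U \<inter> ?W = {0}" using Pu invariantD(5)[OF U] sub linP by auto
  moreover have "\<exists>u\<in>U. \<exists>w\<in>?W. f = u + w" if f: "f \<in> U'" for f
  proof (rule bexI[OF _ PU], rule bexI)
    have "P f \<in> U'" using PU sub by blast
    then have "f + (- P f) \<in> U'" by (intro invariantD(6)[OF U' f] invariantD(8)[OF U'])
    moreover have "P (f + (- P f)) = 0" using linP by (simp only: lin_add lin_uminus Pu[OF PU] add.right_inverse)
    ultimately show "f + (- P f) \<in> ?W" by simp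
  qed simp
  ultimately show ?thesis using that[of ?W] by blast
qed

definition "irreducible_subspace U \<longleftrightarrow> invariant U \<and> U \<noteq> {0} \<and> (\<forall>W. invariant W \<and> W \<subseteq> U \<longrightarrow> W = {0} \<or> W = U)"

lemma submodule_invariant:
  assumes U: "invariant U" and N: "submodule N kG (smod U \<sigma>)"
  shows "invariant N" "N \<subseteq> U"
proof -
  have sub: "N \<subseteq> U" and z: "0 \<in> N" and a: "\<And>f g. \<lbrakk>f \<in> N; g \<in> N\<rbrakk> \<Longrightarrow> f + g \<in> N"
    and s: "\<And>h f. \<lbrakk>h \<in> carrier kG; f \<in> N\<rbrakk> \<Longrightarrow> act \<sigma> h f \<in> N"
    using N by (auto simp: submodule_def submodule_axioms_def subgroup_def)
  show "N \<subseteq> U" by (rule sub)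
  have E: "f \<in> fspace E" if "f \<in> N" for f using that sub invariantD(3)[OF U] by blast
  have "scl c f \<in> N" if "f \<in> N" for c f
  proof -
    have "act \<sigma> (scalar G c) f \<in> N" by (rule s[OF _ that]) (simp add: scalar_def twisted_simps)
    then show ?thesis using scalar_act[OF rep E[OF that], of c] by simp
  qed
  moreover have "\<sigma> g f \<in> N" if "g \<in> carrier G" "f \<in> N" for g f
    using s[OF _ that(2), of "Poly_Mapping.single g 1"] that by (simp add: twisted_simps)
  ultimately show "invariant N" using z a E by (auto simp: invariant_def V.subspace_def)
qed

lemma irreducible_simple: "irreducible_subspace U \<Longrightarrow> simple_module kG (smod U \<sigma>)"
  using left_module_smod submodule_invariant unfolding simple_module_def irreducible_subspace_def smod_simps by blast

text \<open>A nonzero invariant subspace of least dimension inside \<open>U\<close> is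
  irreducible.\<close>

lemma irreducible_exists:
  assumes "invariant U" "U \<noteq> {0}"
  obtains W where "irreducible_subspace W" "W \<subseteq> U"
proof -
  let ?Q = "\<lambda>W. invariant W \<and> W \<noteq> {0} \<and> W \<subseteq> U"
  obtain W where W: "?Q W" "\<And>W'. ?Q W' \<Longrightarrow> V.dim W \<le> V.dim W'"
    using ex_has_least_nat[of ?Q U V.dim] assms by auto
  have "W' = {0} \<or> W' = W" if W': "invariant W'" "W' \<subseteq> W" for W'
  proof (rule ccontr)
    assume "\<not> (W' = {0} \<or> W' = W)"
    then have "?Q W'" "W' \<subset> W" using W' W(1) by auto
    then have "V.dim W' < V.dim W"
      using W(1) by (intro dim_strict_mono[OF invariantD(1)[OF W'(1)] _ _ _ finE]) (auto dest: invariantD(1) invariantD(2))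
    then show False using W(2)[OF \<open>?Q W'\<close>] by simp
  qed
  then show ?thesis using that[of W] W(1) by (simp add: irreducible_subspace_def)
qed

text \<open>The index set of the new coordinates is the chosen basis itself, a set of functions on
  the old index set; no numbering enters. The coordinate map \<theta> is a linear left inverse of
  \<open>comb\<close>, defined on all functions.\<close>

lemma basis_coordinates:
  assumes U: "invariant U"
  obtains B :: "('b \<Rightarrow> 'k) set" and \<rho> where "grep G B \<rho>" "module_iso kG (smod U \<sigma>) (cmod B \<rho>)"
proof -
  obtain B where B: "finite B" "B \<subseteq> U" "V.independent B" "V.span B = U" "card B = V.dim U"
    by (rule finite_basis[OF invariantD(1,2)[OF U] finE])
  define comb where "comb f = (\<Sum>b\<in>B. scl (f b) b)" for f :: "('b \<Rightarrow> 'k) \<Rightarrow> 'k"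
  have lc: "lin comb" unfolding comb_def
    by (rule linI) (simp_all add: fapply scl_add sum.distrib scl_sum)
  have cU: "comb f \<in> U" for f unfolding comb_def using B(2) invariantD[OF U] by (intro V.subspace_sum) auto
  have inj: "inj_on comb (fspace B)"
  proof (rule inj_onI)
    fix f g assume fg: "f \<in> fspace B" "g \<in> fspace B" "comb f = comb g"
    have "comb (f + (- g)) = 0" using lc fg(3) by (simp only: lin_add lin_uminus add.right_inverse)
    then have "f b - g b = 0" if "b \<in> B" for b
      using V.independentD[OF B(3,1) subset_refl, of "\<lambda>b. f b - g b" b] that by (simp add: comb_def fapply)
    then show "f = g" using fg(1,2) by (auto simp: fun_eq_iff fspace_def) (metis right_minus_eq)
  qed
  have surj: "\<exists>f\<in>fspace B. u = comb f" if u: "u \<in> U" for u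
  proof -
    obtain c where "u = (\<Sum>b\<in>B. scl (c b) b)" using u B(4) V.span_finite[OF B(1)] by auto
    then have "u = comb (\<lambda>b. if b \<in> B then c b else 0)" by (simp add: comb_def)
    then show ?thesis by (intro bexI) (auto simp: fspace_def)
  qed
  obtain \<theta> where \<theta>: "lin \<theta>" "\<And>f. \<theta> f \<in> fspace B" "\<And>f. f \<in> fspace B \<Longrightarrow> \<theta> (comb f) = f"
    using lin_left_inverse[OF lc subspace_fspace inj] by metis
  have ct: "comb (\<theta> u) = u" if "u \<in> U" for u using surj[OF that] \<theta>(3) by auto
  define \<rho> where "\<rho> g f = \<theta> (\<sigma> g (comb f))" for g f
  have "grep G B \<rho>"
    unfolding operators_def
  proof (intro conjI ballI)
    fix g assume "g \<in> carrier G"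
    then show "lin (\<rho> g)" unfolding \<rho>_def by (intro lin_comp[OF \<theta>(1)] lin_comp[OF lin_rep lc])
  next
    fix f :: "('b \<Rightarrow> 'k) \<Rightarrow> 'k" assume f: "f \<in> fspace B"
    then show "\<rho> \<one>\<^bsub>G\<^esub> f = f" using invariantD(3)[OF U cU] by (simp add: \<rho>_def rep_one \<theta>(3))
  next
    fix g h and f :: "('b \<Rightarrow> 'k) \<Rightarrow> 'k" assume "g \<in> carrier G" "h \<in> carrier G" "f \<in> fspace B"
    then show "\<rho> g (\<rho> h f) = scl 1 (\<rho> (g \<otimes>\<^bsub>G\<^esub> h) f)"
      using invariantD(3,4)[OF U] cU by (simp add: \<rho>_def ct rep_mult)
  qed (simp_all add: B(1) \<rho>_def \<theta>(2))
  moreover have "module_iso kG (smod U \<sigma>) (cmod B \<rho>)"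
  proof (rule module_isoI[where f = \<theta>])
    show "bij_betw \<theta> (carrier (smod U \<sigma>)) (carrier (cmod B \<rho>))"
      by (rule bij_betw_byWitness[where f' = comb]) (auto simp: ct \<theta>(2,3) cU)
    fix h u assume h: "h \<in> carrier kG" and "u \<in> carrier (smod U \<sigma>)"
    then show "\<theta> (h \<odot>\<^bsub>smod U \<sigma>\<^esub> u) = h \<odot>\<^bsub>cmod B \<rho>\<^esub> \<theta> u"
      by (simp add: act_def lin_sum[OF \<theta>(1)] lin_scl[OF \<theta>(1)] \<rho>_def ct)
  qed (simp add: lin_add[OF \<theta>(1)])
  ultimately show ?thesis by (rule that)
qed

end

definition regular_module :: "('r, 'x) ring_scheme \<Rightarrow> ('r, 'r) module" where
  "regular_module R = \<lparr>carrier = carrier R, monoid.mult = undefined, monoid.one = undefined,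
     ring.zero = \<zero>\<^bsub>R\<^esub>, ring.add = ring.add R, module.smult = monoid.mult R\<rparr>"

lemma regular_module_simps [simp]:
  "carrier (regular_module R) = carrier R" "\<zero>\<^bsub>regular_module R\<^esub> = \<zero>\<^bsub>R\<^esub>"
  "a \<oplus>\<^bsub>regular_module R\<^esub> b = a \<oplus>\<^bsub>R\<^esub> b" "h \<odot>\<^bsub>regular_module R\<^esub> a = h \<otimes>\<^bsub>R\<^esub> a"
  by (simp_all add: regular_module_def)

lemma left_module_regular:
  assumes "ring R"
  shows "left_module R (regular_module R)"
proof -
  interpret R: ring R by fact
  show ?thesis
  proof (rule left_moduleI[OF assms])
    show "abelian_group (regular_module R)"
    proof (rule abelian_groupI, unfold regular_module_simps)
      fix a assume "a \<in> carrier R"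
      then show "\<exists>b\<in>carrier R. b \<oplus>\<^bsub>R\<^esub> a = \<zero>\<^bsub>R\<^esub>" using R.l_neg by blast
    qed (simp_all add: R.a_ac)
  qed (simp_all add: R.l_distr R.r_distr R.m_assoc)
qed

context group_rep
begin

text \<open>
  Completeness of the representatives is available only for modules whose elements are subsets of
  \<open>kG\<close>; a quotient of the regular module is one.
\<close>

lemma irreducible_representative:
  fixes V :: "'i \<Rightarrow> ('g \<Rightarrow>\<^sub>0 'k, 'v) module"
  assumes reps: "simple_representatives kG I V" and U: "irreducible_subspace U"
  shows "\<exists>l\<in>I. module_iso kG (smod U \<sigma>) (V l)"
proof -
  have inv: "invariant U" and ne: "U \<noteq> {0}" and min: "\<And>W. \<lbrakk>invariant W; W \<subseteq> U\<rbrakk> \<Longrightarrow> W = {0} \<or> W = U"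
    using U by (auto simp: irreducible_subspace_def)
  obtain u0 where u0: "u0 \<in> U" "u0 \<noteq> 0" using ne invariantD(5)[OF inv] by blast
  have u0E: "u0 \<in> fspace E" by (rule invariantD(3)[OF inv u0(1)])
  interpret R: ring kG by (rule ring_group_algebra[OF G])
  let ?F = "\<lambda>h. act \<sigma> h u0"
  let ?W = "?F ` carrier kG"
  have WU: "?W \<subseteq> U" using act_invariant[OF inv _ u0(1)] by blast
  have radd: "h + h' \<in> carrier kG" if "h \<in> carrier kG" "h' \<in> carrier kG" for h h' :: "'g \<Rightarrow>\<^sub>0 'k"
    using R.a_closed[OF that] by (simp add: twisted_simps)
  have "invariant ?W"
    unfolding invariant_def V.subspace_def
  proof (intro conjI ballI allI)
    show "0 \<in> ?W" by (rule image_eqI[of _ _ 0]) (simp_all add: twisted_simps)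
    show "?W \<subseteq> fspace E" using WU invariantD(2)[OF inv] by blast
    fix w assume "w \<in> ?W"
    then obtain h where h: "h \<in> carrier kG" "w = ?F h" by blast
    fix w' assume "w' \<in> ?W"
    then obtain h' where h': "h' \<in> carrier kG" "w' = ?F h'" by blast
    show "w + w' \<in> ?W" by (rule image_eqI[of _ _ "h + h'"]) (simp_all only: h h' act_add radd)
  next
    fix c w assume "w \<in> ?W"
    then obtain h where h: "h \<in> carrier kG" "w = ?F h" by blast
    have sc: "scalar G c \<in> carrier kG" by (simp add: scalar_def twisted_simps)
    have "w \<in> fspace E" using h act_invariant[OF inv h(1) u0(1)] invariantD(3)[OF inv] by simp
    then have "scl c w = ?F (scalar G c \<otimes>\<^bsub>kG\<^esub> h)"
      using act_rep_mult[OF sc h(1) u0E] scalar_act[OF rep, of w c] h(2) by simp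
    then show "scl c w \<in> ?W" by (rule image_eqI) (simp add: sc h)
  next
    fix g w assume g: "g \<in> carrier G" and "w \<in> ?W"
    then obtain h where h: "h \<in> carrier kG" "w = ?F h" by blast
    have sc: "Poly_Mapping.single g 1 \<in> carrier kG" using g by (simp add: twisted_simps)
    have "\<sigma> g w = ?F (Poly_Mapping.single g 1 \<otimes>\<^bsub>kG\<^esub> h)"
      using act_rep_mult[OF sc h(1) u0E] h(2) by simp
    then show "\<sigma> g w \<in> ?W" by (rule image_eqI) (simp add: sc h)
  qed
  moreover have "u0 \<in> ?W"
    by (rule image_eqI[of _ _ "Poly_Mapping.single \<one>\<^bsub>G\<^esub> 1"]) (simp_all add: twisted_simps rep_one u0E)
  ultimately have WeqU: "?W = U" using min[OF _ WU] u0(2) by blast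
  let ?Q = "quotient_module (regular_module kG) {h \<in> carrier (regular_module kG). ?F h = \<zero>\<^bsub>smod U \<sigma>\<^esub>}"
  have add: "?F (h \<oplus>\<^bsub>regular_module kG\<^esub> h') = ?F h \<oplus>\<^bsub>smod U \<sigma>\<^esub> ?F h'"
    if "h \<in> carrier (regular_module kG)" "h' \<in> carrier (regular_module kG)" for h h'
    by (simp add: twisted_simps act_add)
  have sm: "?F (h \<odot>\<^bsub>regular_module kG\<^esub> h') = h \<odot>\<^bsub>smod U \<sigma>\<^esub> ?F h'"
    if "h \<in> carrier kG" "h' \<in> carrier (regular_module kG)" for h h'
    using that act_rep_mult[OF _ _ u0E] by simp
  have im: "?F ` carrier (regular_module kG) = carrier (smod U \<sigma>)" using WeqU by simp
  have iso: "module_iso kG (smod U \<sigma>) ?Q" and Q: "left_module kG ?Q"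
    using quotient_module_kernel[OF left_module_regular[OF R.ring_axioms] left_module_smod[OF inv] im add sm refl] by simp_all
  have "simple_module kG ?Q" by (rule simple_transfer[OF irreducible_simple[OF U] Q iso])
  then have "\<exists>l\<in>I. module_iso kG ?Q (V l)"
    by (rule mp[OF spec[OF conjunct2[OF conjunct2[OF reps[unfolded simple_representatives_def]]]]])
  then show ?thesis using module_iso_trans[OF iso] by blast
qed

lemma smod_complement:
  assumes "invariant U" "invariant W" "invariant U'" "U \<subseteq> U'" "W \<subseteq> U'" "U \<inter> W = {0}"
    and ex: "\<And>f. f \<in> U' \<Longrightarrow> \<exists>u\<in>U. \<exists>w\<in>W. f = u + w"
  shows "module_iso kG (smod U' \<sigma>) (binary_sum (smod U \<sigma>) (smod W \<sigma>))"
proof -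
  let ?B = "binary_sum (smod U \<sigma>) (smod W \<sigma>)"
  have car: "carrier ?B = U \<times> W" by (simp add: binary_sum_def)
  have "module_iso kG ?B (smod U' \<sigma>)"
  proof (rule module_isoI[where f = "\<lambda>(u, w). u + w"])
    show "bij_betw (\<lambda>(u, w). u + w) (carrier ?B) (carrier (smod U' \<sigma>))"
      unfolding bij_betw_def car smod_simps
    proof
      show "inj_on (\<lambda>(u, w). u + w) (U \<times> W)"
      proof (rule inj_onI, clarify)
        fix u w u' w' assume a: "u \<in> U" "w \<in> W" "u' \<in> U" "w' \<in> W" and e: "u + w = u' + w'"
        have d: "u + (- u') = w' + (- w)" using e by (simp add: algebra_simps)
        have "u + (- u') \<in> U" using a by (intro invariantD(6,8)[OF assms(1)])
        moreover have "w' + (- w) \<in> W" using a by (intro invariantD(6,8)[OF assms(2)])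
        ultimately have z: "u + (- u') = 0" "w' + (- w) = 0" using d assms(6) by (metis IntI singletonD)+
        show "u = u' \<and> w = w'" using z(1) z(2) by (simp only: add_eq_0_iff2 minus_minus)
      qed
      show "(\<lambda>(u, w). u + w) ` (U \<times> W) = U'"
      proof
        show "(\<lambda>(u, w). u + w) ` (U \<times> W) \<subseteq> U'" using assms(4,5) invariantD(6)[OF assms(3)] by auto
        show "U' \<subseteq> (\<lambda>(u, w). u + w) ` (U \<times> W)"
        proof
          fix f assume "f \<in> U'"
          then obtain u w where "u \<in> U" "w \<in> W" "f = u + w" using ex by blast
          then show "f \<in> (\<lambda>(u, w). u + w) ` (U \<times> W)" by (intro image_eqI[of _ _ "(u, w)"]) simp_all
        qed
      qed
    qed
  qed (auto simp: binary_sum_def algebra_simps lin_add lin_act_rep)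
  moreover have "closed_module kG ?B"
    using left_module_closed[OF left_module_smod[OF assms(1)]] left_module_closed[OF left_module_smod[OF assms(2)]]
    by (auto simp: closed_module_def binary_sum_def)
  ultimately show ?thesis by (rule module_iso_sym)
qed

text \<open>Induction on the dimension: an irreducible subspace is split off, replaced by its
  representative, and its complement is decomposed.\<close>

lemma decompose:
  fixes V :: "'i \<Rightarrow> ('g \<Rightarrow>\<^sub>0 'k, 'v) module"
  assumes reps: "simple_representatives kG I V" and U: "invariant U"
  shows "\<exists>n c. (\<forall>k<n. c k \<in> I) \<and> module_iso kG (smod U \<sigma>) (direct_sum {..<n::nat} (\<lambda>k. V (c k)))"
  using U
proof (induction "V.dim U" arbitrary: U rule: less_induct)
  case less
  have Vl: "left_module kG (V l)" if "l \<in> I" for l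
    using reps that by (simp add: simple_representatives_def simple_module_def)
  show ?case
  proof (cases "U = {0}")
    case True
    have "module_iso kG (smod U \<sigma>) (direct_sum {..<0::nat} (\<lambda>k. V (undefined k)))"
      unfolding True
      by (rule module_isoI[where f = "\<lambda>_ _. undefined"])
        (auto simp: direct_sum_def bij_betw_def act_def lin_zero[OF lin_rep] twisted_simps subset_iff restrict_def)
    then show ?thesis by blast
  next
    case False
    obtain U1 where U1: "irreducible_subspace U1" "U1 \<subseteq> U" using irreducible_exists[OF less.prems False] by blast
    have inv1: "invariant U1" and ne1: "U1 \<noteq> {0}" using U1 by (auto simp: irreducible_subspace_def)
    obtain W where W: "invariant W" "W \<subseteq> U" "U1 \<inter> W = {0}" "\<And>f. f \<in> U \<Longrightarrow> \<exists>u\<in>U1. \<exists>w\<in>W. f = u + w"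
      by (rule complement[OF inv1 less.prems U1(2)]) blast
    have "W \<noteq> U" using W(3) U1(2) ne1 by blast
    then have "V.dim W < V.dim U"
      using W(2) by (intro dim_strict_mono[OF invariantD(1)[OF W(1)] invariantD(1)[OF less.prems] _ invariantD(2)[OF less.prems] finE]) blast
    then obtain n c where c: "\<And>k. k < n \<Longrightarrow> c k \<in> I" and isoW: "module_iso kG (smod W \<sigma>) (direct_sum {..<n::nat} (\<lambda>k. V (c k)))"
      using less.hyps[OF _ W(1)] by blast
    obtain l where l: "l \<in> I" "module_iso kG (smod U1 \<sigma>) (V l)" using irreducible_representative[OF reps U1(1)] by blast
    let ?c = "case_nat l c"
    have c': "?c k \<in> I" if "k < Suc n" for k using that c l by (cases k) auto
    have "module_iso kG (smod U \<sigma>) (binary_sum (smod U1 \<sigma>) (smod W \<sigma>))"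
      by (rule smod_complement[OF inv1 W(1) less.prems U1(2) W(2,3,4)])
    also have "module_iso kG \<dots> (binary_sum (direct_sum {0::nat} (\<lambda>_. V l)) (direct_sum {..<n} (\<lambda>k. V (c k))))"
      by (rule binary_sum_iso[OF module_iso_trans[OF l(2) direct_sum_singleton] isoW])
    also have "module_iso kG \<dots> (direct_sum ({0::nat} <+> {..<n}) (case_sum (\<lambda>_. V l) (\<lambda>k. V (c k))))"
      by (rule module_iso_sym[OF direct_sum_Plus left_module_closed[OF left_module_direct_sum[OF ring_group_algebra[OF G]]]])
        (use c l Vl in auto)
    also have "module_iso kG \<dots> (direct_sum {..<Suc n} (\<lambda>k. V (?c k)))"
    proof (rule direct_sum_iso)
      show "bij_betw (case_sum (\<lambda>_. 0) Suc) ({0::nat} <+> {..<n}) {..<Suc n}"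
        by (rule bij_betw_byWitness[where f' = "case_nat (Inl 0) Inr"]) (auto split: nat.splits)
      fix j assume "j \<in> {0::nat} <+> {..<n}"
      then show "left_module kG (case_sum (\<lambda>_. V l) (\<lambda>k. V (c k)) j)"
        "module_iso kG (case_sum (\<lambda>_. V l) (\<lambda>k. V (c k)) j) (V (?c (case_sum (\<lambda>_. 0) Suc j)))"
        using c l Vl by (auto intro: module_iso_refl)
    next
      fix k assume "k \<in> {..<Suc n}"
      then show "left_module kG (V (?c k))" using c' Vl by simp
    qed
    finally show ?thesis using c' by blast
  qed
qed

lemma multiplicities_exist:
  fixes V :: "'i \<Rightarrow> ('g \<Rightarrow>\<^sub>0 'k, 'v) module"
  assumes reps: "simple_representatives kG I V"
  shows "\<exists>N. module_iso kG (cmod E \<sigma>) (direct_sum I (\<lambda>l. copies (N l) (V l)))"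
proof -
  obtain n c where c: "\<And>k. k < n \<Longrightarrow> c k \<in> I" and iso: "module_iso kG (cmod E \<sigma>) (direct_sum {..<n::nat} (\<lambda>k. V (c k)))"
    using decompose[OF reps invariant_fspace] unfolding cmod_smod by blast
  have Vl: "left_module kG (V l)" if "l \<in> I" for l
    using reps that by (simp add: simple_representatives_def simple_module_def)
  let ?N = "\<lambda>l. card {k \<in> {..<n}. c k = l}"
  obtain h where h: "bij_betw h {..<n} (Sigma I (\<lambda>l. {..<?N l}))" "\<And>k. k \<in> {..<n} \<Longrightarrow> fst (h k) = c k"
    by (rule fibre_bij[of I "{..<n}" c]) (use c in auto)
  note iso
  also have "module_iso kG (direct_sum {..<n} (\<lambda>k. V (c k))) (direct_sum (Sigma I (\<lambda>l. {..<?N l})) (\<lambda>(l, k). V l))"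
    by (rule direct_sum_iso[OF h(1)]) (use c h(2) Vl in \<open>auto simp: split_beta intro: module_iso_refl\<close>)
  also have "module_iso kG \<dots> (direct_sum I (\<lambda>l. copies (?N l) (V l)))"
    unfolding copies_def by (rule direct_sum_nest)
  finally show ?thesis by (intro exI[of _ ?N])
qed

end

section \<open>Coordinates of a simple module and the scalar of a central element\<close>

locale simple_kG =
  fixes G :: "('g, 'x) monoid_scheme" and V :: "('g \<Rightarrow>\<^sub>0 'k::{alg_closed_field, field_char_0}, 'v) module"
  assumes G: "group G" and fin: "finite (carrier G)" and simple: "simple_module (group_algebra G) V"
begin

sublocale G: group G by (rule G)
abbreviation "kG \<equiv> group_algebra G :: ('g \<Rightarrow>\<^sub>0 'k) ring"
sublocale lm: left_module kG V using simple by (simp add: simple_module_def)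

lemma ex_nonzero: "\<exists>v\<in>carrier V. v \<noteq> \<zero>\<^bsub>V\<^esub>"
proof (rule ccontr)
  assume "\<not> ?thesis"
  then have "carrier V = {\<zero>\<^bsub>V\<^esub>}" using lm.zero_closed by blast
  then show False using simple by (simp add: simple_module_def)
qed

definition emb :: "('g \<Rightarrow> 'k) \<Rightarrow> 'g \<Rightarrow>\<^sub>0 'k" where
  "emb f = (\<Sum>g\<in>carrier G. Poly_Mapping.single g (f g))"

text \<open>Left translation of functions on \<open>G\<close>. Under \<open>emb\<close> it becomes
  left multiplication in \<open>kG\<close>.\<close>

definition reg :: "'g \<Rightarrow> ('g \<Rightarrow> 'k) \<Rightarrow> 'g \<Rightarrow> 'k" where
  "reg g f = (\<lambda>x. if x \<in> carrier G then f (inv\<^bsub>G\<^esub> g \<otimes>\<^bsub>G\<^esub> x) else 0)"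

sublocale R: group_rep G "carrier G" reg
proof (unfold_locales)
  show "grep G (carrier G) reg"
    unfolding operators_def
  proof (intro conjI ballI)
    show "lin (reg g)" for g by (rule linI) (auto simp: reg_def fun_eq_iff fapply)
    fix f :: "'g \<Rightarrow> 'k" assume f: "f \<in> fspace (carrier G)"
    show "reg \<one>\<^bsub>G\<^esub> f = f" using f by (auto simp: reg_def fun_eq_iff fspace_def)
    fix g h assume gh: "g \<in> carrier G" "h \<in> carrier G"
    show "reg g (reg h f) = scl 1 (reg (g \<otimes>\<^bsub>G\<^esub> h) f)"
      using gh by (auto simp: reg_def fun_eq_iff G.inv_mult_group G.m_assoc)
  qed (auto simp: fin reg_def fspace_def)
qed (rule G fin)+

lemma emb_closed [simp]: "emb f \<in> carrier kG"
proof -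
  have "Poly_Mapping.keys (emb f) \<subseteq> carrier G"
    unfolding emb_def by (rule order_trans[OF keys_sum]) auto
  then show ?thesis by (simp add: twisted_simps)
qed

lemma emb_add: "emb (f + f') = emb f + emb f'"
  by (simp add: emb_def fapply single_add sum.distrib)

lemma emb_zero: "emb 0 = 0"
  by (simp add: emb_def fapply)

lemma emb_sum: "emb (\<Sum>i\<in>A. f i) = (\<Sum>i\<in>A. emb (f i))"
  by (induction A rule: infinite_finite_induct) (simp_all add: emb_zero emb_add)

lemma emb_reg:
  assumes g: "g \<in> carrier G"
  shows "emb (scl c (reg g f)) = Poly_Mapping.single g c \<otimes>\<^bsub>kG\<^esub> emb f"
proof -
  have "emb (scl c (reg g f)) = (\<Sum>x\<in>carrier G. Poly_Mapping.single x (c * f (inv\<^bsub>G\<^esub> g \<otimes>\<^bsub>G\<^esub> x)))"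
    by (simp add: emb_def scl_apply reg_def)
  also have "\<dots> = (\<Sum>h\<in>carrier G. Poly_Mapping.single (g \<otimes>\<^bsub>G\<^esub> h) (c * f (inv\<^bsub>G\<^esub> g \<otimes>\<^bsub>G\<^esub> (g \<otimes>\<^bsub>G\<^esub> h))))"
  proof (rule sum.reindex_bij_betw[symmetric])
    show "bij_betw (\<lambda>k. g \<otimes>\<^bsub>G\<^esub> k) (carrier G) (carrier G)"
      by (rule bij_betw_byWitness[where f' = "\<lambda>k. inv\<^bsub>G\<^esub> g \<otimes>\<^bsub>G\<^esub> k"]) (auto simp: g G.m_assoc[symmetric])
  qed
  also have "\<dots> = Poly_Mapping.single g c \<otimes>\<^bsub>kG\<^esub> emb f"
    using g by (simp add: emb_def twisted_mult_sum_right twisted_mult_single G.m_assoc[symmetric])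
  finally show ?thesis .
qed

lemma emb_act: "h \<in> carrier kG \<Longrightarrow> emb (act reg h f) = h \<otimes>\<^bsub>kG\<^esub> emb f"
proof -
  assume "h \<in> carrier kG"
  then have h: "Poly_Mapping.keys h \<subseteq> carrier G" by (simp add: twisted_simps)
  have "emb (act reg h f) = (\<Sum>p\<in>Poly_Mapping.keys h. Poly_Mapping.single p (Poly_Mapping.lookup h p) \<otimes>\<^bsub>kG\<^esub> emb f)"
    unfolding act_def emb_sum using h by (intro sum.cong refl emb_reg) auto
  also have "\<dots> = h \<otimes>\<^bsub>kG\<^esub> emb f"
    by (simp only: twisted_mult_sum_left[symmetric] poly_mapping_sum_single[symmetric])
  finally show ?thesis .
qed

lemma emb_lookup: "h \<in> carrier kG \<Longrightarrow> emb (Poly_Mapping.lookup h) = h"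
proof -
  assume "h \<in> carrier kG"
  then have "Poly_Mapping.keys h \<subseteq> carrier G" by (simp add: twisted_simps)
  then have "emb (Poly_Mapping.lookup h) = (\<Sum>g\<in>Poly_Mapping.keys h. Poly_Mapping.single g (Poly_Mapping.lookup h g))"
    unfolding emb_def using fin by (intro sum.mono_neutral_right) (auto simp: in_keys_iff)
  then show ?thesis by (simp only: poly_mapping_sum_single[symmetric])
qed

lemma lookup_fspace: "h \<in> carrier kG \<Longrightarrow> Poly_Mapping.lookup h \<in> fspace (carrier G)"
  by (auto simp: twisted_simps fspace_def in_keys_iff subset_iff)

text \<open>For \<open>v0 \<noteq> 0\<close> the map \<open>f \<mapsto> emb f \<odot> v0\<close>
  sends the regular representation onto \<open>V\<close> by simplicity. A Maschke complement of its
  kernel is isomorphic to \<open>V\<close> and consists of functions on \<open>G\<close>, so a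
  finite basis can be taken there. The type of the index set therefore depends on \<open>G\<close>
  and \<open>k\<close> but not on \<open>V\<close>.\<close>

lemma ex_coordinates: "\<exists>(B :: ('g \<Rightarrow> 'k) set) \<rho> \<theta> \<eta>. coordinates G (\<lambda>_ _. 1) V B \<rho> \<theta> \<eta>"
proof -
  obtain v0 where v0: "v0 \<in> carrier V" "v0 \<noteq> \<zero>\<^bsub>V\<^esub>"
    using ex_nonzero by blast
  let ?F = "\<lambda>f. emb f \<odot>\<^bsub>V\<^esub> v0"
  let ?E = "fspace (carrier G)"
  have Fc: "?F f \<in> carrier V" for f by (rule lm.smult_closed[OF emb_closed v0(1)])
  have Fadd: "?F (f + f') = ?F f \<oplus>\<^bsub>V\<^esub> ?F f'" for f f'
    using lm.smult_l_distr[OF emb_closed emb_closed v0(1)] by (simp add: emb_add twisted_simps)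
  have Fact: "?F (act reg h f) = h \<odot>\<^bsub>V\<^esub> ?F f" if "h \<in> carrier kG" for h f
    using lm.smult_assoc[OF that emb_closed v0(1)] by (simp add: emb_act[OF that])
  have F0: "?F 0 = \<zero>\<^bsub>V\<^esub>"
    using Fadd[of 0 0] Fc[of 0] lm.add.l_cancel_one[of "?F 0" "?F 0"] by simp
  have hz: "h \<odot>\<^bsub>V\<^esub> \<zero>\<^bsub>V\<^esub> = \<zero>\<^bsub>V\<^esub>" if "h \<in> carrier kG" for h
    using Fact[OF that, of 0] F0 act_def[of reg h 0] by (simp add: lin_zero[OF R.lin_act_rep[OF that]])
  let ?W = "?F ` ?E"
  have "submodule ?W kG V"
  proof -
    have Fm: "?F (- f) = \<ominus>\<^bsub>V\<^esub> ?F f" for f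
      using Fadd[of "- f" f] F0 lm.minus_equality[OF _ Fc Fc, of "- f" f] by simp
    show ?thesis
      unfolding submodule_def submodule_axioms_def subgroup_def a_inv_def[symmetric]
    proof (intro conjI allI impI)
      fix w w' assume "w \<in> ?W" "w' \<in> ?W"
      then obtain f f' where "f \<in> ?E" "w = ?F f" "f' \<in> ?E" "w' = ?F f'" by blast
      then show "w \<otimes>\<^bsub>add_monoid V\<^esub> w' \<in> ?W" by (intro image_eqI[of _ _ "f + f'"]) (simp_all add: Fadd fspace_add)
    next
      fix h w assume h: "h \<in> carrier kG" and "w \<in> ?W"
      then obtain f where "f \<in> ?E" "w = ?F f" by blast
      then show "h \<odot>\<^bsub>V\<^esub> w \<in> ?W"
        using R.act_invariant[OF R.invariant_fspace h] by (intro image_eqI[of _ _ "act reg h f"]) (simp_all add: Fact h)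
    next
      fix w assume "w \<in> ?W"
      then obtain f where "f \<in> ?E" "w = ?F f" by blast
      then show "\<ominus>\<^bsub>V\<^esub> w \<in> ?W" by (intro image_eqI[of _ _ "- f"]) (simp_all add: Fm fspace_uminus)
    next
      show "\<one>\<^bsub>add_monoid V\<^esub> \<in> ?W" by (intro image_eqI[of _ _ 0]) (simp_all add: F0)
    qed (use Fc in auto)
  qed
  moreover have "v0 \<in> ?W"
  proof (rule image_eqI)
    have one: "\<one>\<^bsub>kG\<^esub> \<in> carrier kG" by (rule lm.one_closed)
    show "v0 = ?F (Poly_Mapping.lookup \<one>\<^bsub>kG\<^esub>)" by (simp only: emb_lookup[OF one] lm.smult_one[OF v0(1)])
    show "Poly_Mapping.lookup \<one>\<^bsub>kG\<^esub> \<in> ?E" by (rule lookup_fspace[OF one])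
  qed
  ultimately have WV: "?W = carrier V" using simple v0(2) unfolding simple_module_def by blast
  let ?K = "{f \<in> ?E. ?F f = \<zero>\<^bsub>V\<^esub>}"
  have Ks: "act reg h f \<in> ?K" if "h \<in> carrier kG" "f \<in> ?K" for h f
    using that Fact[OF that(1), of f] hz R.act_invariant[OF R.invariant_fspace that(1)] by simp
  have "R.invariant ?K"
    unfolding R.invariant_def R.V.subspace_def
  proof (intro conjI ballI allI)
    fix c f assume f: "f \<in> ?K"
    then have "act reg (scalar G c) f \<in> ?K" by (intro Ks) (simp_all add: scalar_def twisted_simps)
    then show "scl c f \<in> ?K" using scalar_act[OF R.rep, of f c] f by simp
  next
    fix g f assume "g \<in> carrier G" "f \<in> ?K"
    then have "act reg (Poly_Mapping.single g 1) f \<in> ?K" by (intro Ks) (simp_all add: twisted_simps)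
    then show "reg g f \<in> ?K" by simp
  qed (auto simp: F0 Fadd fspace_add)
  then obtain W where W: "R.invariant W" "W \<subseteq> ?E" "?K \<inter> W = {0}" "\<And>f. f \<in> ?E \<Longrightarrow> \<exists>u\<in>?K. \<exists>w\<in>W. f = u + w"
    using R.complement[OF _ R.invariant_fspace, of ?K] by (metis (no_types, lifting) mem_Collect_eq subsetI)
  have "module_iso kG (smod W reg) V"
  proof (rule module_isoI[where f = ?F])
    show "bij_betw ?F (carrier (smod W reg)) (carrier V)"
      unfolding bij_betw_def smod_simps
    proof
      show "inj_on ?F W"
      proof (rule inj_onI)
        fix f g assume fg: "f \<in> W" "g \<in> W" "?F f = ?F g"
        have d: "f + (- g) \<in> W" using fg by (intro R.invariantD(6,8)[OF W(1)])
        have "?F (f + (- g)) = ?F (g + (- g))" unfolding Fadd fg(3) ..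
        then have "f + (- g) \<in> ?K" using d W(2) F0 by auto
        then have "f + (- g) = 0" using d W(3) by blast
        then show "f = g" by (simp only: add_eq_0_iff2 minus_minus)
      qed
      have "v \<in> ?F ` W" if "v \<in> carrier V" for v
      proof -
        have "v \<in> ?F ` ?E" using that WV by simp
        then obtain f where f: "f \<in> ?E" "v = ?F f" by blast
        obtain u w where u: "u \<in> ?K" "w \<in> W" "f = u + w" using W(4)[OF f(1)] by blast
        have "?F u = \<zero>\<^bsub>V\<^esub>" using u(1) by blast
        then have "v = ?F w" using f(2) Fc[of w] by (simp add: u(3) Fadd)
        then show ?thesis using u(2) by (rule image_eqI)
      qed
      then show "?F ` W = carrier V" using Fc by auto
    qed
    show "?F (f \<oplus>\<^bsub>smod W reg\<^esub> g) = ?F f \<oplus>\<^bsub>V\<^esub> ?F g" if "f \<in> carrier (smod W reg)" "g \<in> carrier (smod W reg)" for f g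
      by (simp add: Fadd)
    show "?F (h \<odot>\<^bsub>smod W reg\<^esub> f) = h \<odot>\<^bsub>V\<^esub> ?F f" if "h \<in> carrier kG" "f \<in> carrier (smod W reg)" for h f
      using that by (simp add: Fact)
  qed
  then have iso: "module_iso kG V (smod W reg)"
    by (rule module_iso_sym[OF _ left_module_closed[OF R.left_module_smod[OF W(1)]]])
  obtain B :: "('g \<Rightarrow> 'k) set" and \<rho> where B: "grep G B \<rho>" "module_iso kG (smod W reg) (cmod B \<rho>)"
    by (rule R.basis_coordinates[OF W(1)])
  obtain \<theta> \<eta> where "coordinates G (\<lambda>_ _. 1) V B \<rho> \<theta> \<eta>"
    by (rule coordinates_exist[OF module_iso_trans[OF iso B(2)] lm.left_module_axioms B(1)])
  then show ?thesis by (intro exI)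
qed

end

text \<open>Here \<open>p\<close> is a nonzero polynomial with \<open>p(T) f = 0\<close>. A root
  \<open>z\<close> gives \<open>p = (X - z) q\<close>; either \<open>q(T) f\<close> is nonzero and
  an eigenvector for \<open>z\<close>, or \<open>q\<close> is an annihilating polynomial of smaller
  degree.\<close>

lemma eigenvector_exists:
  fixes T :: "('b \<Rightarrow> 'k::alg_closed_field) \<Rightarrow> 'b \<Rightarrow> 'k"
  assumes T: "lin T" and cl: "\<And>f. f \<in> fspace B \<Longrightarrow> T f \<in> fspace B" and f: "f \<in> fspace B" "f \<noteq> 0"
    and p: "p \<noteq> 0" "(\<Sum>i\<le>degree p. scl (coeff p i) ((T ^^ i) f)) = 0"
  shows "\<exists>z w. w \<in> fspace B \<and> w \<noteq> 0 \<and> T w = scl z w"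
  using p
proof (induction "degree p" arbitrary: p rule: less_induct)
  case less
  define P where "P p = (\<Sum>i\<le>degree p. scl (coeff p i) ((T ^^ i) f))" for p
  have Psup: "P p = (\<Sum>i\<le>n. scl (coeff p i) ((T ^^ i) f))" if "degree p \<le> n" for p n
    unfolding P_def by (rule sum.mono_neutral_left) (use that in \<open>auto simp: coeff_eq_0\<close>)
  show ?case
  proof (cases "degree p = 0")
    case True
    then have c: "coeff p 0 \<noteq> 0" "scl (coeff p 0) f = 0" using less.prems leading_coeff_0_iff[of p] by auto
    have "scl (inverse (coeff p 0)) (scl (coeff p 0) f) = 0" unfolding c(2) by simp
    then show ?thesis using c(1) f(2) by simp
  next
    case False
    then obtain z where "poly p z = 0" using alg_closed_imp_poly_has_root[of p] by auto
    then obtain q where q: "p = [:- z, 1:] * q" by (auto simp: poly_eq_0_iff_dvd elim: dvdE)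
    have q0: "q \<noteq> 0" using q less.prems(1) by auto
    have "degree p = degree [:- z, 1:] + degree q" unfolding q using q0 by (intro degree_mult_eq) auto
    then have dq: "degree p = Suc (degree q)" by simp
    have Pq: "P p = T (P q) + scl (- z) (P q)"
    proof -
      have cp: "coeff p i = (if i = 0 then 0 else coeff q (i - 1)) - z * coeff q i" for i
        by (cases i) (simp_all add: q)
      let ?n = "degree q"
      have "P p = (\<Sum>i\<le>Suc ?n. scl (if i = 0 then 0 else coeff q (i - 1)) ((T ^^ i) f)) + (\<Sum>i\<le>Suc ?n. scl (- z * coeff q i) ((T ^^ i) f))"
        unfolding P_def dq cp sum.distrib[symmetric] by (intro sum.cong refl) (simp add: scl_add(2)[symmetric])
      also have "(\<Sum>i\<le>Suc ?n. scl (if i = 0 then 0 else coeff q (i - 1)) ((T ^^ i) f)) = (\<Sum>i\<le>?n. scl (coeff q i) (T ((T ^^ i) f)))"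
        by (subst sum.atMost_Suc_shift) simp
      also have "\<dots> = T (P q)" by (simp add: P_def lin_sum[OF T] lin_scl[OF T])
      also have "(\<Sum>i\<le>Suc ?n. scl (- z * coeff q i) ((T ^^ i) f)) = scl (- z) (P q)"
        by (simp add: Psup[of q "Suc ?n"] scl_sum del: sum.atMost_Suc)
      finally show ?thesis .
    qed
    show ?thesis
    proof (cases "P q = 0")
      case True
      then show ?thesis using less.hyps[of q] q0 dq by (simp add: P_def)
    next
      case False
      have "(T ^^ i) f \<in> fspace B" for i using cl f(1) by (induction i) simp_all
      then have "P q \<in> fspace B" unfolding P_def by (intro fspace_sum fspace_scl)
      moreover have "T (P q) = scl z (P q)"
      proof -
        have "T (P q) + scl (- z) (P q) + scl z (P q) = 0 + scl z (P q)" using Pq less.prems(2) by (simp add: P_def)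
        moreover have "scl (- z) (P q) + scl z (P q) = 0" by (simp flip: scl_add(2))
        ultimately show ?thesis by (simp add: add.assoc)
      qed
      ultimately show ?thesis using False by blast
    qed
  qed
qed

context simple_kG
begin

text \<open>Schur's lemma. The operator of \<open>a\<close> has an eigenvector since
  \<open>a\<close> has finite order; its eigenspace is invariant because \<open>a\<close> is
  central, so it is everything. The eigenvalue is nonzero because a power of the operator is the
  identity, and it is the one in \<open>central_scalar\<close> because \<open>V\<close> is not
  zero.\<close>

lemma central_acts_by_scalar:
  fixes B :: "'b set"
  assumes co: "coordinates G (\<lambda>_ _. 1) V B \<rho> \<theta> \<eta>" and a: "a \<in> carrier G" "\<forall>g\<in>carrier G. a \<otimes>\<^bsub>G\<^esub> g = g \<otimes>\<^bsub>G\<^esub> a"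
  shows "central_scalar G a V \<noteq> 0 \<and> (\<forall>f\<in>fspace B. \<rho> a f = scl (central_scalar G a V) f)"
proof -
  interpret C: coord G "\<lambda>_ _. 1" V B \<rho> \<theta> \<eta> using co G.is_monoid by (simp add: coord_def)
  interpret B: group_rep G B \<rho> by unfold_locales (rule G fin C.L)+
  obtain v0 where v0: "v0 \<in> carrier V" "v0 \<noteq> \<zero>\<^bsub>V\<^esub>"
    using ex_nonzero by blast
  have t0: "\<theta> \<zero>\<^bsub>V\<^esub> = 0" using C.theta(5)[OF lm.zero_closed lm.zero_closed] by simp
  have tv0: "\<theta> v0 \<noteq> 0" using C.theta_inj[OF v0(1) lm.zero_closed] v0(2) t0 by auto
  define N where "N = Coset.order G"
  have N0: "0 < N" unfolding N_def using fin by (simp add: G.order_gt_0_iff_finite)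
  have pow: "(\<rho> a ^^ n) f = \<rho> (a [^]\<^bsub>G\<^esub> n) f" if f: "f \<in> fspace B" for n f
  proof (induction n)
    case 0 then show ?case using f by (simp add: B.rep_one)
  next
    case (Suc n)
    then show ?case using f a(1) by (simp add: B.rep_mult flip: G.nat_pow_Suc2)
  qed
  have aN: "(\<rho> a ^^ N) f = f" if "f \<in> fspace B" for f
    using pow[OF that, of N] a(1) that by (simp add: N_def G.pow_order_eq_1 B.rep_one)
  \<comment> \<open>\<open>X^N - 1\<close> with \<open>N\<close> the group order annihilates the
    operator of \<open>a\<close>; it is nonzero since \<open>N\<close> is positive.\<close>
  let ?p = "monom 1 N - 1 :: 'k poly"
  have cp: "coeff ?p i = (if i = N then 1 else 0) - (if i = 0 then 1 else 0)" for i by simp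
  have p0: "?p \<noteq> 0" using cp[of N] N0 by (metis coeff_0 diff_zero less_numeral_extra(3) one_neq_zero)
  have dN: "degree ?p \<le> N" by (rule degree_le) (simp add: cp)
  have "(\<Sum>i\<le>degree ?p. scl (coeff ?p i) ((\<rho> a ^^ i) (\<theta> v0))) = (\<Sum>i\<le>N. scl (coeff ?p i) ((\<rho> a ^^ i) (\<theta> v0)))"
  proof (rule sum.mono_neutral_left)
    show "\<forall>i\<in>{..N} - {..degree ?p}. scl (coeff ?p i) ((\<rho> a ^^ i) (\<theta> v0)) = 0"
    proof
      fix i assume "i \<in> {..N} - {..degree ?p}"
      then have "coeff ?p i = 0" by (intro coeff_eq_0) auto
      then show "scl (coeff ?p i) ((\<rho> a ^^ i) (\<theta> v0)) = 0" by (simp only: scl_zero)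
    qed
  qed (use dN in auto)
  also have "\<dots> = (\<Sum>i\<in>{0, N}. scl (coeff ?p i) ((\<rho> a ^^ i) (\<theta> v0)))"
    by (rule sum.mono_neutral_right) (auto simp: cp)
  also have "\<dots> = scl (- 1) (\<theta> v0) + scl 1 (\<theta> v0)"
    using N0 v0(1) by (simp add: cp aN)
  also have "\<dots> = 0" by (simp only: scl_add(2)[symmetric]) simp
  finally obtain z w where w: "w \<in> fspace B" "w \<noteq> 0" "\<rho> a w = scl z w"
    using eigenvector_exists[OF B.lin_rep[OF a(1)] _ _ tv0 p0, of B] B.rep_closed[OF a(1)] v0(1) by auto
  let ?W = "{f \<in> fspace B. \<rho> a f = scl z f}"
  have "B.invariant ?W"
    unfolding B.invariant_def B.V.subspace_def
  proof (intro conjI ballI allI)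
    fix g f assume g: "g \<in> carrier G" and f: "f \<in> ?W"
    have "\<rho> a (\<rho> g f) = \<rho> (a \<otimes>\<^bsub>G\<^esub> g) f" using g f a(1) by (simp add: B.rep_mult)
    also have "\<dots> = \<rho> (g \<otimes>\<^bsub>G\<^esub> a) f" using g a(2) by simp
    also have "\<dots> = \<rho> g (\<rho> a f)" by (rule B.rep_mult[symmetric]) (use g f a(1) in auto)
    finally have "\<rho> a (\<rho> g f) = \<rho> g (\<rho> a f)" .
    then show "\<rho> g f \<in> ?W" using g f by (simp add: B.rep_closed lin_scl[OF B.lin_rep])
  qed (use B.lin_rep[OF a(1)] in \<open>auto simp: lin_add lin_scl fspace_add fspace_scl scl_add mult.commute\<close>)
  then have inv: "B.invariant ?W" .
  have "simple_module kG (cmod B \<rho>)"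
  proof (rule simple_transfer[OF simple])
    show "left_module kG (cmod B \<rho>)" by (rule grep_left_module[OF G C.L])
    show "module_iso kG V (cmod B \<rho>)"
    proof (rule module_isoI[where f = \<theta>])
      show "bij_betw \<theta> (carrier V) (carrier (cmod B \<rho>))"
        by (rule bij_betw_byWitness[where f' = \<eta>]) auto
    qed (auto simp: twisted_simps)
  qed
  moreover have "submodule ?W kG (cmod B \<rho>)"
    unfolding submodule_def submodule_axioms_def subgroup_def a_inv_def[symmetric]
  proof (intro conjI allI impI)
    fix f assume f: "f \<in> ?W"
    have "\<ominus>\<^bsub>cmod B \<rho>\<^esub> f = - f"
      using abelian_group.minus_equality[OF abelian_group_fspace[of B \<rho>], of "- f" f] f by (auto simp: fspace_uminus)
    then show "\<ominus>\<^bsub>cmod B \<rho>\<^esub> f \<in> ?W" using B.invariantD(8)[OF inv f] by simp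
  next
    fix f f' assume "f \<in> ?W" "f' \<in> ?W"
    then have "f + f' \<in> ?W" by (rule B.invariantD(6)[OF inv])
    then show "f \<otimes>\<^bsub>add_monoid (cmod B \<rho>)\<^esub> f' \<in> ?W" by simp
  next
    fix h f assume "h \<in> carrier kG" "f \<in> ?W"
    then have "act \<rho> h f \<in> ?W" by (rule B.act_invariant[OF inv])
    then show "h \<odot>\<^bsub>cmod B \<rho>\<^esub> f \<in> ?W" by simp
  next
    show "?W \<subseteq> carrier (add_monoid (cmod B \<rho>))" by auto
    have "0 \<in> ?W" by (rule B.invariantD(5)[OF inv])
    then show "\<one>\<^bsub>add_monoid (cmod B \<rho>)\<^esub> \<in> ?W" by simp
  qed
  ultimately have "?W = fspace B" using w unfolding simple_module_def by auto
  then have all: "\<rho> a f = scl z f" if "f \<in> fspace B" for f using that by blast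
  have Ga: "Poly_Mapping.keys (Poly_Mapping.single a (1::'k)) \<subseteq> carrier G" using a by simp
  have act_z: "Poly_Mapping.single a 1 \<odot>\<^bsub>V\<^esub> v = scalar G z \<odot>\<^bsub>V\<^esub> v" if v: "v \<in> carrier V" for v
  proof (rule C.theta_inj)
    have "\<theta> (Poly_Mapping.single a 1 \<odot>\<^bsub>V\<^esub> v) = act \<rho> (Poly_Mapping.single a 1) (\<theta> v)" using v a by simp
    then show "\<theta> (Poly_Mapping.single a 1 \<odot>\<^bsub>V\<^esub> v) = \<theta> (scalar G z \<odot>\<^bsub>V\<^esub> v)" using v all by simp
    show "Poly_Mapping.single a 1 \<odot>\<^bsub>V\<^esub> v \<in> carrier V" by (rule lm.smult_closed[OF _ v]) (simp add: twisted_simps a)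
    show "scalar G z \<odot>\<^bsub>V\<^esub> v \<in> carrier V" using v by simp
  qed
  have uniq: "y = z" if y: "\<forall>v\<in>carrier V. Poly_Mapping.single a 1 \<odot>\<^bsub>V\<^esub> v = scalar G y \<odot>\<^bsub>V\<^esub> v" for y
  proof -
    have "\<theta> (scalar G y \<odot>\<^bsub>V\<^esub> v0) = \<theta> (scalar G z \<odot>\<^bsub>V\<^esub> v0)" using y act_z[OF v0(1)] v0(1) by simp
    then have e: "scl y (\<theta> v0) = scl z (\<theta> v0)" using v0(1) by simp
    obtain b where "\<theta> v0 b \<noteq> 0" using tv0 by (auto simp: fun_eq_iff zero_fun_apply)
    then show ?thesis using fun_cong[OF e, of b] by (simp add: scl_apply)
  qed
  have cs: "central_scalar G a V = z"
    unfolding central_scalar_def by (rule the_equality) (use act_z uniq in blast)+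
  have "z \<noteq> 0"
  proof
    assume z: "z = 0"
    have "(\<rho> a ^^ N) w = 0"
    proof -
      obtain m where m: "N = Suc m" using N0 by (cases N) auto
      have "\<rho> a w = 0" using w(3) z by simp
      then have "(\<rho> a ^^ Suc m) w = (\<rho> a ^^ m) 0" by (simp only: funpow_Suc_right comp_apply)
      also have "\<dots> = 0" by (induction m) (simp_all add: lin_zero[OF B.lin_rep[OF a(1)]])
      finally show ?thesis by (simp add: m)
    qed
    then show False using aN[OF w(1)] w(2) by simp
  qed
  then show ?thesis using all by (simp add: cs)
qed

end

section \<open>Decomposition of the tensor products\<close>

text \<open>The relation between \<open>x\<close> and \<open>g\<close> holds for each of the two
  summands; for \<open>x \<otimes> a\<close> centrality of \<open>a\<close> is what lets
  \<open>g\<close> pass the second factor.\<close>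

lemma hrep_tensor:
  fixes B :: "'b set" and C :: "'c set" and \<chi> :: "'g \<Rightarrow> 'k::field"
  assumes G: "group G" and a: "a \<in> carrier G" "\<forall>g\<in>carrier G. a \<otimes>\<^bsub>G\<^esub> g = g \<otimes>\<^bsub>G\<^esub> a"
    and B: "hrep G \<chi> B \<rho> xx" and C: "hrep G \<chi> C \<sigma> Y"
  shows "hrep G \<chi> (B \<times> C) (\<lambda>g. kron (\<rho> g) (\<sigma> g)) (\<lambda>\<phi>. kron xx (\<sigma> a) \<phi> + kron (\<lambda>f. f) Y \<phi>)"
proof -
  have rB: "grep G B \<rho>" and rC: "grep G C \<sigma>" and lx: "lin xx" "lin Y"
    and xc: "\<And>f. f \<in> fspace B \<Longrightarrow> xx f \<in> fspace B" and Yc: "\<And>f. f \<in> fspace C \<Longrightarrow> Y f \<in> fspace C"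
    and xr: "\<And>g f. \<lbrakk>g \<in> carrier G; f \<in> fspace B\<rbrakk> \<Longrightarrow> xx (\<rho> g f) = scl (inverse (\<chi> g)) (\<rho> g (xx f))"
    and Yr: "\<And>g f. \<lbrakk>g \<in> carrier G; f \<in> fspace C\<rbrakk> \<Longrightarrow> Y (\<sigma> g f) = scl (inverse (\<chi> g)) (\<sigma> g (Y f))"
    using B C by (auto simp: hrep_def)
  have fin: "finite B" "finite C" and l: "\<And>g. g \<in> carrier G \<Longrightarrow> lin (\<rho> g)" "\<And>g. g \<in> carrier G \<Longrightarrow> lin (\<sigma> g)"
    and ac: "\<And>f. f \<in> fspace C \<Longrightarrow> \<sigma> a f \<in> fspace C"
    and m: "\<And>g h f. \<lbrakk>g \<in> carrier G; h \<in> carrier G; f \<in> fspace C\<rbrakk> \<Longrightarrow> \<sigma> g (\<sigma> h f) = \<sigma> (g \<otimes>\<^bsub>G\<^esub> h) f"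
    using rB rC a(1) by (auto simp: operators_def)
  let ?x = "\<lambda>\<phi> :: 'b \<times> 'c \<Rightarrow> 'k. kron xx (\<sigma> a) \<phi> + kron (\<lambda>f. f) Y \<phi>"
  have lin: "lin ?x" by (rule lin_plus[OF lin_kron[OF lx(1) l(2)[OF a(1)]] lin_kron[OF lin_id lx(2)]])
  moreover have "?x \<phi> \<in> fspace (B \<times> C)" if "\<phi> \<in> fspace (B \<times> C)" for \<phi>
    by (intro fspace_add kron_closed[OF lx(1) l(2)[OF a(1)] xc ac that] kron_closed[OF lin_id lx(2) _ Yc that])
  moreover have "?x (kron (\<rho> g) (\<sigma> g) \<phi>) = scl (inverse (\<chi> g)) (kron (\<rho> g) (\<sigma> g) (?x \<phi>))"
    if g: "g \<in> carrier G" and \<phi>: "\<phi> \<in> fspace (B \<times> C)" for g \<phi>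
  proof (rule kron_eqI[OF _ _ fin \<phi>, of "\<lambda>\<phi>. ?x (kron (\<rho> g) (\<sigma> g) \<phi>)" "\<lambda>\<phi>. scl (inverse (\<chi> g)) (kron (\<rho> g) (\<sigma> g) (?x \<phi>))"])
    have lk: "lin (kron (\<rho> g) (\<sigma> g))" by (rule lin_kron[OF l(1,2)[OF g]])
    show "lin (\<lambda>\<phi>. ?x (kron (\<rho> g) (\<sigma> g) \<phi>))" by (rule lin_comp[OF lin lk])
    show "lin (\<lambda>\<phi>. scl (inverse (\<chi> g)) (kron (\<rho> g) (\<sigma> g) (?x \<phi>)))" by (rule lin_scale[OF lin_comp[OF lk lin]])
    fix f :: "'b \<Rightarrow> 'k" and v :: "'c \<Rightarrow> 'k" assume f: "f \<in> fspace B" and v: "v \<in> fspace C"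
    have c: "\<sigma> a (\<sigma> g v) = \<sigma> g (\<sigma> a v)" using m[OF a(1) g v] m[OF g a(1) v] a(2) g by simp
    show "?x (kron (\<rho> g) (\<sigma> g) (tens f v)) = scl (inverse (\<chi> g)) (kron (\<rho> g) (\<sigma> g) (?x (tens f v)))"
      using l[OF g] l(2)[OF a(1)] lx f v g
      by (simp add: kron_tens lin_add[OF lk] xr Yr c tens_scl scl_add)
  qed
  ultimately show ?thesis using grep_kron[OF G rB rC] by (simp add: hrep_def)
qed

lemma (in two_factors) graded_x': "graded s E' deg' x'"
proof -
  have sl: "(\<lambda>e. f (l, e)) \<in> fspace (sdom s (\<lambda>_. len l))" if "f \<in> fspace E'" for f :: "_ \<Rightarrow> 'k" and l
    using that by (cases l) (auto simp: fspace_def E'_def)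
  show ?thesis
    unfolding graded_def
  proof (intro conjI ballI allI impI)
    fix f :: "(nat \<times> nat) \<times> nat \<times> nat \<Rightarrow> 'k" assume f: "f \<in> fspace E'"
    show "x' f \<in> fspace E'"
    proof -
      have "x' f (l, e) = 0" if "(l, e) \<notin> E'" for l e
      proof (cases "l \<in> idx")
        case True
        then have "e \<notin> sdom s (\<lambda>_. len l)" using that by (simp add: E'_def)
        then show ?thesis using fspaceD[OF xop_closed[of s "\<lambda>_. len l" \<gamma> "\<lambda>e. f (l, e)"]] by (cases e) (simp add: x'_def)
      next
        case False
        then have "(\<lambda>e. f (l, e)) = 0" using f by (cases l) (auto simp: fun_eq_iff fapply fspace_def E'_def)
        then show ?thesis by (simp add: x'_def lin_zero[OF lin_xop] fapply)
      qed
      then show ?thesis by (auto simp: fspace_def)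
    qed
    fix z :: 'k assume z: "z ^ s = 1"
    show "x' (Dg deg' z f) = scl (inverse z) (Dg deg' z (x' f))"
    proof (rule ext, clarify)
      fix l c m
      have D: "(\<lambda>e. Dg deg' z f (l, e)) = Dg fst z (\<lambda>e. f (l, e))" by (simp add: Dg_def deg'_def)
      have "xop s (\<lambda>_. len l) \<gamma> (Dg fst z (\<lambda>e. f (l, e))) = scl (inverse z) (Dg fst z (xop s (\<lambda>_. len l) \<gamma> (\<lambda>e. f (l, e))))"
        using graded_xop[OF shape'[of "len l"]] z sl[OF f, of l] by (simp add: graded_def)
      then show "x' (Dg deg' z f) (l, c, m) = scl (inverse z) (Dg deg' z (x' f)) (l, c, m)"
        by (simp add: x'_def D) (simp add: fapply Dg_def deg'_def)
    qed
  qed (rule finE' lin_x')+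
qed

text \<open>
  In degree \<open>c\<close> the nilpotent factor has \<open>u + 1\<close> basis vectors if \<open>hi c\<close> and \<open>u\<close> otherwise. The summation index
  of the theorem is \<open>m = min t (u + 1) - j\<close>, respectively \<open>m = min t u - j\<close>, for the string index \<open>j\<close>.
\<close>

lemma reassemble:
  fixes P :: "nat \<Rightarrow> 'i \<Rightarrow> ('r, 'm) module" and N :: "'i \<Rightarrow> nat"
  assumes R: "ring R" and P: "\<And>n l. \<lbrakk>0 < n; l \<in> I\<rbrakk> \<Longrightarrow> left_module R (P n l)"
    and idx: "idx = Sigma {..<s} (\<lambda>c. {..<mn c})"
    and mn: "\<And>c. c < s \<Longrightarrow> mn c = (if hi c then min t (u + 1) else min t u)"
    and len: "\<And>c j. c < s \<Longrightarrow> len (c, j) = u + (if hi c then 1 else 0) + t - 1 - 2 * j"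
    and r: "card {c \<in> {..<s}. hi c} = r"
  shows "module_iso R (direct_sum (Sigma I (\<lambda>l. {..<N l}) \<times> idx) (\<lambda>(j, q). P (len q) (fst j)))
    (binary_sum
      (direct_sum I (\<lambda>l. direct_sum {1..min t u} (\<lambda>m. copies (N l * (s - r)) (P (2 * m - 1 + nat \<bar>int t - int u\<bar>) l))))
      (direct_sum I (\<lambda>l. direct_sum {1..min t (u + 1)} (\<lambda>m. copies (N l * r) (P (2 * m - 1 + nat \<bar>int t - int u - 1\<bar>) l)))))"
proof -
  let ?X = "Sigma I (\<lambda>l. {..<N l}) \<times> idx"
  let ?A = "{1..min t u}" and ?A' = "{1..min t (u + 1)}"
  let ?P1 = "\<lambda>l m. P (2 * m - 1 + nat \<bar>int t - int u\<bar>) l" and ?P2 = "\<lambda>l m. P (2 * m - 1 + nat \<bar>int t - int u - 1\<bar>) l"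
  let ?K = "(I \<times> ?A) <+> (I \<times> ?A')"
  \<comment> \<open>The summand of the theorem to which a string belongs: which of the two sums, the
    simple module \<open>l\<close> and the index \<open>m\<close>. The fibre over it is parametrized
    by the copy \<open>k\<close> of \<open>V l\<close> and by the degree \<open>c\<close>, hence has
    \<open>N l * r\<close> or \<open>N l * (s - r)\<close> elements.\<close>
  define key where "key = (\<lambda>((l, k :: nat), (c, j)). if hi c then Inr (l, min t (u + 1) - j) else Inl (l, min t u - j) :: ('i \<times> nat) + ('i \<times> nat))"
  have key [simp]: "key ((l, k), (c, j)) = (if hi c then Inr (l, min t (u + 1) - j) else Inl (l, min t u - j))" for l k c j
    by (simp add: key_def)
  let ?PK = "case_sum (\<lambda>(l, m). ?P1 l m) (\<lambda>(l, m). ?P2 l m)"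
  have finlo: "card {c \<in> {..<s}. \<not> hi c} = s - r"
  proof -
    have "{c \<in> {..<s}. \<not> hi c} = {..<s} - {c \<in> {..<s}. hi c}" by auto
    moreover have "card ({..<s} - {c \<in> {..<s}. hi c}) = card {..<s} - card {c \<in> {..<s}. hi c}"
      by (rule card_Diff_subset) auto
    ultimately show ?thesis using r by simp
  qed
  have fib1: "{x \<in> ?X. key x = Inl (l, m)} = (\<lambda>(k, c). ((l, k), (c, min t u - m))) ` ({..<N l} \<times> {c \<in> {..<s}. \<not> hi c})"
    if l: "l \<in> I" and m: "m \<in> ?A" for l m
  proof (intro equalityI subsetI)
    fix x assume "x \<in> {x \<in> ?X. key x = Inl (l, m)}"
    then obtain l' k c j where x: "x = ((l', k), (c, j))" "l' \<in> I" "k < N l'" "c < s" "j < mn c" "key x = Inl (l, m)"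
      by (auto simp: idx)
    have "\<not> hi c" using x(1,6) by (auto split: if_splits)
    moreover from this have "l' = l" "m = min t u - j" "j < min t u" using x by (auto simp: mn)
    ultimately show "x \<in> (\<lambda>(k, c). ((l, k), (c, min t u - m))) ` ({..<N l} \<times> {c \<in> {..<s}. \<not> hi c})"
      using x(1,3,4) by (intro image_eqI[of _ _ "(k, c)"]) auto
  next
    fix x assume "x \<in> (\<lambda>(k, c). ((l, k), (c, min t u - m))) ` ({..<N l} \<times> {c \<in> {..<s}. \<not> hi c})"
    then obtain k c where x: "x = ((l, k), (c, min t u - m))" "k < N l" "c < s" "\<not> hi c" by auto
    have "min t u - m < min t u" "min t u - (min t u - m) = m" using m by auto
    then show "x \<in> {x \<in> ?X. key x = Inl (l, m)}" using x l by (simp add: idx mn)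
  qed
  have fib2: "{x \<in> ?X. key x = Inr (l, m)} = (\<lambda>(k, c). ((l, k), (c, min t (u + 1) - m))) ` ({..<N l} \<times> {c \<in> {..<s}. hi c})"
    if l: "l \<in> I" and m: "m \<in> ?A'" for l m
  proof (intro equalityI subsetI)
    fix x assume "x \<in> {x \<in> ?X. key x = Inr (l, m)}"
    then obtain l' k c j where x: "x = ((l', k), (c, j))" "l' \<in> I" "k < N l'" "c < s" "j < mn c" "key x = Inr (l, m)"
      by (auto simp: idx)
    have "hi c" using x(1,6) by (auto split: if_splits)
    moreover from this have "l' = l" "m = min t (u + 1) - j" "j < min t (u + 1)" using x by (auto simp: mn)
    ultimately show "x \<in> (\<lambda>(k, c). ((l, k), (c, min t (u + 1) - m))) ` ({..<N l} \<times> {c \<in> {..<s}. hi c})"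
      using x(1,3,4) by (intro image_eqI[of _ _ "(k, c)"]) auto
  next
    fix x assume "x \<in> (\<lambda>(k, c). ((l, k), (c, min t (u + 1) - m))) ` ({..<N l} \<times> {c \<in> {..<s}. hi c})"
    then obtain k c where x: "x = ((l, k), (c, min t (u + 1) - m))" "k < N l" "c < s" "hi c" by auto
    have "min t (u + 1) - m < min t (u + 1)" "min t (u + 1) - (min t (u + 1) - m) = m" using m by auto
    then show "x \<in> {x \<in> ?X. key x = Inr (l, m)}" using x l by (simp add: idx mn)
  qed
  let ?cnt = "\<lambda>\<kappa>. card {x \<in> ?X. key x = \<kappa>}"
  have c1: "?cnt (Inl (l, m)) = N l * (s - r)" if "l \<in> I" "m \<in> ?A" for l m
    unfolding fib1[OF that] using finlo by (subst card_image) (auto simp: inj_on_def card_cartesian_product)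
  have c2: "?cnt (Inr (l, m)) = N l * r" if "l \<in> I" "m \<in> ?A'" for l m
    unfolding fib2[OF that] using r by (subst card_image) (auto simp: inj_on_def card_cartesian_product)
  have keyK: "key x \<in> ?K" if "x \<in> ?X" for x
    using that by (auto simp: idx mn split: if_splits; linarith)
  have fin: "finite {x \<in> ?X. key x = \<kappa>}" if "\<kappa> \<in> ?K" for \<kappa>
    using that
  proof (elim PlusE)
    fix y assume "\<kappa> = Inl y" "y \<in> I \<times> ?A"
    then show ?thesis using fib1[of "fst y" "snd y"] by auto
  next
    fix y assume "\<kappa> = Inr y" "y \<in> I \<times> ?A'"
    then show ?thesis using fib2[of "fst y" "snd y"] by auto
  qed
  obtain h where h: "bij_betw h ?X (Sigma ?K (\<lambda>\<kappa>. {..<?cnt \<kappa>}))" "\<And>x. x \<in> ?X \<Longrightarrow> fst (h x) = key x"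
  proof (rule fibre_bij[of ?K ?X key, OF fin keyK])
    fix h assume h: "bij_betw h ?X (Sigma ?K (\<lambda>\<kappa>. {..<?cnt \<kappa>}))" "\<And>x. x \<in> ?X \<Longrightarrow> fst (h x) = key x"
    show thesis by (rule that[OF h])
  qed
  have PK: "left_module R (?PK \<kappa>)" if "\<kappa> \<in> ?K" for \<kappa>
    using that by (auto intro!: P)
  have same: "P (len q) (fst j) = ?PK (key (j, q)) \<and> 0 < len q \<and> fst j \<in> I" if jq: "(j, q) \<in> ?X" for j q
  proof -
    obtain l k c i where x: "j = (l, k)" "q = (c, i)" "l \<in> I" "c < s" "i < mn c" using jq by (auto simp: idx)
    show ?thesis
    proof (cases "hi c")
      case True
      then have "i < min t (u + 1)" using x by (simp add: mn)
      \<comment> \<open>The Clebsch-Gordan length becomes the index of the theorem through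
        \<open>(u + 1) + t = 2 min t (u + 1) + |t - u - 1|\<close>. Because \<open>i\<close> is
        below the minimum, \<open>m\<close> is at least 1 and the truncated \<open>2 m - 1\<close>
        is genuine.\<close>
      then have "u + 1 + t - 1 - 2 * i = 2 * (min t (u + 1) - i) - 1 + nat \<bar>int t - int u - 1\<bar>" "0 < u + 1 + t - 1 - 2 * i"
        by linarith+
      then show ?thesis using x True by (simp add: len)
    next
      case False
      then have "i < min t u" using x by (simp add: mn)
      then have "u + t - 1 - 2 * i = 2 * (min t u - i) - 1 + nat \<bar>int t - int u\<bar>" "0 < u + t - 1 - 2 * i"
        by linarith+
      then show ?thesis using x False by (simp add: len)
    qed
  qed
  have "module_iso R (direct_sum ?X (\<lambda>(j, q). P (len q) (fst j))) (direct_sum (Sigma ?K (\<lambda>\<kappa>. {..<?cnt \<kappa>})) (\<lambda>(\<kappa>, _). ?PK \<kappa>))"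
  proof (rule direct_sum_iso[OF h(1)])
    fix x assume x: "x \<in> ?X"
    obtain j q where jq: "x = (j, q)" by (cases x)
    note s = same[OF x[unfolded jq]]
    show "left_module R (case x of (j, q) \<Rightarrow> P (len q) (fst j))" using P[of "len q" "fst j"] s by (simp only: jq case_prod_conv)
    obtain i where "h x = (key x, i)" using h(2)[OF x] by (metis prod.collapse)
    then have "(case h x of (\<kappa>, _) \<Rightarrow> ?PK \<kappa>) = ?PK (key x)" by (simp only: case_prod_conv)
    also have "\<dots> = (case x of (j, q) \<Rightarrow> P (len q) (fst j))" using s by (simp only: jq case_prod_conv)
    finally show "module_iso R (case x of (j, q) \<Rightarrow> P (len q) (fst j)) (case h x of (\<kappa>, _) \<Rightarrow> ?PK \<kappa>)"
      by (simp only: module_iso_refl)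
  next
    fix y assume "y \<in> Sigma ?K (\<lambda>\<kappa>. {..<?cnt \<kappa>})"
    then obtain \<kappa> i where "y = (\<kappa>, i)" "\<kappa> \<in> ?K" by blast
    then show "left_module R (case y of (\<kappa>, _) \<Rightarrow> ?PK \<kappa>)" using PK by (simp only: case_prod_conv)
  qed
  also have "module_iso R \<dots> (direct_sum ?K (\<lambda>\<kappa>. copies (?cnt \<kappa>) (?PK \<kappa>)))"
    unfolding copies_def by (rule direct_sum_nest)
  also have "module_iso R \<dots> (direct_sum ?K (case_sum (\<lambda>(l, m). copies (N l * (s - r)) (?P1 l m)) (\<lambda>(l, m). copies (N l * r) (?P2 l m))))"
  proof (rule direct_sum_iso[OF bij_betw_id])
    fix \<kappa> assume \<kappa>: "\<kappa> \<in> ?K"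
    have e: "copies (?cnt \<kappa>) (?PK \<kappa>) = case_sum (\<lambda>(l, m). copies (N l * (s - r)) (?P1 l m)) (\<lambda>(l, m). copies (N l * r) (?P2 l m)) \<kappa>"
      using \<kappa>
    proof (elim PlusE)
      fix y assume "\<kappa> = Inl y" "y \<in> I \<times> ?A"
      then show ?thesis using c1[of "fst y" "snd y"] by (auto simp: split_beta)
    next
      fix y assume "\<kappa> = Inr y" "y \<in> I \<times> ?A'"
      then show ?thesis using c2[of "fst y" "snd y"] by (auto simp: split_beta)
    qed
    show lm: "left_module R (copies (?cnt \<kappa>) (?PK \<kappa>))"
      unfolding copies_def by (rule left_module_direct_sum[OF R PK[OF \<kappa>]])
    show "left_module R (case_sum (\<lambda>(l, m). copies (N l * (s - r)) (?P1 l m)) (\<lambda>(l, m). copies (N l * r) (?P2 l m)) \<kappa>)"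
      using lm unfolding e .
    show "module_iso R (copies (?cnt \<kappa>) (?PK \<kappa>)) (case_sum (\<lambda>(l, m). copies (N l * (s - r)) (?P1 l m)) (\<lambda>(l, m). copies (N l * r) (?P2 l m)) (id \<kappa>))"
      unfolding e id_apply by (rule module_iso_refl)
  qed
  also have "module_iso R \<dots> (binary_sum (direct_sum (I \<times> ?A) (\<lambda>(l, m). copies (N l * (s - r)) (?P1 l m)))
      (direct_sum (I \<times> ?A') (\<lambda>(l, m). copies (N l * r) (?P2 l m))))"
    by (rule direct_sum_Plus)
  also have "module_iso R \<dots> (binary_sum (direct_sum I (\<lambda>l. direct_sum ?A (\<lambda>m. copies (N l * (s - r)) (?P1 l m))))
      (direct_sum I (\<lambda>l. direct_sum ?A' (\<lambda>m. copies (N l * r) (?P2 l m)))))"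
    by (rule binary_sum_iso[OF direct_sum_nest direct_sum_nest])
  finally show ?thesis .
qed

section \<open>Powers and orders of scalars and characters\<close>

lemma unit_group_pow: "x [^]\<^bsub>unit_group\<^esub> (n::nat) = (x::'k::field) ^ n"
  by (induction n) (simp_all add: unit_group_def nat_pow_def mult.commute)

lemma group_unit_group: "group (unit_group :: 'k::field monoid)"
proof (rule groupI)
  fix x :: 'k assume "x \<in> carrier unit_group"
  then show "\<exists>y\<in>carrier unit_group. y \<otimes>\<^bsub>unit_group\<^esub> x = \<one>\<^bsub>unit_group\<^esub>"
    by (intro bexI[of _ "inverse x"]) (simp_all add: unit_group_def)
qed (simp_all add: unit_group_def)

lemma group_character_group:
  assumes "group G"
  shows "group (character_group G :: ('g \<Rightarrow> 'k::field) monoid)"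
proof -
  interpret group G by fact
  show ?thesis
  proof (rule groupI)
    fix x :: "'g \<Rightarrow> 'k" assume x: "x \<in> carrier (character_group G)"
    note nz = character_nonzero[OF x]
    show "\<exists>y\<in>carrier (character_group G). y \<otimes>\<^bsub>character_group G\<^esub> x = \<one>\<^bsub>character_group G\<^esub>"
      by (rule bexI[of _ "\<lambda>g\<in>carrier G. inverse (x g)"])
        (auto simp: character_group_def unit_group_def hom_def nz character_mult[OF x] fun_eq_iff)
  qed (auto simp: character_group_def unit_group_def hom_def fun_eq_iff restrict_def extensional_def)
qed

lemma character_pow:
  assumes "g \<in> carrier G"
  shows "(\<chi> [^]\<^bsub>character_group G\<^esub> (n::nat)) g = (\<chi> g :: 'k::field) ^ n"
proof (induction n)
  case 0 then show ?case using assms by (simp add: nat_pow_def character_group_def)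
next
  case (Suc n)
  then show ?case using assms by (simp add: nat_pow_def character_group_def mult.commute)
qed

section \<open>The modules of the theorem in coordinates and the decomposition of their tensor
  products\<close>

locale ore_setting =
  fixes G :: "('g, 'x) monoid_scheme" and \<chi> :: "'g \<Rightarrow> 'k::{alg_closed_field, field_char_0}"
    and a :: 'g and I :: "'i set" and V :: "'i \<Rightarrow> ('g \<Rightarrow>\<^sub>0 'k, 'v) module" and s :: nat
  assumes G: "group G" and fin: "finite (carrier G)" and a: "a \<in> carrier G"
    and central: "\<forall>g\<in>carrier G. a \<otimes>\<^bsub>G\<^esub> g = g \<otimes>\<^bsub>G\<^esub> a" and \<chi>: "\<chi> \<in> carrier (character_group G)"
    and ord_q: "group.ord unit_group (\<chi> a) = s" and ord_\<chi>: "group.ord (character_group G) \<chi> = s"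
    and s0: "0 < s" and reps: "simple_representatives (group_algebra G) I V"
begin

sublocale G: group G by (rule G)

abbreviation "kG \<equiv> group_algebra G :: ('g \<Rightarrow>\<^sub>0 'k) ring"
abbreviation "H \<equiv> ore_algebra G \<chi>"
abbreviation "fus i j l \<equiv> fusion_mult G I V i j l"

lemma chis: "g \<in> carrier G \<Longrightarrow> \<chi> g ^ s = 1"
proof -
  assume g: "g \<in> carrier G"
  have "\<chi> [^]\<^bsub>character_group G\<^esub> s = \<one>\<^bsub>character_group G\<^esub>"
    using group.pow_ord_eq_1[OF group_character_group[OF G] \<chi>] ord_\<chi> by simp
  then have "\<chi> g ^ s = \<one>\<^bsub>character_group G\<^esub> g" using character_pow[OF g, of \<chi> s] by simp
  then show ?thesis using g by (simp add: character_group_def)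
qed

lemma q_ord: "\<lbrakk>0 < i; i < s\<rbrakk> \<Longrightarrow> \<chi> a ^ i \<noteq> 1"
proof
  assume i: "0 < i" "i < s" and e: "\<chi> a ^ i = 1"
  have "\<chi> a \<in> carrier unit_group" using character_nonzero[OF \<chi> a] by (simp add: unit_group_def)
  moreover have "\<chi> a [^]\<^bsub>unit_group\<^esub> i = \<one>\<^bsub>unit_group\<^esub>" using e by (simp add: unit_group_pow) (simp add: unit_group_def)
  ultimately have "s dvd i" using group.pow_eq_id[OF group_unit_group, of "\<chi> a" i] ord_q by simp
  then show False using i by (auto dest: dvd_imp_le)
qed

lemma ring_kG: "ring kG" by (rule ring_group_algebra[OF G])

lemma simple: "l \<in> I \<Longrightarrow> simple_kG G (V l)"
  using reps G fin by (simp add: simple_representatives_def simple_kG_def)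

lemma left_module_V: "l \<in> I \<Longrightarrow> left_module kG (V l)"
  using reps by (simp add: simple_representatives_def simple_module_def)

lemma ex_coords: "\<exists>c. \<forall>l\<in>I. case c l of (B :: ('g \<Rightarrow> 'k) set, \<rho>, \<theta>, \<eta>) \<Rightarrow> coordinates G (\<lambda>_ _. 1) (V l) B \<rho> \<theta> \<eta>"
proof (rule bchoice, rule ballI)
  fix l assume "l \<in> I"
  then obtain B :: "('g \<Rightarrow> 'k) set" and \<rho> \<theta> \<eta> where "coordinates G (\<lambda>_ _. 1) (V l) B \<rho> \<theta> \<eta>"
    using simple_kG.ex_coordinates[OF simple] by blast
  then show "\<exists>c. case c of (B :: ('g \<Rightarrow> 'k) set, \<rho>, \<theta>, \<eta>) \<Rightarrow> coordinates G (\<lambda>_ _. 1) (V l) B \<rho> \<theta> \<eta>"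
    by (intro exI[of _ "(B, \<rho>, \<theta>, \<eta>)"]) simp
qed

definition "coords = (SOME c. \<forall>l\<in>I. case c l of (B :: ('g \<Rightarrow> 'k) set, \<rho>, \<theta>, \<eta>) \<Rightarrow> coordinates G (\<lambda>_ _. 1) (V l) B \<rho> \<theta> \<eta>)"
definition "B l = fst (coords l)"
definition "\<rho> l = fst (snd (coords l))"
definition "\<theta> l = fst (snd (snd (coords l)))"
definition "\<eta> l = snd (snd (snd (coords l)))"

lemma co: "l \<in> I \<Longrightarrow> coordinates G (\<lambda>_ _. 1) (V l) (B l) (\<rho> l) (\<theta> l) (\<eta> l)"
  using someI_ex[OF ex_coords] unfolding coords_def[symmetric] by (auto simp: B_def \<rho>_def \<theta>_def \<eta>_def split_beta)

lemma rep: "l \<in> I \<Longrightarrow> grep G (B l) (\<rho> l)"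
  using co[of l] by (simp add: coordinates_def)

lemma V_iso: "l \<in> I \<Longrightarrow> module_iso kG (V l) (cmod (B l) (\<rho> l))"
proof -
  assume l: "l \<in> I"
  interpret C: coord G "\<lambda>_ _. 1" "V l" "B l" "\<rho> l" "\<theta> l" "\<eta> l" using co[OF l] G.is_monoid by (simp add: coord_def)
  show ?thesis
  proof (rule module_isoI[where f = "\<theta> l"])
    show "bij_betw (\<theta> l) (carrier (V l)) (carrier (cmod (B l) (\<rho> l)))"
      by (rule bij_betw_byWitness[where f' = "\<eta> l"]) auto
  qed (auto simp: twisted_simps)
qed

text \<open>One family for both kinds of modules: \<open>\<beta> = 0\<close> with
  \<open>nil_shape u r\<close> models the nilpotent ones and a constant \<open>n\<close> the
  others.\<close>

abbreviation "model l n \<beta> \<equiv> cmod (sdom s n \<times> B l) (ten \<chi> fst (xop s n \<beta>) (\<rho> l))"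

lemma hrep_model: "\<lbrakk>l \<in> I; shape s n \<beta>\<rbrakk> \<Longrightarrow> hrep G \<chi> (sdom s n \<times> B l) (tenrep \<chi> fst (\<rho> l)) (kron (xop s n \<beta>) (\<lambda>f. f))"
  by (rule hrep_ten[OF G \<chi> chis graded_xop rep])

lemma left_module_model: "\<lbrakk>l \<in> I; shape s n \<beta>\<rbrakk> \<Longrightarrow> left_module H (model l n \<beta>)"
  unfolding ten_def by (rule left_module_hact[OF G \<chi> hrep_model])

lemma shape_eigen: "shape s (\<lambda>_. t) \<beta>"
  using s0 by (simp add: shape_def)

lemma eigen_model:
  assumes l: "l \<in> I" and t: "0 < t"
  shows "module_iso H (model l (\<lambda>_. t) \<beta>) (eigen_module G \<chi> s t (V l) \<beta>)" and "left_module H (eigen_module G \<chi> s t (V l) \<beta>)"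
proof -
  interpret Z: induced G \<chi> "V l" "B l" "\<rho> l" "\<theta> l" "\<eta> l" s "\<lambda>_. t" \<beta>
    using G \<chi> chis co[OF l] shape_eigen t by unfold_locales auto
  show "module_iso H (model l (\<lambda>_. t) \<beta>) (eigen_module G \<chi> s t (V l) \<beta>)" "left_module H (eigen_module G \<chi> s t (V l) \<beta>)"
    by (rule Z.eigen_quotient[OF refl])+
qed

lemma shape_nil: "r < s \<Longrightarrow> shape s (nil_shape u r) (0::'k)"
  by (auto simp: shape_def nil_shape_def)

lemma nilpotent_model:
  assumes l: "l \<in> I" and p: "p = u * s + r" "r < s" "0 < p"
  shows "module_iso H (model l (nil_shape u r) 0) (nilpotent_module G \<chi> p (V l))" and "left_module H (nilpotent_module G \<chi> p (V l))"
proof -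
  interpret Z: induced G \<chi> "V l" "B l" "\<rho> l" "\<theta> l" "\<eta> l" s "nil_shape u r" 0
    using G \<chi> chis co[OF l] shape_nil[OF p(2)] p by unfold_locales (auto simp: nil_shape_def)
  show "module_iso H (model l (nil_shape u r) 0) (nilpotent_module G \<chi> p (V l))" "left_module H (nilpotent_module G \<chi> p (V l))"
    by (rule Z.nilpotent_quotient[OF refl _ p(1,2)], simp add: nil_shape_def fun_eq_iff)+
qed

text \<open>\<open>fusion_mult\<close> is a choice among the multiplicity functions that fit
  \<open>V i \<otimes> V j\<close>. Maschke's theorem provides such a function, so the chosen one
  fits as well.\<close>

lemma group_tensor_decomposition:
  assumes i: "i \<in> I" and j: "j \<in> I"
  shows "module_iso kG (cmod (B i \<times> B j) (\<lambda>g. kron (\<rho> i g) (\<rho> j g)))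
    (direct_sum (Sigma I (\<lambda>l. {..<fus i j l})) (\<lambda>q. cmod (B (fst q)) (\<rho> (fst q))))"
proof -
  let ?T = "cmod (B i \<times> B j) (\<lambda>g. kron (\<rho> i g) (\<rho> j g))"
  interpret T: group_rep G "B i \<times> B j" "\<lambda>g. kron (\<rho> i g) (\<rho> j g)"
    by unfold_locales (rule G fin grep_kron[OF G rep[OF i] rep[OF j]])+
  note gt = group_tensor_iso[OF G co[OF i] co[OF j]]
  obtain N where "module_iso kG ?T (direct_sum I (\<lambda>l. copies (N l) (V l)))" using T.multiplicities_exist[OF reps] by blast
  then have "module_iso kG (group_tensor G (V i) (V j)) (direct_sum I (\<lambda>l. copies (N l) (V l)))"
    by (rule module_iso_trans[OF gt(1)])
  then have fusion: "module_iso kG (group_tensor G (V i) (V j)) (direct_sum I (\<lambda>l. copies (fus i j l) (V l)))"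
    unfolding fusion_mult_def
    by (rule someI[of "\<lambda>N. module_iso kG (group_tensor G (V i) (V j)) (direct_sum I (\<lambda>l. copies (N l) (V l)))"])
  have "module_iso kG ?T (group_tensor G (V i) (V j))" by (rule module_iso_sym[OF gt])
  also note fusion
  also have "module_iso kG (direct_sum I (\<lambda>l. copies (fus i j l) (V l))) (direct_sum (Sigma I (\<lambda>l. {..<fus i j l})) (\<lambda>(l, k). V l))"
    unfolding copies_def
    by (rule module_iso_sym[OF direct_sum_nest left_module_closed[OF left_module_direct_sum[OF ring_kG]]])
      (auto intro: left_module_V)
  also have "module_iso kG \<dots> (direct_sum (Sigma I (\<lambda>l. {..<fus i j l})) (\<lambda>q. cmod (B (fst q)) (\<rho> (fst q))))"
    by (rule direct_sum_iso[OF bij_betw_id]) (auto intro: left_module_V V_iso grep_left_module[OF G rep])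
  finally show ?thesis .
qed

text \<open>Regrouping isolates the graded parts, where \<open>Q\<close>, used backwards, replaces
  the product basis by strings. Decomposing the product of the simple modules at the same time
  leaves one model with constant column length for every string and every simple
  constituent.\<close>

lemma tensor_decomposition:
  assumes i: "i \<in> I" and j: "j \<in> I"
    and tf: "two_factors s n1 n2 \<beta>1 \<beta>2 (central_scalar G a (V j)) (\<chi> a)"
    and M: "module_iso H (model i n1 \<beta>1) M" "left_module H M"
    and N: "module_iso H (model j n2 \<beta>2) N" "left_module H N"
  shows "module_iso H (ore_tensor G \<chi> a M N)
    (direct_sum (Sigma I (\<lambda>l. {..<fus i j l}) \<times> two_factors.idx s n1 n2)
      (\<lambda>(p, q). eigen_module G \<chi> s (two_factors.len s n1 n2 q) (V (fst p)) (two_factors.\<gamma> s \<beta>1 \<beta>2 (central_scalar G a (V j)))))"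
proof -
  let ?\<omega> = "central_scalar G a (V j)"
  interpret F: two_factors s n1 n2 \<beta>1 \<beta>2 ?\<omega> "\<chi> a" by (rule tf)
  let ?J = "Sigma I (\<lambda>l. {..<fus i j l})"
  let ?r = "\<lambda>g. kron (\<rho> i g) (\<rho> j g)"
  let ?C = "B i \<times> B j"
  have rT: "grep G ?C ?r" by (rule grep_kron[OF G rep[OF i] rep[OF j]])
  note hM = hrep_model[OF i F.sh1] and hN = hrep_model[OF j F.sh2]
  have ops: "hops G \<chi> (sdom s n1 \<times> B i) (ten \<chi> fst (xop s n1 \<beta>1) (\<rho> i))" "hops G \<chi> (sdom s n2 \<times> B j) (ten \<chi> fst (xop s n2 \<beta>2) (\<rho> j))"
    unfolding ten_def by (rule hops_hact[OF hM], rule hops_hact[OF hN])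
  have isoM: "module_iso H M (model i n1 \<beta>1)" by (rule module_iso_sym[OF M(1) left_module_closed[OF left_module_model[OF i F.sh1]]])
  have isoN: "module_iso H N (model j n2 \<beta>2)" by (rule module_iso_sym[OF N(1) left_module_closed[OF left_module_model[OF j F.sh2]]])
  obtain \<theta>1 \<eta>1 where c1: "coordinates (ore_basis G) (ore_twist \<chi>) M (sdom s n1 \<times> B i) (ten \<chi> fst (xop s n1 \<beta>1) (\<rho> i)) \<theta>1 \<eta>1"
    by (rule coordinates_exist[OF isoM[unfolded ore_algebra_def] M(2)[unfolded ore_algebra_def] ops(1)])
  obtain \<theta>2 \<eta>2 where c2: "coordinates (ore_basis G) (ore_twist \<chi>) N (sdom s n2 \<times> B j) (ten \<chi> fst (xop s n2 \<beta>2) (\<rho> j)) \<theta>2 \<eta>2"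
    by (rule coordinates_exist[OF isoN[unfolded ore_algebra_def] N(2)[unfolded ore_algebra_def] ops(2)])
  have \<omega>: "\<rho> j a v = scl ?\<omega> v" if "v \<in> fspace (B j)" for v
    using simple_kG.central_acts_by_scalar[OF simple[OF j] co[OF j] a central] that by blast
  have xt: "(\<lambda>\<psi>. kron (xop s n1 \<beta>1) (\<lambda>f. scl ?\<omega> (Dg fst (\<chi> a) f)) \<psi> + kron (\<lambda>f. f) (xop s n2 \<beta>2) \<psi>) = F.xt"
    unfolding F.xt_def F.opA_def F.opB_def F.twist_def ..
  have "module_iso H (ore_tensor G \<chi> a M N)
      (cmod ((sdom s n1 \<times> B i) \<times> (sdom s n2 \<times> B j)) (hact (\<lambda>g. kron (tenrep \<chi> fst (\<rho> i) g) (tenrep \<chi> fst (\<rho> j) g))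
        (\<lambda>\<phi>. kron (kron (xop s n1 \<beta>1) (\<lambda>f. f)) (tenrep \<chi> fst (\<rho> j) a) \<phi> + kron (\<lambda>f. f) (kron (xop s n2 \<beta>2) (\<lambda>f. f)) \<phi>)))"
    by (rule ore_tensor_iso[OF G \<chi> a hM hN c1[unfolded ten_def] c2[unfolded ten_def]])
  also have "module_iso H \<dots> (cmod ((sdom s n1 \<times> sdom s n2) \<times> ?C) (ten \<chi> F.dg F.xt ?r))"
    unfolding xt[symmetric] F.dg_def
    by (rule ten_tensor_iso[OF G \<chi> chis a graded_xop[OF F.sh1] graded_xop[OF F.sh2] rep[OF i] rep[OF j] \<omega>
          hrep_tensor[OF G a central hM hN]])
  also have "module_iso H \<dots> (cmod (F.E' \<times> ?C) (ten \<chi> F.deg' F.x' ?r))"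
  proof (rule module_iso_sym)
    show "module_iso H (cmod (F.E' \<times> ?C) (ten \<chi> F.deg' F.x' ?r)) (cmod ((sdom s n1 \<times> sdom s n2) \<times> ?C) (ten \<chi> F.dg F.xt ?r))"
      by (rule ten_change_basis[OF G \<chi> chis F.graded_x' F.graded_xt rT F.lin_Q F.Q_bij F.Q_x' F.Q_Dg])
    show "closed_module H (cmod (F.E' \<times> ?C) (ten \<chi> F.deg' F.x' ?r))"
      unfolding ten_def by (rule left_module_closed[OF left_module_hact[OF G \<chi> hrep_ten[OF G \<chi> chis F.graded_x' rT]]])
  qed
  also have "module_iso H \<dots> (direct_sum (?J \<times> F.idx) (\<lambda>(p, q). cmod (sdom s (\<lambda>_. F.len q) \<times> B (fst p)) (ten \<chi> fst (xop s (\<lambda>_. F.len q) F.\<gamma>) (\<rho> (fst p)))))"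
    unfolding F.E'_def
  proof (rule ten_decompose[OF G \<chi> chis _ _ rT _ group_tensor_decomposition[OF i j]])
    show "F.x' = (\<lambda>f (l, e). xop s (\<lambda>_. F.len l) F.\<gamma> (\<lambda>e. f (l, e)) e)" by (simp add: F.x'_def fun_eq_iff)
    show "F.deg' = (\<lambda>(l, e). fst e)" by (simp add: F.deg'_def)
    show "graded s (Sigma F.idx (\<lambda>q. sdom s (\<lambda>_. F.len q))) F.deg' F.x'" using F.graded_x' unfolding F.E'_def .
    show "finite F.idx" by (simp add: F.idx_def)
  qed (auto intro: graded_xop F.shape' rep)
  also have "module_iso H \<dots> (direct_sum (?J \<times> F.idx) (\<lambda>(p, q). eigen_module G \<chi> s (F.len q) (V (fst p)) F.\<gamma>))"
  proof (rule direct_sum_iso[OF bij_betw_id])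
    fix x assume x: "x \<in> ?J \<times> F.idx"
    then obtain l k c m where lk: "x = ((l, k), (c, m))" "l \<in> I" "(c, m) \<in> F.idx" by auto
    have len: "0 < F.len (c, m)" using lk(3) by (auto simp: F.idxD F.len_def)
    show "left_module H (case x of (p, q) \<Rightarrow> model (fst p) (\<lambda>_. F.len q) F.\<gamma>)"
      using left_module_model[OF lk(2) F.shape'] by (simp add: lk(1))
    show "module_iso H (case x of (p, q) \<Rightarrow> model (fst p) (\<lambda>_. F.len q) F.\<gamma>) (case id x of (p, q) \<Rightarrow> eigen_module G \<chi> s (F.len q) (V (fst p)) F.\<gamma>)"
      using eigen_model(1)[OF lk(2) len] by (simp add: lk(1))
    show "left_module H (case x of (p, q) \<Rightarrow> eigen_module G \<chi> s (F.len q) (V (fst p)) F.\<gamma>)"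
      using eigen_model(2)[OF lk(2) len] by (simp add: lk(1))
  qed
  finally show ?thesis .
qed

end

section \<open>The degrees in which the nilpotent factor is larger, and the theorem\<close>

lemma neg_neg: "c < s \<Longrightarrow> (s - (s - c) mod s) mod s = (c :: nat)"
  by (cases "c = 0") auto

text \<open>The two cases belong to the two orders of the factors: the nilpotent factor has degree
  \<open>c\<close> when it stands on the left and degree \<open>- c\<close> modulo \<open>s\<close>
  when it stands on the right. Negation is an involution, so the counts agree.\<close>

lemma card_nil_high:
  assumes "r < s"
  shows "card {c \<in> {..<s}. c < r} = r" and "card {c \<in> {..<s}. (s - c) mod s < r} = r"
proof -
  have e: "{c \<in> {..<s}. c < r} = {..<r}" using assms by auto
  then show c: "card {c \<in> {..<s}. c < r} = r" by simp
  have "bij_betw (\<lambda>c. (s - c) mod s) {c \<in> {..<s}. (s - c) mod s < r} {c \<in> {..<s}. c < r}"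
    by (rule bij_betw_byWitness[where f' = "\<lambda>c. (s - c) mod s"]) (use assms neg_neg in \<open>auto intro!: mod_less_divisor\<close>)
  then show "card {c \<in> {..<s}. (s - c) mod s < r} = r" using c by (simp add: bij_betw_same_card)
qed

lemma sum_neg_reindex: "0 < (s::nat) \<Longrightarrow> (\<Sum>c<s. f ((s - c) mod s)) = (\<Sum>c<s. (f c :: nat))"
  by (rule sum.reindex_bij_betw, rule bij_betw_byWitness[where f' = "\<lambda>c. (s - c) mod s"])
    (auto intro!: mod_less_divisor simp: neg_neg)

theorem proposition5p3:
  fixes G :: "('g, 'x) monoid_scheme"
    and \<chi> :: "'g \<Rightarrow> 'k::{alg_closed_field, field_char_0}"
    and a :: 'g and \<beta> :: 'k
    and I :: "'i set" and V :: "'i \<Rightarrow> ('g \<Rightarrow>\<^sub>0 'k, 'v) module"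
    and i j :: 'i and s p t u r :: nat
  assumes "group G" and "finite (carrier G)"
    and "a \<in> carrier G" and "\<forall>g\<in>carrier G. a \<otimes>\<^bsub>G\<^esub> g = g \<otimes>\<^bsub>G\<^esub> a"
    and "\<chi> \<in> carrier (character_group G)"
    and "\<chi> a \<noteq> 1"
    and "group.ord unit_group (\<chi> a) = s" and "group.ord (character_group G) \<chi> = s"
    and "simple_representatives (group_algebra G) I V"
    and "i \<in> I" and "j \<in> I"
    and "p \<ge> 1" and "t \<ge> 1" and "\<beta> \<noteq> 0"
    and "p = u * s + r" and "r < s"
  shows "module_iso (ore_algebra G \<chi>)
      (ore_tensor G \<chi> a (nilpotent_module G \<chi> p (V i)) (eigen_module G \<chi> s t (V j) \<beta>))
      (binary_sum
        (direct_sum I (\<lambda>l. direct_sum {1..min t u} (\<lambda>m.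
          copies (fusion_mult G I V i j l * (s - r))
            (eigen_module G \<chi> s (2 * m - 1 + nat \<bar>int t - int u\<bar>) (V l) \<beta>))))
        (direct_sum I (\<lambda>l. direct_sum {1..min t (u + 1)} (\<lambda>m.
          copies (fusion_mult G I V i j l * r)
            (eigen_module G \<chi> s (2 * m - 1 + nat \<bar>int t - int u - 1\<bar>) (V l) \<beta>)))))
    \<and> module_iso (ore_algebra G \<chi>)
      (ore_tensor G \<chi> a (eigen_module G \<chi> s t (V j) \<beta>) (nilpotent_module G \<chi> p (V i)))
      (binary_sum
        (direct_sum I (\<lambda>l. direct_sum {1..min u t} (\<lambda>m.
          copies (fusion_mult G I V j i l * (s - r))
            (eigen_module G \<chi> s (2 * m - 1 + nat \<bar>int t - int u\<bar>) (V l)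
              (central_scalar G a (V i) ^ s * \<beta>)))))
        (direct_sum I (\<lambda>l. direct_sum {1..min (u + 1) t} (\<lambda>m.
          copies (fusion_mult G I V j i l * r)
            (eigen_module G \<chi> s (2 * m - 1 + nat \<bar>int t - int u - 1\<bar>) (V l)
              (central_scalar G a (V i) ^ s * \<beta>))))))"
proof -
  have s0: "0 < s" using assms(16) by simp
  interpret ore_setting G \<chi> a I V s
    by (rule ore_setting.intro[OF assms(1-5,7,8) s0 assms(9)])
  note i = assms(10) and j = assms(11) and t = assms(13) and \<beta> = assms(14) and p = assms(15,16)
  have p0: "0 < p" and t0: "0 < t" using assms(12,13) by auto
  let ?n = "nil_shape u r"
  note nil = nilpotent_model[OF i p p0] and eig = eigen_model[OF j t0, of \<beta>]
  have q: "\<chi> a ^ s = 1" by (rule chis[OF a])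
  have \<omega>: "central_scalar G a (V l) \<noteq> 0" if "l \<in> I" for l
    using simple_kG.central_acts_by_scalar[OF simple[OF that] co[OF that] a central] by blast
  have R: "ring (ore_algebra G \<chi>)" by (rule ring_ore_algebra[OF assms(1) assms(5)])
  have P: "left_module (ore_algebra G \<chi>) (eigen_module G \<chi> s n (V l) \<gamma>)" if "0 < n" "l \<in> I" for n l \<gamma>
    by (rule eigen_model(2)[OF that(2,1)])
  let ?S = "\<lambda>N \<gamma>. binary_sum
      (direct_sum I (\<lambda>l. direct_sum {1..min t u} (\<lambda>m.
        copies (N l * (s - r)) (eigen_module G \<chi> s (2 * m - 1 + nat \<bar>int t - int u\<bar>) (V l) \<gamma>))))
      (direct_sum I (\<lambda>l. direct_sum {1..min t (u + 1)} (\<lambda>m.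
        copies (N l * r) (eigen_module G \<chi> s (2 * m - 1 + nat \<bar>int t - int u - 1\<bar>) (V l) \<gamma>))))"
  have "module_iso (ore_algebra G \<chi>)
      (ore_tensor G \<chi> a (nilpotent_module G \<chi> p (V i)) (eigen_module G \<chi> s t (V j) \<beta>)) (?S (fus i j) \<beta>)"
  proof -
    let ?w = "central_scalar G a (V j)"
    have count: "s * (\<Sum>c<s. ?n c * t) = (\<Sum>c<s. ?n c) * (\<Sum>c<s. t)" by (simp add: sum_distrib_right[symmetric])
    have tf: "two_factors s ?n (\<lambda>_. t) 0 \<beta> ?w (\<chi> a)"
      by (rule two_factors.intro[OF shape_nil[OF p(2)] shape_eigen \<omega>[OF j] q q_ord _ count]) (simp_all add: \<beta>)
    interpret F: two_factors s ?n "\<lambda>_. t" 0 \<beta> ?w "\<chi> a" by (rule tf)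
    \<comment> \<open>The scalar of \<open>a\<close> multiplies the parameter of the left factor
      only, and this is 0 for the nilpotent module.\<close>
    have \<gamma>: "F.\<gamma> = \<beta>" by (simp add: F.\<gamma>_def)
    have "module_iso (ore_algebra G \<chi>)
      (ore_tensor G \<chi> a (nilpotent_module G \<chi> p (V i)) (eigen_module G \<chi> s t (V j) \<beta>))
      (direct_sum (Sigma I (\<lambda>l. {..<fus i j l}) \<times> F.idx) (\<lambda>(k, q). eigen_module G \<chi> s (F.len q) (V (fst k)) \<beta>))"
      using tensor_decomposition[OF i j tf nil eig] unfolding \<gamma> .
    also have "module_iso (ore_algebra G \<chi>) \<dots> (?S (fus i j) \<beta>)"
      by (rule reassemble[OF R P F.idx_def _ _ card_nil_high(1)[OF p(2)]]) (simp_all only: F.len_def prod.case, auto simp: nil_shape_def)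
    finally show ?thesis .
  qed
  moreover have "module_iso (ore_algebra G \<chi>)
      (ore_tensor G \<chi> a (eigen_module G \<chi> s t (V j) \<beta>) (nilpotent_module G \<chi> p (V i)))
      (?S (fus j i) (central_scalar G a (V i) ^ s * \<beta>))"
  proof -
    let ?w = "central_scalar G a (V i)"
    \<comment> \<open>The degrees of the right factor run through all residues modulo
      \<open>s\<close>, in the order given by negation.\<close>
    have "(\<Sum>c<s. t * ?n ((s - c) mod s)) = t * (\<Sum>c<s. ?n c)"
      using sum_neg_reindex[OF s0, of "\<lambda>c. t * ?n c"] by (simp only: sum_distrib_left)
    then have count: "s * (\<Sum>c<s. t * ?n ((s - c) mod s)) = (\<Sum>c<s. t) * (\<Sum>c<s. ?n c)" by simp
    have tf: "two_factors s (\<lambda>_. t) ?n \<beta> 0 ?w (\<chi> a)"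
      by (rule two_factors.intro[OF shape_eigen shape_nil[OF p(2)] \<omega>[OF i] q q_ord _ count]) (simp_all add: \<omega>[OF i] \<beta>)
    interpret F: two_factors s "\<lambda>_. t" ?n \<beta> 0 ?w "\<chi> a" by (rule tf)
    \<comment> \<open>Now the factor with parameter \<beta> stands on the left, where
      \<open>x\<close> comes with an \<open>a\<close> on the right: \<open>x^s \<otimes> a^s\<close>
      contributes \<beta> times the \<open>s\<close>-th power of the scalar of \<open>a\<close> on
      \<open>V i\<close>.\<close>
    have \<gamma>: "F.\<gamma> = ?w ^ s * \<beta>" by (simp add: F.\<gamma>_def)
    have "module_iso (ore_algebra G \<chi>)
      (ore_tensor G \<chi> a (eigen_module G \<chi> s t (V j) \<beta>) (nilpotent_module G \<chi> p (V i)))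
      (direct_sum (Sigma I (\<lambda>l. {..<fus j i l}) \<times> F.idx) (\<lambda>(k, q). eigen_module G \<chi> s (F.len q) (V (fst k)) (?w ^ s * \<beta>)))"
      using tensor_decomposition[OF j i tf eig nil] unfolding \<gamma> .
    also have "module_iso (ore_algebra G \<chi>) \<dots> (?S (fus j i) (?w ^ s * \<beta>))"
      by (rule reassemble[OF R P F.idx_def _ _ card_nil_high(2)[OF p(2)]]) (simp_all only: F.len_def F.neg_def prod.case, auto simp: nil_shape_def)
    finally show ?thesis .
  qed
  ultimately show ?thesis by (simp only: min.commute[of u t] min.commute[of "u + 1" t] conj_absorb simp_thms)
qed

end
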